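(* Given a finite set $\Sigma$ of tgds, the problem of testing whether $\Sigma\in\mathsf{CStr}$ is in $\Pi^p_2$.
   Context: Let $\mathsf{Cons}$ (constants), $\mathsf{Nulls}$ (nulls) and $\mathsf{Vars}$ (variables) be pairwise disjoint countably infinite sets. An instance is a finite set of atoms $R(a_1,\dots,a_k)$ with $a_i\in\mathsf{Cons}\cup\mathsf{Nulls}$. A tgd $\xi=\alpha\to\beta$ is a sentence $\forall\bar x,\bar y\,(\alpha(\bar x,\bar y)\to\exists\bar z\,\beta(\bar x,\bar z))$, with body $\alpha$ and head $\beta$ conjunctions of relational atoms over variables and constants. A trigger on $I$ is a pair $(\xi,h)$ with $h$ a mapping of the universal variables of $\xi$ to $\mathsf{Cons}\cup\mathsf{Nulls}$ (identity on constants) with $h(\alpha)\subseteq I$. An oblivious chase step $I\xrightarrow{(\xi,h)}J$ fires such a trigger (whether or not the tgd is violated): $J=I\cup h'(\beta)$, where $h'$ extends $h$ by assigning new fresh nulls to the existential variables. For a tgd $\xi=\alpha\to\exists\bar z\,\beta$ and a mapping $h$ of its universal variables to $\mathsf{Cons}\cup\mathsf{Nulls}$, $I\models h(\xi)$ means: if $h(\alpha)\subseteq I$ then some extension $h'$ of $h$ to $\bar z$ has $h'(\beta)\subseteq I$. For tgds $\xi_1,\xi_2$, $\xi_1\prec\xi_2$ holds if there exist an instance $I$ and mappings $h_1,h_2$ of the universal variables of $\xi_1$ and $\xi_2$, respectively, such that (i) $I\models h_2(\xi_2)$, (ii) $I\xrightarrow{(\xi_1,h_1)}J$ by an oblivious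 chase step, and (iii) $J\not\models h_2(\xi_2)$. The chase graph of $\Sigma$ has the tgds of $\Sigma$ as vertices and an edge from $\xi_1$ to $\xi_2$ whenever $\xi_1\prec\xi_2$. $\mathsf{CStr}$ (C-stratified sets) is the class of finite sets $\Sigma$ of tgds such that the set of vertices of every cycle in the chase graph is weakly acyclic. Weak acyclicity: the dependency graph of a set of tgds has as vertices the positions $(R,i)$. For each tgd, each universal variable $x$ occurring in both body and head, and each position $p$ at which $x$ occurs in the body, there is a copy edge from $p$ to every position of $x$ in the head and a generating edge from $p$ to every position of an existential variable in the head. The set is weakly acyclic if this graph has no cycle involving a generating edge. *)

theory Defs
  imports Complex_Main "HOL-Computational_Algebra.Polynomial"
begin

section \<open>Instances and tuple-generating dependencies\<close>

text \<open>A relation symbol is a name together with an arity, the arity being read off the argument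
  list: atoms with the same name and argument lists of different lengths use different symbols.\<close>

datatype 'a atom = Atom (rel: nat) (args: "'a list")

datatype val = Const nat | Null nat

datatype trm = Cst nat | Var nat

type_synonym inst = "val atom set"

text \<open>Conjunctions are lists of atoms. The universal variables of a tgd are those of its body, the
  existential variables are the remaining variables of its head.\<close>

datatype tgd = TGD (body: "trm atom list") (head: "trm atom list")

definition atom_vars :: "trm atom list \<Rightarrow> nat set" where
  "atom_vars As = {x. \<exists>A \<in> set As. Var x \<in> set (args A)}"

definition univ_vars :: "tgd \<Rightarrow> nat set" where
  "univ_vars \<xi> = atom_vars (body \<xi>)"

definition ex_vars :: "tgd \<Rightarrow> nat set" where
  "ex_vars \<xi> = atom_vars (head \<xi>) - atom_vars (body \<xi>)"

fun subst :: "(nat \<Rightarrow> val) \<Rightarrow> trm \<Rightarrow> val" where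
  "subst h (Cst c) = Const c"
| "subst h (Var x) = h x"

definition hom_image :: "(nat \<Rightarrow> val) \<Rightarrow> trm atom list \<Rightarrow> inst" where
  "hom_image h As = map_atom (subst h) ` set As"

definition inst_vals :: "inst \<Rightarrow> val set" where
  "inst_vals I = (\<Union>A \<in> I. set (args A))"

text \<open>A mapping of the universal variables is a total function of which only the values on
  \<open>univ_vars \<xi>\<close> matter.\<close>

definition extends :: "tgd \<Rightarrow> (nat \<Rightarrow> val) \<Rightarrow> (nat \<Rightarrow> val) \<Rightarrow> bool" where
  "extends \<xi> h h' \<longleftrightarrow> (\<forall>x \<in> univ_vars \<xi>. h' x = h x)"

definition sat :: "inst \<Rightarrow> (nat \<Rightarrow> val) \<Rightarrow> tgd \<Rightarrow> bool" where
  "sat I h \<xi> \<longleftrightarrow>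
     (hom_image h (body \<xi>) \<subseteq> I \<longrightarrow> (\<exists>h'. extends \<xi> h h' \<and> hom_image h' (head \<xi>) \<subseteq> I))"

definition fresh_ext :: "inst \<Rightarrow> tgd \<Rightarrow> (nat \<Rightarrow> val) \<Rightarrow> (nat \<Rightarrow> val) \<Rightarrow> bool" where
  "fresh_ext I \<xi> h h' \<longleftrightarrow>
     extends \<xi> h h' \<and> inj_on h' (ex_vars \<xi>) \<and>
     (\<forall>z \<in> ex_vars \<xi>. h' z \<in> range Null \<and> h' z \<notin> inst_vals I)"

definition oblivious_step :: "inst \<Rightarrow> tgd \<Rightarrow> (nat \<Rightarrow> val) \<Rightarrow> inst \<Rightarrow> bool" where
  "oblivious_step I \<xi> h J \<longleftrightarrow>
     hom_image h (body \<xi>) \<subseteq> I \<and> (\<exists>h'. fresh_ext I \<xi> h h' \<and> J = I \<union> hom_image h' (head \<xi>))"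

definition prec :: "tgd \<Rightarrow> tgd \<Rightarrow> bool"  (infix \<open>\<prec>\<close> 50) where
  "\<xi>1 \<prec> \<xi>2 \<longleftrightarrow>
     (\<exists>I h1 h2 J. finite I \<and> sat I h2 \<xi>2 \<and> oblivious_step I \<xi>1 h1 J \<and> \<not> sat J h2 \<xi>2)"


section \<open>C-stratification\<close>

text \<open>A cycle is a closed walk with at least one edge; vertices may repeat. The list
  \<open>[v\<^sub>0, \<dots>, v\<^sub>n]\<close> stands for the walk through these vertices that returns from the last to the first.\<close>

definition walk_edges :: "'a list \<Rightarrow> ('a \<times> 'a) set" where
  "walk_edges p = set (zip p (rotate1 p))"

definition is_cycle :: "('a \<times> 'a) set \<Rightarrow> 'a list \<Rightarrow> bool" where
  "is_cycle E p \<longleftrightarrow> p \<noteq> [] \<and> walk_edges p \<subseteq> E"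

definition chase_graph :: "tgd set \<Rightarrow> (tgd \<times> tgd) set" where
  "chase_graph \<Sigma> = {(\<xi>1, \<xi>2). \<xi>1 \<in> \<Sigma> \<and> \<xi>2 \<in> \<Sigma> \<and> \<xi>1 \<prec> \<xi>2}"

text \<open>A position consists of a relation symbol (name and arity) and an argument index.\<close>

type_synonym pos = "(nat \<times> nat) \<times> nat"

definition positions :: "trm atom list \<Rightarrow> nat \<Rightarrow> pos set" where
  "positions As x =
     {((rel A, length (args A)), i) | A i. A \<in> set As \<and> i < length (args A) \<and> args A ! i = Var x}"

definition copy_edges :: "tgd set \<Rightarrow> (pos \<times> pos) set" where
  "copy_edges S =
     {(p, q). \<exists>\<xi> \<in> S. \<exists>x \<in> univ_vars \<xi> \<inter> atom_vars (head \<xi>).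
        p \<in> positions (body \<xi>) x \<and> q \<in> positions (head \<xi>) x}"

definition gen_edges :: "tgd set \<Rightarrow> (pos \<times> pos) set" where
  "gen_edges S =
     {(p, q). \<exists>\<xi> \<in> S. \<exists>x \<in> univ_vars \<xi> \<inter> atom_vars (head \<xi>). \<exists>z \<in> ex_vars \<xi>.
        p \<in> positions (body \<xi>) x \<and> q \<in> positions (head \<xi>) z}"

definition weakly_acyclic :: "tgd set \<Rightarrow> bool" where
  "weakly_acyclic S \<longleftrightarrow>
     \<not> (\<exists>p. is_cycle (copy_edges S \<union> gen_edges S) p \<and> walk_edges p \<inter> gen_edges S \<noteq> {})"

definition CStr :: "tgd set set" where
  "CStr = {\<Sigma>. finite \<Sigma> \<and> (\<forall>p. is_cycle (chase_graph \<Sigma>) p \<longrightarrow> weakly_acyclic (set p))}"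


section \<open>Encoding sets of tgds as bit strings\<close>

text \<open>All encodings are self-delimiting: in \<open>enc_list\<close>, \<open>True\<close> announces a further element and
  \<open>False\<close> the end of the list. Numbers (names of relations, constants, variables) are written in
  binary, least significant bit first.\<close>

fun bin :: "nat \<Rightarrow> bool list" where
  "bin n = (if n = 0 then [] else odd n # bin (n div 2))"

declare bin.simps [simp del]

fun enc_list :: "('a \<Rightarrow> bool list) \<Rightarrow> 'a list \<Rightarrow> bool list" where
  "enc_list e [] = [False]"
| "enc_list e (x # xs) = True # e x @ enc_list e xs"

definition enc_nat :: "nat \<Rightarrow> bool list" where
  "enc_nat n = enc_list (\<lambda>b. [b]) (bin n)"

fun enc_trm :: "trm \<Rightarrow> bool list" where
  "enc_trm (Cst c) = False # enc_nat c"
| "enc_trm (Var x) = True # enc_nat x"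

definition enc_atom :: "trm atom \<Rightarrow> bool list" where
  "enc_atom A = enc_nat (rel A) @ enc_list enc_trm (args A)"

definition enc_tgd :: "tgd \<Rightarrow> bool list" where
  "enc_tgd \<xi> = enc_list enc_atom (body \<xi>) @ enc_list enc_atom (head \<xi>)"

definition enc_tgds :: "tgd list \<Rightarrow> bool list" where
  "enc_tgds = enc_list enc_tgd"

definition CStr_problem :: "bool list set" where
  "CStr_problem = {enc_tgds \<Xi> | \<Xi>. set \<Xi> \<in> CStr}"

text \<open>The encoding is injective, so membership in \<open>CStr_problem\<close> is a property of the encoded set.\<close>

definition prefix_code :: "('a \<Rightarrow> bool list) \<Rightarrow> bool" where
  "prefix_code e \<longleftrightarrow> (\<forall>x y u v. e x @ u = e y @ v \<longrightarrow> x = y \<and> u = v)"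

lemma prefix_codeD: "prefix_code e \<Longrightarrow> e x @ u = e y @ v \<Longrightarrow> x = y \<and> u = v"
  unfolding prefix_code_def by blast

lemma prefix_code_list:
  assumes "prefix_code e"
  shows "prefix_code (enc_list e)"
proof -
  have "enc_list e xs @ u = enc_list e ys @ v \<longrightarrow> xs = ys \<and> u = v" for xs ys u v
  proof (induction xs arbitrary: ys)
    case Nil
    then show ?case by (cases ys) auto
  next
    case (Cons x xs)
    show ?case
    proof (cases ys)
      case Nil
      then show ?thesis by simp
    next
      case (Cons y ys')
      show ?thesis
      proof
        assume "enc_list e (x # xs) @ u = enc_list e ys @ v"
        then have "e x @ (enc_list e xs @ u) = e y @ (enc_list e ys' @ v)"
          by (simp add: Cons)
        from prefix_codeD[OF assms this] show "x # xs = ys \<and> u = v"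
          using Cons.IH[of ys'] by (simp add: Cons)
      qed
    qed
  qed
  then show ?thesis unfolding prefix_code_def by blast
qed

lemma bin_inject: "bin m = bin n \<Longrightarrow> m = n"
proof (induction m arbitrary: n rule: less_induct)
  case (less m)
  show ?case
  proof (cases "m = 0 \<or> n = 0")
    case True
    then show ?thesis using less.prems by (auto simp: bin.simps[of m] bin.simps[of n] split: if_splits)
  next
    case False
    then have *: "odd m = odd n" "bin (m div 2) = bin (n div 2)"
      using less.prems by (auto simp: bin.simps[of m] bin.simps[of n])
    then have "m div 2 = n div 2" using less.IH[of "m div 2"] False by simp
    moreover from *(1) have "m mod 2 = n mod 2" by presburger
    ultimately have "m div 2 * 2 + m mod 2 = n div 2 * 2 + n mod 2" by (simp only:)
    then show ?thesis by (simp only: div_mult_mod_eq)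
  qed
qed

lemma prefix_code_nat: "prefix_code enc_nat"
proof -
  have "prefix_code (enc_list (\<lambda>b::bool. [b]))"
    by (rule prefix_code_list) (simp add: prefix_code_def)
  from prefix_codeD[OF this] show ?thesis
    unfolding prefix_code_def enc_nat_def by (blast dest: bin_inject)
qed

lemma prefix_code_iff: "prefix_code e \<Longrightarrow> e x @ u = e y @ v \<longleftrightarrow> x = y \<and> u = v"
  unfolding prefix_code_def by blast

lemma prefix_code_trm: "prefix_code enc_trm"
  unfolding prefix_code_def
proof (intro allI impI)
  fix s t u v assume "enc_trm s @ u = enc_trm t @ v"
  then show "s = t \<and> u = v"
    by (cases s; cases t) (simp_all add: prefix_code_iff[OF prefix_code_nat])
qed

lemma prefix_code_atom: "prefix_code enc_atom"
  unfolding prefix_code_def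
proof (intro allI impI)
  fix A B u v assume "enc_atom A @ u = enc_atom B @ v"
  then show "A = B \<and> u = v"
    by (cases A; cases B)
      (simp add: enc_atom_def prefix_code_iff[OF prefix_code_nat]
        prefix_code_iff[OF prefix_code_list[OF prefix_code_trm]])
qed

lemma prefix_code_tgd: "prefix_code enc_tgd"
  unfolding prefix_code_def
proof (intro allI impI)
  fix \<xi> \<zeta> u v assume "enc_tgd \<xi> @ u = enc_tgd \<zeta> @ v"
  then show "\<xi> = \<zeta> \<and> u = v"
    by (cases \<xi>; cases \<zeta>)
      (simp add: enc_tgd_def prefix_code_iff[OF prefix_code_list[OF prefix_code_atom]])
qed

lemma enc_tgds_inject: "enc_tgds \<Xi> = enc_tgds \<Xi>' \<longleftrightarrow> \<Xi> = \<Xi>'"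
  unfolding enc_tgds_def
  using prefix_code_iff[OF prefix_code_list[OF prefix_code_tgd], of \<Xi> "[]" \<Xi>' "[]"] by simp

lemma enc_in_CStr_problem: "enc_tgds \<Xi> \<in> CStr_problem \<longleftrightarrow> set \<Xi> \<in> CStr"
  unfolding CStr_problem_def by (auto simp: enc_tgds_inject)


section \<open>Deterministic multi-tape Turing machines\<close>

datatype sym = Blank | Sep | Bit bool | Aux nat

datatype dir = Left | Stay | Right

text \<open>A two-way infinite tape is a pair \<open>(l, r)\<close>: \<open>l\<close> lists the cells to the left of the head, nearest
  first, and \<open>r\<close> the cells from the scanned one to the right; all further cells are blank.\<close>

type_synonym tape = "sym list \<times> sym list"

definition first :: "sym list \<Rightarrow> sym" where
  "first xs = (case xs of [] \<Rightarrow> Blank | x # _ \<Rightarrow> x)"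

fun tape_read :: "tape \<Rightarrow> sym" where
  "tape_read (l, r) = first r"

fun tape_write :: "sym \<Rightarrow> tape \<Rightarrow> tape" where
  "tape_write a (l, r) = (l, a # tl r)"

fun tape_move :: "dir \<Rightarrow> tape \<Rightarrow> tape" where
  "tape_move Left (l, r) = (tl l, first l # r)"
| "tape_move Stay (l, r) = (l, r)"
| "tape_move Right (l, r) = (first r # l, tl r)"

record tm =
  tapes :: nat
  states :: "nat set"
  symbols :: "sym set"
  start :: nat
  accept :: nat
  reject :: nat
  delta :: "nat \<Rightarrow> sym list \<Rightarrow> nat \<times> (sym \<times> dir) list"

definition wf_tm :: "tm \<Rightarrow> bool" where
  "wf_tm M \<longleftrightarrow>
     tapes M \<ge> 1 \<and> finite (states M) \<and> finite (symbols M) \<and>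
     {start M, accept M, reject M} \<subseteq> states M \<and> accept M \<noteq> reject M \<and>
     {Blank, Sep, Bit False, Bit True} \<subseteq> symbols M \<and>
     (\<forall>q \<in> states M. \<forall>as. length as = tapes M \<and> set as \<subseteq> symbols M \<longrightarrow>
        (case delta M q as of (q', acts) \<Rightarrow>
           q' \<in> states M \<and> length acts = tapes M \<and> fst ` set acts \<subseteq> symbols M))"

type_synonym config = "nat \<times> tape list"

fun tm_step :: "tm \<Rightarrow> config \<Rightarrow> config" where
  "tm_step M (q, ts) =
     (if q = accept M \<or> q = reject M then (q, ts)
      else case delta M q (map tape_read ts) of (q', acts) \<Rightarrow>
        (q', map2 (\<lambda>(a, d) t. tape_move d (tape_write a t)) acts ts))"

definition tm_init :: "tm \<Rightarrow> sym list \<Rightarrow> config" where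
  "tm_init M w = (start M, ([], w) # replicate (tapes M - 1) ([], []))"

text \<open>Halting states are fixed points of \<open>tm_step\<close>, so the state after \<open>t\<close> steps tells whether \<open>M\<close>
  has accepted or rejected within \<open>t\<close> steps.\<close>

definition state_after :: "tm \<Rightarrow> sym list \<Rightarrow> nat \<Rightarrow> nat" where
  "state_after M w t = fst ((tm_step M ^^ t) (tm_init M w))"


section \<open>The second level of the polynomial hierarchy\<close>

definition triple :: "bool list \<Rightarrow> bool list \<Rightarrow> bool list \<Rightarrow> sym list" where
  "triple x u v = map Bit x @ [Sep] @ map Bit u @ [Sep] @ map Bit v"

definition ptime_rel :: "(bool list \<Rightarrow> bool list \<Rightarrow> bool list \<Rightarrow> bool) \<Rightarrow> bool" where
  "ptime_rel R \<longleftrightarrow>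
     (\<exists>M (p :: nat poly). wf_tm M \<and>
        (\<forall>x u v. state_after M (triple x u v) (poly p (length (triple x u v)))
           = (if R x u v then accept M else reject M)))"

definition Pi2p :: "bool list set set" where
  "Pi2p = {L. \<exists>R (p :: nat poly). ptime_rel R \<and>
     (\<forall>x. x \<in> L \<longleftrightarrow>
        (\<forall>u. length u \<le> poly p (length x) \<longrightarrow>
           (\<exists>v. length v \<le> poly p (length x) \<and> R x u v)))}"

end

theory Submission
  imports Defs "HOL-Library.Countable"
begin

text \<open>If \<open>\<Sigma>\<close> is not C-stratified, some cycle of the chase graph carries a cycle of the dependency
  graph through a generating edge. Both cycles are closed walks of polynomial length, and running
  through them simultaneously gives one list of records, each naming a tgd, a position, and a small
  witness for all conditions on the next chase edge except \<open>J \<not>\<Turnstile> h\<^sub>2(\<xi>\<^sub>2)\<close>. That last condition is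
  universal: a second certificate refutes it by extending \<open>h\<^sub>2\<close>. Hence \<open>\<Sigma>\<close> is C-stratified iff for every
  list of records there is a refutation, and whether a refutation is correct is a first-order property of the
  three words, once a finite automaton has parsed them. A first-order formula is evaluated by finitely
  many heads, in nested loops over the positions, and a single-tape machine simulates the heads in
  polynomial time.\<close>

section \<open>Programs moving reading heads over a word\<close>

text \<open>One polynomial in the length of the input bounds both certificates, so a refutation must
  stay short even against records whose constants and nulls are written with very many bits. It
  therefore never writes a value: the records may contain only facts used by the two triggers, every
  value is then the image of a term of the two tgds, and the refutation names that term. Plain
  first-order logic over words cannot tell whether two names of unbounded length agree. The atomic
  formulas are therefore synchronised scans by two heads; they compare names, arities, argument
  indices and whole conjunctions, and they also yield the order of positions. The chase walk may
  visit tgds outside of the given cycle, since failure of weak acyclicity passes to larger sets.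
  Taking the product of the lengths of the two closed walks as the number of records lets both walks
  close up together.\<close>

text \<open>All heads of a program read the same word \<open>w\<close>; the cells outside of it are \<open>None\<close>.\<close>

definition cell :: "'c list \<Rightarrow> int \<Rightarrow> 'c option" where
  "cell w p = (if 0 \<le> p \<and> p < int (length w) then Some (w ! nat p) else None)"

fun shift :: "dir \<Rightarrow> int" where
  "shift Left = -1" | "shift Stay = 0" | "shift Right = 1"

datatype 'c cmd =
    Mv "nat \<Rightarrow> dir"
  | Then "'c cmd" "'c cmd"
  | Cond "(nat \<Rightarrow> 'c option) \<Rightarrow> bool" "'c cmd" "'c cmd"
  | Loop "(nat \<Rightarrow> 'c option) \<Rightarrow> bool" "'c cmd"

definition heads :: "'c list \<Rightarrow> nat \<Rightarrow> (nat \<Rightarrow> int) \<Rightarrow> nat \<Rightarrow> 'c option" where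
  "heads w K \<sigma> i = (if i < K then cell w (\<sigma> i) else None)"

text \<open>The step counts are exactly those of the machine built later: a move takes one step, and
  so does replacing a compound command by its components on the control stack. Thus
  \<open>simulate\<close> is an equation between numbers of steps; upper bounds enter only with
  \<open>runs\<close>.\<close>

inductive exec :: "'c list \<Rightarrow> nat \<Rightarrow> 'c cmd \<Rightarrow> (nat \<Rightarrow> int) \<Rightarrow> nat \<Rightarrow> (nat \<Rightarrow> int) \<Rightarrow> bool"
  for w K where
  Mv: "exec w K (Mv m) \<sigma> 1 (\<lambda>i. \<sigma> i + shift (m i))"
| Then: "exec w K a \<sigma> t \<sigma>' \<Longrightarrow> exec w K b \<sigma>' t' \<sigma>'' \<Longrightarrow> exec w K (Then a b) \<sigma> (Suc (t + t')) \<sigma>''"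
| Cond: "exec w K (if b (heads w K \<sigma>) then x else y) \<sigma> t \<sigma>' \<Longrightarrow> exec w K (Cond b x y) \<sigma> (Suc t) \<sigma>'"
| Loop_end: "\<not> b (heads w K \<sigma>) \<Longrightarrow> exec w K (Loop b x) \<sigma> 1 \<sigma>"
| Loop: "b (heads w K \<sigma>) \<Longrightarrow> exec w K x \<sigma> t \<sigma>' \<Longrightarrow> exec w K (Loop b x) \<sigma>' t' \<sigma>'' \<Longrightarrow>
    exec w K (Loop b x) \<sigma> (Suc (t + t')) \<sigma>''"

definition runs :: "'c list \<Rightarrow> nat \<Rightarrow> 'c cmd \<Rightarrow> (nat \<Rightarrow> int) \<Rightarrow> nat \<Rightarrow> (nat \<Rightarrow> int) \<Rightarrow> bool" where
  "runs w K c \<sigma> T \<sigma>' \<longleftrightarrow> (\<exists>t \<le> T. exec w K c \<sigma> t \<sigma>')"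

lemma runs_mono: "runs w K c \<sigma> T \<sigma>' \<Longrightarrow> T \<le> T' \<Longrightarrow> runs w K c \<sigma> T' \<sigma>'"
  unfolding runs_def by (meson le_trans)

lemma runs_Mv: "\<sigma>' = (\<lambda>i. \<sigma> i + shift (m i)) \<Longrightarrow> 1 \<le> T \<Longrightarrow> runs w K (Mv m) \<sigma> T \<sigma>'"
  unfolding runs_def using exec.Mv by metis

lemma runs_Then:
  assumes "runs w K a \<sigma> t \<sigma>'" "runs w K b \<sigma>' t' \<sigma>''" "Suc (t + t') \<le> T"
  shows "runs w K (Then a b) \<sigma> T \<sigma>''"
proof -
  obtain s s' where "s \<le> t" "s' \<le> t'" "exec w K a \<sigma> s \<sigma>'" "exec w K b \<sigma>' s' \<sigma>''"
    using assms unfolding runs_def by blast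
  then have "exec w K (Then a b) \<sigma> (Suc (s + s')) \<sigma>''" "Suc (s + s') \<le> T"
    using assms(3) by (auto intro: exec.Then)
  then show ?thesis unfolding runs_def by blast
qed

lemma runs_Cond:
  assumes "runs w K (if b (heads w K \<sigma>) then x else y) \<sigma> t \<sigma>'" "Suc t \<le> T"
  shows "runs w K (Cond b x y) \<sigma> T \<sigma>'"
proof -
  obtain s where "s \<le> t" "exec w K (if b (heads w K \<sigma>) then x else y) \<sigma> s \<sigma>'"
    using assms unfolding runs_def by blast
  then have "exec w K (Cond b x y) \<sigma> (Suc s) \<sigma>'" "Suc s \<le> T"
    using assms(2) by (auto intro: exec.Cond)
  then show ?thesis unfolding runs_def by blast
qed

lemma runs_Loop_end: "\<not> b (heads w K \<sigma>) \<Longrightarrow> 1 \<le> T \<Longrightarrow> \<sigma>' = \<sigma> \<Longrightarrow> runs w K (Loop b x) \<sigma> T \<sigma>'"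
  unfolding runs_def using exec.Loop_end by metis

lemma runs_Loop:
  assumes "b (heads w K \<sigma>)" "runs w K x \<sigma> t \<sigma>'" "runs w K (Loop b x) \<sigma>' t' \<sigma>''" "Suc (t + t') \<le> T"
  shows "runs w K (Loop b x) \<sigma> T \<sigma>''"
proof -
  obtain s s' where "s \<le> t" "s' \<le> t'" "exec w K x \<sigma> s \<sigma>'" "exec w K (Loop b x) \<sigma>' s' \<sigma>''"
    using assms unfolding runs_def by blast
  then have "exec w K (Loop b x) \<sigma> (Suc (s + s')) \<sigma>''" "Suc (s + s') \<le> T"
    using assms(1,4) by (auto intro: exec.Loop)
  then show ?thesis unfolding runs_def by blast
qed

definition mv :: "nat set \<Rightarrow> dir \<Rightarrow> 'c cmd" where
  "mv A d = Mv (\<lambda>i. if i \<in> A then d else Stay)"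

lemma runs_mv:
  "\<sigma>' = (\<lambda>i. \<sigma> i + (if i \<in> A then shift d else 0)) \<Longrightarrow> 1 \<le> T \<Longrightarrow> runs w K (mv A d) \<sigma> T \<sigma>'"
  unfolding mv_def by (rule runs_Mv) auto

lemma heads_in: "i < K \<Longrightarrow> 0 \<le> \<sigma> i \<Longrightarrow> \<sigma> i < int (length w) \<Longrightarrow> heads w K \<sigma> i = Some (w ! nat (\<sigma> i))"
  by (simp add: heads_def cell_def)

lemma heads_out: "\<sigma> i < 0 \<or> int (length w) \<le> \<sigma> i \<Longrightarrow> heads w K \<sigma> i = None"
  by (auto simp: heads_def cell_def)

definition rewind :: "nat \<Rightarrow> 'c cmd" where
  "rewind i = Loop (\<lambda>h. h i \<noteq> None) (mv {i} Left)"

lemma runs_rewind: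
  fixes w :: "'a list"
  assumes "i < K" "\<sigma> i = int k - 1" "k \<le> length w"
  shows "runs w K (rewind i) \<sigma> (2 * k + 1) (\<sigma>(i := -1))"
  using assms(2,3)
proof (induction k arbitrary: \<sigma>)
  case 0
  then have eq: "\<sigma>(i := -1) = \<sigma>" by (intro ext) simp
  have "heads w K \<sigma> i = None" using 0 by (simp add: heads_out)
  then show ?case unfolding rewind_def by (intro runs_Loop_end[OF _ _ eq]) simp_all
next
  case (Suc k)
  let ?\<sigma> = "\<sigma>(i := int k - 1)"
  let ?b = "\<lambda>h::nat \<Rightarrow> 'a option. h i \<noteq> None"
  have "runs w K (rewind i) ?\<sigma> (2 * k + 1) (?\<sigma>(i := -1))"
    using Suc.prems by (intro Suc.IH) simp_all
  then have *: "runs w K (rewind i) ?\<sigma> (2 * k + 1) (\<sigma>(i := -1))"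
    by (simp only: fun_upd_upd)
  have "?b (heads w K \<sigma>)" using Suc.prems assms(1) by (simp add: heads_in)
  moreover have "runs w K (mv {i} Left) \<sigma> 1 ?\<sigma>"
    using Suc.prems by (intro runs_mv ext) simp_all
  moreover note *
  ultimately show ?case unfolding rewind_def by (rule runs_Loop[where b = ?b]) simp
qed

text \<open>Heads can neither jump nor compare positions. Head \<open>a\<close> walks right while
  \<open>v\<close> walks left to the cell before the word, and head 2 records the distance so that
  \<open>v\<close> can be walked back.\<close>

definition copy_head :: "nat \<Rightarrow> nat \<Rightarrow> 'c cmd" where
  "copy_head v a = Then
     (Loop (\<lambda>h. h v \<noteq> None) (Mv (\<lambda>i. if i = v then Left else if i = a \<or> i = 2 then Right else Stay)))
     (Loop (\<lambda>h. h 2 \<noteq> None) (Mv (\<lambda>i. if i = v then Right else if i = 2 then Left else Stay)))"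

lemma runs_copy_head:
  fixes w :: "'a list"
  assumes K: "v < K" "2 < K" and ne: "v \<noteq> a" "v \<noteq> 2" "a \<noteq> 2"
    and pos: "\<sigma> v = int p" "p < length w" "\<sigma> a = -1" "\<sigma> 2 = -1"
  shows "runs w K (copy_head v a) \<sigma> (4 * length w + 3) (\<sigma>(a := int p))"
proof -
  have 1: "runs w K (Loop (\<lambda>h. h v \<noteq> None)
      (Mv (\<lambda>i. if i = v then Left else if i = a \<or> i = 2 then Right else Stay))) \<sigma> (2 * k + 1)
      (\<sigma>(v := -1, a := \<sigma> a + int k, 2 := \<sigma> 2 + int k))"
    if "\<sigma> v = int k - 1" "k \<le> length w" for \<sigma> k
    using that
  proof (induction k arbitrary: \<sigma>)
    case 0
    then have eq: "\<sigma>(v := -1, a := \<sigma> a + int 0, 2 := \<sigma> 2 + int 0) = \<sigma>" using ne by (intro ext) simp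
    have "heads w K \<sigma> v = None" using 0 by (simp add: heads_out)
    then show ?case by (intro runs_Loop_end[OF _ _ eq]) simp_all
  next
    case (Suc k)
    let ?\<sigma> = "\<sigma>(v := int k - 1, a := \<sigma> a + 1, 2 := \<sigma> 2 + 1)"
    let ?b = "\<lambda>h::nat \<Rightarrow> 'a option. h v \<noteq> None"
    let ?m = "\<lambda>i. if i = v then Left else if i = a \<or> i = 2 then Right else Stay"
    have *: "?\<sigma>(v := -1, a := ?\<sigma> a + int k, 2 := ?\<sigma> 2 + int k)
       = \<sigma>(v := -1, a := \<sigma> a + int (Suc k), 2 := \<sigma> 2 + int (Suc k))"
      using ne by (intro ext) simp
    have "?b (heads w K \<sigma>)" using Suc.prems K by (simp add: heads_in)
    moreover have "runs w K (Mv ?m) \<sigma> 1 ?\<sigma>"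
      using Suc.prems ne by (intro runs_Mv ext) simp_all
    moreover have "runs w K (Loop ?b (Mv ?m)) ?\<sigma> (2 * k + 1) (\<sigma>(v := -1, a := \<sigma> a + int (Suc k), 2 := \<sigma> 2 + int (Suc k)))"
      unfolding *[symmetric] using Suc.prems ne by (intro Suc.IH) simp_all
    ultimately show ?case by (rule runs_Loop[where b = ?b]) simp
  qed
  have 2: "runs w K (Loop (\<lambda>h. h 2 \<noteq> None)
      (Mv (\<lambda>i. if i = v then Right else if i = 2 then Left else Stay))) \<sigma> (2 * k + 1)
      (\<sigma>(v := \<sigma> v + int k, 2 := -1))"
    if "\<sigma> 2 = int k - 1" "k \<le> length w" for \<sigma> k
    using that
  proof (induction k arbitrary: \<sigma>)
    case 0
    then have eq: "\<sigma>(v := \<sigma> v + int 0, 2 := -1) = \<sigma>" using ne by (intro ext) simp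
    have "heads w K \<sigma> 2 = None" using 0 by (simp add: heads_out)
    then show ?case by (intro runs_Loop_end[OF _ _ eq]) simp_all
  next
    case (Suc k)
    let ?\<sigma> = "\<sigma>(v := \<sigma> v + 1, 2 := int k - 1)"
    let ?b = "\<lambda>h::nat \<Rightarrow> 'a option. h 2 \<noteq> None"
    let ?m = "\<lambda>i. if i = v then Right else if i = 2 then Left else Stay"
    have *: "?\<sigma>(v := ?\<sigma> v + int k, 2 := -1) = \<sigma>(v := \<sigma> v + int (Suc k), 2 := -1)"
      using ne by (intro ext) simp
    have "?b (heads w K \<sigma>)" using Suc.prems K by (simp add: heads_in)
    moreover have "runs w K (Mv ?m) \<sigma> 1 ?\<sigma>"
      using Suc.prems ne by (intro runs_Mv ext) simp_all
    moreover have "runs w K (Loop ?b (Mv ?m)) ?\<sigma> (2 * k + 1) (\<sigma>(v := \<sigma> v + int (Suc k), 2 := -1))"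
      unfolding *[symmetric] using Suc.prems ne by (intro Suc.IH) simp_all
    ultimately show ?case by (rule runs_Loop[where b = ?b]) simp
  qed
  \<comment> \<open>Both loops run \<open>Suc p\<close> times, because a resting head stands at
    position -1 and not at 0.\<close>
  let ?\<sigma> = "\<sigma>(v := -1, a := int p, 2 := int p)"
  have "runs w K (copy_head v a) \<sigma> (2 * Suc p + 1 + (2 * Suc p + 1) + 1) (?\<sigma>(v := ?\<sigma> v + int (Suc p), 2 := -1))"
    unfolding copy_head_def
  proof (rule runs_Then)
    have "\<sigma>(v := -1, a := \<sigma> a + int (Suc p), 2 := \<sigma> 2 + int (Suc p)) = ?\<sigma>"
      using pos by simp
    with 1[of \<sigma> "Suc p"] pos
    show "runs w K (Loop (\<lambda>h. h v \<noteq> None)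
      (Mv (\<lambda>i. if i = v then Left else if i = a \<or> i = 2 then Right else Stay))) \<sigma> (2 * Suc p + 1) ?\<sigma>"
      by simp
    show "runs w K (Loop (\<lambda>h. h 2 \<noteq> None)
      (Mv (\<lambda>i. if i = v then Right else if i = 2 then Left else Stay))) ?\<sigma> (2 * Suc p + 1)
      (?\<sigma>(v := ?\<sigma> v + int (Suc p), 2 := -1))"
      by (rule 2) (use pos in simp_all)
  qed simp
  moreover have "?\<sigma>(v := ?\<sigma> v + int (Suc p), 2 := -1) = \<sigma>(a := int p)"
    using ne pos by (intro ext) simp
  ultimately have "runs w K (copy_head v a) \<sigma> (2 * Suc p + 1 + (2 * Suc p + 1) + 1) (\<sigma>(a := int p))"
    by (simp only:)
  then show ?thesis by (rule runs_mono) (use pos in simp)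
qed

section \<open>First-order formulas over words\<close>

definition hd_option :: "'a list \<Rightarrow> 'a option" where
  "hd_option xs = (case xs of [] \<Rightarrow> None | x # _ \<Rightarrow> Some x)"

lemma hd_option_simps [simp]: "hd_option [] = None" "hd_option (x # xs) = Some x"
  by (simp_all add: hd_option_def)

lemma hd_option_hd: "xs \<noteq> [] \<Longrightarrow> hd_option xs = Some (hd xs)"
  by (cases xs) auto

text \<open>Two lists are read in parallel, ignoring the elements in \<open>k1\<close> and \<open>k2\<close>, up to the first
  pair that satisfies \<open>c\<close> (or the end of one list); there \<open>r\<close> is tested.\<close>

function sync :: "('c \<Rightarrow> bool) \<Rightarrow> ('c \<Rightarrow> bool) \<Rightarrow> ('c \<Rightarrow> 'c \<Rightarrow> bool) \<Rightarrow>
    ('c option \<Rightarrow> 'c option \<Rightarrow> bool) \<Rightarrow> 'c list \<Rightarrow> 'c list \<Rightarrow> bool" where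
  "sync k1 k2 c r xs ys =
    (if xs \<noteq> [] \<and> k1 (hd xs) then sync k1 k2 c r (tl xs) ys
     else if ys \<noteq> [] \<and> k2 (hd ys) then sync k1 k2 c r xs (tl ys)
     else if xs = [] \<or> ys = [] \<or> c (hd xs) (hd ys) then r (hd_option xs) (hd_option ys)
     else sync k1 k2 c r (tl xs) (tl ys))"
  by pat_completeness auto
termination
  by (relation "measure (\<lambda>(_, _, _, _, xs, ys). length xs + length ys)") (auto simp: neq_Nil_conv)

declare sync.simps [simp del]

text \<open>A leftward scan lists the prefix up to and including position \<open>p\<close>
  backwards, so in both directions the list begins with the scanned cell. Positions are integers
  because a head may leave the word.\<close>

definition scan :: "bool \<Rightarrow> 'c list \<Rightarrow> int \<Rightarrow> 'c list" where
  "scan rt w p = (if rt then drop (nat p) w else rev (take (nat (p + 1)) w))"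

datatype 'c fo =
    Sync bool "'c \<Rightarrow> bool" "'c \<Rightarrow> bool" "'c \<Rightarrow> 'c \<Rightarrow> bool" "'c option \<Rightarrow> 'c option \<Rightarrow> bool" nat nat
  | Neg "'c fo"
  | Conj "'c fo" "'c fo"
  | Ex "'c fo"

text \<open>Variables are de Bruijn indices; they range over the positions of the word.\<close>

primrec eval :: "'c list \<Rightarrow> (nat \<Rightarrow> nat) \<Rightarrow> 'c fo \<Rightarrow> bool" where
  "eval w e (Sync rt k1 k2 c r p q) = sync k1 k2 c r (scan rt w (int (e p))) (scan rt w (int (e q)))"
| "eval w e (Neg \<phi>) = (\<not> eval w e \<phi>)"
| "eval w e (Conj \<phi> \<psi>) = (eval w e \<phi> \<and> eval w e \<psi>)"
| "eval w e (Ex \<phi>) = (\<exists>i < length w. eval w (case_nat i e) \<phi>)"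

text \<open>A scanning head may overrun the word by one cell, on the side towards which it
  moves.\<close>

definition scan_ok :: "bool \<Rightarrow> 'c list \<Rightarrow> int \<Rightarrow> bool" where
  "scan_ok rt w p = (if rt then 0 \<le> p \<and> p \<le> int (length w) else -1 \<le> p \<and> p < int (length w))"

abbreviation scan_dir :: "bool \<Rightarrow> dir" where
  "scan_dir rt \<equiv> (if rt then Right else Left)"

lemma scan_hd: "scan_ok rt w p \<Longrightarrow> hd_option (scan rt w p) = cell w p"
proof (cases rt)
  case True
  assume "scan_ok rt w p"
  then show ?thesis using True
    by (cases "nat p < length w")
      (auto simp: scan_def scan_ok_def cell_def hd_option_hd hd_drop_conv_nth nat_less_iff)
next
  case False
  assume *: "scan_ok rt w p"
  show ?thesis
  proof (cases "p = -1")
    case False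
    then have "0 \<le> p" "nat p < length w" using * \<open>\<not> rt\<close> by (auto simp: scan_ok_def)
    moreover from this have "nat (p + 1) = Suc (nat p)" by simp
    ultimately show ?thesis using \<open>\<not> rt\<close>
      by (auto simp: scan_def cell_def take_Suc_conv_app_nth)
  qed (use \<open>\<not> rt\<close> in \<open>simp add: scan_def cell_def\<close>)
qed

lemma scan_step:
  assumes "scan_ok rt w p" "scan rt w p \<noteq> []"
  shows "scan rt w (p + shift (scan_dir rt)) = tl (scan rt w p) \<and> scan_ok rt w (p + shift (scan_dir rt))"
proof (cases rt)
  case True
  then show ?thesis using assms
    by (auto simp: scan_def scan_ok_def drop_Suc tl_drop nat_add_distrib)
next
  case False
  then have "0 \<le> p" "nat p < length w" using assms
    by (auto simp: scan_ok_def scan_def)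
  moreover from this have "nat (p + 1) = Suc (nat p)" by simp
  ultimately show ?thesis using False
    by (auto simp: scan_def scan_ok_def take_Suc_conv_app_nth)
qed

abbreviation holds :: "('c \<Rightarrow> bool) \<Rightarrow> 'c option \<Rightarrow> bool" where
  "holds k x \<equiv> (\<exists>a. x = Some a \<and> k a)"

definition stop :: "('c \<Rightarrow> 'c \<Rightarrow> bool) \<Rightarrow> 'c option \<Rightarrow> 'c option \<Rightarrow> bool" where
  "stop c x y \<longleftrightarrow> x = None \<or> y = None \<or> c (the x) (the y)"

definition scan_loop :: "bool \<Rightarrow> ('c \<Rightarrow> bool) \<Rightarrow> ('c \<Rightarrow> bool) \<Rightarrow> ('c \<Rightarrow> 'c \<Rightarrow> bool) \<Rightarrow> 'c cmd" where
  "scan_loop rt k1 k2 c =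
     Loop (\<lambda>h. holds k1 (h 0) \<or> holds k2 (h 1) \<or> \<not> stop c (h 0) (h 1))
       (Cond (\<lambda>h. holds k1 (h 0)) (mv {0} (scan_dir rt))
         (Cond (\<lambda>h. holds k2 (h 1)) (mv {1} (scan_dir rt)) (mv {0, 1} (scan_dir rt))))"

text \<open>A round takes at most four steps, one for the loop and three for the two tests and the
  move, and it removes at least one cell from what remains to be scanned. The final head positions
  stay unspecified; what counts is that \<open>r\<close>, applied to the cells below them, gives the
  value of \<open>sync\<close>.\<close>

lemma runs_scan_loop:
  assumes "1 < K" "scan_ok rt w (\<sigma> 0)" "scan_ok rt w (\<sigma> 1)"
  shows "\<exists>a b. scan_ok rt w a \<and> scan_ok rt w b \<and>
    runs w K (scan_loop rt k1 k2 c) \<sigma>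
      (4 * (length (scan rt w (\<sigma> 0)) + length (scan rt w (\<sigma> 1))) + 1) (\<sigma>(0 := a, 1 := b)) \<and>
    r (cell w a) (cell w b) = sync k1 k2 c r (scan rt w (\<sigma> 0)) (scan rt w (\<sigma> 1))"
  using assms(2,3)
proof (induction "length (scan rt w (\<sigma> 0)) + length (scan rt w (\<sigma> 1))" arbitrary: \<sigma> rule: less_induct)
  case less
  let ?xs = "scan rt w (\<sigma> 0)" and ?ys = "scan rt w (\<sigma> 1)" and ?d = "shift (scan_dir rt)"
  let ?G = "\<lambda>h. holds k1 (h 0) \<or> holds k2 (h (1::nat)) \<or> \<not> stop c (h (0::nat)) (h 1)"
  let ?B = "Cond (\<lambda>h. holds k1 (h 0)) (mv {0} (scan_dir rt))
         (Cond (\<lambda>h. holds k2 (h 1)) (mv {1} (scan_dir rt)) (mv {0, 1} (scan_dir rt)))"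
  have h: "heads w K \<sigma> 0 = hd_option ?xs" "heads w K \<sigma> 1 = hd_option ?ys"
    using less.prems assms(1) scan_hd[of rt w] by (simp_all add: heads_def)
  have step: ?case
    if G: "?G (heads w K \<sigma>)" and run: "runs w K ?B \<sigma> 3 \<sigma>'"
      and \<sigma>': "\<sigma>' = \<sigma>(0 := a, 1 := b)" and ok: "scan_ok rt w a" "scan_ok rt w b"
      and sm: "length (scan rt w a) + length (scan rt w b) < length ?xs + length ?ys"
      and eq: "sync k1 k2 c r ?xs ?ys = sync k1 k2 c r (scan rt w a) (scan rt w b)" for \<sigma>' a b
  proof -
    obtain a' b' where *: "scan_ok rt w a'" "scan_ok rt w b'"
      "runs w K (scan_loop rt k1 k2 c) \<sigma>' (4 * (length (scan rt w a) + length (scan rt w b)) + 1)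
        (\<sigma>'(0 := a', 1 := b'))"
      "r (cell w a') (cell w b') = sync k1 k2 c r (scan rt w a) (scan rt w b)"
      using less.hyps[of \<sigma>'] ok sm unfolding \<sigma>' by auto
    have "runs w K (scan_loop rt k1 k2 c) \<sigma> (4 * (length ?xs + length ?ys) + 1) (\<sigma>'(0 := a', 1 := b'))"
      using sm unfolding scan_loop_def
      by (intro runs_Loop[OF G run *(3)[unfolded scan_loop_def]]) arith
    moreover have "\<sigma>'(0 := a', 1 := b') = \<sigma>(0 := a', 1 := b')" unfolding \<sigma>' by auto
    ultimately show ?thesis using *(1,2,4) eq by metis
  qed
  consider (k1) "?xs \<noteq> []" "k1 (hd ?xs)"
    | (k2) "\<not> (?xs \<noteq> [] \<and> k1 (hd ?xs))" "?ys \<noteq> []" "k2 (hd ?ys)"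
    | (st) "\<not> (?xs \<noteq> [] \<and> k1 (hd ?xs))" "\<not> (?ys \<noteq> [] \<and> k2 (hd ?ys))"
        "?xs = [] \<or> ?ys = [] \<or> c (hd ?xs) (hd ?ys)"
    | (go) "\<not> (?xs \<noteq> [] \<and> k1 (hd ?xs))" "\<not> (?ys \<noteq> [] \<and> k2 (hd ?ys))"
        "?xs \<noteq> []" "?ys \<noteq> []" "\<not> c (hd ?xs) (hd ?ys)"
    by blast
  then show ?case
  proof cases
    case k1
    let ?\<sigma> = "\<sigma>(0 := \<sigma> 0 + ?d, 1 := \<sigma> 1)"
    have h0: "hd_option ?xs = Some (hd ?xs)" using k1(1) by (rule hd_option_hd)
    have mv: "runs w K (mv {0} (scan_dir rt)) \<sigma> 1 ?\<sigma>" by (intro runs_mv ext) simp_all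
    have run: "runs w K ?B \<sigma> 3 ?\<sigma>"
      by (rule runs_Cond[where t = 1]) (use mv k1(2) in \<open>simp_all only: h h0\<close>, simp_all)
    have "?G (heads w K \<sigma>)" using k1(2) unfolding h h0 by simp
    moreover note st = scan_step[OF less.prems(1) k1(1)]
    have "sync k1 k2 c r ?xs ?ys = sync k1 k2 c r (scan rt w (\<sigma> 0 + ?d)) (scan rt w (\<sigma> 1))"
      using k1 st by (subst sync.simps) auto
    moreover have "length (scan rt w (\<sigma> 0 + ?d)) + length (scan rt w (\<sigma> 1)) < length ?xs + length ?ys"
      using k1 st by (cases ?xs; cases ?ys) simp_all
    moreover have "scan_ok rt w (\<sigma> 0 + ?d)" "scan_ok rt w (\<sigma> 1)" using st less.prems by simp_all
    ultimately show ?thesis by (intro step[OF _ run refl])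
  next
    case k2
    let ?\<sigma> = "\<sigma>(0 := \<sigma> 0, 1 := \<sigma> 1 + ?d)"
    have h1: "hd_option ?ys = Some (hd ?ys)" using k2(2) by (rule hd_option_hd)
    have h0: "\<not> holds k1 (hd_option ?xs)" using k2(1) by (cases ?xs) auto
    have mv: "runs w K (mv {1} (scan_dir rt)) \<sigma> 1 ?\<sigma>" by (intro runs_mv ext) simp_all
    have run1: "runs w K (Cond (\<lambda>h. holds k2 (h 1)) (mv {1} (scan_dir rt)) (mv {0, 1} (scan_dir rt))) \<sigma> 2 ?\<sigma>"
      by (rule runs_Cond[where t = 1]) (use mv k2(3) in \<open>simp_all only: h h1\<close>, simp_all)
    have run: "runs w K ?B \<sigma> 3 ?\<sigma>"
      by (rule runs_Cond[where t = 2]) (use run1 h0 in \<open>simp_all only: h\<close>, simp_all)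
    have "?G (heads w K \<sigma>)" using k2(3) unfolding h h1 by simp
    moreover note st = scan_step[OF less.prems(2) k2(2)]
    have "sync k1 k2 c r ?xs ?ys = sync k1 k2 c r (scan rt w (\<sigma> 0)) (scan rt w (\<sigma> 1 + ?d))"
      using k2 st by (subst sync.simps) auto
    moreover have "length (scan rt w (\<sigma> 0)) + length (scan rt w (\<sigma> 1 + ?d)) < length ?xs + length ?ys"
      using k2 st by (cases ?xs; cases ?ys) simp_all
    moreover have "scan_ok rt w (\<sigma> 0)" "scan_ok rt w (\<sigma> 1 + ?d)" using st less.prems by simp_all
    ultimately show ?thesis by (intro step[OF _ run refl])
  next
    case st
    have "\<not> ?G (heads w K \<sigma>)" using st unfolding h stop_def by (cases ?xs; cases ?ys) auto
    then have "runs w K (scan_loop rt k1 k2 c) \<sigma> 1 \<sigma>"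
      unfolding scan_loop_def by (rule runs_Loop_end) simp_all
    then have "runs w K (scan_loop rt k1 k2 c) \<sigma> (4 * (length ?xs + length ?ys) + 1) \<sigma>"
      by (rule runs_mono) simp
    moreover have "r (cell w (\<sigma> 0)) (cell w (\<sigma> 1)) = sync k1 k2 c r ?xs ?ys"
      unfolding scan_hd[OF less.prems(1), symmetric] scan_hd[OF less.prems(2), symmetric]
      using st by (subst sync.simps) auto
    ultimately show ?thesis using less.prems by (intro exI[of _ "\<sigma> 0"] exI[of _ "\<sigma> 1"]) simp
  next
    case go
    let ?\<sigma> = "\<sigma>(0 := \<sigma> 0 + ?d, 1 := \<sigma> 1 + ?d)"
    have h01: "\<not> holds k1 (hd_option ?xs)" "\<not> holds k2 (hd_option ?ys)" "\<not> stop c (hd_option ?xs) (hd_option ?ys)"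
      using go by (cases ?xs; cases ?ys; simp add: stop_def)+
    have mv: "runs w K (mv {0, 1} (scan_dir rt)) \<sigma> 1 ?\<sigma>" by (intro runs_mv ext) simp_all
    have run1: "runs w K (Cond (\<lambda>h. holds k2 (h 1)) (mv {1} (scan_dir rt)) (mv {0, 1} (scan_dir rt))) \<sigma> 2 ?\<sigma>"
      by (rule runs_Cond[where t = 1]) (use mv h01 in \<open>simp_all only: h\<close>, simp_all)
    have run: "runs w K ?B \<sigma> 3 ?\<sigma>"
      by (rule runs_Cond[where t = 2]) (use run1 h01 in \<open>simp_all only: h\<close>, simp_all)
    have "?G (heads w K \<sigma>)" using h01 unfolding h by simp
    moreover note st = scan_step[OF less.prems(1) go(3)] scan_step[OF less.prems(2) go(4)]
    have "sync k1 k2 c r ?xs ?ys = sync k1 k2 c r (scan rt w (\<sigma> 0 + ?d)) (scan rt w (\<sigma> 1 + ?d))"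
      using go st by (subst sync.simps) auto
    moreover have "length (scan rt w (\<sigma> 0 + ?d)) + length (scan rt w (\<sigma> 1 + ?d)) < length ?xs + length ?ys"
      using go st by (cases ?xs; cases ?ys) simp_all
    moreover have "scan_ok rt w (\<sigma> 0 + ?d)" "scan_ok rt w (\<sigma> 1 + ?d)" using st less.prems by simp_all
    ultimately show ?thesis by (intro step[OF _ run refl])
  qed
qed

section \<open>Compilation of formulas into head programs\<close>

primrec depth :: "'c fo \<Rightarrow> nat" where
  "depth (Sync rt k1 k2 c r p q) = 0"
| "depth (Neg \<phi>) = depth \<phi>"
| "depth (Conj \<phi> \<psi>) = max (depth \<phi>) (depth \<psi>)"
| "depth (Ex \<phi>) = Suc (depth \<phi>)"

text \<open>Heads 0 and 1 perform the scans, head 2 serves to copy positions, and head 3 holds the truth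
  value (outside of the word for false, on its first cell for true). The variable \<open>v\<close> is held
  by head \<open>\<rho> v\<close>; from \<open>d\<close> on the heads are unused and rest at position -1.\<close>

primrec comp :: "'c fo \<Rightarrow> (nat \<Rightarrow> nat) \<Rightarrow> nat \<Rightarrow> 'c cmd" where
  "comp (Sync rt k1 k2 c r p q) \<rho> d =
     Then (copy_head (\<rho> p) 0) (Then (copy_head (\<rho> q) 1) (Then (scan_loop rt k1 k2 c)
       (Then (Cond (\<lambda>h. r (h 0) (h 1)) (mv {3} Right) (mv {} Stay))
         (Then (mv (if rt then {0, 1} else {}) Left) (Then (rewind 0) (rewind 1))))))"
| "comp (Neg \<phi>) \<rho> d = Then (comp \<phi> \<rho> d) (Cond (\<lambda>h. h 3 = None) (mv {3} Right) (mv {3} Left))"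
| "comp (Conj \<phi> \<psi>) \<rho> d =
     Then (comp \<phi> \<rho> d) (Cond (\<lambda>h. h 3 = None) (mv {} Stay) (Then (mv {3} Left) (comp \<psi> \<rho> d)))"
| "comp (Ex \<phi>) \<rho> d =
     Then (mv {d} Right)
      (Then (Loop (\<lambda>h. h d \<noteq> None \<and> h 3 = None)
          (Then (comp \<phi> (case_nat d \<rho>) (Suc d)) (Cond (\<lambda>h. h 3 = None) (mv {d} Right) (mv {} Stay))))
        (Then (mv {d} Left) (rewind d)))"

text \<open>For a word of length n, the atomic case takes 4n + 3 steps for each copy, 8n + 1 for the
  scan, 2 for the result, 1 for stepping back, at most 2n + 1 for each rewinding, and 6 for
  sequencing: 20n + 18 in all. A quantifier contributes a factor n + 1, so a fixed formula has
  polynomial cost.\<close>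

primrec cost :: "'c fo \<Rightarrow> nat poly" where
  "cost (Sync rt k1 k2 c r p q) = [:18, 20:]"
| "cost (Neg \<phi>) = cost \<phi> + [:3:]"
| "cost (Conj \<phi> \<psi>) = cost \<phi> + cost \<psi> + [:5:]"
| "cost (Ex \<phi>) = [:1, 1:] * (cost \<phi> + [:4:]) + [:7, 2:]"

text \<open>The invariant between commands: the auxiliary heads and all heads from \<open>d\<close>
  on rest just before the word. A compiled formula restores it, except that head 3 carries the truth
  value.\<close>

definition ready :: "'c list \<Rightarrow> (nat \<Rightarrow> nat) \<Rightarrow> (nat \<Rightarrow> nat) \<Rightarrow> nat \<Rightarrow> (nat \<Rightarrow> int) \<Rightarrow> bool" where
  "ready w e \<rho> d \<sigma> \<longleftrightarrow> w \<noteq> [] \<and> 5 \<le> d \<and> \<sigma> 0 = -1 \<and> \<sigma> 1 = -1 \<and> \<sigma> 2 = -1 \<and> \<sigma> 3 = -1 \<and>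
     (\<forall>v. \<sigma> (\<rho> v) = int (e v) \<and> e v < length w \<and> 4 \<le> \<rho> v \<and> \<rho> v < d) \<and> (\<forall>j \<ge> d. \<sigma> j = -1)"

lemma length_scan: "length (scan rt w p) \<le> length w"
  by (simp add: scan_def)

lemma runs_comp:
  "ready w e \<rho> d \<sigma> \<Longrightarrow> d + depth \<phi> \<le> K \<Longrightarrow>
   runs w K (comp \<phi> \<rho> d) \<sigma> (poly (cost \<phi>) (length w)) (\<sigma>(3 := if eval w e \<phi> then 0 else -1))"
proof (induction \<phi> arbitrary: \<rho> d \<sigma> e)
  case (Sync rt k1 k2 c r p q)
  note rd = Sync.prems(1)[unfolded ready_def]
  let ?n = "length w"
  let ?S = "Sync rt k1 k2 c r p q" let ?f = "if eval w e ?S then 0 else -1 :: int"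
  have d: "5 \<le> d" "d \<le> K" using Sync.prems rd by auto
  have \<rho>: "4 \<le> \<rho> v" "\<rho> v < d" "\<sigma> (\<rho> v) = int (e v)" "e v < ?n" for v
    using rd by auto
  have ne: "\<rho> v \<noteq> 0" "\<rho> v \<noteq> 1" "\<rho> v \<noteq> 2" "\<rho> v < K" for v
    using \<rho>[of v] d by auto
  let ?\<sigma>1 = "\<sigma>(0 := int (e p))"
  let ?\<sigma>2 = "?\<sigma>1(1 := int (e q))"
  have s1: "runs w K (copy_head (\<rho> p) 0) \<sigma> (4 * ?n + 3) ?\<sigma>1"
    using rd \<rho> ne d by (intro runs_copy_head) auto
  have s2: "runs w K (copy_head (\<rho> q) 1) ?\<sigma>1 (4 * ?n + 3) ?\<sigma>2"
    using rd \<rho> ne[of q] d by (intro runs_copy_head) auto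
  have ok: "scan_ok rt w (?\<sigma>2 0)" "scan_ok rt w (?\<sigma>2 1)"
    using \<rho>[of p] \<rho>[of q] by (auto simp: scan_ok_def)
  obtain a b where ab: "scan_ok rt w a" "scan_ok rt w b"
    "runs w K (scan_loop rt k1 k2 c) ?\<sigma>2
       (4 * (length (scan rt w (?\<sigma>2 0)) + length (scan rt w (?\<sigma>2 1))) + 1) (?\<sigma>2(0 := a, 1 := b))"
    "r (cell w a) (cell w b) = sync k1 k2 c r (scan rt w (?\<sigma>2 0)) (scan rt w (?\<sigma>2 1))"
    using runs_scan_loop[of K rt w ?\<sigma>2 k1 k2 c r, OF _ ok] d by auto
  let ?\<sigma>3 = "\<sigma>(0 := a, 1 := b)"
  have eq3: "?\<sigma>2(0 := a, 1 := b) = ?\<sigma>3" by (intro ext) simp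
  have s3: "runs w K (scan_loop rt k1 k2 c) ?\<sigma>2 (8 * ?n + 1) ?\<sigma>3"
    using ab(3) unfolding eq3
    by (rule runs_mono) (use length_scan[of rt w "?\<sigma>2 0"] length_scan[of rt w "?\<sigma>2 1"] in arith)
  have res: "r (heads w K ?\<sigma>3 0) (heads w K ?\<sigma>3 1) = eval w e ?S"
    using ab(4) d by (simp add: heads_def)
  let ?\<sigma>4 = "\<sigma>(0 := a, 1 := b, 3 := ?f)"
  have s4: "runs w K (Cond (\<lambda>h. r (h 0) (h 1)) (mv {3} Right) (mv {} Stay)) ?\<sigma>3 2 ?\<sigma>4"
  proof (rule runs_Cond)
    show "runs w K (if r (heads w K ?\<sigma>3 0) (heads w K ?\<sigma>3 1) then mv {3} Right else mv {} Stay) ?\<sigma>3 1 ?\<sigma>4"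
      unfolding res using rd by (cases "eval w e ?S") (simp_all, (intro runs_mv ext; simp)+)
  qed simp
  \<comment> \<open>\<open>rewind\<close> stops at the first cell outside of the word, so a head
    that has overrun the right end must step back before it is rewound.\<close>
  define a' b' where "a' = (if rt then a - 1 else a)" and "b' = (if rt then b - 1 else b)"
  let ?\<sigma>5 = "\<sigma>(0 := a', 1 := b', 3 := ?f)"
  have s5: "runs w K (mv (if rt then {0, 1} else {}) Left) ?\<sigma>4 1 ?\<sigma>5"
    unfolding a'_def b'_def by (intro runs_mv ext) auto
  obtain i j where ij: "a' = int i - 1" "i \<le> ?n" "b' = int j - 1" "j \<le> ?n"
  proof
    show "a' = int (nat (a' + 1)) - 1" "nat (a' + 1) \<le> ?n" "b' = int (nat (b' + 1)) - 1" "nat (b' + 1) \<le> ?n"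
      using ab(1,2) by (auto simp: scan_ok_def a'_def b'_def split: if_splits)
  qed
  let ?\<sigma>6 = "?\<sigma>5(0 := -1)" let ?\<sigma>7 = "?\<sigma>6(1 := -1)"
  have s6: "runs w K (rewind 0) ?\<sigma>5 (2 * i + 1) ?\<sigma>6"
    using ij d by (intro runs_rewind) auto
  have s7: "runs w K (rewind 1) ?\<sigma>6 (2 * j + 1) ?\<sigma>7"
    using ij d by (intro runs_rewind) auto
  have eq7: "?\<sigma>7 = \<sigma>(3 := ?f)" using rd by (intro ext) simp
  show ?case
    unfolding comp.simps
    using runs_Then[OF s1 runs_Then[OF s2 runs_Then[OF s3 runs_Then[OF s4 runs_Then[OF s5 runs_Then[OF s6 s7
      order_refl] order_refl] order_refl] order_refl] order_refl] order_refl]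
    unfolding eq7
    by (rule runs_mono) (use ij in simp)
next
  case (Neg \<phi>)
  have IH: "runs w K (comp \<phi> \<rho> d) \<sigma> (poly (cost \<phi>) (length w)) (\<sigma>(3 := if eval w e \<phi> then 0 else -1))"
    by (rule Neg.IH) (use Neg.prems in simp_all)
  let ?\<sigma> = "\<sigma>(3 := if eval w e \<phi> then 0 else -1)"
  have d: "3 < K" "0 < length w" using Neg.prems by (auto simp: ready_def)
  have "runs w K (Cond (\<lambda>h. h 3 = None) (mv {3} Right) (mv {3} Left)) ?\<sigma> 2
      (\<sigma>(3 := if eval w e (Neg \<phi>) then 0 else -1))"
  proof (rule runs_Cond)
    show "runs w K (if heads w K ?\<sigma> 3 = None then mv {3} Right else mv {3} Left) ?\<sigma> 1
      (\<sigma>(3 := if eval w e (Neg \<phi>) then 0 else -1))"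
      using d by (cases "eval w e \<phi>") (simp_all add: heads_in heads_out, (intro runs_mv ext; simp)+)
  qed simp
  from runs_Then[OF IH this order_refl] show ?case
    unfolding comp.simps by (rule runs_mono) (use Neg.prems in simp_all)
next
  case (Conj \<phi> \<psi>)
  let ?\<sigma> = "\<sigma>(3 := if eval w e \<phi> then 0 else -1)"
  let ?n = "length w"
  have d: "3 < K" "0 < length w" "\<sigma> 3 = -1" using Conj.prems by (auto simp: ready_def)
  have IH1: "runs w K (comp \<phi> \<rho> d) \<sigma> (poly (cost \<phi>) ?n) ?\<sigma>"
    by (rule Conj.IH) (use Conj.prems in simp_all)
  have IH2: "runs w K (comp \<psi> \<rho> d) \<sigma> (poly (cost \<psi>) ?n) (\<sigma>(3 := if eval w e \<psi> then 0 else -1))"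
    by (rule Conj.IH) (use Conj.prems in simp_all)
  have "runs w K (Cond (\<lambda>h. h 3 = None) (mv {} Stay) (Then (mv {3} Left) (comp \<psi> \<rho> d))) ?\<sigma>
      (poly (cost \<psi>) ?n + 3) (\<sigma>(3 := if eval w e (Conj \<phi> \<psi>) then 0 else -1))"
  proof (rule runs_Cond)
    show "runs w K (if heads w K ?\<sigma> 3 = None then mv {} Stay else Then (mv {3} Left) (comp \<psi> \<rho> d)) ?\<sigma>
      (poly (cost \<psi>) ?n + 2) (\<sigma>(3 := if eval w e (Conj \<phi> \<psi>) then 0 else -1))"
    proof (cases "eval w e \<phi>")
      case True
      have "runs w K (mv {3} Left) ?\<sigma> 1 \<sigma>" using True d by (intro runs_mv ext) simp_all
      then have "runs w K (Then (mv {3} Left) (comp \<psi> \<rho> d)) ?\<sigma> (poly (cost \<psi>) ?n + 2)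
         (\<sigma>(3 := if eval w e \<psi> then 0 else -1))"
        by (rule runs_Then[OF _ IH2]) simp
      then show ?thesis using True d by (simp add: heads_in)
    next
      case False
      then show ?thesis using d by (simp add: heads_out) (intro runs_mv ext; simp)
    qed
  qed simp
  then show ?case unfolding comp.simps
    by (rule runs_Then[OF IH1]) simp
next
  case (Ex \<phi>)
  note rd = Ex.prems(1)[unfolded ready_def]
  let ?n = "length w" let ?c = "poly (cost \<phi>) ?n"
  let ?b = "\<lambda>h. h d \<noteq> None \<and> h 3 = None"
  let ?body = "Then (comp \<phi> (case_nat d \<rho>) (Suc d)) (Cond (\<lambda>h. h 3 = None) (mv {d} Right) (mv {} Stay))"
  have d: "5 \<le> d" "d < K" "3 < K" "0 < ?n" using Ex.prems rd by auto
  \<comment> \<open>The loop leaves the head of the bound variable on the first witness, or one cell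
    beyond the word if there is none; \<open>k\<close> stands for either place.\<close>
  have loop: "\<exists>k \<le> ?n. runs w K (Loop ?b ?body) (\<sigma>(d := int i)) ((?n - i) * (?c + 4) + 1)
      (\<sigma>(d := int k, 3 := if \<exists>j \<ge> i. j < ?n \<and> eval w (case_nat j e) \<phi> then 0 else -1))"
    if "i \<le> ?n" for i
    using that
  proof (induction "?n - i" arbitrary: i)
    case 0
    then have i: "i = ?n" by simp
    have "runs w K (Loop ?b ?body) (\<sigma>(d := int i)) 1
      (\<sigma>(d := int i, 3 := if \<exists>j \<ge> i. j < ?n \<and> eval w (case_nat j e) \<phi> then 0 else -1))"
    proof (rule runs_Loop_end)
      show "\<not> ?b (heads w K (\<sigma>(d := int i)))" by (simp add: heads_out i)
      show "\<sigma>(d := int i, 3 := if \<exists>j \<ge> i. j < ?n \<and> eval w (case_nat j e) \<phi> then 0 else -1) = \<sigma>(d := int i)"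
        using rd d i by (intro ext) auto
    qed simp
    then have "runs w K (Loop ?b ?body) (\<sigma>(d := int i)) ((?n - i) * (?c + 4) + 1)
      (\<sigma>(d := int i, 3 := if \<exists>j \<ge> i. j < ?n \<and> eval w (case_nat j e) \<phi> then 0 else -1))"
      by (rule runs_mono) simp
    then show ?case using 0 by blast
  next
    case (Suc m)
    let ?\<sigma> = "\<sigma>(d := int i)"
    let ?ev = "eval w (case_nat i e) \<phi>"
    have i: "i < ?n" using Suc by simp
    have "ready w (case_nat i e) (case_nat d \<rho>) (Suc d) ?\<sigma>"
      unfolding ready_def
    proof (intro conjI allI)
      fix v
      show "(\<sigma>(d := int i)) (case_nat d \<rho> v) = int (case_nat i e v)" "case_nat i e v < ?n"
        "4 \<le> case_nat d \<rho> v" "case_nat d \<rho> v < Suc d"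
        using rd d i by (cases v; force simp: less_Suc_eq)+
    qed (use rd d in auto)
    then have r1: "runs w K (comp \<phi> (case_nat d \<rho>) (Suc d)) ?\<sigma> ?c
        (?\<sigma>(3 := if ?ev then 0 else -1))"
      by (rule Ex.IH) (use Ex.prems(2) in simp)
    have b: "?b (heads w K ?\<sigma>)" using i d rd by (simp add: heads_in heads_out)
    show ?case
    proof (cases ?ev)
      case True
      let ?\<sigma>' = "\<sigma>(d := int i, 3 := 0)"
      have r2: "runs w K (Cond (\<lambda>h. h 3 = None) (mv {d} Right) (mv {} Stay)) ?\<sigma>' 2 ?\<sigma>'"
        using d by (intro runs_Cond[where t = 1]) (simp_all add: heads_in, intro runs_mv ext, simp_all)
      have "runs w K ?body ?\<sigma> (?c + 3) ?\<sigma>'"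
        by (rule runs_Then[OF r1[unfolded if_P[OF True]] r2]) simp
      moreover have "runs w K (Loop ?b ?body) ?\<sigma>' 1 ?\<sigma>'"
        by (rule runs_Loop_end) (use d in \<open>simp_all add: heads_in\<close>)
      ultimately have "runs w K (Loop ?b ?body) ?\<sigma> (?c + 4 + 1) ?\<sigma>'"
        by (rule runs_Loop[where b = ?b, OF b]) simp
      moreover have "?c + 4 + 1 \<le> (?n - i) * (?c + 4) + 1"
        using i by (cases "?n - i") auto
      ultimately have "runs w K (Loop ?b ?body) ?\<sigma> ((?n - i) * (?c + 4) + 1) ?\<sigma>'"
        by (rule runs_mono)
      moreover have "\<exists>j \<ge> i. j < ?n \<and> eval w (case_nat j e) \<phi>" using True i by blast
      ultimately show ?thesis using i by (intro exI[of _ i]) simp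
    next
      case False
      let ?\<sigma>' = "\<sigma>(d := int (Suc i))"
      have eq: "?\<sigma>(3 := -1) = ?\<sigma>" using rd d by (intro ext) simp
      have r2: "runs w K (Cond (\<lambda>h. h 3 = None) (mv {d} Right) (mv {} Stay)) ?\<sigma> 2 ?\<sigma>'"
        using d rd by (intro runs_Cond[where t = 1]) (simp_all add: heads_out, intro runs_mv ext, simp_all)
      have body: "runs w K ?body ?\<sigma> (?c + 3) ?\<sigma>'"
        by (rule runs_Then[OF r1[unfolded if_not_P[OF False] eq] r2]) simp
      obtain k where k: "k \<le> ?n" "runs w K (Loop ?b ?body) ?\<sigma>' ((?n - Suc i) * (?c + 4) + 1)
        (\<sigma>(d := int k, 3 := if \<exists>j \<ge> Suc i. j < ?n \<and> eval w (case_nat j e) \<phi> then 0 else -1))"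
      proof -
        have "m = ?n - Suc i" "Suc i \<le> ?n" using Suc.hyps(2) i by simp_all
        from Suc.hyps(1)[OF this] that show thesis by blast
      qed
      have ex: "(\<exists>j \<ge> Suc i. j < ?n \<and> eval w (case_nat j e) \<phi>) \<longleftrightarrow>
          (\<exists>j \<ge> i. j < ?n \<and> eval w (case_nat j e) \<phi>)"
        using False by (metis Suc_leD le_antisym not_less_eq_eq)
      have "runs w K (Loop ?b ?body) ?\<sigma> ((?n - i) * (?c + 4) + 1)
        (\<sigma>(d := int k, 3 := if \<exists>j \<ge> Suc i. j < ?n \<and> eval w (case_nat j e) \<phi> then 0 else -1))"
      proof (rule runs_Loop[where b = ?b, OF b body k(2)])
        have "?n - i = Suc (?n - Suc i)" using i by simp
        then show "Suc (?c + 3 + ((?n - Suc i) * (?c + 4) + 1)) \<le> (?n - i) * (?c + 4) + 1" by simp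
      qed
      then show ?thesis using k(1) unfolding ex by blast
    qed
  qed
  let ?f = "if eval w e (Ex \<phi>) then 0 else -1 :: int"
  obtain k where k: "k \<le> ?n" "runs w K (Loop ?b ?body) (\<sigma>(d := int 0)) (?n * (?c + 4) + 1)
      (\<sigma>(d := int k, 3 := ?f))"
    using loop[of 0] by auto
  let ?\<sigma>3 = "\<sigma>(d := int k - 1, 3 := ?f)"
  have s1: "runs w K (mv {d} Right) \<sigma> 1 (\<sigma>(d := int 0))"
    using rd by (intro runs_mv ext) simp_all
  have s3: "runs w K (mv {d} Left) (\<sigma>(d := int k, 3 := ?f)) 1 ?\<sigma>3"
    using d by (intro runs_mv ext) simp_all
  have s4: "runs w K (rewind d) ?\<sigma>3 (2 * k + 1) (?\<sigma>3(d := -1))"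
    using d k by (intro runs_rewind) simp_all
  have eq: "?\<sigma>3(d := -1) = \<sigma>(3 := ?f)" using rd d by (intro ext) simp
  show ?case unfolding comp.simps
    using runs_Then[OF s1 runs_Then[OF k(2) runs_Then[OF s3 s4 order_refl] order_refl] order_refl]
    unfolding eq by (rule runs_mono) (use k(1) in simp)
qed

section \<open>Turing machines for first-order formulas\<close>

instance sym :: countable
  by countable_datatype

declare tm_step.simps [simp del]

text \<open>The machine first annotates every symbol of its input with the state of a finite
  automaton reading it, copying the result to all tapes; the end of the input is treated as a
  further separator. Then it evaluates a formula on the annotated word.\<close>

fun trace :: "('q \<Rightarrow> sym \<Rightarrow> 'q) \<Rightarrow> 'q \<Rightarrow> sym list \<Rightarrow> ('q \<times> sym) list" where
  "trace \<delta> q [] = []"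
| "trace \<delta> q (a # w) = (q, a) # trace \<delta> (\<delta> q a) w"

definition code :: "'q::countable \<times> sym \<Rightarrow> sym" where
  "code c = Aux (to_nat c)"

definition decode :: "sym \<Rightarrow> ('q::countable \<times> sym) option" where
  "decode s = (case s of Aux n \<Rightarrow> Some (from_nat n) | _ \<Rightarrow> None)"

lemma decode_code [simp]: "decode (code c) = Some c"
  by (simp add: decode_def code_def)

lemma decode_Blank [simp]: "decode Blank = None"
  by (simp add: decode_def)

definition sym_at :: "('q::countable \<times> sym) list \<Rightarrow> int \<Rightarrow> sym" where
  "sym_at w p = (case cell w p of None \<Rightarrow> Blank | Some c \<Rightarrow> code c)"

lemma decode_sym_at [simp]: "decode (sym_at w p) = cell w p"
  by (simp add: sym_at_def split: option.split)

definition nth_sym :: "sym list \<Rightarrow> nat \<Rightarrow> sym" where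
  "nth_sym xs j = (if j < length xs then xs ! j else Blank)"

text \<open>A tape is described by its contents \<open>W\<close> on all integers. Lists that differ
  in trailing blanks represent the same contents, so a head may leave the annotated word and
  return.\<close>

fun repr :: "(int \<Rightarrow> sym) \<Rightarrow> int \<Rightarrow> tape \<Rightarrow> bool" where
  "repr W p (l, r) \<longleftrightarrow> (\<forall>j. nth_sym r j = W (p + int j)) \<and> (\<forall>j. nth_sym l j = W (p - 1 - int j))"

lemma nth_sym_first: "first xs = nth_sym xs 0"
  by (cases xs) (simp_all add: first_def nth_sym_def)

lemma nth_sym_tl: "nth_sym (tl xs) j = nth_sym xs (Suc j)"
  by (cases xs) (simp_all add: nth_sym_def)

lemma nth_sym_Cons: "nth_sym (x # xs) j = (case j of 0 \<Rightarrow> x | Suc i \<Rightarrow> nth_sym xs i)"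
  by (simp add: nth_sym_def split: nat.split)

lemma repr_read: "repr W p t \<Longrightarrow> tape_read t = W p"
  by (cases t) (auto simp: nth_sym_first dest: spec[of _ 0])

lemma repr_step:
  assumes "repr W p t"
  shows "repr W (p + shift d) (tape_move d (tape_write (W p) t))"
proof -
  obtain l r where t: "t = (l, r)" by (cases t)
  have r: "nth_sym r j = W (p + int j)" and l: "nth_sym l j = W (p - 1 - int j)" for j
    using assms unfolding t by auto
  have p: "p - 1 - int i = p - 2 - (int i - 1)" for i by simp
  show ?thesis
    by (cases d)
      (auto simp: t nth_sym_Cons nth_sym_tl nth_sym_first r l first_def algebra_simps split: nat.split)
qed

section \<open>The control unit: command stacks as states\<close>

datatype ('q, 'c) ctrl = Copy 'q | Run "'c cmd list" | Acc | Rej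

text \<open>The stacks that arise from \<open>c\<close> on top of the continuation \<open>k\<close>
  before \<open>k\<close> itself is reached. There are finitely many, since the body of a loop
  returns to the same stack \<open>Loop b x # k\<close>; so whole stacks can serve as states of the
  machine.\<close>

fun stacks :: "'c cmd \<Rightarrow> 'c cmd list \<Rightarrow> 'c cmd list set" where
  "stacks (Mv m) k = {Mv m # k}"
| "stacks (Then a b) k = {Then a b # k} \<union> stacks a (b # k) \<union> stacks b k"
| "stacks (Cond b x y) k = {Cond b x y # k} \<union> stacks x k \<union> stacks y k"
| "stacks (Loop b x) k = {Loop b x # k} \<union> stacks x (Loop b x # k)"

lemma finite_stacks: "finite (stacks c k)"
  by (induction c arbitrary: k) auto

lemma stacks_self: "c # k \<in> stacks c k"
  by (cases c) auto

locale fo_machine =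
  fixes \<delta> :: "'q::countable \<Rightarrow> sym \<Rightarrow> 'q" and q0 :: 'q and Q :: "'q set" and \<phi> :: "('q \<times> sym) fo"
  assumes Q: "finite Q" "q0 \<in> Q" "\<And>q a. q \<in> Q \<Longrightarrow> \<delta> q a \<in> Q"
begin

text \<open>Heads 0 to 3 are auxiliary, head 4 stands on the first cell as the value of all free
  variables, and each level of quantification adds one head.\<close>

definition K :: nat where
  "K = 5 + depth \<phi>"

text \<open>After the annotation phase all heads are on the last symbol.\<close>

definition main :: "('q \<times> sym) cmd" where
  "main = Then (Loop (\<lambda>h. h 0 \<noteq> None) (mv UNIV Left)) (Then (mv {4} Right) (comp \<phi> (\<lambda>_. 4) 5))"

text \<open>On bits and separators this is the identity. It keeps the written symbols in a finite
  alphabet also when \<open>Copy\<close> meets an annotated cell, a case that well-formedness of the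
  machine includes.\<close>

definition norm :: "sym \<Rightarrow> sym" where
  "norm a = (if a \<in> range Bit then a else Sep)"

definition env :: "sym list \<Rightarrow> nat \<Rightarrow> ('q \<times> sym) option" where
  "env as i = (if i < K then decode (as ! i) else None)"

fun ctrl_step :: "('q, 'q \<times> sym) ctrl \<Rightarrow> sym list \<Rightarrow> ('q, 'q \<times> sym) ctrl \<times> (sym \<times> dir) list" where
  "ctrl_step (Copy q) as =
     (if as ! 0 = Blank then (Run [main], replicate K (code (q, Sep), Stay))
      else (Copy (\<delta> q (as ! 0)), replicate K (code (q, norm (as ! 0)), Right)))"
| "ctrl_step (Run []) as = (if env as 3 = None then Rej else Acc, map (\<lambda>a. (a, Stay)) as)"
| "ctrl_step (Run (Mv m # k)) as = (Run k, map (\<lambda>i. (as ! i, m i)) [0..<K])"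
| "ctrl_step (Run (Then a b # k)) as = (Run (a # b # k), map (\<lambda>a. (a, Stay)) as)"
| "ctrl_step (Run (Cond b x y # k)) as = (Run ((if b (env as) then x else y) # k), map (\<lambda>a. (a, Stay)) as)"
| "ctrl_step (Run (Loop b x # k)) as =
     (Run (if b (env as) then x # Loop b x # k else k), map (\<lambda>a. (a, Stay)) as)"
| "ctrl_step Acc as = (Acc, map (\<lambda>a. (a, Stay)) as)"
| "ctrl_step Rej as = (Rej, map (\<lambda>a. (a, Stay)) as)"

definition S :: "('q, 'q \<times> sym) ctrl set" where
  "S = Copy ` Q \<union> Run ` insert [] (stacks main []) \<union> {Acc, Rej}"

lemma finite_S: "finite S"
  unfolding S_def using Q(1) finite_stacks by blast

definition enc :: "('q, 'q \<times> sym) ctrl \<Rightarrow> nat" where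
  "enc = (SOME f. inj_on f S)"

lemma inj_enc: "inj_on enc S"
  unfolding enc_def using finite_imp_inj_to_nat_seg[OF finite_S] by (metis someI_ex)

definition M :: tm where
  "M = \<lparr>tapes = K, states = enc ` S,
     symbols = {Blank, Sep, Bit False, Bit True} \<union> code ` (Q \<times> {Sep, Bit False, Bit True}),
     start = enc (Copy q0), accept = enc Acc, reject = enc Rej,
     delta = (\<lambda>n as. case ctrl_step (inv_into S enc n) as of (s, acts) \<Rightarrow> (enc s, acts))\<rparr>"

lemma Run_closed:
  "s \<in> stacks c k \<Longrightarrow> \<exists>k'. fst (ctrl_step (Run s) as) = Run k' \<and> k' \<in> insert k (stacks c k)"
proof (induction c arbitrary: k)
  case (Then a b)
  then consider "s = Then a b # k" | "s \<in> stacks a (b # k)" | "s \<in> stacks b k" by auto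
  then show ?case
  proof cases
    case 2
    then show ?thesis using Then.IH(1)[of "b # k"] stacks_self[of b k] by auto
  qed (use stacks_self[of a "b # k"] Then.IH(2)[of k] in auto)
next
  case (Cond t x y)
  then consider "s = Cond t x y # k" | "s \<in> stacks x k" | "s \<in> stacks y k" by auto
  then show ?case
    by cases (use stacks_self[of x k] stacks_self[of y k] Cond.IH in \<open>auto\<close>)
next
  case (Loop t x)
  then consider "s = Loop t x # k" | "s \<in> stacks x (Loop t x # k)" by auto
  then show ?case
    by cases (use stacks_self[of x "Loop t x # k"] Loop.IH[of "Loop t x # k"] in auto)
qed auto

lemma ctrl_step_closed: "s \<in> S \<Longrightarrow> fst (ctrl_step s as) \<in> S"
proof -
  assume "s \<in> S"
  then consider q where "s = Copy q" "q \<in> Q" | "s = Run []" | k where "s = Run k" "k \<in> stacks main []"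
    | "s = Acc" | "s = Rej" unfolding S_def by auto
  then show ?thesis
  proof cases
    case 1
    then show ?thesis using Q(3) stacks_self[of main "[]"] by (auto simp: S_def)
  next
    case 3
    then show ?thesis using Run_closed[of k main "[]" as] by (auto simp: S_def)
  qed (auto simp: S_def)
qed

lemma ctrl_step_acts:
  assumes "s \<in> S" "length as = K" "set as \<subseteq> symbols M"
  shows "length (snd (ctrl_step s as)) = K \<and> fst ` set (snd (ctrl_step s as)) \<subseteq> symbols M"
proof -
  have nth: "as ! i \<in> symbols M" if "i < K" for i using assms(2,3) that by (metis nth_mem subsetD)
  have c: "q \<in> Q \<Longrightarrow> code (q, norm a) \<in> symbols M" "q \<in> Q \<Longrightarrow> code (q, Sep) \<in> symbols M" for q a
    by (auto simp: M_def norm_def intro!: imageI)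
  show ?thesis
    using assms nth c
    by (cases "(s, as)" rule: ctrl_step.cases) (auto simp: S_def image_image split: if_splits)
qed

lemma wf_M: "wf_tm M"
proof -
  have *: "case delta M n as of (q', acts) \<Rightarrow>
      q' \<in> states M \<and> length acts = tapes M \<and> fst ` set acts \<subseteq> symbols M"
    if n: "n \<in> states M" and as: "length as = tapes M" "set as \<subseteq> symbols M" for n as
  proof -
    obtain s where s: "s \<in> S" "n = enc s" using n by (auto simp: M_def)
    then have "inv_into S enc n = s" using inj_enc by simp
    moreover have "length as = K" using as by (simp add: M_def)
    moreover obtain s' acts where step: "ctrl_step s as = (s', acts)" by (cases "ctrl_step s as")
    ultimately have "delta M n as = (enc s', acts)" "s' \<in> S" "length acts = K" "fst ` set acts \<subseteq> symbols M"
      using ctrl_step_closed[OF s(1), of as] ctrl_step_acts[OF s(1) _ as(2)]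
      by (simp_all add: M_def)
    then show ?thesis by (simp add: M_def)
  qed
  have "enc Acc \<noteq> enc Rej" using inj_onD[OF inj_enc, of Acc Rej] by (auto simp: S_def)
  then have "finite (states M)" "finite (symbols M)" "{start M, accept M, reject M} \<subseteq> states M" "1 \<le> tapes M"
    "accept M \<noteq> reject M" "{Blank, Sep, Bit False, Bit True} \<subseteq> symbols M"
    using finite_S Q(1,2) unfolding M_def K_def by (simp_all add: S_def)
  moreover have "\<forall>q \<in> states M. \<forall>as. length as = tapes M \<and> set as \<subseteq> symbols M \<longrightarrow>
      (case delta M q as of (q', acts) \<Rightarrow>
        q' \<in> states M \<and> length acts = tapes M \<and> fst ` set acts \<subseteq> symbols M)"
    by (intro ballI allI impI, erule conjE, rule *)
  ultimately show ?thesis unfolding wf_tm_def by (intro conjI)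
qed

lemma step_M:
  assumes "s \<in> S" "s \<noteq> Acc" "s \<noteq> Rej"
  shows "tm_step M (enc s, ts) =
    (let (s', acts) = ctrl_step s (map tape_read ts)
     in (enc s', map2 (\<lambda>(a, d) t. tape_move d (tape_write a t)) acts ts))"
proof -
  have "enc s \<noteq> enc Acc" "enc s \<noteq> enc Rej"
    using assms inj_onD[OF inj_enc, of s Acc] inj_onD[OF inj_enc, of s Rej] by (auto simp: S_def)
  then show ?thesis using inj_enc assms(1) by (simp add: M_def tm_step.simps split: prod.split)
qed

section \<open>Simulation of head programs by the machine\<close>

definition tapes_at :: "('q \<times> sym) list \<Rightarrow> (nat \<Rightarrow> int) \<Rightarrow> tape list \<Rightarrow> bool" where
  "tapes_at w \<sigma> ts \<longleftrightarrow> length ts = K \<and> (\<forall>i < K. repr (sym_at w) (\<sigma> i) (ts ! i))"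

lemma tapes_at_read:
  assumes "tapes_at w \<sigma> ts"
  shows "i < K \<Longrightarrow> map tape_read ts ! i = sym_at w (\<sigma> i)" "env (map tape_read ts) = heads w K \<sigma>"
proof -
  show 1: "map tape_read ts ! i = sym_at w (\<sigma> i)" if "i < K" for i
    using assms that by (auto simp: tapes_at_def intro: repr_read)
  show "env (map tape_read ts) = heads w K \<sigma>"
    by (intro ext) (simp add: env_def heads_def 1 del: nth_map)
qed

lemma tapes_at_move:
  assumes "tapes_at w \<sigma> ts" "length acts = K" "\<And>i. i < K \<Longrightarrow> acts ! i = (map tape_read ts ! i, m i)"
  shows "tapes_at w (\<lambda>i. \<sigma> i + shift (m i)) (map2 (\<lambda>(a, d) t. tape_move d (tape_write a t)) acts ts)"
  using assms tapes_at_read(1)[OF assms(1)] unfolding tapes_at_def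
  by (auto simp del: nth_map simp: nth_map[of _ "zip acts ts"] intro!: repr_step)

lemma tapes_at_stay:
  assumes "tapes_at w \<sigma> ts"
  shows "tapes_at w \<sigma> (map2 (\<lambda>(a, d) t. tape_move d (tape_write a t)) (map (\<lambda>a. (a, Stay)) (map tape_read ts)) ts)"
  using tapes_at_move[OF assms, of "map (\<lambda>a. (a, Stay)) (map tape_read ts)" "\<lambda>_. Stay"] assms
  by (simp add: tapes_at_def)

text \<open>The hypothesis on the stacks keeps every control state inside \<open>S\<close>. There
  \<open>enc\<close> is injective, so the coded transition function does what
  \<open>ctrl_step\<close> says.\<close>

lemma simulate:
  assumes "exec w K c \<sigma> t \<sigma>'" "tapes_at w \<sigma> ts" "Run ` insert k (stacks c k) \<subseteq> S"
  shows "\<exists>ts'. tapes_at w \<sigma>' ts' \<and> (tm_step M ^^ t) (enc (Run (c # k)), ts) = (enc (Run k), ts')"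
  using assms
proof (induction arbitrary: k ts)
  case (Mv m \<sigma>)
  have "Run (Mv m # k) \<in> S" using Mv by auto
  then show ?case
    using tapes_at_move[OF Mv(1), of "map (\<lambda>i. (map tape_read ts ! i, m i)) [0..<K]" m]
    by (auto simp: step_M)
next
  case (Then a \<sigma> t \<sigma>' b t' \<sigma>'')
  have S: "Run (Then a b # k) \<in> S" "Run ` insert (b # k) (stacks a (b # k)) \<subseteq> S" "Run ` insert k (stacks b k) \<subseteq> S"
    using Then.prems(2) stacks_self[of b k] by auto
  obtain ts0 where ts0: "tapes_at w \<sigma> ts0" "tm_step M (enc (Run (Then a b # k)), ts) = (enc (Run (a # b # k)), ts0)"
    using tapes_at_stay[OF Then.prems(1)] S(1) by (simp add: step_M)
  obtain ts1 where ts1: "tapes_at w \<sigma>' ts1" "(tm_step M ^^ t) (enc (Run (a # b # k)), ts0) = (enc (Run (b # k)), ts1)"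
    using Then.IH(1)[OF ts0(1) S(2)] by blast
  obtain ts2 where ts2: "tapes_at w \<sigma>'' ts2" "(tm_step M ^^ t') (enc (Run (b # k)), ts1) = (enc (Run k), ts2)"
    using Then.IH(2)[OF ts1(1) S(3)] by blast
  have "(tm_step M ^^ Suc (t + t')) (enc (Run (Then a b # k)), ts) = (enc (Run k), ts2)"
    using ts0(2) ts1(2) ts2(2) by (simp add: add.commute[of t t'] funpow_add funpow_swap1)
  then show ?case using ts2(1) by blast
next
  case (Cond b \<sigma> x y t \<sigma>')
  let ?z = "if b (heads w K \<sigma>) then x else y"
  have S: "Run (Cond b x y # k) \<in> S" "Run ` insert k (stacks ?z k) \<subseteq> S"
    using Cond.prems(2) by auto
  obtain ts0 where ts0: "tapes_at w \<sigma> ts0" "tm_step M (enc (Run (Cond b x y # k)), ts) = (enc (Run (?z # k)), ts0)"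
    using tapes_at_stay[OF Cond.prems(1)] S(1) by (simp add: step_M tapes_at_read(2)[OF Cond.prems(1)])
  obtain ts1 where ts1: "tapes_at w \<sigma>' ts1" "(tm_step M ^^ t) (enc (Run (?z # k)), ts0) = (enc (Run k), ts1)"
    using Cond.IH[OF ts0(1) S(2)] by blast
  have "(tm_step M ^^ Suc t) (enc (Run (Cond b x y # k)), ts) = (enc (Run k), ts1)"
    using ts0(2) ts1(2) by (simp add: funpow_swap1)
  then show ?case using ts1(1) by blast
next
  case (Loop_end b \<sigma> x)
  have S: "Run (Loop b x # k) \<in> S" using Loop_end.prems(2) by auto
  then show ?case
    using tapes_at_stay[OF Loop_end.prems(1)] Loop_end.hyps
    by (simp add: step_M tapes_at_read(2)[OF Loop_end.prems(1)])
next
  case (Loop b \<sigma> x t \<sigma>' t' \<sigma>'')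
  have S: "Run (Loop b x # k) \<in> S" "Run ` insert (Loop b x # k) (stacks x (Loop b x # k)) \<subseteq> S"
    using Loop.prems(2) by auto
  obtain ts0 where ts0: "tapes_at w \<sigma> ts0" "tm_step M (enc (Run (Loop b x # k)), ts) = (enc (Run (x # Loop b x # k)), ts0)"
    using tapes_at_stay[OF Loop.prems(1)] S(1) Loop.hyps(1)
    by (simp add: step_M tapes_at_read(2)[OF Loop.prems(1)])
  obtain ts1 where ts1: "tapes_at w \<sigma>' ts1"
    "(tm_step M ^^ t) (enc (Run (x # Loop b x # k)), ts0) = (enc (Run (Loop b x # k)), ts1)"
    using Loop.IH(1)[OF ts0(1) S(2)] by blast
  obtain ts2 where ts2: "tapes_at w \<sigma>'' ts2" "(tm_step M ^^ t') (enc (Run (Loop b x # k)), ts1) = (enc (Run k), ts2)"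
    using Loop.IH(2)[OF ts1(1) Loop.prems(2)] by blast
  have "(tm_step M ^^ Suc (t + t')) (enc (Run (Loop b x # k)), ts) = (enc (Run k), ts2)"
    using ts0(2) ts1(2) ts2(2) by (simp add: add.commute[of t t'] funpow_add funpow_swap1)
  then show ?case using ts2(1) by blast
qed

lemma copy_step:
  assumes "q \<in> Q" "a \<noteq> Blank"
  shows "tm_step M (enc (Copy q), (l, a # w) # replicate (K - 1) (l, [])) =
    (enc (Copy (\<delta> q a)), (code (q, norm a) # l, w) # replicate (K - 1) (code (q, norm a) # l, []))"
proof -
  obtain m where m: "K = Suc m" by (auto simp: K_def)
  have "Copy q \<in> S" using assms by (simp add: S_def)
  then show ?thesis using assms(2) by (simp add: step_M first_def m zip_replicate)
qed

lemma foldl_Q: "q \<in> Q \<Longrightarrow> foldl \<delta> q w \<in> Q"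
  by (induction w arbitrary: q) (simp_all add: Q(3))

text \<open>Each head of the program gets a tape of its own. All tapes receive the same annotated
  prefix, so that several ordinary tapes imitate several heads on one word.\<close>

lemma copy_phase:
  assumes "q \<in> Q" "set w \<subseteq> insert Sep (range Bit)"
  shows "(tm_step M ^^ length w) (enc (Copy q), (l, w) # replicate (K - 1) (l, [])) =
    (enc (Copy (foldl \<delta> q w)), replicate K (rev (map code (trace \<delta> q w)) @ l, []))"
  using assms
proof (induction w arbitrary: q l)
  case Nil
  have "K = Suc (K - 1)" by (simp add: K_def)
  then show ?case by (metis append_Nil foldl_Nil funpow_0 list.size(3) list.simps(8) replicate_Suc rev.simps(1) trace.simps(1))
next
  case (Cons a w)
  have "norm a = a" "a \<noteq> Blank" using Cons.prems by (auto simp: norm_def)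
  then show ?case
    using copy_step[OF Cons.prems(1)] Cons.IH[OF Q(3)[OF Cons.prems(1)]] Cons.prems(2)
    by (simp add: funpow_swap1)
qed

lemma tapes_at_end:
  "tapes_at (cs @ [c]) (\<lambda>_. int (length cs)) (replicate K (rev (map code cs), [code c]))"
proof -
  have "nat (1 + int j) = Suc j" for j by simp
  then show ?thesis
    by (auto simp: tapes_at_def sym_at_def cell_def nth_sym_def rev_nth nth_append nat_diff_distrib)
qed

lemma runs_main:
  assumes "w \<noteq> []"
  shows "\<exists>\<sigma>. runs w K main (\<lambda>_. int (length w) - 1) (2 * length w + 4 + poly (cost \<phi>) (length w)) \<sigma> \<and>
    \<sigma> 3 = (if eval w (\<lambda>_. 0) \<phi> then 0 else -1)"
proof -
  let ?m = "mv UNIV Left"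
  let ?b = "\<lambda>h::nat \<Rightarrow> ('q \<times> sym) option. h 0 \<noteq> None"
  have K0: "0 < K" by (simp add: K_def)
  have 1: "runs w K (Loop ?b ?m) (\<lambda>_. int k - 1) (2 * k + 1) (\<lambda>_. -1)" if "k \<le> length w" for k
    using that
  proof (induction k)
    case 0
    show ?case by (rule runs_Loop_end) (simp_all add: heads_out)
  next
    case (Suc k)
    have "?b (heads w K (\<lambda>_. int (Suc k) - 1))" using Suc.prems K0 by (simp add: heads_in)
    moreover have "runs w K ?m (\<lambda>_. int (Suc k) - 1) 1 (\<lambda>_. int k - 1)" by (intro runs_mv ext) simp_all
    moreover have "runs w K (Loop ?b ?m) (\<lambda>_. int k - 1) (2 * k + 1) (\<lambda>_. -1)" using Suc by simp
    ultimately show ?case by (rule runs_Loop[where b = ?b]) simp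
  qed
  let ?\<sigma> = "\<lambda>i::nat. if i = 4 then 0 else -1 :: int"
  have 2: "runs w K (mv {4} Right) (\<lambda>_. -1) 1 ?\<sigma>" by (intro runs_mv ext) simp_all
  have "ready w (\<lambda>_. 0) (\<lambda>_. 4) 5 ?\<sigma>" using assms by (auto simp: ready_def)
  then have 3: "runs w K (comp \<phi> (\<lambda>_. 4) 5) ?\<sigma> (poly (cost \<phi>) (length w))
      (?\<sigma>(3 := if eval w (\<lambda>_. 0) \<phi> then 0 else -1))"
    by (rule runs_comp) (simp add: K_def)
  have "runs w K main (\<lambda>_. int (length w) - 1) (2 * length w + 4 + poly (cost \<phi>) (length w))
      (?\<sigma>(3 := if eval w (\<lambda>_. 0) \<phi> then 0 else -1))"
    unfolding main_def by (rule runs_Then[OF 1[OF order_refl] runs_Then[OF 2 3 order_refl]]) simp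
  then show ?thesis by (intro exI conjI) (assumption, simp)
qed

lemma trace_snoc: "trace \<delta> q (w @ [a]) = trace \<delta> q w @ [(foldl \<delta> q w, a)]"
  by (induction w arbitrary: q) simp_all

lemma length_trace: "length (trace \<delta> q w) = length w"
  by (induction w arbitrary: q) simp_all

lemma halted: "s = Acc \<or> s = Rej \<Longrightarrow> (tm_step M ^^ t) (enc s, ts) = (enc s, ts)"
  by (induction t) (auto simp: M_def tm_step.simps)

text \<open>Copying takes |w| steps, annotating the end one, the program at most 2(|w| + 1) + 4 plus
  the cost of the formula, and turning the reading of head 3 into a verdict one more. The argument
  of \<open>cost\<close> is |w| + 1 because of the added separator. At all later times the machine
  is still in its halting state.\<close>

lemma decides:
  assumes w: "set w \<subseteq> insert Sep (range Bit)"
    and T: "3 * length w + 8 + poly (cost \<phi>) (length w + 1) \<le> T"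
  shows "state_after M w T = (if eval (trace \<delta> q0 (w @ [Sep])) (\<lambda>_. 0) \<phi> then accept M else reject M)"
proof -
  let ?w = "trace \<delta> q0 (w @ [Sep])" and ?q = "foldl \<delta> q0 w"
  let ?ts = "replicate K (rev (map code (trace \<delta> q0 w)), [code (?q, Sep)])"
  have 1: "(tm_step M ^^ length w) (tm_init M w) = (enc (Copy ?q), replicate K (rev (map code (trace \<delta> q0 w)), []))"
    using copy_phase[OF Q(2) w, of "[]"] by (simp add: tm_init_def M_def)
  have q: "?q \<in> Q" by (rule foldl_Q) (rule Q)
  have 2: "tm_step M (enc (Copy ?q), replicate K (rev (map code (trace \<delta> q0 w)), [])) = (enc (Run [main]), ?ts)"
    using q by (subst step_M) (simp_all add: S_def K_def first_def zip_replicate)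
  have at: "tapes_at ?w (\<lambda>_. int (length ?w) - 1) ?ts"
    using tapes_at_end[of "trace \<delta> q0 w"] by (simp add: trace_snoc length_trace)
  obtain \<sigma> where \<sigma>: "runs ?w K main (\<lambda>_. int (length ?w) - 1) (2 * length ?w + 4 + poly (cost \<phi>) (length ?w)) \<sigma>"
    "\<sigma> 3 = (if eval ?w (\<lambda>_. 0) \<phi> then 0 else -1)"
    using runs_main[of ?w] by (auto simp: trace_snoc)
  then obtain t where t': "t \<le> 2 * length ?w + 4 + poly (cost \<phi>) (length ?w)"
    "exec ?w K main (\<lambda>_. int (length ?w) - 1) t \<sigma>"
    unfolding runs_def by blast
  have t: "t \<le> 2 * length w + 6 + poly (cost \<phi>) (length w + 1)"
    using t'(1) by (simp add: length_trace)
  have "Run ` insert [] (stacks main []) \<subseteq> S" by (auto simp: S_def)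
  from simulate[OF t'(2) at this] obtain ts where ts: "tapes_at ?w \<sigma> ts"
    "(tm_step M ^^ t) (enc (Run [main]), ?ts) = (enc (Run []), ts)" by blast
  define s where "s = (if eval ?w (\<lambda>_. 0) \<phi> then Acc else Rej :: ('q, 'q \<times> sym) ctrl)"
  have hd: "heads ?w K \<sigma> 3 = None \<longleftrightarrow> \<not> eval ?w (\<lambda>_. 0) \<phi>"
    using \<sigma>(2) by (simp add: heads_def cell_def K_def trace_snoc)
  have "Run [] \<in> S" by (simp add: S_def)
  then have "fst (tm_step M (enc (Run []), ts)) = enc s"
    by (simp add: step_M tapes_at_read(2)[OF ts(1)] s_def hd)
  then obtain ts' where 3: "tm_step M (enc (Run []), ts) = (enc s, ts')"
    by (metis prod.collapse)
  have "length w + Suc (t + Suc 0) \<le> T" using t T by simp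
  then obtain m where "T = length w + Suc (t + Suc 0) + m" using le_Suc_ex by blast
  then have m: "T = m + (Suc 0 + (t + (Suc 0 + length w)))" by simp
  have "(tm_step M ^^ T) (tm_init M w) = (tm_step M ^^ m) (enc s, ts')"
    unfolding m funpow_add by (simp add: 1 2 3 ts(2))
  also have "\<dots> = (enc s, ts')" by (rule halted) (simp add: s_def)
  finally show ?thesis by (simp add: state_after_def s_def M_def)
qed

lemma ptime: "ptime_rel (\<lambda>x u v. eval (trace \<delta> q0 (triple x u v @ [Sep])) (\<lambda>_. 0) \<phi>)"
  unfolding ptime_rel_def
proof (intro exI[of _ M] exI[of _ "[:8, 3:] + pcompose (cost \<phi>) [:1, 1:]"] conjI wf_M allI decides)
  fix x u v
  show "set (triple x u v) \<subseteq> insert Sep (range Bit)" by (auto simp: triple_def)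
  show "3 * length (triple x u v) + 8 + poly (cost \<phi>) (length (triple x u v) + 1)
    \<le> poly ([:8, 3:] + pcompose (cost \<phi>) [:1, 1:]) (length (triple x u v))"
    by (simp add: poly_pcompose add.commute)
qed

end

section \<open>Parsing lists of items\<close>

text \<open>An item is a fixed number \<open>m\<close> of conjunctions, its slots. A tgd is an item with two slots.\<close>

type_synonym item = "trm atom list list"

definition enc_item :: "item \<Rightarrow> bool list" where
  "enc_item it = concat (map (enc_list enc_atom) it)"

definition enc_items :: "item list \<Rightarrow> bool list" where
  "enc_items = enc_list enc_item"

text \<open>A state says what the next bit means. \<open>Atoms s f\<close>, \<open>Args s\<close>: another element of the list or not,
  where \<open>f\<close> holds at the beginning of an item; \<open>RelM s c\<close>, \<open>NamM s c\<close>: another digit of a number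
  or not, where \<open>c\<close> is 0 if there was no digit so far, and otherwise tells the last digit (1 or, if it
  was a leading zero so far, 2); \<open>RelB s\<close>, \<open>NamB s\<close>: a digit; \<open>Kind s\<close>: constant or variable. The
  number \<open>s\<close> is the current slot.\<close>

datatype st = Items | Atoms nat bool | RelM nat nat | RelB nat | Args nat | Kind nat | NamM nat nat | NamB nat | Done | Err

instance st :: countable
  by countable_datatype

fun step :: "nat \<Rightarrow> st \<Rightarrow> bool \<Rightarrow> st" where
  "step m Items b = (if b then Atoms 0 True else Done)"
| "step m (Atoms s f) b = (if b then RelM s 0 else if Suc s = m then Items else Atoms (Suc s) False)"
| "step m (RelM s c) b = (if b then RelB s else if c = 2 then Err else Args s)"
| "step m (RelB s) b = RelM s (if b then 1 else 2)"
| "step m (Args s) b = (if b then Kind s else Atoms s False)"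
| "step m (Kind s) b = NamM s 0"
| "step m (NamM s c) b = (if b then NamB s else if c = 2 then Err else Args s)"
| "step m (NamB s) b = NamM s (if b then 1 else 2)"
| "step m Done b = Err"
| "step m Err b = Err"

text \<open>This and the following functions prescribe, along the syntax, which state is to stand
  next to which bit; \<open>yields_pcells\<close> confirms that the automaton produces it.\<close>

fun ncells :: "(nat \<Rightarrow> st) \<Rightarrow> st \<Rightarrow> nat \<Rightarrow> bool list \<Rightarrow> (st \<times> bool) list" where
  "ncells M B c [] = [(M c, False)]"
| "ncells M B c (b # bs) = (M c, True) # (B, b) # ncells M B (if b then 1 else 2) bs"

text \<open>\<open>f\<close> is the state at the first announcing bit and \<open>g\<close> at the
  later ones. They differ in slot 0, whose first cell marks the beginning of an item.\<close>

fun lcells :: "st \<Rightarrow> st \<Rightarrow> ('a \<Rightarrow> (st \<times> bool) list) \<Rightarrow> 'a list \<Rightarrow> (st \<times> bool) list" where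
  "lcells f g e [] = [(f, False)]"
| "lcells f g e (x # xs) = (f, True) # e x @ lcells g g e xs"

fun name :: "trm \<Rightarrow> nat" where
  "name (Cst c) = c"
| "name (Var x) = x"

definition is_var :: "trm \<Rightarrow> bool" where
  "is_var t \<longleftrightarrow> (\<exists>x. t = Var x)"

lemma is_var_simps [simp]: "is_var (Var x)" "\<not> is_var (Cst c)"
  by (simp_all add: is_var_def)

lemma trm_eq_iff: "t = u \<longleftrightarrow> is_var t = is_var u \<and> name t = name u"
  by (cases t; cases u) auto

definition tcells :: "nat \<Rightarrow> trm \<Rightarrow> (st \<times> bool) list" where
  "tcells s t = (Kind s, is_var t) # ncells (NamM s) (NamB s) 0 (bin (name t))"

definition acells :: "nat \<Rightarrow> trm atom \<Rightarrow> (st \<times> bool) list" where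
  "acells s A = ncells (RelM s) (RelB s) 0 (bin (rel A)) @ lcells (Args s) (Args s) (tcells s) (args A)"

definition scells :: "nat \<Rightarrow> trm atom list \<Rightarrow> (st \<times> bool) list" where
  "scells s As = lcells (Atoms s (s = 0)) (Atoms s False) (acells s) As"

fun icells :: "nat \<Rightarrow> item \<Rightarrow> (st \<times> bool) list" where
  "icells s [] = []"
| "icells s (As # it) = scells s As @ icells (Suc s) it"

definition pcells :: "item list \<Rightarrow> (st \<times> bool) list" where
  "pcells its = lcells Items Items (icells 0) its"

lemma bits_ncells: "map snd (ncells M B c bs) = enc_list (\<lambda>b. [b]) bs"
  by (induction bs arbitrary: c) auto

lemma bits_lcells:
  "(\<And>x. x \<in> set xs \<Longrightarrow> map snd (e x) = d x) \<Longrightarrow> map snd (lcells f g e xs) = enc_list d xs"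
  by (induction xs arbitrary: f) auto

lemma bits_tcells: "map snd (tcells s t) = enc_trm t"
  by (cases t) (simp_all add: tcells_def bits_ncells enc_nat_def)

lemma bits_acells: "map snd (acells s A) = enc_atom A"
  by (simp add: acells_def bits_ncells enc_atom_def enc_nat_def bits_lcells bits_tcells)

lemma bits_scells: "map snd (scells s As) = enc_list enc_atom As"
  by (simp add: scells_def bits_lcells bits_acells)

lemma bits_icells: "map snd (icells s it) = enc_item it"
  by (induction it arbitrary: s) (simp_all add: enc_item_def bits_scells)

lemma bits_pcells: "map snd (pcells its) = enc_items its"
  by (simp add: pcells_def enc_items_def bits_lcells bits_icells)

section \<open>The automaton annotates encoded items as prescribed\<close>

fun annot :: "nat \<Rightarrow> st \<Rightarrow> bool list \<Rightarrow> (st \<times> bool) list" where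
  "annot m q [] = []"
| "annot m q (b # bs) = (q, b) # annot m (step m q b) bs"

lemma annot_append: "annot m q (bs @ bs') = annot m q bs @ annot m (foldl (step m) q bs) bs'"
  by (induction bs arbitrary: q) auto

definition yields :: "nat \<Rightarrow> st \<Rightarrow> (st \<times> bool) list \<Rightarrow> st \<Rightarrow> bool" where
  "yields m q cs q' \<longleftrightarrow> annot m q (map snd cs) = cs \<and> foldl (step m) q (map snd cs) = q'"

lemma yields_append: "yields m q cs q' \<Longrightarrow> yields m q' ds q'' \<Longrightarrow> yields m q (cs @ ds) q''"
  by (simp add: yields_def annot_append)

lemma yields_Nil [simp]: "yields m q [] q' \<longleftrightarrow> q = q'"
  by (auto simp: yields_def)

lemma yields_Cons: "yields m q ((p, b) # cs) q' \<longleftrightarrow> p = q \<and> yields m (step m q b) cs q'"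
  by (auto simp: yields_def)

lemma last_bin: "n > 0 \<Longrightarrow> bin n \<noteq> [] \<and> last (bin n)"
proof (induction n rule: less_induct)
  case (less n)
  then have b: "bin n = odd n # bin (n div 2)" by (simp add: bin.simps[of n])
  show ?case
  proof (cases "n div 2 = 0")
    case True
    then have "n = 1" using less.prems by linarith
    then show ?thesis by (simp add: bin.simps)
  next
    case False
    then show ?thesis using less.IH[of "n div 2"] b less.prems by simp
  qed
qed

lemma bin_0 [simp]: "bin 0 = []"
  by (simp add: bin.simps)

text \<open>Digits are listed from the least significant one, so the condition excludes leading
  zeros. The automaton tests it through the value 2 in \<open>RelM\<close> and
  \<open>NamM\<close>.\<close>

lemma bin_surj: "ds = [] \<or> last ds \<Longrightarrow> \<exists>n. bin n = ds"
proof (induction ds)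
  case (Cons d ds)
  then have "ds = [] \<or> last ds" by (auto split: if_splits)
  then obtain n where n: "bin n = ds" using Cons.IH by blast
  have "n = 0 \<Longrightarrow> d" using n Cons.prems by auto
  then have "bin (2 * n + of_bool d) = d # bin n"
    by (subst bin.simps) auto
  then show ?case using n by blast
qed (use bin_0 in blast)

lemma yields_ncells:
  assumes "bs = [] \<longrightarrow> c \<noteq> 2" "bs \<noteq> [] \<longrightarrow> last bs"
    "\<And>c. step m (M c) True = B" "\<And>c. c \<noteq> 2 \<Longrightarrow> step m (M c) False = q" "\<And>b. step m B b = M (if b then 1 else 2)"
  shows "yields m (M c) (ncells M B c bs) q"
  using assms(1,2)
proof (induction bs arbitrary: c)
  case (Cons b bs)
  then show ?case by (auto simp: yields_Cons assms(3,5))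
qed (simp add: yields_Cons assms(4))

lemma yields_bin:
  assumes "\<And>c. step m (M c) True = B" "\<And>c. c \<noteq> 2 \<Longrightarrow> step m (M c) False = q" "\<And>b. step m B b = M (if b then 1 else 2)"
  shows "yields m (M 0) (ncells M B 0 (bin n)) q"
  using last_bin[of n] by (intro yields_ncells assms) (cases "n = 0"; simp)+

lemma yields_lcells:
  assumes "\<And>x. x \<in> set xs \<Longrightarrow> yields m q (e x) g" "step m f True = q" "step m g True = q"
    "step m f False = h" "step m g False = h"
  shows "yields m f (lcells f g e xs) h"
  using assms
proof (induction xs arbitrary: f)
  case (Cons x xs)
  have 1: "yields m q (e x) g" using Cons.prems(1) by simp
  have 2: "yields m g (lcells g g e xs) h"
    by (rule Cons.IH) (use Cons.prems in \<open>simp_all only: list.set insert_iff simp_thms\<close>)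
  from yields_append[OF 1 2] show ?case by (simp add: yields_Cons Cons.prems(2))
qed (simp add: yields_Cons)

lemma yields_tcells: "yields m (Kind s) (tcells s t) (Args s)"
  by (auto simp: tcells_def yields_Cons intro!: yields_bin)

lemma yields_acells: "yields m (RelM s 0) (acells s A) (Atoms s False)"
  unfolding acells_def
  by (rule yields_append[of _ _ _ "Args s"]) (auto intro!: yields_bin yields_lcells yields_tcells)

lemma yields_scells: "yields m (Atoms s (s = 0)) (scells s As) (if Suc s = m then Items else Atoms (Suc s) False)"
  unfolding scells_def by (rule yields_lcells[OF yields_acells]) auto

lemma yields_icells: "it \<noteq> [] \<Longrightarrow> s + length it = m \<Longrightarrow> yields m (Atoms s (s = 0)) (icells s it) Items"
proof (induction it arbitrary: s)
  case (Cons As it)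
  show ?case
  proof (cases it)
    case Nil
    then show ?thesis using yields_scells[of m s As] Cons.prems by simp
  next
    case (Cons As' it')
    have "yields m (Atoms s (s = 0)) (scells s As) (Atoms (Suc s) (Suc s = 0))"
      using yields_scells[of m s As] Cons.prems Cons by simp
    moreover have "yields m (Atoms (Suc s) (Suc s = 0)) (icells (Suc s) it) Items"
      using Cons.IH[of "Suc s"] Cons.prems Cons by simp
    ultimately show ?thesis unfolding icells.simps by (rule yields_append)
  qed
qed simp

lemma yields_pcells: "0 < m \<Longrightarrow> \<forall>it \<in> set its. length it = m \<Longrightarrow> yields m Items (pcells its) Done"
  unfolding pcells_def
proof (rule yields_lcells)
  fix it assume "0 < m" "\<forall>it \<in> set its. length it = m" "it \<in> set its"
  then show "yields m (Atoms 0 True) (icells 0 it) Items" using yields_icells[of it 0 m] by auto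
qed auto

section \<open>Every accepted word is an encoding\<close>

lemma foldl_Err: "foldl (step m) Err bs = Err"
  by (induction bs) auto

lemma parse_bits:
  fixes M :: "nat \<Rightarrow> st"
  assumes "foldl (step m) (M c) bs = Done"
    "\<And>c. M c \<noteq> Done" "B \<noteq> Done" "\<And>c. step m (M c) True = B"
    "\<And>c. step m (M c) False = (if c = 2 then Err else q)" "\<And>b. step m B b = M (if b then 1 else 2)"
  shows "\<exists>ds rest. bs = enc_list (\<lambda>b. [b]) ds @ rest \<and> (ds = [] \<longrightarrow> c \<noteq> 2) \<and> (ds \<noteq> [] \<longrightarrow> last ds) \<and>
    foldl (step m) q rest = Done"
  using assms(1)
proof (induction "length bs" arbitrary: bs c rule: less_induct)
  case less
  consider "bs = []" | bs1 where "bs = False # bs1" | "bs = [True]" | b bs1 where "bs = True # b # bs1"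
    by (metis (full_types) list.exhaust)
  then show ?case
  proof cases
    case 1
    then show ?thesis using less.prems assms(2) by simp
  next
    case 2
    then show ?thesis using less.prems
      by (intro exI[of _ "[]"] exI[of _ bs1]) (auto simp: assms(5) foldl_Err split: if_splits)
  next
    case 3
    then show ?thesis using less.prems assms(3) by (simp add: assms(4))
  next
    case 4
    then have "foldl (step m) (M (if b then 1 else 2)) bs1 = Done" "length bs1 < length bs"
      using less.prems by (simp_all add: assms(4,6))
    from less.hyps[OF this(2,1)] obtain ds rest where "bs1 = enc_list (\<lambda>b. [b]) ds @ rest"
      "ds = [] \<longrightarrow> (if b then 1 else 2) \<noteq> (2::nat)" "ds \<noteq> [] \<longrightarrow> last ds" "foldl (step m) q rest = Done"
      by blast
    then show ?thesis using 4 by (intro exI[of _ "b # ds"] exI[of _ rest]) (auto split: if_splits)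
  qed
qed

lemma parse_nat:
  fixes M :: "nat \<Rightarrow> st"
  assumes "foldl (step m) (M 0) bs = Done"
    "\<And>c. M c \<noteq> Done" "B \<noteq> Done" "\<And>c. step m (M c) True = B"
    "\<And>c. step m (M c) False = (if c = 2 then Err else q)" "\<And>b. step m B b = M (if b then 1 else 2)"
  shows "\<exists>n rest. bs = enc_nat n @ rest \<and> foldl (step m) q rest = Done"
proof -
  obtain ds rest where *: "bs = enc_list (\<lambda>b. [b]) ds @ rest" "ds \<noteq> [] \<longrightarrow> last ds" "foldl (step m) q rest = Done"
    using parse_bits[of m M 0 bs B q] assms by blast
  moreover obtain n where "bin n = ds" using bin_surj *(2) by blast
  ultimately have "bs = enc_nat n @ rest" by (simp add: enc_nat_def)
  with *(3) show ?thesis by blast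
qed

text \<open>The induction is on the length of the word, because an element consumes a prefix of
  unknown length. The predicate \<open>P\<close> carries the number of slots of an item through the
  recursion.\<close>

lemma parse_list:
  assumes "foldl (step m) f bs = Done"
    "\<And>bs. foldl (step m) q bs = Done \<Longrightarrow> \<exists>x rest. P x \<and> bs = e x @ rest \<and> foldl (step m) g rest = Done"
    "f \<noteq> Done" "g \<noteq> Done" "step m f True = q" "step m g True = q" "step m f False = h" "step m g False = h"
  shows "\<exists>xs rest. (\<forall>x \<in> set xs. P x) \<and> bs = enc_list e xs @ rest \<and> foldl (step m) h rest = Done"
  using assms(1,3,5,7)
proof (induction "length bs" arbitrary: bs f rule: less_induct)
  case less
  consider "bs = []" | bs1 where "bs = False # bs1" | bs1 where "bs = True # bs1"
    by (metis (full_types) list.exhaust)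
  then show ?case
  proof cases
    case 1
    then show ?thesis using less.prems by simp
  next
    case 2
    then show ?thesis using less.prems by (intro exI[of _ "[]"] exI[of _ bs1]) auto
  next
    case 3
    then obtain x rest where x: "P x" "bs1 = e x @ rest" "foldl (step m) g rest = Done"
      using assms(2)[of bs1] less.prems by auto
    then obtain xs rest' where "\<forall>x \<in> set xs. P x" "rest = enc_list e xs @ rest'" "foldl (step m) h rest' = Done"
      using less.hyps[of rest g] 3 assms by auto
    then show ?thesis using x 3 by (intro exI[of _ "x # xs"] exI[of _ rest']) auto
  qed
qed

lemma parse_trm:
  assumes "foldl (step m) (Kind s) bs = Done"
  shows "\<exists>t rest. bs = enc_trm t @ rest \<and> foldl (step m) (Args s) rest = Done"
proof -
  obtain b bs1 where bs: "bs = b # bs1" using assms by (cases bs) auto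
  have "\<exists>n rest. bs1 = enc_nat n @ rest \<and> foldl (step m) (Args s) rest = Done"
    by (rule parse_nat[where M = "NamM s" and B = "NamB s"]) (use assms bs in auto)
  then obtain n rest where n: "bs1 = enc_nat n @ rest" "foldl (step m) (Args s) rest = Done" by blast
  then have "bs = enc_trm (if b then Var n else Cst n) @ rest" using bs by (cases b) auto
  then show ?thesis using n(2) by blast
qed

lemma parse_atom:
  assumes "foldl (step m) (RelM s 0) bs = Done"
  shows "\<exists>A rest. bs = enc_atom A @ rest \<and> foldl (step m) (Atoms s False) rest = Done"
proof -
  have "\<exists>n rest. bs = enc_nat n @ rest \<and> foldl (step m) (Args s) rest = Done"
    by (rule parse_nat[where M = "RelM s" and B = "RelB s"]) (use assms in auto)
  then obtain n rest where n: "bs = enc_nat n @ rest" "foldl (step m) (Args s) rest = Done" by blast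
  obtain ts rest' where "rest = enc_list enc_trm ts @ rest'" "foldl (step m) (Atoms s False) rest' = Done"
    using parse_list[OF n(2), of "Kind s" "\<lambda>_. True" enc_trm "Args s" "Atoms s False"] parse_trm by auto
  then show ?thesis using n by (intro exI[of _ "Atom n ts"]) (auto simp: enc_atom_def)
qed

lemma parse_item:
  assumes "foldl (step m) (Atoms s f) bs = Done" "s < m"
  shows "\<exists>it rest. s + length it = m \<and> bs = enc_item it @ rest \<and> foldl (step m) Items rest = Done"
  using assms
proof (induction "m - s" arbitrary: s f bs)
  case (Suc k)
  obtain As rest where As: "bs = enc_list enc_atom As @ rest"
    "foldl (step m) (if Suc s = m then Items else Atoms (Suc s) False) rest = Done"
    using parse_list[OF Suc.prems(1), of "RelM s 0" "\<lambda>_. True" enc_atom "Atoms s False"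
        "if Suc s = m then Items else Atoms (Suc s) False"] parse_atom by auto
  show ?case
  proof (cases "Suc s = m")
    case True
    then show ?thesis using As by (intro exI[of _ "[As]"]) (auto simp: enc_item_def)
  next
    case False
    then obtain it rest' where "Suc s + length it = m" "rest = enc_item it @ rest'" "foldl (step m) Items rest' = Done"
    proof -
      have "k = m - Suc s" "Suc s < m" "foldl (step m) (Atoms (Suc s) False) rest = Done"
        using Suc.hyps(2) Suc.prems(2) As(2) False by simp_all
      from Suc.hyps(1)[OF this(1,3,2)] that show thesis by blast
    qed
    then show ?thesis using As(1) by (intro exI[of _ "As # it"]) (auto simp: enc_item_def)
  qed
qed simp

lemma parse_items:
  assumes "foldl (step m) Items bs = Done" "0 < m"
  shows "\<exists>its. (\<forall>it \<in> set its. length it = m) \<and> bs = enc_items its"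
proof -
  have "\<exists>its rest. (\<forall>it \<in> set its. length it = m) \<and> bs = enc_list enc_item its @ rest \<and> foldl (step m) Done rest = Done"
    by (rule parse_list[OF assms(1), where q = "Atoms 0 True" and g = Items])
      (use parse_item[of m 0 True] assms(2) in auto)
  moreover have "foldl (step m) Done rest = Done \<Longrightarrow> rest = []" for rest
    by (cases rest) (auto simp: foldl_Err)
  ultimately show ?thesis unfolding enc_items_def by auto
qed

lemma accepts_items:
  "0 < m \<Longrightarrow> \<forall>it \<in> set its. length it = m \<Longrightarrow> foldl (step m) Items (enc_items its) = Done"
  using yields_pcells[of m its] by (simp add: yields_def bits_pcells)

section \<open>The annotated input\<close>

text \<open>Part 0 holds the tgds and part 2 the refutations, as items with two slots. The seven
  slots of a record in part 1 are: the body and the head of its tgd; the assignment of this tgd; the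
  assignment of the next tgd on the walk; the facts before the chase step; the facts it adds; the
  marked position.\<close>

definition slots :: "nat \<Rightarrow> nat" where
  "slots \<pi> = (if \<pi> = 1 then 7 else 2)"

type_synonym cell = "(nat \<times> st) \<times> sym"

text \<open>The first component counts the separators read so far; its cap at 3 keeps the set of
  states finite.\<close>

fun next_state :: "nat \<times> st \<Rightarrow> sym \<Rightarrow> nat \<times> st" where
  "next_state (\<pi>, q) (Bit b) = (\<pi>, step (slots \<pi>) q b)"
| "next_state (\<pi>, q) a = (min 3 (Suc \<pi>), Items)"

fun st_ok :: "nat \<Rightarrow> st \<Rightarrow> bool" where
  "st_ok m (Atoms s f) = (s < m)"
| "st_ok m (RelM s c) = (s < m \<and> c \<le> 2)"
| "st_ok m (RelB s) = (s < m)"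
| "st_ok m (Args s) = (s < m)"
| "st_ok m (Kind s) = (s < m)"
| "st_ok m (NamM s c) = (s < m \<and> c \<le> 2)"
| "st_ok m (NamB s) = (s < m)"
| "st_ok m q = True"

lemma st_ok_step: "0 < m \<Longrightarrow> st_ok m q \<Longrightarrow> st_ok m (step m q b)"
  by (cases "(m, q, b)" rule: step.cases) auto

lemma finite_st_ok: "finite {q. st_ok m q}"
proof (rule finite_subset)
  let ?s = "{..<m}" and ?c = "{..2::nat}"
  show "{q. st_ok m q} \<subseteq> {Items, Done, Err} \<union> (\<lambda>(s, f). Atoms s f) ` (?s \<times> UNIV) \<union>
     (\<lambda>(s, c). RelM s c) ` (?s \<times> ?c) \<union> (\<lambda>(s, c). NamM s c) ` (?s \<times> ?c) \<union>
     RelB ` ?s \<union> Args ` ?s \<union> Kind ` ?s \<union> NamB ` ?s"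
  proof
    fix q assume "q \<in> {q. st_ok m q}"
    then show "q \<in> {Items, Done, Err} \<union> (\<lambda>(s, f). Atoms s f) ` (?s \<times> UNIV) \<union>
     (\<lambda>(s, c). RelM s c) ` (?s \<times> ?c) \<union> (\<lambda>(s, c). NamM s c) ` (?s \<times> ?c) \<union>
     RelB ` ?s \<union> Args ` ?s \<union> Kind ` ?s \<union> NamB ` ?s"
      by (cases q) (auto simp: image_iff)
  qed
qed auto

definition all_states :: "(nat \<times> st) set" where
  "all_states = (SIGMA \<pi>:{..3}. {q. st_ok (slots \<pi>) q})"

interpretation parser: fo_machine next_state "(0, Items)" all_states \<phi> for \<phi>
proof
  show "finite all_states" unfolding all_states_def by (auto simp: finite_st_ok)
  show "(0, Items) \<in> all_states" by (simp add: all_states_def)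
  fix q a assume "q \<in> all_states"
  moreover have "0 < slots \<pi>" for \<pi> by (simp add: slots_def)
  ultimately show "next_state q a \<in> all_states"
    by (cases "(q, a)" rule: next_state.cases) (auto simp: all_states_def st_ok_step)
qed

definition mk_cell :: "nat \<Rightarrow> st \<times> bool \<Rightarrow> cell" where
  "mk_cell \<pi> c = ((\<pi>, fst c), Bit (snd c))"

text \<open>The state \<open>Done\<close> at the closing separator is the trace that a well-formed
  part leaves in the word, and so something that a formula can test.\<close>

definition part :: "nat \<Rightarrow> item list \<Rightarrow> cell list" where
  "part \<pi> its = map (mk_cell \<pi>) (pcells its) @ [((\<pi>, Done), Sep)]"

lemma trace_bits:
  "trace next_state (\<pi>, q) (map Bit bs @ Sep # w) =
    map (mk_cell \<pi>) (annot (slots \<pi>) q bs) @ ((\<pi>, foldl (step (slots \<pi>)) q bs), Sep) # trace next_state (min 3 (Suc \<pi>), Items) w"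
  by (induction bs arbitrary: q) (auto simp: mk_cell_def)

definition tagged :: "bool list \<Rightarrow> bool list \<Rightarrow> bool list \<Rightarrow> cell list" where
  "tagged x u v = trace next_state (0, Items) (triple x u v @ [Sep])"

lemma tagged_eq:
  "tagged x u v =
    map (mk_cell 0) (annot (slots 0) Items x) @ ((0, foldl (step (slots 0)) Items x), Sep) #
    map (mk_cell 1) (annot (slots 1) Items u) @ ((1, foldl (step (slots 1)) Items u), Sep) #
    map (mk_cell 2) (annot (slots 2) Items v) @ [((2, foldl (step (slots 2)) Items v), Sep)]"
  by (simp add: tagged_def triple_def trace_bits min_def numeral_2_eq_2)

lemma map_annot:
  assumes "\<forall>it \<in> set its. length it = slots \<pi>"
  shows "map (mk_cell \<pi>) (annot (slots \<pi>) Items (enc_items its)) @ ((\<pi>, foldl (step (slots \<pi>)) Items (enc_items its)), Sep) # w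
    = part \<pi> its @ w"
  using yields_pcells[OF _ assms] by (simp add: yields_def bits_pcells part_def slots_def)

definition doc_ok :: "(nat \<Rightarrow> item list) \<Rightarrow> bool" where
  "doc_ok D \<longleftrightarrow> (\<forall>\<pi>. \<forall>it \<in> set (D \<pi>). length it = slots \<pi>)"

definition word :: "(nat \<Rightarrow> item list) \<Rightarrow> cell list" where
  "word D = part 0 (D 0) @ part 1 (D 1) @ part 2 (D 2)"

lemma tagged_word: "doc_ok D \<Longrightarrow> tagged (enc_items (D 0)) (enc_items (D 1)) (enc_items (D 2)) = word D"
  unfolding tagged_eq doc_ok_def word_def using map_annot[of "D 0" 0] map_annot[of "D 1" 1] map_annot[of "D 2" 2 "[]"]
  by simp

section \<open>Definable predicates\<close>

definition dec :: "('c list \<Rightarrow> (nat \<Rightarrow> nat) \<Rightarrow> bool) \<Rightarrow> bool" where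
  "dec P \<longleftrightarrow> (\<exists>\<phi>. \<forall>w e. (\<forall>v. e v < length w) \<longrightarrow> eval w e \<phi> = P w e)"

lemma dec_neg: "dec P \<Longrightarrow> dec (\<lambda>w e. \<not> P w e)"
proof -
  assume "dec P"
  then obtain \<phi> where "\<And>w e. (\<forall>v. e v < length w) \<Longrightarrow> eval w e \<phi> = P w e" unfolding dec_def by blast
  then show ?thesis unfolding dec_def by (intro exI[of _ "Neg \<phi>"]) simp
qed

lemma dec_conj: "dec P \<Longrightarrow> dec Q \<Longrightarrow> dec (\<lambda>w e. P w e \<and> Q w e)"
proof -
  assume "dec P" "dec Q"
  then obtain \<phi> \<psi> where "\<And>w e. (\<forall>v. e v < length w) \<Longrightarrow> eval w e \<phi> = P w e"
    "\<And>w e. (\<forall>v. e v < length w) \<Longrightarrow> eval w e \<psi> = Q w e" unfolding dec_def by metis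
  then show ?thesis unfolding dec_def by (intro exI[of _ "Conj \<phi> \<psi>"]) simp
qed

text \<open>\<open>G\<close> takes the environment of the outer variables and the new position as
  separate arguments; the premise performs the de Bruijn shift, and the conclusion can be stated
  with an ordinary bound variable.\<close>

lemma dec_ex:
  assumes "dec (\<lambda>w e. G w (\<lambda>v. e (Suc v)) (e 0))"
  shows "dec (\<lambda>w e. \<exists>i < length w. G w e i)"
proof -
  obtain \<phi> where \<phi>: "\<And>w e. (\<forall>v. e v < length w) \<Longrightarrow> eval w e \<phi> = G w (\<lambda>v. e (Suc v)) (e 0)"
    using assms unfolding dec_def by blast
  have "eval w (case_nat i e) \<phi> = G w e i" if "\<forall>v. e v < length w" "i < length w" for w e i
    by (subst \<phi>) (use that in \<open>auto split: nat.split\<close>)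
  then show ?thesis unfolding dec_def by (intro exI[of _ "Ex \<phi>"]) auto
qed

lemma dec_sync: "dec (\<lambda>w e. sync k1 k2 c r (scan rt w (int (e i))) (scan rt w (int (e j))))"
  unfolding dec_def by (intro exI[of _ "Sync rt k1 k2 c r i j"]) simp

lemma dec_nth: "dec (\<lambda>w e. C (w ! e i))"
  unfolding dec_def
proof (intro exI[of _ "Sync True (\<lambda>_. False) (\<lambda>_. False) (\<lambda>_ _. True) (\<lambda>x _. holds C x) i i"] allI impI)
  fix w :: "'a list" and e :: "nat \<Rightarrow> nat"
  assume "\<forall>v. e v < length w"
  then have "drop (e i) w = w ! e i # drop (Suc (e i)) w" by (simp add: Cons_nth_drop_Suc)
  then show "eval w e (Sync True (\<lambda>_. False) (\<lambda>_. False) (\<lambda>_ _. True) (\<lambda>x _. holds C x) i i) = C (w ! e i)"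
    by (simp add: scan_def) (subst sync.simps, simp)
qed

lemma sync_less:
  "sync (\<lambda>_. False) (\<lambda>_. False) (\<lambda>_ _. False) (\<lambda>x y. x = None \<and> (\<exists>z. y = Some z)) xs ys \<longleftrightarrow> length xs < length ys"
proof (induction xs arbitrary: ys)
  case Nil
  then show ?case by (subst sync.simps) (cases ys; simp)
next
  case (Cons x xs)
  then show ?case by (subst sync.simps) (cases ys; simp)
qed

text \<open>The order of positions is not built into the formulas. Two leftward scans are run to the
  edge without a stopping condition, and the head that leaves the word first started further
  left.\<close>

lemma dec_less: "dec (\<lambda>w e. e i < e j)"
  unfolding dec_def
proof (intro exI[of _ "Sync False (\<lambda>_. False) (\<lambda>_. False) (\<lambda>_ _. False) (\<lambda>x y. x = None \<and> (\<exists>z. y = Some z)) i j"] allI impI)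
  fix w :: "'a list" and e :: "nat \<Rightarrow> nat"
  assume "\<forall>v. e v < length w"
  then have "e i < length w" "e j < length w" by simp_all
  moreover have "nat (int n + 1) = Suc n" for n by simp
  ultimately show "eval w e (Sync False (\<lambda>_. False) (\<lambda>_. False) (\<lambda>_ _. False) (\<lambda>x y. x = None \<and> (\<exists>z. y = Some z)) i j)
      = (e i < e j)"
    by (simp only: eval.simps sync_less scan_def) simp
qed

fun sync0 :: "('c \<Rightarrow> 'c \<Rightarrow> bool) \<Rightarrow> ('c option \<Rightarrow> 'c option \<Rightarrow> bool) \<Rightarrow> 'c list \<Rightarrow> 'c list \<Rightarrow> bool" where
  "sync0 c r (x # xs) (y # ys) = (if c x y then r (Some x) (Some y) else sync0 c r xs ys)"
| "sync0 c r xs ys = r (hd_option xs) (hd_option ys)"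

lemma sync_filter: "sync (\<lambda>x. \<not> k1 x) (\<lambda>x. \<not> k2 x) c r xs ys = sync0 c r (filter k1 xs) (filter k2 ys)"
proof (induction "length xs + length ys" arbitrary: xs ys rule: less_induct)
  case less
  show ?case
  proof (cases "xs \<noteq> [] \<and> \<not> k1 (hd xs)")
    case True
    then show ?thesis using less[of "tl xs" ys] by (subst sync.simps) (cases xs; simp)
  next
    case 1: False
    show ?thesis
    proof (cases "ys \<noteq> [] \<and> \<not> k2 (hd ys)")
      case True
      then show ?thesis using 1 less[of xs "tl ys"] by (subst sync.simps) (cases ys; auto)
    next
      case False
      then show ?thesis using 1 less[of "tl xs" "tl ys"] by (subst sync.simps) (cases xs; cases ys; simp)
    qed
  qed
qed

text \<open>Compares the letters in \<open>k1\<close>, respectively \<open>k2\<close>, up to the first letter in \<open>t\<close>.\<close>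

definition match :: "bool \<Rightarrow> ('c \<Rightarrow> bool) \<Rightarrow> ('c \<Rightarrow> bool) \<Rightarrow> ('c \<Rightarrow> bool) \<Rightarrow> ('c \<Rightarrow> bool) \<Rightarrow> 'c list \<Rightarrow> nat \<Rightarrow> nat \<Rightarrow> bool" where
  "match rt k1 k2 t f w p q \<longleftrightarrow>
     sync (\<lambda>x. \<not> k1 x) (\<lambda>x. \<not> k2 x) (\<lambda>a b. t a \<or> t b \<or> f a \<noteq> f b) (\<lambda>x y. holds t x \<and> holds t y)
       (scan rt w (int p)) (scan rt w (int q))"

lemma dec_match: "dec (\<lambda>w e. match rt k1 k2 t f w (e i) (e j))"
  unfolding match_def by (rule dec_sync)

text \<open>If only one list reaches its terminator, the scan stops there with the verdict false; so
  the lengths of \<open>us\<close> and \<open>vs\<close> are compared along with their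
  images.\<close>

lemma sync0_match:
  assumes "\<forall>u \<in> set us. \<not> t u" "\<forall>v \<in> set vs. \<not> t v" "t x" "t y"
  shows "sync0 (\<lambda>a b. t a \<or> t b \<or> f a \<noteq> f b) (\<lambda>x y. holds t x \<and> holds t y) (us @ x # xs) (vs @ y # ys)
    \<longleftrightarrow> map f us = map f vs"
  using assms(1,2)
proof (induction us arbitrary: vs)
  case Nil
  then show ?case using assms(3,4) by (cases vs) auto
next
  case (Cons u us)
  then show ?case using assms(3,4) by (cases vs) auto
qed

lemma match_iff:
  assumes "filter k1 (scan rt w (int p)) = us @ x # xs" "filter k2 (scan rt w (int q)) = vs @ y # ys"
    "\<forall>u \<in> set us. \<not> t u" "\<forall>v \<in> set vs. \<not> t v" "t x" "t y"
  shows "match rt k1 k2 t f w p q \<longleftrightarrow> map f us = map f vs"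
  unfolding match_def sync_filter assms(1,2) using assms(3-6) by (rule sync0_match)

section \<open>The syntax tree of a document inside its word\<close>

section \<open>Nodes\<close>

text \<open>No \<open>C\<close> occurs before the first \<open>B\<close>. If the rest of a word
  after a block has this property, none of its \<open>C\<close>-cells is attributed to the
  block.\<close>

fun guarded :: "('a \<Rightarrow> bool) \<Rightarrow> ('a \<Rightarrow> bool) \<Rightarrow> 'a list \<Rightarrow> bool" where
  "guarded C B [] = True"
| "guarded C B (x # xs) = (B x \<or> \<not> C x \<and> guarded C B xs)"

lemma guarded_append: "guarded C B xs \<Longrightarrow> guarded C B ys \<Longrightarrow> guarded C B (xs @ ys)"
  by (induction xs) auto

lemma guarded_nth: "guarded C B xs \<Longrightarrow> p < length xs \<Longrightarrow> C (xs ! p) \<Longrightarrow> \<exists>c \<le> p. B (xs ! c)"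
proof (induction xs arbitrary: p)
  case (Cons x xs)
  show ?case
  proof (cases "B x")
    case False
    then obtain p' where p: "p = Suc p'" using Cons.prems by (cases p) auto
    then obtain c where "c \<le> p'" "B (xs ! c)" using Cons.IH[of p'] Cons.prems False by auto
    then show ?thesis using p by (intro exI[of _ "Suc c"]) simp
  qed auto
qed simp

fun poss :: "('a \<Rightarrow> bool) \<Rightarrow> nat \<Rightarrow> 'a list \<Rightarrow> nat set" where
  "poss C p [] = {}"
| "poss C p (x # xs) = (if C x then insert p (poss C (Suc p) xs) else poss C (Suc p) xs)"

lemma poss_append: "poss C p (xs @ ys) = poss C p xs \<union> poss C (p + length xs) ys"
  by (induction xs arbitrary: p) auto

lemma poss_iff: "q \<in> poss C p xs \<longleftrightarrow> p \<le> q \<and> q < p + length xs \<and> C (xs ! (q - p))"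
proof (induction xs arbitrary: p)
  case (Cons x xs)
  show ?case
  proof (cases "p < q")
    case True
    then have "q - p = Suc (q - Suc p)" by simp
    then show ?thesis using True by (simp add: Cons.IH)
  next
    case False
    then show ?thesis by (cases "p = q") (simp_all add: Cons.IH)
  qed
qed simp

lemma poss_map: "poss C p (map f xs) = poss (\<lambda>x. C (f x)) p xs"
  by (induction xs arbitrary: p) auto

lemma poss_none: "\<forall>x \<in> set xs. \<not> C x \<Longrightarrow> poss C p xs = {}"
  by (induction xs arbitrary: p) auto

text \<open>The syntax tree in first-order terms: the parent of a \<open>C\<close>-cell is the
  nearest \<open>B\<close>-cell to its left.\<close>

definition child :: "('c \<Rightarrow> bool) \<Rightarrow> ('c \<Rightarrow> bool) \<Rightarrow> 'c list \<Rightarrow> nat \<Rightarrow> nat \<Rightarrow> bool" where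
  "child B C w r p \<longleftrightarrow> B (w ! r) \<and> C (w ! p) \<and> r < p \<and> \<not> (\<exists>c < length w. r < c \<and> c < p \<and> B (w ! c))"

lemma dec_child: "dec (\<lambda>w e. child B C w (e i) (e j))"
  unfolding child_def by (intro dec_conj dec_neg dec_ex dec_nth dec_less)

text \<open>The first cell is the only \<open>B\<close>-cell of the block, so it is the parent of
  all \<open>C\<close>-cells in the block; a \<open>C\<close>-cell further right has a
  \<open>B\<close>-cell of the rest before it.\<close>

lemma child_blk:
  assumes w: "w = pre @ blk @ rest" "length pre = r"
    and B: "poss B r blk = {r}" and G: "guarded C B rest" and CB: "\<And>x. C x \<Longrightarrow> \<not> B x"
  shows "{p. p < length w \<and> child B C w r p} = poss C r blk"
proof (intro set_eqI)
  fix p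
  have Br: "r < r + length blk" "B (blk ! 0)" and Bo: "q = r" if "r \<le> q" "q < r + length blk" "B (blk ! (q - r))" for q
    using B poss_iff[of r B r blk] poss_iff[of _ B r blk] that by auto
  have Br: "r < r + length blk" "B (blk ! 0)" using B poss_iff[of r B r blk] by auto
  have nth: "w ! q = (if q < r + length blk then blk ! (q - r) else rest ! (q - r - length blk))" if "r \<le> q" for q
    using that w by (auto simp: nth_append)
  show "p \<in> {p. p < length w \<and> child B C w r p} \<longleftrightarrow> p \<in> poss C r blk"
  proof
    assume "p \<in> {p. p < length w \<and> child B C w r p}"
    then have p: "p < length w" "C (w ! p)" "r < p" "\<And>c. r < c \<Longrightarrow> c < p \<Longrightarrow> \<not> B (w ! c)"
      by (auto simp: child_def)
    have "p < r + length blk"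
    proof (rule ccontr)
      assume *: "\<not> p < r + length blk"
      define j where "j = p - r - length blk"
      have j: "p = r + length blk + j" "j < length rest" using * p(1) w unfolding j_def by auto
      then have "C (rest ! j)" using p(2) nth[of p] by simp
      with guarded_nth[OF G j(2)] obtain c where c: "c \<le> j" "B (rest ! c)" by blast
      then have "c \<noteq> j" using CB \<open>C (rest ! j)\<close> by blast
      then show False using p(4)[of "r + length blk + c"] c j nth[of "r + length blk + c"] Br(1) by simp
    qed
    then show "p \<in> poss C r blk" using p nth[of p] by (simp add: poss_iff)
  next
    assume "p \<in> poss C r blk"
    then have p: "r \<le> p" "p < r + length blk" "C (blk ! (p - r))" by (auto simp: poss_iff)
    have "p \<noteq> r" using p Br CB by auto
    moreover have "\<not> B (w ! c)" if "r < c" "c < p" for c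
      using Bo[of c] that p(2) nth[of c] by auto
    ultimately show "p \<in> {p. p < length w \<and> child B C w r p}"
      using p Br nth[of p] nth[of r] w by (auto simp: child_def)
  qed
qed

text \<open>An element starts one cell after the bit that announces it, hence \<open>Suc p\<close>;
  \<open>l\<close> gives the length of its code.\<close>

fun lnodes :: "('a \<Rightarrow> nat) \<Rightarrow> nat \<Rightarrow> nat \<Rightarrow> 'a list \<Rightarrow> (nat \<times> nat \<times> 'a) list" where
  "lnodes l p k [] = []"
| "lnodes l p k (x # xs) = (Suc p, k, x) # lnodes l (Suc p + l x) (Suc k) xs"

text \<open>The final clause counts marked cells in front of an element. Applied to the starts of
  terms, it shows that the index of an argument can be recovered from the word.\<close>

lemma lnodes_lcells:
  assumes "(q, k, x) \<in> set (lnodes l p k0 xs)" "\<And>x. x \<in> set xs \<Longrightarrow> l x = length (e x)"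
  shows "\<exists>cs j. lcells f g e xs = cs @ e x @ lcells g g e (drop (Suc j) xs) \<and> q = p + length cs \<and> k = k0 + j \<and>
    j < length xs \<and> x = xs ! j \<and>
    (\<forall>P. \<not> P f \<and> \<not> P g \<longrightarrow> filter P (map fst cs) = concat (map (\<lambda>x. filter P (map fst (e x))) (take j xs)))"
  using assms
proof (induction xs arbitrary: p k0 f)
  case (Cons y ys)
  show ?case
  proof (cases "(q, k, x) = (Suc p, k0, y)")
    case True
    then show ?thesis by (intro exI[of _ "[(f, True)]"] exI[of _ 0]) auto
  next
    case False
    then have "(q, k, x) \<in> set (lnodes l (Suc p + l y) (Suc k0) ys)" using Cons.prems(1) by auto
    moreover have l: "\<And>x. x \<in> set ys \<Longrightarrow> l x = length (e x)" using Cons.prems(2) by simp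
    ultimately have "\<exists>cs j. lcells g g e ys = cs @ e x @ lcells g g e (drop (Suc j) ys) \<and>
      q = Suc p + l y + length cs \<and> k = Suc k0 + j \<and> j < length ys \<and> x = ys ! j \<and>
      (\<forall>P. \<not> P g \<and> \<not> P g \<longrightarrow> filter P (map fst cs) = concat (map (\<lambda>x. filter P (map fst (e x))) (take j ys)))"
      by (rule Cons.IH)
    then obtain cs j where *: "lcells g g e ys = cs @ e x @ lcells g g e (drop (Suc j) ys)"
      "q = Suc p + l y + length cs" "k = Suc k0 + j" "j < length ys" "x = ys ! j"
      "\<And>P. \<not> P g \<Longrightarrow> filter P (map fst cs) = concat (map (\<lambda>x. filter P (map fst (e x))) (take j ys))"
      by blast
    then show ?thesis using Cons.prems(2)[of y]
      by (intro exI[of _ "(f, True) # e y @ cs"] exI[of _ "Suc j"]) auto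
  qed
qed simp

lemma lnodes_index: "(k, x) \<in> snd ` set (lnodes l p k0 xs) \<longleftrightarrow> k0 \<le> k \<and> k < k0 + length xs \<and> x = xs ! (k - k0)"
proof (induction xs arbitrary: p k0)
  case (Cons y ys)
  show ?case
  proof (cases "k0 < k")
    case True
    then have "k - k0 = Suc (k - Suc k0)" by simp
    then show ?thesis using True Cons.IH[of "Suc p + l y" "Suc k0"] by (auto simp: image_iff)
  next
    case False
    then show ?thesis using Cons.IH[of "Suc p + l y" "Suc k0"] by (cases "k = k0") auto
  qed
qed simp

lemma lnodes_mono: "(q, k, x) \<in> set (lnodes l p k0 xs) \<Longrightarrow> (q', k', x') \<in> set (lnodes l p k0 xs) \<Longrightarrow> q < q' \<longleftrightarrow> k < k'"
proof (induction xs arbitrary: p k0)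
  case (Cons y ys)
  have *: "p < q \<and> k0 \<le> k" if "(q, k, x) \<in> set (lnodes l p k0 xs)" for q k x p k0 and xs :: "'a list"
    using that by (induction xs arbitrary: p k0) force+
  note b = *[of _ _ _ "Suc p + l y" "Suc k0" ys]
  from Cons.prems consider "q = Suc p" "k = k0" "q' = Suc p" "k' = k0"
    | "q = Suc p" "k = k0" "(q', k', x') \<in> set (lnodes l (Suc p + l y) (Suc k0) ys)"
    | "(q, k, x) \<in> set (lnodes l (Suc p + l y) (Suc k0) ys)" "q' = Suc p" "k' = k0"
    | "(q, k, x) \<in> set (lnodes l (Suc p + l y) (Suc k0) ys)" "(q', k', x') \<in> set (lnodes l (Suc p + l y) (Suc k0) ys)"
    by auto
  then show ?case
    by cases (use Cons.IH b in fastforce)+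
qed simp

lemma poss_lcells:
  assumes "\<not> P f" "\<not> P g" "\<And>x p. x \<in> set xs \<Longrightarrow> poss P p (map fst (e x)) = {p}" "\<And>x. x \<in> set xs \<Longrightarrow> l x = length (e x)"
  shows "poss P p (map fst (lcells f g e xs)) = fst ` set (lnodes l p k xs)"
  using assms
proof (induction xs arbitrary: p k f)
  case (Cons x xs)
  have "poss P (Suc p + length (e x)) (map fst (lcells g g e xs)) =
      fst ` set (lnodes l (Suc p + length (e x)) (Suc k) xs)"
    by (rule Cons.IH) (use Cons.prems in simp_all)
  then show ?case using Cons.prems by (simp add: poss_append)
qed simp

lemma set_lcells: "x \<in> set (lcells f g e xs) \<Longrightarrow> fst x = f \<or> fst x = g \<or> (\<exists>y \<in> set xs. x \<in> set (e y))"
  by (induction xs arbitrary: f) auto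

lemma guarded_lcells:
  assumes "\<not> C f" "\<not> C g" "\<And>x. x \<in> set xs \<Longrightarrow> guarded C B (map fst (e x))"
  shows "guarded C B (map fst (lcells f g e xs))"
  using assms by (induction xs arbitrary: f) (auto intro: guarded_append)

lemma hd_lcells: "\<exists>b cs. lcells f g e xs = (f, b) # cs"
  by (cases xs) auto

section \<open>The cells where items, atoms and terms begin\<close>

abbreviation st_of :: "cell \<Rightarrow> st" where
  "st_of c \<equiv> snd (fst c)"

text \<open>Each of these kinds of state is met exactly once per item, atom or term, on its first
  cell: the flag of \<open>Atoms\<close> is set only there, and 0 in \<open>RelM\<close> means that
  no digit has been read.\<close>

definition itemS :: "st \<Rightarrow> bool" where "itemS q \<longleftrightarrow> q = Atoms 0 True"
definition atomS :: "st \<Rightarrow> bool" where "atomS q \<longleftrightarrow> (\<exists>s. q = RelM s 0)"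
definition termS :: "st \<Rightarrow> bool" where "termS q \<longleftrightarrow> (\<exists>s. q = Kind s)"

lemmas S_defs = itemS_def atomS_def termS_def

lemma mk_cell_simps [simp]: "st_of (mk_cell \<pi> c) = fst c" "fst (fst (mk_cell \<pi> c)) = \<pi>"
  "snd (mk_cell \<pi> c) = Bit (snd c)"
  by (simp_all add: mk_cell_def)

lemma map_mk_cell [simp]: "map st_of (map (mk_cell \<pi>) cs) = map fst cs"
  by simp

lemma ncells_Cons: "\<exists>b cs. ncells M B c bs = (M c, b) # cs \<and>
   (\<forall>x \<in> set cs. fst x = B \<or> fst x = M 1 \<or> fst x = M 2)"
proof (induction bs arbitrary: c)
  case (Cons b bs)
  obtain b' cs where "ncells M B (if b then 1 else 2) bs = (M (if b then 1 else 2), b') # cs"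
    "\<forall>x \<in> set cs. fst x = B \<or> fst x = M 1 \<or> fst x = M 2" using Cons.IH by blast
  then show ?case by (cases b) auto
qed (auto intro: exI[of _ False])

lemma poss_ncells_other:
  assumes "\<And>c. \<not> P (M c)" "\<not> P B"
  shows "poss P p (map fst (ncells M B c bs)) = {}"
  using assms by (induction bs arbitrary: p c) auto

lemma poss_ncells_first:
  assumes "P (M 0)" "\<And>c. c \<noteq> 0 \<Longrightarrow> \<not> P (M c)" "\<not> P B"
  shows "poss P p (map fst (ncells M B 0 bs)) = {p}"
proof -
  have "poss P p (map fst (ncells M B c bs)) = {}" if "c \<noteq> 0" for c p bs
    using that assms by (induction bs arbitrary: p c) auto
  then show ?thesis using assms by (cases bs) simp_all
qed

lemma poss_tcells_term: "poss termS p (map fst (tcells s t)) = {p}"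
  by (simp add: tcells_def termS_def poss_ncells_other)

lemma poss_tcells_atom: "P = (\<lambda>q. q = RelM s' 0) \<or> P = atomS \<or> P = itemS \<Longrightarrow> poss P p (map fst (tcells s t)) = {}"
  by (auto simp: tcells_def S_defs poss_ncells_other)

lemma length_tcells: "length (tcells s t) = length (enc_trm t)"
  using bits_tcells[of s t] by (metis length_map)

lemma length_acells: "length (acells s A) = length (enc_atom A)"
  using bits_acells[of s A] by (metis length_map)

lemma length_icells: "length (icells s it) = length (enc_item it)"
  using bits_icells[of s it] by (metis length_map)

lemma length_ncells: "length (ncells M B 0 (bin n)) = length (enc_nat n)"
  using bits_ncells[of M B 0 "bin n"] by (metis enc_nat_def length_map)

lemma poss_lcells_none:
  assumes "\<not> P f" "\<not> P g" "\<And>x p. x \<in> set xs \<Longrightarrow> poss P p (map fst (e x)) = {}"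
  shows "poss P p (map fst (lcells f g e xs)) = {}"
  using assms by (induction xs arbitrary: p f) (auto simp: poss_append)

lemma poss_acells:
  "poss P p (map fst (acells s A)) = poss P p (map fst (ncells (RelM s) (RelB s) 0 (bin (rel A)))) \<union>
    poss P (p + length (enc_nat (rel A))) (map fst (lcells (Args s) (Args s) (tcells s) (args A)))"
  by (simp add: acells_def poss_append length_ncells)

lemma poss_args_none:
  assumes "P = (\<lambda>q. q = RelM s' 0) \<or> P = atomS \<or> P = itemS"
  shows "poss P p (map fst (lcells (Args s) (Args s) (tcells s) ts)) = {}"
  by (rule poss_lcells_none) (use assms poss_tcells_atom[OF assms] in \<open>auto simp: S_defs\<close>)

lemma poss_acells_atom:
  assumes "P = (\<lambda>q. q = RelM s 0) \<or> P = atomS"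
  shows "poss P p (map fst (acells s A)) = {p}"
proof -
  have "poss P p (map fst (ncells (RelM s) (RelB s) 0 (bin (rel A)))) = {p}"
    by (rule poss_ncells_first) (use assms in \<open>auto simp: S_defs\<close>)
  moreover have "poss P q (map fst (lcells (Args s) (Args s) (tcells s) (args A))) = {}" for q
    by (rule poss_args_none) (use assms in blast)
  ultimately show ?thesis by (simp add: poss_acells)
qed

lemma poss_acells_none:
  assumes "P = (\<lambda>q. q = RelM s' 0) \<and> s' \<noteq> s \<or> P = itemS"
  shows "poss P p (map fst (acells s A)) = {}"
proof -
  have "poss P p (map fst (ncells (RelM s) (RelB s) 0 (bin (rel A)))) = {}"
    by (rule poss_ncells_other) (use assms in \<open>auto simp: S_defs\<close>)
  moreover have "poss P q (map fst (lcells (Args s) (Args s) (tcells s) (args A))) = {}" for q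
    by (rule poss_args_none[where s' = s']) (use assms in blast)
  ultimately show ?thesis by (simp add: poss_acells)
qed

lemma poss_acells_term:
  "poss termS p (map fst (acells s A)) = fst ` set (lnodes (\<lambda>t. length (enc_trm t)) (p + length (enc_nat (rel A))) 0 (args A))"
proof -
  have "poss termS p (map fst (ncells (RelM s) (RelB s) 0 (bin (rel A)))) = {}"
    by (rule poss_ncells_other) (auto simp: S_defs)
  moreover have "poss termS q (map fst (lcells (Args s) (Args s) (tcells s) (args A))) =
      fst ` set (lnodes (\<lambda>t. length (enc_trm t)) q 0 (args A))" for q
    by (rule poss_lcells) (simp_all add: poss_tcells_term length_tcells, simp_all add: S_defs)
  ultimately show ?thesis by (simp add: poss_acells)
qed

lemma poss_scells_atom:
  "poss (\<lambda>q. q = RelM s 0) p (map fst (scells s As)) = fst ` set (lnodes (\<lambda>A. length (enc_atom A)) p 0 As)"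
  unfolding scells_def by (rule poss_lcells) (simp_all add: length_acells poss_acells_atom)

lemma poss_scells_atom_other: "s' \<noteq> s \<Longrightarrow> poss (\<lambda>q. q = RelM s' 0) p (map fst (scells s As)) = {}"
  unfolding scells_def
  by (rule poss_lcells_none) (use poss_acells_none[of "\<lambda>q. q = RelM s' 0" s' s] in simp_all)

lemma poss_scells_item: "poss itemS p (map fst (scells s As)) = (if s = 0 then {p} else {})"
proof (cases As)
  case (Cons A As')
  have "poss itemS p (map fst (acells s A)) = {}" "poss itemS p (map fst (lcells (Atoms s False) (Atoms s False) (acells s) As')) = {}" for p
    by (rule poss_acells_none, simp)
      (rule poss_lcells_none, simp add: S_defs, simp add: S_defs, rule poss_acells_none, simp)
  then show ?thesis
    by (cases "s = 0") (simp_all add: Cons scells_def poss_append, simp_all add: S_defs)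
qed (simp add: scells_def S_defs)

lemma poss_icells_atom:
  "poss (\<lambda>q. q = RelM s' 0) p (map fst (icells s it)) =
    (if s \<le> s' \<and> s' < s + length it
     then fst ` set (lnodes (\<lambda>A. length (enc_atom A)) (p + length (enc_item (take (s' - s) it))) 0 (it ! (s' - s))) else {})"
proof (induction it arbitrary: s p)
  case (Cons As it)
  show ?case
  proof (cases "s' = s")
    case True
    show ?thesis unfolding True[symmetric]
      by (simp add: poss_append poss_scells_atom Cons.IH enc_item_def)
  next
    case False
    have *: "Suc s \<le> s' \<Longrightarrow> s' - s = Suc (s' - Suc s)" by simp
    have "length (scells s As) = length (enc_list enc_atom As)"
      using bits_scells[of s As] by (metis length_map)
    with False show ?thesis
      by (cases "Suc s \<le> s'") (simp_all add: poss_append poss_scells_atom_other Cons.IH enc_item_def * add.assoc)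
  qed
qed auto

lemma poss_icells_item: "it \<noteq> [] \<Longrightarrow> poss itemS p (map fst (icells 0 it)) = {p}"
proof (cases it)
  case (Cons As it')
  have "poss itemS p (map fst (icells s it')) = {}" if "s > 0" for p s
    using that by (induction it' arbitrary: s p) (auto simp: poss_append poss_scells_item)
  then show ?thesis by (simp add: Cons poss_append poss_scells_item)
qed simp

lemma poss_pcells:
  "\<forall>it \<in> set its. it \<noteq> [] \<Longrightarrow>
   poss itemS p (map fst (pcells its)) = fst ` set (lnodes (\<lambda>it. length (enc_item it)) p 0 its)"
  unfolding pcells_def
  by (rule poss_lcells) (simp_all add: poss_icells_item length_icells, simp_all add: S_defs)

lemma hd_scells: "\<exists>b cs. scells s As = (Atoms s (s = 0), b) # cs"
  unfolding scells_def by (rule hd_lcells)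

lemma hd_icells: "it \<noteq> [] \<Longrightarrow> \<exists>b cs. icells s it = (Atoms s (s = 0), b) # cs"
proof (cases it)
  case (Cons As it')
  then show ?thesis using hd_scells[of s As] by auto
qed simp

lemma guarded_acells: "guarded termS atomS (map fst (acells s A))"
  unfolding acells_def using ncells_Cons[of "RelM s" "RelB s" 0 "bin (rel A)"] by (auto simp: S_defs)

lemma guarded_scells: "guarded termS atomS (map fst (scells s As))"
  unfolding scells_def by (rule guarded_lcells) (auto simp: guarded_acells, simp_all add: S_defs)

lemma guarded_icells: "guarded termS atomS (map fst (icells s it))"
  by (induction it arbitrary: s) (auto intro: guarded_append guarded_scells)

lemma guarded_icells_item: "it \<noteq> [] \<Longrightarrow> guarded atomS itemS (map fst (icells 0 it))"
  using hd_icells[of it 0] by (auto simp: S_defs)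

lemma guarded_items:
  "guarded termS atomS (map fst (lcells Items Items (icells 0) its))"
  "\<forall>it \<in> set its. it \<noteq> [] \<Longrightarrow> guarded atomS itemS (map fst (lcells Items Items (icells 0) its))"
  by (rule guarded_lcells; auto simp: guarded_icells guarded_icells_item; simp add: S_defs)+

definition guarded2 :: "cell list \<Rightarrow> bool" where
  "guarded2 w \<longleftrightarrow> guarded termS atomS (map st_of w) \<and> guarded atomS itemS (map st_of w)"

lemma guarded2_append: "guarded2 v \<Longrightarrow> guarded2 w \<Longrightarrow> guarded2 (v @ w)"
  by (simp add: guarded2_def guarded_append)

lemma guarded2_items: "\<forall>it \<in> set its. it \<noteq> [] \<Longrightarrow> guarded2 (map (mk_cell \<pi>) (lcells Items Items (icells 0) its))"
  unfolding guarded2_def map_mk_cell by (simp add: guarded_items)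

lemma guarded2_Done: "guarded2 [((\<pi>, Done), Sep)]"
  by (simp add: guarded2_def S_defs)

lemma guarded2_part: "\<forall>it \<in> set its. it \<noteq> [] \<Longrightarrow> guarded2 (part \<pi> its)"
  unfolding part_def pcells_def by (intro guarded2_append guarded2_items guarded2_Done)

text \<open>A node pairs a position in the word with the piece of syntax that starts there, so that
  a formula about positions can be read as a statement about items, atoms and terms.
  \<open>TNode\<close> also records the index of the argument.\<close>

datatype node = INode nat item | ANode nat "trm atom" | TNode nat nat trm

fun npos :: "node \<Rightarrow> nat" where
  "npos (INode p it) = p"
| "npos (ANode p A) = p"
| "npos (TNode p k t) = p"

text \<open>The word must not only contain the code of a node but also delimit it. An item is
  followed by an \<open>Items\<close> cell, what comes after an item or an atom is guarded and adds
  no children to it, and between a term and the first cell \<open>c\<close> of its atom there are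
  exactly \<open>k\<close> starts of terms.\<close>

fun wfn :: "cell list \<Rightarrow> node \<Rightarrow> bool" where
  "wfn w (INode p it) \<longleftrightarrow> (\<exists>\<pi> pre b rest. w = pre @ map (mk_cell \<pi>) (icells 0 it) @ mk_cell \<pi> (Items, b) # rest \<and>
     length pre = p \<and> 2 \<le> length it \<and> guarded2 rest)"
| "wfn w (ANode p A) \<longleftrightarrow> (\<exists>\<pi> s pre rest. w = pre @ map (mk_cell \<pi>) (acells s A) @ rest \<and>
     length pre = p \<and> guarded termS atomS (map st_of rest))"
| "wfn w (TNode p k t) \<longleftrightarrow> (\<exists>\<pi> s pre c mid rest. w = pre @ c # mid @ map (mk_cell \<pi>) (tcells s t) @ rest \<and>
     p = Suc (length pre + length mid) \<and> atomS (st_of c) \<and> filter atomS (map st_of mid) = [] \<and>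
     length (filter termS (map st_of mid)) = k)"

section \<open>Enumeration of the nodes of a document and of their children\<close>

definition part_start :: "nat \<Rightarrow> (nat \<Rightarrow> item list) \<Rightarrow> nat" where
  "part_start \<pi> D = (if \<pi> = 0 then 0 else if \<pi> = 1 then length (part 0 (D 0)) else length (part 0 (D 0)) + length (part 1 (D 1)))"

definition items :: "nat \<Rightarrow> (nat \<Rightarrow> item list) \<Rightarrow> node set" where
  "items \<pi> D = (\<lambda>(p, k, it). INode p it) ` set (lnodes (\<lambda>it. length (enc_item it)) (part_start \<pi> D) 0 (D \<pi>))"

fun atoms :: "nat \<Rightarrow> node \<Rightarrow> node set" where
  "atoms s (INode p it) = (if s < length it then (\<lambda>(p, k, A). ANode p A) `
      set (lnodes (\<lambda>A. length (enc_atom A)) (p + length (enc_item (take s it))) 0 (it ! s)) else {})"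
| "atoms s _ = {}"

fun terms :: "node \<Rightarrow> node set" where
  "terms (ANode p A) = (\<lambda>(p, k, t). TNode p k t) `
      set (lnodes (\<lambda>t. length (enc_trm t)) (p + length (enc_nat (rel A))) 0 (args A))"
| "terms _ = {}"

lemma npos_items: "npos ` items \<pi> D = fst ` set (lnodes (\<lambda>it. length (enc_item it)) (part_start \<pi> D) 0 (D \<pi>))"
  by (force simp: items_def)

lemma npos_atoms: "npos ` atoms s (INode p it) = (if s < length it then fst `
    set (lnodes (\<lambda>A. length (enc_atom A)) (p + length (enc_item (take s it))) 0 (it ! s)) else {})"
  by force

lemma npos_terms: "npos ` terms (ANode p A) = fst `
    set (lnodes (\<lambda>t. length (enc_trm t)) (p + length (enc_nat (rel A))) 0 (args A))"
  by force

lemma poss_part_item: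
  assumes "\<forall>it \<in> set its. it \<noteq> []"
  shows "poss (\<lambda>c. fst (fst c) = \<pi> \<and> itemS (st_of c)) p (part \<pi>' its) =
    (if \<pi>' = \<pi> then fst ` set (lnodes (\<lambda>it. length (enc_item it)) p 0 its) else {})"
proof -
  have "poss (\<lambda>c. fst (fst c) = \<pi> \<and> itemS (st_of c)) p (map (mk_cell \<pi>') cs) =
    (if \<pi>' = \<pi> then poss itemS p (map fst cs) else {})" for cs
    unfolding poss_map by (auto simp: poss_none)
  then show ?thesis using poss_pcells[OF assms, of p]
    by (auto simp: part_def poss_append S_defs)
qed

lemma doc_nonempty: "doc_ok D \<Longrightarrow> \<forall>it \<in> set (D \<pi>). it \<noteq> []"
  unfolding doc_ok_def slots_def by (metis length_0_conv zero_neq_numeral)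

lemma positions_items:
  assumes "doc_ok D" "\<pi> \<le> 2"
  shows "{p. p < length (word D) \<and> fst (fst (word D ! p)) = \<pi> \<and> itemS (st_of (word D ! p))} = npos ` items \<pi> D"
proof -
  have "{p. p < length (word D) \<and> fst (fst (word D ! p)) = \<pi> \<and> itemS (st_of (word D ! p))} =
    poss (\<lambda>c. fst (fst c) = \<pi> \<and> itemS (st_of c)) 0 (word D)"
    by (auto simp: poss_iff)
  also have "\<dots> = npos ` items \<pi> D"
    unfolding npos_items word_def poss_append poss_part_item[OF doc_nonempty[OF assms(1)]]
    using assms(2) by (auto simp: part_start_def le_Suc_eq numeral_2_eq_2)
  finally show ?thesis .
qed

lemma wfn_items:
  assumes D: "doc_ok D" and "\<pi> \<le> 2" "n \<in> items \<pi> D"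
  shows "wfn (word D) n"
proof -
  obtain p k it where n: "n = INode p it" and
    m: "(p, k, it) \<in> set (lnodes (\<lambda>it. length (enc_item it)) (part_start \<pi> D) 0 (D \<pi>))"
    using assms(3) by (auto simp: items_def)
  obtain cs j where cs: "pcells (D \<pi>) = cs @ icells 0 it @ lcells Items Items (icells 0) (drop (Suc j) (D \<pi>))"
    "p = part_start \<pi> D + length cs" "j < length (D \<pi>)" "it = D \<pi> ! j"
    using lnodes_lcells[OF m, of "icells 0" Items Items] by (auto simp: length_icells pcells_def)
  obtain pre post where w: "word D = pre @ part \<pi> (D \<pi>) @ post" "length pre = part_start \<pi> D" "guarded2 post"
  proof -
    note g = guarded2_part[OF doc_nonempty[OF D]]
    consider "\<pi> = 0" | "\<pi> = 1" | "\<pi> = 2" using assms(2) by linarith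
    then show thesis
    proof cases
      case 1
      show thesis by (rule that[of "[]" "part 1 (D 1) @ part 2 (D 2)"])
          (auto simp: word_def 1 part_start_def intro!: guarded2_append g)
    next
      case 2
      show thesis by (rule that[of "part 0 (D 0)" "part 2 (D 2)"])
          (auto simp: word_def 2 part_start_def intro!: g)
    next
      case 3
      show thesis by (rule that[of "part 0 (D 0) @ part 1 (D 1)" "[]"])
          (auto simp: word_def 3 part_start_def guarded2_def)
    qed
  qed
  let ?l = "lcells Items Items (icells 0) (drop (Suc j) (D \<pi>))"
  \<comment> \<open>Whether or not a further item follows, the next cell has state
    \<open>Items\<close>: it holds either the announcement of that item or the end of the
    list.\<close>
  obtain b ds where ds: "?l = (Items, b) # ds" using hd_lcells[of Items Items] by blast
  have ne: "\<forall>it \<in> set (drop (Suc j) (D \<pi>)). it \<noteq> []"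
    using doc_nonempty[OF D, of \<pi>] by (auto dest: in_set_dropD)
  have "guarded2 (map (mk_cell \<pi>) ?l)" by (rule guarded2_items[OF ne])
  then have "guarded2 (map (mk_cell \<pi>) ds)" unfolding ds by (simp add: guarded2_def S_defs)
  then have "guarded2 (map (mk_cell \<pi>) ds @ [((\<pi>, Done), Sep)] @ post)"
    using w(3) by (intro guarded2_append guarded2_Done)
  moreover have "it \<in> set (D \<pi>)" using cs(3,4) by simp
  then have "2 \<le> length it" using D by (simp add: doc_ok_def slots_def)
  moreover have "word D = (pre @ map (mk_cell \<pi>) cs) @ map (mk_cell \<pi>) (icells 0 it) @ mk_cell \<pi> (Items, b) # map (mk_cell \<pi>) ds @ [((\<pi>, Done), Sep)] @ post"
    using w(1) cs(1) ds by (simp add: part_def)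
  ultimately show ?thesis unfolding n wfn.simps using w(2) cs(2)
    by (intro exI[of _ \<pi>] exI[of _ "pre @ map (mk_cell \<pi>) cs"] exI[of _ b] exI[of _ "map (mk_cell \<pi>) ds @ [((\<pi>, Done), Sep)] @ post"]) simp
qed

lemma guarded_map: "guarded C B (map f xs) = guarded (\<lambda>x. C (f x)) (\<lambda>x. B (f x)) xs"
  by (induction xs) auto

lemma guarded_mono: "guarded C B xs \<Longrightarrow> (\<And>x. C' x \<Longrightarrow> C x) \<Longrightarrow> guarded C' B xs"
  by (induction xs) auto

lemma icells_append: "icells s (xs @ ys) = icells s xs @ icells (s + length xs) ys"
  by (induction xs arbitrary: s) auto

lemma icells_split:
  assumes "s < length it"
  shows "icells 0 it = icells 0 (take s it) @ scells s (it ! s) @ icells (Suc s) (drop (Suc s) it)"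
  by (subst id_take_nth_drop[OF assms]) (use assms in \<open>simp add: icells_append\<close>)

lemma wfn_atoms:
  assumes "wfn w n" "m \<in> atoms s n"
  shows "wfn w m"
proof -
  obtain p it where n: "n = INode p it" using assms(2) by (cases n) auto
  obtain \<pi> pre b rest where w: "w = pre @ map (mk_cell \<pi>) (icells 0 it) @ mk_cell \<pi> (Items, b) # rest"
    "length pre = p" "guarded2 rest" using assms(1) unfolding n by auto
  have s: "s < length it" using assms(2) unfolding n by (auto split: if_splits)
  then obtain q k A where m: "m = ANode q A"
    "(q, k, A) \<in> set (lnodes (\<lambda>A. length (enc_atom A)) (p + length (enc_item (take s it))) 0 (it ! s))"
    using assms(2) unfolding n by auto
  obtain cs j where cs: "scells s (it ! s) = cs @ acells s A @ lcells (Atoms s False) (Atoms s False) (acells s) (drop (Suc j) (it ! s))"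
    "q = p + length (enc_item (take s it)) + length cs"
    using lnodes_lcells[OF m(2), of "acells s" "Atoms s (s = 0)" "Atoms s False"] by (auto simp: length_acells scells_def)
  let ?ds = "lcells (Atoms s False) (Atoms s False) (acells s) (drop (Suc j) (it ! s))"
  let ?rest = "map (mk_cell \<pi>) ?ds @ map (mk_cell \<pi>) (icells (Suc s) (drop (Suc s) it)) @ mk_cell \<pi> (Items, b) # rest"
  have "guarded termS atomS (map fst ?ds)"
    by (rule guarded_lcells) (simp_all add: guarded_acells, simp_all add: S_defs)
  moreover have "guarded termS atomS (map st_of (mk_cell \<pi> (Items, b) # rest))"
    using w(3) by (simp add: guarded2_def) (simp add: S_defs)
  ultimately have "guarded termS atomS (map st_of ?rest)"
    unfolding map_append map_mk_cell by (intro guarded_append guarded_icells)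
  moreover have "w = (pre @ map (mk_cell \<pi>) (icells 0 (take s it)) @ map (mk_cell \<pi>) cs) @ map (mk_cell \<pi>) (acells s A) @ ?rest"
    using w(1) icells_split[OF s] cs(1) by simp
  moreover have "length (pre @ map (mk_cell \<pi>) (icells 0 (take s it)) @ map (mk_cell \<pi>) cs) = q"
    using w(2) cs(2) by (simp add: length_icells)
  ultimately show ?thesis unfolding m(1) wfn.simps by blast
qed

lemma acells_hd: "\<exists>b cs. acells s A = (RelM s 0, b) # cs"
  unfolding acells_def using ncells_Cons[of "RelM s" "RelB s" 0 "bin (rel A)"] by auto

lemma wfn_npos:
  assumes "wfn w n"
  shows "npos n < length w"
    "itemS (st_of (w ! npos n)) \<longleftrightarrow> (\<exists>p it. n = INode p it)"
    "atomS (st_of (w ! npos n)) \<longleftrightarrow> (\<exists>p A. n = ANode p A)"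
    "termS (st_of (w ! npos n)) \<longleftrightarrow> (\<exists>p k t. n = TNode p k t)"
proof -
  obtain pre c rest where *: "w = pre @ c # rest" "length pre = npos n"
    "st_of c = (case n of INode _ _ \<Rightarrow> Atoms 0 True | ANode _ _ \<Rightarrow> RelM (case st_of c of RelM s _ \<Rightarrow> s) 0
       | TNode _ _ _ \<Rightarrow> Kind (case st_of c of Kind s \<Rightarrow> s))"
  proof (cases n)
    case (INode p it)
    then obtain \<pi> pre b rest where w: "w = pre @ map (mk_cell \<pi>) (icells 0 it) @ mk_cell \<pi> (Items, b) # rest"
      "length pre = p" "2 \<le> length it" using assms by auto
    then obtain b' cs where "icells 0 it = (Atoms 0 True, b') # cs" using hd_icells[of it 0] by fastforce
    then show thesis using w INode by (intro that[of pre "mk_cell \<pi> (Atoms 0 True, b')"]) auto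
  next
    case (ANode p A)
    then obtain \<pi> s pre rest where w: "w = pre @ map (mk_cell \<pi>) (acells s A) @ rest" "length pre = p"
      using assms by auto
    obtain b' cs where "acells s A = (RelM s 0, b') # cs" using acells_hd by blast
    then show thesis using w ANode by (intro that[of pre "mk_cell \<pi> (RelM s 0, b')"]) auto
  next
    case (TNode p k t)
    then obtain \<pi> s pre c mid rest where w: "w = pre @ c # mid @ map (mk_cell \<pi>) (tcells s t) @ rest"
      "p = Suc (length pre + length mid)" using assms by auto
    then show thesis using TNode
      by (intro that[of "pre @ c # mid" "mk_cell \<pi> (Kind s, is_var t)"]) (auto simp: tcells_def)
  qed
  then have nth: "w ! npos n = c" by (metis nth_append_length)
  show "npos n < length w" using * by simp
  show "itemS (st_of (w ! npos n)) \<longleftrightarrow> (\<exists>p it. n = INode p it)"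
    "atomS (st_of (w ! npos n)) \<longleftrightarrow> (\<exists>p A. n = ANode p A)"
    "termS (st_of (w ! npos n)) \<longleftrightarrow> (\<exists>p k t. n = TNode p k t)"
    unfolding nth by (subst *(3), cases n; simp add: S_defs)+
qed

lemma positions_atoms:
  assumes "wfn w n"
  shows "{p. p < length w \<and> child (\<lambda>c. itemS (st_of c)) (\<lambda>c. st_of c = RelM s 0) w (npos n) p} = npos ` atoms s n"
proof (cases n)
  case (INode p it)
  then obtain \<pi> pre b rest where w: "w = pre @ map (mk_cell \<pi>) (icells 0 it) @ mk_cell \<pi> (Items, b) # rest"
    "length pre = p" "2 \<le> length it" "guarded2 rest" using assms by auto
  then have ne: "it \<noteq> []" by auto
  have "{q. q < length w \<and> child (\<lambda>c. itemS (st_of c)) (\<lambda>c. st_of c = RelM s 0) w p q} =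
      poss (\<lambda>c. st_of c = RelM s 0) p (map (mk_cell \<pi>) (icells 0 it))"
  proof (rule child_blk[OF w(1,2)])
    show "poss (\<lambda>c. itemS (st_of c)) p (map (mk_cell \<pi>) (icells 0 it)) = {p}"
      using poss_icells_item[OF ne, of p] unfolding poss_map by simp
    have "guarded atomS itemS (map st_of (mk_cell \<pi> (Items, b) # rest))"
      using w(4) by (simp add: guarded2_def) (simp add: S_defs)
    then show "guarded (\<lambda>c. st_of c = RelM s 0) (\<lambda>c. itemS (st_of c)) (mk_cell \<pi> (Items, b) # rest)"
      unfolding guarded_map by (rule guarded_mono) (simp add: S_defs)
  qed (simp add: S_defs)
  also have "\<dots> = npos ` atoms s n"
    unfolding INode npos_atoms poss_map mk_cell_simps
    using poss_icells_atom[of s p 0 it] unfolding poss_map by simp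
  finally show ?thesis using INode by simp
qed (use wfn_npos(2)[OF assms] in \<open>auto simp: child_def\<close>)

lemma filter_ncells: "\<not> P B \<Longrightarrow> (\<And>c. \<not> P (M c)) \<Longrightarrow> filter P (map fst (ncells M B c bs)) = []"
  by (induction bs arbitrary: c) auto

lemma filter_tcells_term: "filter termS (map fst (tcells s t)) = [Kind s]"
  unfolding tcells_def by (simp add: S_defs filter_ncells)

lemma filter_tcells_atom: "filter atomS (map fst (tcells s t)) = []"
  unfolding tcells_def by (simp add: S_defs filter_ncells)

lemma ncells_tl: "\<exists>b cs. ncells M B 0 bs = (M 0, b) # cs \<and> (\<forall>P. \<not> P B \<and> \<not> P (M 1) \<and> \<not> P (M 2) \<longrightarrow> filter P (map fst cs) = [])"
proof -
  obtain b cs where *: "ncells M B 0 bs = (M 0, b) # cs" "\<forall>x \<in> set cs. fst x = B \<or> fst x = M 1 \<or> fst x = M 2"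
    using ncells_Cons by blast
  then have "filter P (map fst cs) = []" if "\<not> P B \<and> \<not> P (M 1) \<and> \<not> P (M 2)" for P
    using that by (fastforce simp: filter_empty_conv)
  then show ?thesis using *(1) by blast
qed

lemma wfn_terms:
  assumes "wfn w n" "m \<in> terms n"
  shows "wfn w m"
proof -
  obtain p A where n: "n = ANode p A" using assms(2) by (cases n) auto
  obtain \<pi> s pre rest where w: "w = pre @ map (mk_cell \<pi>) (acells s A) @ rest" "length pre = p"
    using assms(1) unfolding n by auto
  obtain q k t where m: "m = TNode q k t"
    "(q, k, t) \<in> set (lnodes (\<lambda>t. length (enc_trm t)) (p + length (enc_nat (rel A))) 0 (args A))"
    using assms(2) unfolding n by auto
  have "\<exists>cs j. lcells (Args s) (Args s) (tcells s) (args A) = cs @ tcells s t @ lcells (Args s) (Args s) (tcells s) (drop (Suc j) (args A)) \<and>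
    q = p + length (enc_nat (rel A)) + length cs \<and> k = 0 + j \<and> j < length (args A) \<and> t = args A ! j \<and>
    (\<forall>P. \<not> P (Args s) \<and> \<not> P (Args s) \<longrightarrow> filter P (map fst cs) = concat (map (\<lambda>x. filter P (map fst (tcells s x))) (take j (args A))))"
    by (rule lnodes_lcells[OF m(2)]) (simp add: length_tcells)
  then obtain cs where cs: "lcells (Args s) (Args s) (tcells s) (args A) = cs @ tcells s t @ lcells (Args s) (Args s) (tcells s) (drop (Suc k) (args A))"
    "q = p + length (enc_nat (rel A)) + length cs" "k < length (args A)"
    "\<And>P. \<not> P (Args s) \<Longrightarrow> filter P (map fst cs) = concat (map (\<lambda>x. filter P (map fst (tcells s x))) (take k (args A)))"
    by auto
  obtain b ns where ns: "ncells (RelM s) (RelB s) 0 (bin (rel A)) = (RelM s 0, b) # ns"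
    "\<And>P. \<not> P (RelB s) \<and> \<not> P (RelM s 1) \<and> \<not> P (RelM s 2) \<Longrightarrow> filter P (map fst ns) = []"
    using ncells_tl[of "RelM s" "RelB s" "bin (rel A)"] by blast
  let ?mid = "map (mk_cell \<pi>) (ns @ cs)"
  let ?rest = "map (mk_cell \<pi>) (lcells (Args s) (Args s) (tcells s) (drop (Suc k) (args A))) @ rest"
  have "w = pre @ mk_cell \<pi> (RelM s 0, b) # ?mid @ map (mk_cell \<pi>) (tcells s t) @ ?rest"
    using w(1) by (simp add: acells_def ns(1) cs(1))
  moreover have "q = Suc (length pre + length ?mid)"
    using cs(2) w(2) ns(1) length_ncells[of "RelM s" "RelB s" "rel A"] by simp
  moreover have "atomS (st_of (mk_cell \<pi> (RelM s 0, b)))" by (simp add: S_defs)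
  moreover have "filter atomS (map st_of ?mid) = []"
    unfolding map_mk_cell map_append filter_append using ns(2)[of atomS] cs(4)[of atomS]
    by (simp add: filter_tcells_atom) (simp add: S_defs)
  moreover have "length (filter termS (map st_of ?mid)) = k"
  proof -
    have "filter termS (map fst ns) = []" by (rule ns(2)) (simp add: S_defs)
    moreover have "filter termS (map fst cs) = concat (map (\<lambda>x. [Kind s]) (take k (args A)))"
      using cs(4)[of termS] by (simp add: filter_tcells_term) (simp add: S_defs)
    ultimately show ?thesis unfolding map_mk_cell map_append filter_append
      using cs(3) by (simp only:) simp
  qed
  ultimately show ?thesis unfolding m(1) wfn.simps by blast
qed

lemma positions_terms:
  assumes "wfn w n"
  shows "{p. p < length w \<and> child (\<lambda>c. atomS (st_of c)) (\<lambda>c. termS (st_of c)) w (npos n) p} = npos ` terms n"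
proof (cases n)
  case (ANode p A)
  then obtain \<pi> s pre rest where w: "w = pre @ map (mk_cell \<pi>) (acells s A) @ rest"
    "length pre = p" "guarded termS atomS (map st_of rest)" using assms by auto
  have "{q. q < length w \<and> child (\<lambda>c. atomS (st_of c)) (\<lambda>c. termS (st_of c)) w p q} =
      poss (\<lambda>c. termS (st_of c)) p (map (mk_cell \<pi>) (acells s A))"
  proof (rule child_blk[OF w(1,2)])
    show "poss (\<lambda>c. atomS (st_of c)) p (map (mk_cell \<pi>) (acells s A)) = {p}"
      using poss_acells_atom[of atomS s p A] unfolding poss_map by simp
    show "guarded (\<lambda>c. termS (st_of c)) (\<lambda>c. atomS (st_of c)) rest"
      using w(3) unfolding guarded_map .
  qed (auto simp: S_defs)
  also have "\<dots> = npos ` terms n"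
    unfolding ANode npos_terms poss_map mk_cell_simps
    using poss_acells_term[of p s A] unfolding poss_map by simp
  finally show ?thesis using ANode by simp
qed (use wfn_npos(3)[OF assms] in \<open>auto simp: child_def\<close>)

section \<open>Predicates definable on documents\<close>

text \<open>Variables from \<open>n\<close> on denote position 0, a legal value because the word of
  a document is never empty.\<close>

definition penv :: "nat \<Rightarrow> (nat \<Rightarrow> node) \<Rightarrow> nat \<Rightarrow> nat" where
  "penv n e v = (if v < n then npos (e v) else 0)"

definition ddef :: "nat \<Rightarrow> ((nat \<Rightarrow> item list) \<Rightarrow> (nat \<Rightarrow> node) \<Rightarrow> bool) \<Rightarrow> bool" where
  "ddef n P \<longleftrightarrow> (\<exists>\<phi>. \<forall>D e. doc_ok D \<longrightarrow> (\<forall>v < n. wfn (word D) (e v)) \<longrightarrow> eval (word D) (penv n e) \<phi> = P D e)"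

lemma penv_less: "\<forall>v < n. wfn (word D) (e v) \<Longrightarrow> penv n e v < length (word D)"
  using wfn_npos(1)[of "word D" "e v"] by (simp add: penv_def) (simp add: word_def part_def)

lemma ddefI:
  assumes "dec P'" "\<And>D e. doc_ok D \<Longrightarrow> (\<forall>v < n. wfn (word D) (e v)) \<Longrightarrow> P' (word D) (penv n e) = P D e"
  shows "ddef n P"
proof -
  obtain \<phi> where "\<And>w e. (\<forall>v. e v < length w) \<Longrightarrow> eval w e \<phi> = P' w e" using assms(1) unfolding dec_def by blast
  then show ?thesis unfolding ddef_def using penv_less assms(2) by (intro exI[of _ \<phi>]) simp
qed

lemma ddef_neg: "ddef n P \<Longrightarrow> ddef n (\<lambda>D e. \<not> P D e)"
proof -
  assume "ddef n P"
  then obtain \<phi> where "\<And>D e. doc_ok D \<Longrightarrow> (\<forall>v < n. wfn (word D) (e v)) \<Longrightarrow> eval (word D) (penv n e) \<phi> = P D e"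
    unfolding ddef_def by blast
  then show ?thesis unfolding ddef_def by (intro exI[of _ "Neg \<phi>"]) simp
qed

lemma ddef_conj: "ddef n P \<Longrightarrow> ddef n Q \<Longrightarrow> ddef n (\<lambda>D e. P D e \<and> Q D e)"
proof -
  assume "ddef n P" "ddef n Q"
  then obtain \<phi> \<psi> where
    "\<forall>D e. doc_ok D \<longrightarrow> (\<forall>v < n. wfn (word D) (e v)) \<longrightarrow> eval (word D) (penv n e) \<phi> = P D e"
    "\<forall>D e. doc_ok D \<longrightarrow> (\<forall>v < n. wfn (word D) (e v)) \<longrightarrow> eval (word D) (penv n e) \<psi> = Q D e"
    unfolding ddef_def by (elim exE)
  then show ?thesis unfolding ddef_def by (intro exI[of _ "Conj \<phi> \<psi>"]) simp
qed

lemma ddef_disj: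
  assumes "ddef n P" "ddef n Q"
  shows "ddef n (\<lambda>D e. P D e \<or> Q D e)"
  using ddef_neg[OF ddef_conj[OF ddef_neg[OF assms(1)] ddef_neg[OF assms(2)]]] by simp

lemma ddef_imp:
  assumes "ddef n P" "ddef n Q"
  shows "ddef n (\<lambda>D e. P D e \<longrightarrow> Q D e)"
  using ddef_disj[OF ddef_neg[OF assms(1)] assms(2)] by simp

text \<open>A quantifier over nodes becomes a quantifier over positions, relativised by
  \<open>B\<close> to the positions of such nodes. This is faithful because the formula for the body
  sees a node only through its position.\<close>

lemma ddef_ex:
  assumes "dec (\<lambda>w e. B w (\<lambda>v. e (Suc v)) (e 0))"
    and B: "\<And>D e. doc_ok D \<Longrightarrow> (\<forall>v < n. wfn (word D) (e v)) \<Longrightarrow> {p. p < length (word D) \<and> B (word D) (penv n e) p} = npos ` N D e"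
    and N: "\<And>D e a. doc_ok D \<Longrightarrow> (\<forall>v < n. wfn (word D) (e v)) \<Longrightarrow> a \<in> N D e \<Longrightarrow> wfn (word D) a"
    and "ddef (Suc n) (\<lambda>D e. G D (\<lambda>v. e (Suc v)) (e 0))"
  shows "ddef n (\<lambda>D e. \<exists>a \<in> N D e. G D e a)"
proof -
  obtain \<beta> where \<beta>: "\<And>w e. (\<forall>v. e v < length w) \<Longrightarrow> eval w e \<beta> = B w (\<lambda>v. e (Suc v)) (e 0)"
    using assms(1) unfolding dec_def by blast
  obtain \<phi> where \<phi>: "\<And>D e. doc_ok D \<Longrightarrow> (\<forall>v < Suc n. wfn (word D) (e v)) \<Longrightarrow>
      eval (word D) (penv (Suc n) e) \<phi> = G D (\<lambda>v. e (Suc v)) (e 0)"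
    using assms(4) unfolding ddef_def by blast
  have "eval (word D) (penv n e) (Ex (Conj \<beta> \<phi>)) = (\<exists>a \<in> N D e. G D e a)"
    if D: "doc_ok D" and e: "\<forall>v < n. wfn (word D) (e v)" for D e
  proof -
    have 1: "eval (word D) (case_nat p (penv n e)) \<beta> = B (word D) (penv n e) p" if "p < length (word D)" for p
      by (subst \<beta>) (use that penv_less[OF e] in \<open>auto split: nat.split\<close>)
    have 2: "eval (word D) (case_nat (npos a) (penv n e)) \<phi> = G D e a" if "a \<in> N D e" for a
    proof -
      have "case_nat (npos a) (penv n e) = penv (Suc n) (case_nat a e)"
        by (intro ext) (simp add: penv_def split: nat.split)
      moreover have "\<forall>v < Suc n. wfn (word D) (case_nat a e v)"
        using N[OF D e that] e by (auto split: nat.split)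
      ultimately show ?thesis using \<phi>[OF D, of "case_nat a e"] by simp
    qed
    have "eval (word D) (penv n e) (Ex (Conj \<beta> \<phi>)) \<longleftrightarrow>
      (\<exists>p \<in> {p. p < length (word D) \<and> B (word D) (penv n e) p}. eval (word D) (case_nat p (penv n e)) \<phi>)"
      using 1 by auto
    also have "\<dots> \<longleftrightarrow> (\<exists>a \<in> N D e. G D e a)" unfolding B[OF D e] using 2 by auto
    finally show ?thesis .
  qed
  then show ?thesis unfolding ddef_def by blast
qed

lemma ddef_items:
  assumes "\<pi> \<le> 2" "ddef (Suc n) (\<lambda>D e. G D (\<lambda>v. e (Suc v)) (e 0))"
  shows "ddef n (\<lambda>D e. \<exists>a \<in> items \<pi> D. G D e a)"
proof (rule ddef_ex[where B = "\<lambda>w e p. fst (fst (w ! p)) = \<pi> \<and> itemS (st_of (w ! p))", OF dec_nth _ _ assms(2)])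
  fix D :: "nat \<Rightarrow> item list" assume D: "doc_ok D"
  show "{p. p < length (word D) \<and> fst (fst (word D ! p)) = \<pi> \<and> itemS (st_of (word D ! p))} = npos ` items \<pi> D"
    by (rule positions_items[OF D assms(1)])
  show "wfn (word D) a" if "a \<in> items \<pi> D" for a by (rule wfn_items[OF D assms(1) that])
qed

lemma ddef_atoms:
  assumes "i < n" "ddef (Suc n) (\<lambda>D e. G D (\<lambda>v. e (Suc v)) (e 0))"
  shows "ddef n (\<lambda>D e. \<exists>a \<in> atoms s (e i). G D e a)"
proof (rule ddef_ex[where B = "\<lambda>w e p. child (\<lambda>c. itemS (st_of c)) (\<lambda>c. st_of c = RelM s 0) w (e i) p", OF dec_child _ _ assms(2)])
  fix D e assume "\<forall>v < n. wfn (word D) (e v)"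
  then have w: "wfn (word D) (e i)" "penv n e i = npos (e i)" using assms(1) by (simp_all add: penv_def)
  show "{p. p < length (word D) \<and> child (\<lambda>c. itemS (st_of c)) (\<lambda>c. st_of c = RelM s 0) (word D) (penv n e i) p} = npos ` atoms s (e i)"
    unfolding w(2) by (rule positions_atoms[OF w(1)])
  show "wfn (word D) a" if "a \<in> atoms s (e i)" for a using wfn_atoms[OF w(1) that] .
qed

lemma ddef_terms:
  assumes "i < n" "ddef (Suc n) (\<lambda>D e. G D (\<lambda>v. e (Suc v)) (e 0))"
  shows "ddef n (\<lambda>D e. \<exists>a \<in> terms (e i). G D e a)"
proof (rule ddef_ex[where B = "\<lambda>w e p. child (\<lambda>c. atomS (st_of c)) (\<lambda>c. termS (st_of c)) w (e i) p", OF dec_child _ _ assms(2)])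
  fix D e assume "\<forall>v < n. wfn (word D) (e v)"
  then have w: "wfn (word D) (e i)" "penv n e i = npos (e i)" using assms(1) by (simp_all add: penv_def)
  show "{p. p < length (word D) \<and> child (\<lambda>c. atomS (st_of c)) (\<lambda>c. termS (st_of c)) (word D) (penv n e i) p} = npos ` terms (e i)"
    unfolding w(2) by (rule positions_terms[OF w(1)])
  show "wfn (word D) a" if "a \<in> terms (e i)" for a using wfn_terms[OF w(1) that] .
qed

section \<open>Comparisons of nodes by synchronised scans\<close>

fun node_name :: "node \<Rightarrow> nat option" where
  "node_name (ANode p A) = Some (rel A)"
| "node_name (TNode p k t) = Some (name t)"
| "node_name _ = None"

definition same_name :: "node \<Rightarrow> node \<Rightarrow> bool" where
  "same_name a b \<longleftrightarrow> node_name a \<noteq> None \<and> node_name a = node_name b"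

fun var_node :: "node \<Rightarrow> bool" where
  "var_node (TNode p k t) = is_var t"
| "var_node _ = False"

fun same_index :: "node \<Rightarrow> node \<Rightarrow> bool" where
  "same_index (TNode p k t) (TNode p' k' t') = (k = k')"
| "same_index _ _ = False"

fun same_arity :: "node \<Rightarrow> node \<Rightarrow> bool" where
  "same_arity (ANode p A) (ANode p' A') = (length (args A) = length (args A'))"
| "same_arity _ _ = False"

fun same_slot :: "nat \<Rightarrow> node \<Rightarrow> node \<Rightarrow> bool" where
  "same_slot s (INode p it) (INode p' it') = (it ! s = it' ! s)"
| "same_slot s _ _ = False"

definition before :: "node \<Rightarrow> node \<Rightarrow> bool" where
  "before a b \<longleftrightarrow> npos a < npos b"

lemma ddef_before: "i < n \<Longrightarrow> j < n \<Longrightarrow> ddef n (\<lambda>D e. before (e i) (e j))"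
  by (rule ddefI[OF dec_less[where i = i and j = j]]) (simp add: before_def penv_def)

definition is_one :: "cell \<Rightarrow> bool" where
  "is_one c \<longleftrightarrow> snd c = Bit True"

lemma is_one_mk_cell [simp]: "is_one (mk_cell \<pi> c) = snd c"
  by (simp add: is_one_def)

lemma is_one_comp [simp]: "is_one \<circ> mk_cell \<pi> = snd"
  by (rule ext) simp

lemma scan_True: "scan True w (int p) = drop p w"
  by (simp add: scan_def)

lemma ddef_var_node:
  assumes "i < n"
  shows "ddef n (\<lambda>D e. var_node (e i))"
proof (rule ddefI[OF dec_nth[of "\<lambda>c. termS (st_of c) \<and> is_one c" i]])
  fix D e assume "\<forall>v < n. wfn (word D) (e v)"
  then have w: "wfn (word D) (e i)" "penv n e i = npos (e i)" using assms by (simp_all add: penv_def)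
  show "(termS (st_of (word D ! penv n e i)) \<and> is_one (word D ! penv n e i)) = var_node (e i)"
  proof (cases "e i")
    case (TNode p k t)
    then obtain \<pi> s pre c mid rest where "word D = pre @ c # mid @ map (mk_cell \<pi>) (tcells s t) @ rest"
      "p = Suc (length pre + length mid)" using w(1) by auto
    then have "word D = (pre @ c # mid) @ mk_cell \<pi> (Kind s, is_var t) # tl (map (mk_cell \<pi>) (tcells s t)) @ rest"
      "p = length (pre @ c # mid)" by (auto simp: tcells_def)
    then have "word D ! p = mk_cell \<pi> (Kind s, is_var t)" by (metis nth_append_length)
    then show ?thesis using w(2) TNode by (simp add: S_defs)
  qed (use wfn_npos(4)[OF w(1)] w(2) in auto)
qed

definition name_end :: "cell \<Rightarrow> bool" where
  "name_end c \<longleftrightarrow> (\<exists>s i. st_of c = RelM s i \<or> st_of c = NamM s i) \<and> \<not> is_one c"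

lemma ncells_end:
  "\<exists>us c'. ncells M B c bs = us @ [(M c', False)] \<and> (\<forall>u \<in> set us. fst u = B \<or> snd u)"
proof (induction bs arbitrary: c)
  case (Cons b bs)
  obtain us c' where "ncells M B (if b then 1 else 2) bs = us @ [(M c', False)]" "\<forall>u \<in> set us. fst u = B \<or> snd u"
    using Cons.IH by blast
  then show ?case by (intro exI[of _ "(M c, True) # (B, b) # us"]) auto
qed (auto intro: exI[of _ "[]"])

lemma name_scan_aux:
  assumes "M = RelM s \<and> B = RelB s \<or> M = NamM s \<and> B = NamB s"
  shows "\<exists>us x. map (mk_cell \<pi>) (ncells M B 0 (bin n)) = us @ [x] \<and> (\<forall>u \<in> set us. \<not> name_end u) \<and> name_end x \<and>
    map is_one us @ [False] = enc_nat n \<and> filter (\<lambda>c. \<not> termS (st_of c)) us = us \<and> \<not> termS (st_of x)"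
proof -
  obtain us c where us: "ncells M B 0 (bin n) = us @ [(M c, False)]" "\<forall>u \<in> set us. fst u = B \<or> snd u"
    using ncells_end by blast
  have "filter termS (map fst (ncells M B 0 (bin n))) = []"
    by (rule filter_ncells) (use assms in \<open>auto simp: S_defs\<close>)
  then have nt: "\<forall>u \<in> set (us @ [(M c, False)]). \<not> termS (fst u)"
    unfolding us by (auto simp: filter_empty_conv)
  have "map snd (us @ [(M c, False)]) = enc_nat n"
    unfolding us(1)[symmetric] by (simp add: bits_ncells enc_nat_def)
  then show ?thesis unfolding us
    by (intro exI[of _ "map (mk_cell \<pi>) us"] exI[of _ "mk_cell \<pi> (M c, False)"])
      (use us(2) assms nt in \<open>auto simp: name_end_def filter_id_conv comp_def\<close>)
qed

text \<open>Dropping the \<open>Kind\<close> cells removes the tag in front of the digits of a term.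
  So relation names and names of terms can be compared bit by bit, also with each other, as the
  assignments require.\<close>

lemma name_scan:
  assumes "wfn w n" "node_name n = Some i"
  shows "\<exists>us x xs. filter (\<lambda>c. \<not> termS (st_of c)) (scan True w (int (npos n))) = us @ x # xs \<and>
    (\<forall>u \<in> set us. \<not> name_end u) \<and> name_end x \<and> map is_one us @ [False] = enc_nat i"
proof (cases n)
  case (ANode p A)
  then obtain \<pi> s pre rest where w: "w = pre @ map (mk_cell \<pi>) (acells s A) @ rest" "length pre = p"
    using assms(1) by auto
  obtain us x where us: "map (mk_cell \<pi>) (ncells (RelM s) (RelB s) 0 (bin i)) = us @ [x]"
    "\<forall>u \<in> set us. \<not> name_end u" "name_end x" "map is_one us @ [False] = enc_nat i"
    "filter (\<lambda>c. \<not> termS (st_of c)) us = us" "\<not> termS (st_of x)"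
    using name_scan_aux[of "RelM s" s "RelB s" \<pi> i] by blast
  let ?r = "map (mk_cell \<pi>) (lcells (Args s) (Args s) (tcells s) (args A)) @ rest"
  have "rel A = i" using assms(2) ANode by simp
  then have "scan True w (int (npos n)) = us @ x # ?r"
    using w ANode us(1) by (simp add: scan_def acells_def)
  then have "filter (\<lambda>c. \<not> termS (st_of c)) (scan True w (int (npos n))) = us @ x # filter (\<lambda>c. \<not> termS (st_of c)) ?r"
    using us(5,6) by simp
  then show ?thesis using us(2-4) by blast
next
  case (TNode p k t)
  then obtain \<pi> s pre c mid rest where w: "w = pre @ c # mid @ map (mk_cell \<pi>) (tcells s t) @ rest"
      "p = Suc (length pre + length mid)" using assms(1) by auto
  obtain us x where us: "map (mk_cell \<pi>) (ncells (NamM s) (NamB s) 0 (bin i)) = us @ [x]"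
    "\<forall>u \<in> set us. \<not> name_end u" "name_end x" "map is_one us @ [False] = enc_nat i"
    "filter (\<lambda>c. \<not> termS (st_of c)) us = us" "\<not> termS (st_of x)"
    using name_scan_aux[of "NamM s" s "NamB s" \<pi> i] by blast
  have "name t = i" using assms(2) TNode by simp
  then have "drop p w = mk_cell \<pi> (Kind s, is_var t) # us @ x # rest"
    using w us(1) by (simp add: tcells_def)
  then have "scan True w (int (npos n)) = mk_cell \<pi> (Kind s, is_var t) # us @ x # rest"
    using TNode by (simp add: scan_True)
  then have "filter (\<lambda>c. \<not> termS (st_of c)) (scan True w (int (npos n))) = us @ x # filter (\<lambda>c. \<not> termS (st_of c)) rest"
    using us(5,6) by (simp add: termS_def)
  then show ?thesis using us(2-4) by blast
qed (use assms in simp)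

lemma enc_nat_inject: "enc_nat m = enc_nat n \<longleftrightarrow> m = n"
  using prefix_code_iff[OF prefix_code_nat, of m "[]" n "[]"] by simp

definition has_name :: "cell \<Rightarrow> bool" where
  "has_name c \<longleftrightarrow> atomS (st_of c) \<or> termS (st_of c)"

lemma has_name_iff: "wfn w n \<Longrightarrow> has_name (w ! npos n) \<longleftrightarrow> node_name n \<noteq> None"
  unfolding has_name_def using wfn_npos(3,4)[of w n] by (cases n) auto

lemma ddef_same_name:
  assumes "i < n" "j < n"
  shows "ddef n (\<lambda>D e. same_name (e i) (e j))"
proof (rule ddefI[OF dec_conj[OF dec_conj[OF dec_nth[of has_name i] dec_nth[of has_name j]]
        dec_match[of True "\<lambda>c. \<not> termS (st_of c)" "\<lambda>c. \<not> termS (st_of c)" name_end is_one i j]]])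
  fix D e assume "\<forall>v < n. wfn (word D) (e v)"
  then have w: "wfn (word D) (e i)" "wfn (word D) (e j)" and p: "penv n e i = npos (e i)" "penv n e j = npos (e j)"
    using assms by (simp_all add: penv_def)
  show "((has_name (word D ! penv n e i) \<and> has_name (word D ! penv n e j)) \<and>
      match True (\<lambda>c. \<not> termS (st_of c)) (\<lambda>c. \<not> termS (st_of c)) name_end is_one (word D) (penv n e i) (penv n e j))
      = same_name (e i) (e j)"
  proof (cases "node_name (e i) = None \<or> node_name (e j) = None")
    case True
    then show ?thesis unfolding p has_name_iff[OF w(1)] has_name_iff[OF w(2)] same_name_def by auto
  next
    case False
    then obtain a b where ab: "node_name (e i) = Some a" "node_name (e j) = Some b" by auto
    obtain us x xs where us: "filter (\<lambda>c. \<not> termS (st_of c)) (scan True (word D) (int (npos (e i)))) = us @ x # xs"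
      "\<forall>u \<in> set us. \<not> name_end u" "name_end x" "map is_one us @ [False] = enc_nat a"
      using name_scan[OF w(1) ab(1)] by blast
    obtain vs y ys where vs: "filter (\<lambda>c. \<not> termS (st_of c)) (scan True (word D) (int (npos (e j)))) = vs @ y # ys"
      "\<forall>u \<in> set vs. \<not> name_end u" "name_end y" "map is_one vs @ [False] = enc_nat b"
      using name_scan[OF w(2) ab(2)] by blast
    have "match True (\<lambda>c. \<not> termS (st_of c)) (\<lambda>c. \<not> termS (st_of c)) name_end is_one (word D) (npos (e i)) (npos (e j))
      \<longleftrightarrow> map is_one us = map is_one vs"
      by (rule match_iff[OF us(1) vs(1) us(2) vs(2) us(3) vs(3)])
    also have "\<dots> \<longleftrightarrow> a = b" using us(4) vs(4) enc_nat_inject[of a b] by (metis append_same_eq)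
    finally show ?thesis
      unfolding p has_name_iff[OF w(1)] has_name_iff[OF w(2)] same_name_def ab by simp
  qed
qed

lemma index_scan:
  assumes "wfn w (TNode p k t)"
  shows "\<exists>us x xs. filter has_name (scan False w (int p)) = us @ x # xs \<and>
    (\<forall>u \<in> set us. \<not> atomS (st_of u)) \<and> atomS (st_of x) \<and> length us = Suc k"
proof -
  obtain \<pi> s pre c mid rest where w: "w = pre @ c # mid @ map (mk_cell \<pi>) (tcells s t) @ rest"
      "p = Suc (length pre + length mid)" "atomS (st_of c)" "filter atomS (map st_of mid) = []"
      "length (filter termS (map st_of mid)) = k" using assms by auto
  have m: "\<forall>u \<in> set mid. \<not> atomS (st_of u)" using w(4) by (auto simp: filter_empty_conv)
  \<comment> \<open>The leftward scan starts on the term itself, so \<open>Suc k\<close> cells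
    precede the start of the atom and not \<open>k\<close>.\<close>
  have "take (Suc p) w = pre @ c # mid @ [mk_cell \<pi> (Kind s, is_var t)]"
    using w(1,2) by (simp add: tcells_def)
  then have "scan False w (int p) = mk_cell \<pi> (Kind s, is_var t) # rev mid @ c # rev pre"
    by (simp add: scan_def nat_add_distrib)
  moreover have "has_name (mk_cell \<pi> (Kind s, is_var t))" by (simp add: has_name_def S_defs)
  moreover have "has_name c" using w(3) by (simp add: has_name_def)
  ultimately have "filter has_name (scan False w (int p)) =
      (mk_cell \<pi> (Kind s, is_var t) # rev (filter has_name mid)) @ c # filter has_name (rev pre)"
    by (simp add: rev_filter)
  moreover have "filter has_name mid = filter (\<lambda>c. termS (st_of c)) mid"
    using m by (intro filter_cong) (auto simp: has_name_def)
  moreover have "filter termS (map st_of mid) = map st_of (filter (\<lambda>c. termS (st_of c)) mid)"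
    by (induction mid) auto
  then have "length (filter (\<lambda>c. termS (st_of c)) mid) = k" using w(5) by simp
  ultimately show ?thesis using m w(3)
    by (intro exI[of _ "mk_cell \<pi> (Kind s, is_var t) # rev (filter has_name mid)"] exI[of _ c] exI conjI)
      (auto simp: S_defs)
qed

lemma map_const_eq: "map (\<lambda>_. a) xs = map (\<lambda>_. a) ys \<longleftrightarrow> length xs = length ys"
  by (metis length_map map_replicate_const)

text \<open>Indices are compared in unary: two leftward scans keep only the starts of terms and
  atoms, and they reach their atoms together exactly if the indices agree.\<close>

lemma ddef_same_index:
  assumes "i < n" "j < n"
  shows "ddef n (\<lambda>D e. same_index (e i) (e j))"
proof (rule ddefI[OF dec_conj[OF dec_conj[OF dec_nth[of "\<lambda>c. termS (st_of c)" i] dec_nth[of "\<lambda>c. termS (st_of c)" j]]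
        dec_match[of False has_name has_name "\<lambda>c. atomS (st_of c)" "\<lambda>_. True" i j]]])
  fix D e assume "\<forall>v < n. wfn (word D) (e v)"
  then have w: "wfn (word D) (e i)" "wfn (word D) (e j)" and p: "penv n e i = npos (e i)" "penv n e j = npos (e j)"
    using assms by (simp_all add: penv_def)
  show "((termS (st_of (word D ! penv n e i)) \<and> termS (st_of (word D ! penv n e j))) \<and>
      match False has_name has_name (\<lambda>c. atomS (st_of c)) (\<lambda>_. True) (word D) (penv n e i) (penv n e j))
      = same_index (e i) (e j)"
  proof (cases "\<exists>p k t p' k' t'. e i = TNode p k t \<and> e j = TNode p' k' t'")
    case False
    then show ?thesis unfolding p wfn_npos(4)[OF w(1)] wfn_npos(4)[OF w(2)]
      by (cases "e i"; cases "e j") auto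
  next
    case True
    then obtain q k t q' k' t' where ij: "e i = TNode q k t" "e j = TNode q' k' t'" by blast
    obtain us x xs where us: "filter has_name (scan False (word D) (int q)) = us @ x # xs"
      "\<forall>u \<in> set us. \<not> atomS (st_of u)" "atomS (st_of x)" "length us = Suc k"
      using index_scan[OF w(1)[unfolded ij]] by blast
    obtain vs y ys where vs: "filter has_name (scan False (word D) (int q')) = vs @ y # ys"
      "\<forall>u \<in> set vs. \<not> atomS (st_of u)" "atomS (st_of y)" "length vs = Suc k'"
      using index_scan[OF w(2)[unfolded ij]] by blast
    have "match False has_name has_name (\<lambda>c. atomS (st_of c)) (\<lambda>_. True) (word D) q q' \<longleftrightarrow>
        map (\<lambda>_. True) us = map (\<lambda>_. True) vs"
      by (rule match_iff[OF us(1) vs(1) us(2) vs(2) us(3) vs(3)])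
    also have "\<dots> \<longleftrightarrow> k = k'" using us(4) vs(4) by (simp only: map_const_eq) simp
    finally show ?thesis
      unfolding p wfn_npos(4)[OF w(1)] wfn_npos(4)[OF w(2)] using ij by simp
  qed
qed

definition args_end :: "cell \<Rightarrow> bool" where
  "args_end c \<longleftrightarrow> (\<exists>s. st_of c = Args s) \<and> \<not> is_one c"

lemma filter_args:
  "filter (\<lambda>c. termS (st_of c) \<or> args_end c) (map (mk_cell \<pi>) (lcells (Args s) (Args s) (tcells s) ts)) =
    map (\<lambda>t. mk_cell \<pi> (Kind s, is_var t)) ts @ [mk_cell \<pi> (Args s, False)]"
proof (induction ts)
  case (Cons t ts)
  have "filter termS (map fst (ncells (NamM s) (NamB s) 0 (bin (name t)))) = []"
    "filter (\<lambda>q. q = Args s) (map fst (ncells (NamM s) (NamB s) 0 (bin (name t)))) = []"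
    by (rule filter_ncells; simp add: S_defs)+
  moreover have "\<forall>x \<in> set (ncells (NamM s) (NamB s) 0 (bin (name t))). \<forall>s'. fst x \<noteq> Args s'"
    using ncells_Cons[of "NamM s" "NamB s" 0 "bin (name t)"] by fastforce
  ultimately have "filter (\<lambda>c. termS (st_of c) \<or> args_end c) (map (mk_cell \<pi>) (ncells (NamM s) (NamB s) 0 (bin (name t)))) = []"
    by (auto simp: filter_empty_conv args_end_def)
  then show ?case using Cons by (simp add: tcells_def) (simp add: args_end_def S_defs)
qed (simp add: args_end_def)

lemma arity_scan:
  assumes "wfn w (ANode p A)"
  shows "\<exists>us x xs. filter (\<lambda>c. termS (st_of c) \<or> args_end c) (scan True w (int p)) = us @ x # xs \<and>
    (\<forall>u \<in> set us. \<not> args_end u) \<and> args_end x \<and> length us = length (args A)"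
proof -
  obtain \<pi> s pre rest where w: "w = pre @ map (mk_cell \<pi>) (acells s A) @ rest" "length pre = p"
    using assms by auto
  let ?P = "\<lambda>c. termS (st_of c) \<or> args_end c"
  have "\<forall>x \<in> set (ncells (RelM s) (RelB s) 0 (bin (rel A))). \<forall>s'. fst x \<noteq> Args s' \<and> fst x \<noteq> Kind s'"
    using ncells_Cons[of "RelM s" "RelB s" 0 "bin (rel A)"] by fastforce
  then have "filter ?P (map (mk_cell \<pi>) (ncells (RelM s) (RelB s) 0 (bin (rel A)))) = []"
    by (auto simp: filter_empty_conv args_end_def S_defs)
  then have "filter ?P (scan True w (int p)) = map (\<lambda>t. mk_cell \<pi> (Kind s, is_var t)) (args A) @ mk_cell \<pi> (Args s, False) # filter ?P rest"
    using w by (simp only: scan_def acells_def map_append filter_append filter_args if_True nat_int) (simp add: filter_args)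
  then show ?thesis
    by (intro exI[of _ "map (\<lambda>t. mk_cell \<pi> (Kind s, is_var t)) (args A)"] exI[of _ "mk_cell \<pi> (Args s, False)"] exI conjI)
      (assumption, auto simp: args_end_def)
qed

text \<open>Both scans keep one cell per argument and must reach the ends of their argument lists
  together.\<close>

lemma ddef_same_arity:
  assumes "i < n" "j < n"
  shows "ddef n (\<lambda>D e. same_arity (e i) (e j))"
proof (rule ddefI[OF dec_conj[OF dec_conj[OF dec_nth[of "\<lambda>c. atomS (st_of c)" i] dec_nth[of "\<lambda>c. atomS (st_of c)" j]]
        dec_match[of True "\<lambda>c. termS (st_of c) \<or> args_end c" "\<lambda>c. termS (st_of c) \<or> args_end c" args_end "\<lambda>_. True" i j]]])
  let ?P = "\<lambda>c. termS (st_of c) \<or> args_end c"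
  fix D e assume "\<forall>v < n. wfn (word D) (e v)"
  then have w: "wfn (word D) (e i)" "wfn (word D) (e j)" and p: "penv n e i = npos (e i)" "penv n e j = npos (e j)"
    using assms by (simp_all add: penv_def)
  show "((atomS (st_of (word D ! penv n e i)) \<and> atomS (st_of (word D ! penv n e j))) \<and>
      match True ?P ?P args_end (\<lambda>_. True) (word D) (penv n e i) (penv n e j))
      = same_arity (e i) (e j)"
  proof (cases "\<exists>p A p' A'. e i = ANode p A \<and> e j = ANode p' A'")
    case False
    then show ?thesis unfolding p wfn_npos(3)[OF w(1)] wfn_npos(3)[OF w(2)]
      by (cases "e i"; cases "e j") auto
  next
    case True
    then obtain q A q' A' where ij: "e i = ANode q A" "e j = ANode q' A'" by blast
    obtain us x xs where us: "filter ?P (scan True (word D) (int q)) = us @ x # xs"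
      "\<forall>u \<in> set us. \<not> args_end u" "args_end x" "length us = length (args A)"
      using arity_scan[OF w(1)[unfolded ij]] by blast
    obtain vs y ys where vs: "filter ?P (scan True (word D) (int q')) = vs @ y # ys"
      "\<forall>u \<in> set vs. \<not> args_end u" "args_end y" "length vs = length (args A')"
      using arity_scan[OF w(2)[unfolded ij]] by blast
    have "match True ?P ?P args_end (\<lambda>_. True) (word D) q q' \<longleftrightarrow> map (\<lambda>_. True) us = map (\<lambda>_. True) vs"
      by (rule match_iff[OF us(1) vs(1) us(2) vs(2) us(3) vs(3)])
    also have "\<dots> \<longleftrightarrow> length (args A) = length (args A')" using us(4) vs(4) by (simp only: map_const_eq)
    finally show ?thesis
      unfolding p wfn_npos(3)[OF w(1)] wfn_npos(3)[OF w(2)] using ij by simp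
  qed
qed

fun slot_of :: "st \<Rightarrow> nat option" where
  "slot_of (Atoms s f) = Some s"
| "slot_of (RelM s c) = Some s"
| "slot_of (RelB s) = Some s"
| "slot_of (Args s) = Some s"
| "slot_of (Kind s) = Some s"
| "slot_of (NamM s c) = Some s"
| "slot_of (NamB s) = Some s"
| "slot_of q = None"

text \<open>The \<open>Items\<close> cell after an item is kept as the terminator of the
  comparison.\<close>

definition in_slot :: "nat \<Rightarrow> cell \<Rightarrow> bool" where
  "in_slot s c \<longleftrightarrow> st_of c = Items \<or> slot_of (st_of c) = Some s"

lemma slot_ncells:
  assumes "\<And>c. slot_of (M c) = Some s" "slot_of B = Some s" "x \<in> set (ncells M B c bs)"
  shows "slot_of (fst x) = Some s"
  using assms(3) by (induction bs arbitrary: c) (auto simp: assms(1,2))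

lemma slot_scells: "x \<in> set (scells s As) \<Longrightarrow> slot_of (fst x) = Some s"
proof -
  have t: "slot_of (fst x) = Some s" if "x \<in> set (tcells s t)" for x t
    using that slot_ncells[of "NamM s" s "NamB s" x 0 "bin (name t)"] by (auto simp: tcells_def)
  have a: "slot_of (fst x) = Some s" if x: "x \<in> set (acells s A)" for x A
  proof -
    consider "x \<in> set (ncells (RelM s) (RelB s) 0 (bin (rel A)))" | "x \<in> set (lcells (Args s) (Args s) (tcells s) (args A))"
      using x by (auto simp: acells_def)
    then show ?thesis
    proof cases
      case 1
      then show ?thesis by (rule slot_ncells[rotated 2]) simp_all
    next
      case 2
      then show ?thesis using set_lcells[OF 2] t[of x] by auto
    qed
  qed
  show "slot_of (fst x) = Some s" if "x \<in> set (scells s As)"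
    using set_lcells[OF that[unfolded scells_def]] a[of x] by auto
qed

lemma filter_icells:
  "filter (in_slot s) (map (mk_cell \<pi>) (icells r it)) =
    (if r \<le> s \<and> s < r + length it then map (mk_cell \<pi>) (scells s (it ! (s - r))) else [])"
proof (induction it arbitrary: r)
  case (Cons As it)
  have *: "filter (in_slot s) (map (mk_cell \<pi>) (scells r As)) = (if r = s then map (mk_cell \<pi>) (scells r As) else [])"
  proof -
    have "in_slot s c \<longleftrightarrow> r = s" if c: "c \<in> set (map (mk_cell \<pi>) (scells r As))" for c
    proof -
      obtain x where "x \<in> set (scells r As)" "c = mk_cell \<pi> x" using c by auto
      then have "slot_of (st_of c) = Some r" using slot_scells[of x r As] by simp
      then show ?thesis by (auto simp: in_slot_def)
    qed
    note slot = this
    show ?thesis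
    proof (cases "r = s")
      case True
      show ?thesis unfolding if_P[OF True] by (rule filter_True) (use slot True in blast)
    next
      case False
      show ?thesis unfolding if_not_P[OF False] by (rule filter_False) (use slot False in blast)
    qed
  qed
  have "Suc r \<le> s \<Longrightarrow> s - r = Suc (s - Suc r)" by simp
  then show ?case unfolding icells.simps map_append filter_append * Cons.IH
    by (cases "Suc r \<le> s"; cases "r = s") simp_all
qed auto

lemma slot_scan:
  assumes "wfn w (INode p it)" "s < 2"
  shows "\<exists>us x xs. filter (in_slot s) (scan True w (int p)) = us @ x # xs \<and>
    (\<forall>u \<in> set us. st_of u \<noteq> Items) \<and> st_of x = Items \<and> map is_one us = enc_list enc_atom (it ! s)"
proof -
  obtain \<pi> pre b rest where w: "w = pre @ map (mk_cell \<pi>) (icells 0 it) @ mk_cell \<pi> (Items, b) # rest"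
    "length pre = p" "2 \<le> length it" using assms(1) by auto
  have "in_slot s (mk_cell \<pi> (Items, b))" by (simp add: in_slot_def)
  then have "filter (in_slot s) (scan True w (int p)) =
      map (mk_cell \<pi>) (scells s (it ! s)) @ mk_cell \<pi> (Items, b) # filter (in_slot s) rest"
    using w assms(2) by (simp add: scan_def filter_icells)
  moreover have "\<forall>u \<in> set (map (mk_cell \<pi>) (scells s (it ! s))). st_of u \<noteq> Items"
  proof
    fix u assume "u \<in> set (map (mk_cell \<pi>) (scells s (it ! s)))"
    then obtain x where "x \<in> set (scells s (it ! s))" "u = mk_cell \<pi> x" by auto
    then show "st_of u \<noteq> Items" using slot_scells[of x s "it ! s"] by auto
  qed
  moreover have "map is_one (map (mk_cell \<pi>) (scells s (it ! s))) = enc_list enc_atom (it ! s)"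
    using bits_scells[of s "it ! s"] by (simp add: comp_def)
  ultimately show ?thesis by (metis mk_cell_simps(1) fst_conv)
qed

lemma enc_atoms_inject: "enc_list enc_atom As = enc_list enc_atom Bs \<longleftrightarrow> As = Bs"
  using prefix_code_iff[OF prefix_code_list[OF prefix_code_atom], of As "[]" Bs "[]"] by simp

lemma ddef_same_slot:
  assumes "i < n" "j < n" "s < 2"
  shows "ddef n (\<lambda>D e. same_slot s (e i) (e j))"
proof (rule ddefI[OF dec_conj[OF dec_conj[OF dec_nth[of "\<lambda>c. itemS (st_of c)" i] dec_nth[of "\<lambda>c. itemS (st_of c)" j]]
        dec_match[of True "in_slot s" "in_slot s" "\<lambda>c. st_of c = Items" is_one i j]]])
  fix D e assume "\<forall>v < n. wfn (word D) (e v)"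
  then have w: "wfn (word D) (e i)" "wfn (word D) (e j)" and p: "penv n e i = npos (e i)" "penv n e j = npos (e j)"
    using assms by (simp_all add: penv_def)
  show "((itemS (st_of (word D ! penv n e i)) \<and> itemS (st_of (word D ! penv n e j))) \<and>
      match True (in_slot s) (in_slot s) (\<lambda>c. st_of c = Items) is_one (word D) (penv n e i) (penv n e j))
      = same_slot s (e i) (e j)"
  proof (cases "\<exists>p A p' A'. e i = INode p A \<and> e j = INode p' A'")
    case False
    then show ?thesis unfolding p wfn_npos(2)[OF w(1)] wfn_npos(2)[OF w(2)]
      by (cases "e i"; cases "e j") auto
  next
    case True
    then obtain q A q' A' where ij: "e i = INode q A" "e j = INode q' A'" by blast
    obtain us x xs where us: "filter (in_slot s) (scan True (word D) (int q)) = us @ x # xs"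
      "\<forall>u \<in> set us. st_of u \<noteq> Items" "st_of x = Items" "map is_one us = enc_list enc_atom (A ! s)"
      using slot_scan[OF w(1)[unfolded ij] assms(3)] by blast
    obtain vs y ys where vs: "filter (in_slot s) (scan True (word D) (int q')) = vs @ y # ys"
      "\<forall>u \<in> set vs. st_of u \<noteq> Items" "st_of y = Items" "map is_one vs = enc_list enc_atom (A' ! s)"
      using slot_scan[OF w(2)[unfolded ij] assms(3)] by blast
    have "match True (in_slot s) (in_slot s) (\<lambda>c. st_of c = Items) is_one (word D) q q' \<longleftrightarrow> map is_one us = map is_one vs"
      by (rule match_iff[OF us(1) vs(1) us(2) vs(2) us(3) vs(3)])
    also have "\<dots> \<longleftrightarrow> A ! s = A' ! s" unfolding us(4) vs(4) by (rule enc_atoms_inject)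
    finally show ?thesis
      unfolding p wfn_npos(2)[OF w(1)] wfn_npos(2)[OF w(2)] using ij by simp
  qed
qed

section \<open>Verifying documents in polynomial time\<close>

definition encodes :: "nat \<Rightarrow> bool list \<Rightarrow> item list \<Rightarrow> bool" where
  "encodes \<pi> bs its \<longleftrightarrow> (\<forall>it \<in> set its. length it = slots \<pi>) \<and> bs = enc_items its"

definition doc :: "item list \<Rightarrow> item list \<Rightarrow> item list \<Rightarrow> nat \<Rightarrow> item list" where
  "doc X U V \<pi> = (if \<pi> = 0 then X else if \<pi> = 1 then U else if \<pi> = 2 then V else [])"

text \<open>The slots of an item are concatenated without a mark for their number; decoding is
  unique once the numbers of slots agree.\<close>

lemma enc_item_inject:
  "length a = length b \<Longrightarrow> enc_item a @ u = enc_item b @ v \<Longrightarrow> a = b \<and> u = v"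
proof (induction a b rule: list_induct2)
  case (Cons x xs y ys)
  then show ?case
    using prefix_code_iff[OF prefix_code_list[OF prefix_code_atom], of x "enc_item xs @ u" y "enc_item ys @ v"]
    by (simp add: enc_item_def)
qed (simp add: enc_item_def)

lemma encodes_unique:
  assumes "encodes \<pi> bs X" "encodes \<pi> bs Y"
  shows "X = Y"
proof -
  have "\<forall>it \<in> set X \<union> set Y. length it = slots \<pi> \<Longrightarrow> enc_items X = enc_items Y \<Longrightarrow> X = Y"
  proof (induction X arbitrary: Y)
    case Nil
    then show ?case by (cases Y) (simp_all add: enc_items_def)
  next
    case (Cons x X)
    show ?case
    proof (cases Y)
      case Nil
      then show ?thesis using Cons.prems by (simp add: enc_items_def)
    next
      case (Cons y Y')
      have e: "enc_item x @ enc_items X = enc_item y @ enc_items Y'" and l: "length x = length y"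
        using Cons.prems Cons by (simp_all add: enc_items_def)
      from enc_item_inject[OF l e] have "x = y" "enc_items X = enc_items Y'" by simp_all
      moreover have "X = Y'" by (rule Cons.IH) (use Cons.prems(1) Cons calculation in simp_all)
      ultimately show ?thesis using Cons by simp
    qed
  qed
  moreover have "\<forall>it \<in> set X \<union> set Y. length it = slots \<pi>" "enc_items X = enc_items Y"
    using assms unfolding encodes_def by blast+
  ultimately show ?thesis by blast
qed

lemma encodes_iff: "(\<exists>its. encodes \<pi> bs its) \<longleftrightarrow> foldl (step (slots \<pi>)) Items bs = Done"
proof -
  have "0 < slots \<pi>" by (simp add: slots_def)
  then show ?thesis using parse_items accepts_items unfolding encodes_def by metis
qed

lemma tagged_Done:
  assumes "\<pi> \<le> 2"
  shows "(\<exists>i < length (tagged x u v). tagged x u v ! i = ((\<pi>, Done), Sep)) \<longleftrightarrow>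
    foldl (step (slots \<pi>)) Items (if \<pi> = 0 then x else if \<pi> = 1 then u else v) = Done"
proof -
  have "(\<exists>i < length (tagged x u v). tagged x u v ! i = ((\<pi>, Done), Sep)) \<longleftrightarrow> ((\<pi>, Done), Sep) \<in> set (tagged x u v)"
    by (auto simp: in_set_conv_nth)
  also have "\<dots> \<longleftrightarrow> foldl (step (slots \<pi>)) Items (if \<pi> = 0 then x else if \<pi> = 1 then u else v) = Done"
  proof -
    consider "\<pi> = 0" | "\<pi> = 1" | "\<pi> = 2" using assms by linarith
    then show ?thesis by cases (auto simp: tagged_eq mk_cell_def)
  qed
  finally show ?thesis .
qed

text \<open>A malformed input is rejected, a malformed first certificate counts as answered by any
  word, and otherwise the second certificate must be well-formed and satisfy \<open>F\<close>.
  Well-formedness is visible in the annotation and decoding is unique, so no search for the lists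
  takes place.\<close>

theorem ptime_doc:
  assumes "ddef 0 (\<lambda>D e. F (D 0) (D 1) (D 2))"
  shows "ptime_rel (\<lambda>x u v. (\<exists>X. encodes 0 x X) \<and> ((\<exists>U. encodes 1 u U) \<longrightarrow>
    (\<exists>X U V. encodes 0 x X \<and> encodes 1 u U \<and> encodes 2 v V \<and> F X U V)))"
proof -
  obtain \<phi> where \<phi>: "\<And>D e. doc_ok D \<Longrightarrow> eval (word D) (penv 0 e) \<phi> = F (D 0) (D 1) (D 2)"
    using assms unfolding ddef_def by auto
  have dec: "\<exists>\<delta>. \<forall>w e. (\<forall>v. e v < length w) \<longrightarrow> eval w e \<delta> = (\<exists>i < length w. w ! i = ((\<pi> :: nat, Done), Sep))" for \<pi>
    unfolding dec_def[symmetric] by (rule dec_ex) (rule dec_nth)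
  obtain \<delta>0 where \<delta>0: "\<forall>w e. (\<forall>v. e v < length w) \<longrightarrow> eval w e \<delta>0 = (\<exists>i < length w. w ! i = ((0 :: nat, Done), Sep))"
    using dec by blast
  obtain \<delta>1 where \<delta>1: "\<forall>w e. (\<forall>v. e v < length w) \<longrightarrow> eval w e \<delta>1 = (\<exists>i < length w. w ! i = ((1 :: nat, Done), Sep))"
    using dec by blast
  obtain \<delta>2 where \<delta>2: "\<forall>w e. (\<forall>v. e v < length w) \<longrightarrow> eval w e \<delta>2 = (\<exists>i < length w. w ! i = ((2 :: nat, Done), Sep))"
    using dec by blast
  \<comment> \<open>This is \<open>\<delta>0 \<and> (\<delta>1 \<longrightarrow> \<delta>2 \<and>
    \<phi>)\<close>, written with the connectives of \<open>fo\<close>.\<close>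
  let ?\<psi> = "Conj \<delta>0 (Neg (Conj \<delta>1 (Neg (Conj \<delta>2 \<phi>))))"
  have "eval (trace next_state (0, Items) (triple x u v @ [Sep])) (\<lambda>_. 0) ?\<psi> \<longleftrightarrow>
    (\<exists>X. encodes 0 x X) \<and> ((\<exists>U. encodes 1 u U) \<longrightarrow>
      (\<exists>X U V. encodes 0 x X \<and> encodes 1 u U \<and> encodes 2 v V \<and> F X U V))" for x u v
  proof -
    let ?w = "tagged x u v"
    have len: "\<forall>v::nat. 0 < length ?w" by (simp add: tagged_eq)
    have d0: "eval ?w (\<lambda>_. 0) \<delta>0 \<longleftrightarrow> (\<exists>X. encodes 0 x X)"
      unfolding encodes_iff using \<delta>0[rule_format, OF len[rule_format]] tagged_Done[of 0 x u v] by simp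
    have d1: "eval ?w (\<lambda>_. 0) \<delta>1 \<longleftrightarrow> (\<exists>U. encodes 1 u U)"
      unfolding encodes_iff using \<delta>1[rule_format, OF len[rule_format]] tagged_Done[of 1 x u v] by simp
    have d2: "eval ?w (\<lambda>_. 0) \<delta>2 \<longleftrightarrow> (\<exists>V. encodes 2 v V)"
      unfolding encodes_iff using \<delta>2[rule_format, OF len[rule_format]] tagged_Done[of 2 x u v] by simp
    have f: "eval ?w (\<lambda>_. 0) \<phi> = F X U V" if e: "encodes 0 x X" "encodes 1 u U" "encodes 2 v V" for X U V
    proof -
      have ok: "doc_ok (doc X U V)" using e unfolding doc_ok_def encodes_def doc_def by auto
      have "?w = word (doc X U V)"
        using e tagged_word[OF ok] by (simp add: doc_def encodes_def)
      moreover have "penv 0 undefined = (\<lambda>_. 0)" by (rule ext) (simp add: penv_def)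
      ultimately show ?thesis using \<phi>[OF ok, of undefined] by (simp add: doc_def)
    qed
    have "(\<exists>V. encodes 2 v V) \<and> eval ?w (\<lambda>_. 0) \<phi> \<longleftrightarrow> (\<exists>X U V. encodes 0 x X \<and> encodes 1 u U \<and> encodes 2 v V \<and> F X U V)"
      if "encodes 0 x X0" "encodes 1 u U0" for X0 U0
      using f that by meson
    then show ?thesis unfolding tagged_def[symmetric] eval.simps d0 d1 d2 by meson
  qed
  then show ?thesis using parser.ptime[of ?\<psi>] by simp
qed

section \<open>Certificates against C-stratification\<close>

definition same_trm :: "node \<Rightarrow> node \<Rightarrow> bool" where
  "same_trm t u \<longleftrightarrow> same_name t u \<and> (var_node t \<longleftrightarrow> var_node u)"

lemma ddef_iff:
  assumes "ddef n P" "ddef n Q"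
  shows "ddef n (\<lambda>D e. P D e \<longleftrightarrow> Q D e)"
  using ddef_conj[OF ddef_imp[OF assms] ddef_imp[OF assms(2,1)]] by (simp add: iff_conv_conj_imp)

lemma ddef_all_atoms:
  assumes "i < n" "ddef (Suc n) (\<lambda>D e. G D (\<lambda>v. e (Suc v)) (e 0))"
  shows "ddef n (\<lambda>D e. \<forall>a \<in> atoms s (e i). G D e a)"
  using ddef_neg[OF ddef_atoms[OF assms(1) ddef_neg[OF assms(2)], of s]] by simp

lemma ddef_all_terms:
  assumes "i < n" "ddef (Suc n) (\<lambda>D e. G D (\<lambda>v. e (Suc v)) (e 0))"
  shows "ddef n (\<lambda>D e. \<forall>a \<in> terms (e i). G D e a)"
  using ddef_neg[OF ddef_terms[OF assms(1) ddef_neg[OF assms(2)]]] by simp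

lemma ddef_all_items:
  assumes "\<pi> \<le> 2" "ddef (Suc n) (\<lambda>D e. G D (\<lambda>v. e (Suc v)) (e 0))"
  shows "ddef n (\<lambda>D e. \<forall>a \<in> items \<pi> D. G D e a)"
  using ddef_neg[OF ddef_items[OF assms(1) ddef_neg[OF assms(2)]]] by simp

lemma ddef_same_trm: "i < n \<Longrightarrow> j < n \<Longrightarrow> ddef n (\<lambda>D e. same_trm (e i) (e j))"
  unfolding same_trm_def by (intro ddef_conj ddef_iff ddef_same_name ddef_var_node)

lemmas ddef_intros = ddef_neg ddef_conj ddef_disj ddef_imp ddef_iff ddef_items ddef_atoms ddef_terms
  ddef_all_items ddef_all_atoms ddef_all_terms ddef_same_name ddef_var_node ddef_same_index ddef_same_arity
  ddef_same_slot ddef_before ddef_same_trm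

text \<open>The assignment in slot \<open>s\<close> of \<open>r\<close> consists of the atoms \<open>Atom x [v]\<close>, one for each variable \<open>x\<close>, where
  \<open>v\<close> represents the value of \<open>x\<close>. The term \<open>Cst c\<close> stands for the value \<open>Const c\<close>, and \<open>Var n\<close> for \<open>Null n\<close>.\<close>

definition n_val :: "nat \<Rightarrow> node \<Rightarrow> node \<Rightarrow> node \<Rightarrow> bool" where
  "n_val s r t y \<longleftrightarrow> (\<not> var_node t \<and> same_trm t y) \<or>
     (var_node t \<and> (\<exists>a \<in> atoms s r. same_name a t \<and> (\<exists>z \<in> terms a. same_trm z y)))"

definition n_img :: "nat \<Rightarrow> node \<Rightarrow> node \<Rightarrow> node \<Rightarrow> bool" where
  "n_img s r a b \<longleftrightarrow> same_name a b \<and> same_arity a b \<and>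
     (\<forall>t \<in> terms a. \<forall>y \<in> terms b. same_index t y \<longrightarrow> n_val s r t y)"

definition n_func :: "nat \<Rightarrow> node \<Rightarrow> bool" where
  "n_func s r \<longleftrightarrow> (\<forall>a \<in> atoms s r. \<forall>b \<in> atoms s r. same_name a b \<longrightarrow> (\<forall>y \<in> terms a. \<forall>z \<in> terms b. same_trm y z))"

definition n_occ :: "node \<Rightarrow> node \<Rightarrow> bool" where
  "n_occ t r \<longleftrightarrow> (\<exists>a \<in> atoms 0 r. \<exists>u \<in> terms a. same_trm t u)"

lemma ddef_n_val: "i < n \<Longrightarrow> j < n \<Longrightarrow> k < n \<Longrightarrow> ddef n (\<lambda>D e. n_val s (e i) (e j) (e k))"
  unfolding n_val_def by (intro ddef_intros) simp_all

lemma ddef_n_img: "i < n \<Longrightarrow> j < n \<Longrightarrow> k < n \<Longrightarrow> ddef n (\<lambda>D e. n_img s (e i) (e j) (e k))"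
  unfolding n_img_def by (intro ddef_intros ddef_n_val) simp_all

lemma ddef_n_func: "i < n \<Longrightarrow> ddef n (\<lambda>D e. n_func s (e i))"
  unfolding n_func_def by (intro ddef_intros) simp_all

lemma ddef_n_occ: "i < n \<Longrightarrow> j < n \<Longrightarrow> ddef n (\<lambda>D e. n_occ (e i) (e j))"
  unfolding n_occ_def by (intro ddef_intros) simp_all

text \<open>With slot 2 functional, this is \<open>fresh_ext\<close> for the assignment listed
  there: values of existential variables are nulls, absent from slot 4, and pairwise
  distinct.\<close>

definition n_fresh :: "node \<Rightarrow> bool" where
  "n_fresh r \<longleftrightarrow> (\<forall>Z \<in> atoms 1 r. \<forall>z \<in> terms Z. var_node z \<and> \<not> n_occ z r \<longrightarrow>
     (\<forall>a \<in> atoms 2 r. same_name a z \<longrightarrow> (\<forall>y \<in> terms a. var_node y \<and>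
       (\<forall>b \<in> atoms 4 r. \<forall>u \<in> terms b. \<not> same_trm y u) \<and>
       (\<forall>Z' \<in> atoms 1 r. \<forall>z' \<in> terms Z'. var_node z' \<and> \<not> n_occ z' r \<longrightarrow>
         (\<forall>a' \<in> atoms 2 r. same_name a' z' \<longrightarrow> (\<forall>y' \<in> terms a'. same_trm y y' \<longrightarrow> same_trm z z'))))))"

lemma ddef_n_fresh: "i < n \<Longrightarrow> ddef n (\<lambda>D e. n_fresh (e i))"
  unfolding n_fresh_def by (intro ddef_intros ddef_n_occ) simp_all

text \<open>Condition (i) of a chase edge is expressed by a body atom of the second tgd that is
  missing in slot 4. Such an atom must exist: if the whole body held before the step, an extension
  satisfying the head there would still serve afterwards. The last conjunct admits only facts used
  by one of the triggers, which is what allows refutations to name values by terms.\<close>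

definition n_edge :: "node \<Rightarrow> node \<Rightarrow> bool" where
  "n_edge r r' \<longleftrightarrow> n_func 2 r \<and> n_func 3 r \<and>
     (\<forall>a \<in> atoms 0 r. \<exists>b \<in> atoms 4 r. n_img 2 r a b) \<and>
     (\<forall>a \<in> atoms 1 r. \<exists>b \<in> atoms 5 r. n_img 2 r a b) \<and>
     (\<forall>b \<in> atoms 5 r. \<exists>a \<in> atoms 1 r. n_img 2 r a b) \<and>
     n_fresh r \<and>
     (\<forall>a \<in> atoms 0 r'. (\<exists>b \<in> atoms 4 r. n_img 3 r a b) \<or> (\<exists>b \<in> atoms 5 r. n_img 3 r a b)) \<and>
     (\<exists>a \<in> atoms 0 r'. \<forall>b \<in> atoms 4 r. \<not> n_img 3 r a b) \<and>
     (\<forall>b \<in> atoms 4 r. (\<exists>a \<in> atoms 0 r. n_img 2 r a b) \<or> (\<exists>a \<in> atoms 0 r'. n_img 3 r a b))"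

lemma ddef_n_edge: "i < n \<Longrightarrow> j < n \<Longrightarrow> ddef n (\<lambda>D e. n_edge (e i) (e j))"
  unfolding n_edge_def by (intro ddef_intros ddef_n_img ddef_n_func ddef_n_fresh) simp_all

text \<open>A refutation \<open>h\<close> of the last condition on a chase edge extends the second assignment; the value of
  a further variable is given as the image of a term under the first (slot 0) or the second (slot 1)
  assignment, which keeps \<open>h\<close> polynomial in the set of tgds.\<close>

definition n_ext_val :: "node \<Rightarrow> node \<Rightarrow> node \<Rightarrow> node \<Rightarrow> node \<Rightarrow> bool" where
  "n_ext_val r r' h t y \<longleftrightarrow> (\<not> var_node t \<and> same_trm t y) \<or> (var_node t \<and>
     ((n_occ t r' \<and> n_val 3 r t y) \<or>
      (\<not> n_occ t r' \<and> ((\<exists>a \<in> atoms 0 h. same_name a t \<and> (\<exists>z \<in> terms a. n_val 2 r z y)) \<or>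
         (\<exists>a \<in> atoms 1 h. same_name a t \<and> (\<exists>z \<in> terms a. n_val 3 r z y))))))"

definition n_ext_img :: "node \<Rightarrow> node \<Rightarrow> node \<Rightarrow> node \<Rightarrow> node \<Rightarrow> bool" where
  "n_ext_img r r' h a b \<longleftrightarrow> same_name a b \<and> same_arity a b \<and>
     (\<forall>t \<in> terms a. \<forall>y \<in> terms b. same_index t y \<longrightarrow> n_ext_val r r' h t y)"

definition n_ext :: "node \<Rightarrow> node \<Rightarrow> node \<Rightarrow> bool" where
  "n_ext r r' h \<longleftrightarrow> n_func 0 h \<and> n_func 1 h \<and> (\<forall>a \<in> atoms 0 h. \<forall>b \<in> atoms 1 h. \<not> same_name a b) \<and>
     (\<forall>a \<in> atoms 1 r'. (\<exists>b \<in> atoms 4 r. n_ext_img r r' h a b) \<or> (\<exists>b \<in> atoms 5 r. n_ext_img r r' h a b))"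

lemma ddef_n_ext_val: "i < n \<Longrightarrow> j < n \<Longrightarrow> k < n \<Longrightarrow> l < n \<Longrightarrow> m < n \<Longrightarrow>
    ddef n (\<lambda>D e. n_ext_val (e i) (e j) (e k) (e l) (e m))"
  unfolding n_ext_val_def by (intro ddef_intros ddef_n_val ddef_n_occ) simp_all

lemma ddef_n_ext_img: "i < n \<Longrightarrow> j < n \<Longrightarrow> k < n \<Longrightarrow> l < n \<Longrightarrow> m < n \<Longrightarrow>
    ddef n (\<lambda>D e. n_ext_img (e i) (e j) (e k) (e l) (e m))"
  unfolding n_ext_img_def by (intro ddef_intros ddef_n_ext_val) simp_all

lemma ddef_n_ext: "i < n \<Longrightarrow> j < n \<Longrightarrow> k < n \<Longrightarrow> ddef n (\<lambda>D e. n_ext (e i) (e j) (e k))"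
  unfolding n_ext_def by (intro ddef_intros ddef_n_ext_img ddef_n_func) simp_all

text \<open>A vertex of the dependency graph is an atom whose only variable marks the position.\<close>

definition n_at :: "node \<Rightarrow> node \<Rightarrow> node \<Rightarrow> bool" where
  "n_at r a t \<longleftrightarrow> (\<exists>b \<in> atoms 6 r. \<exists>m \<in> terms b. var_node m \<and> same_name a b \<and> same_arity a b \<and> same_index t m)"

definition n_uniq :: "node \<Rightarrow> bool" where
  "n_uniq r \<longleftrightarrow> (\<forall>a \<in> atoms 6 r. \<forall>b \<in> atoms 6 r. \<forall>t \<in> terms a. \<forall>u \<in> terms b.
     var_node t \<and> var_node u \<longrightarrow> same_name a b \<and> same_arity a b \<and> same_index t u)"

text \<open>The tgd \<open>q\<close> behind a dependency edge may be that of any record, because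
  weak acyclicity concerns all vertices of the chase cycle at once. The last conjunct makes
  \<open>t\<close> occur in the head, as generating edges demand.\<close>

definition n_gen :: "(nat \<Rightarrow> item list) \<Rightarrow> node \<Rightarrow> node \<Rightarrow> bool" where
  "n_gen D r r' \<longleftrightarrow> (\<exists>q \<in> items 1 D. \<exists>a \<in> atoms 0 q. \<exists>t \<in> terms a. \<exists>b \<in> atoms 1 q. \<exists>u \<in> terms b.
     n_at r a t \<and> n_at r' b u \<and> var_node t \<and> var_node u \<and> \<not> n_occ u q \<and>
     (\<exists>b' \<in> atoms 1 q. \<exists>u' \<in> terms b'. same_trm t u'))"

definition n_copy :: "(nat \<Rightarrow> item list) \<Rightarrow> node \<Rightarrow> node \<Rightarrow> bool" where
  "n_copy D r r' \<longleftrightarrow> (\<exists>q \<in> items 1 D. \<exists>a \<in> atoms 0 q. \<exists>t \<in> terms a. \<exists>b \<in> atoms 1 q. \<exists>u \<in> terms b.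
     n_at r a t \<and> n_at r' b u \<and> var_node t \<and> same_trm t u)"

lemma ddef_n_at: "i < n \<Longrightarrow> j < n \<Longrightarrow> k < n \<Longrightarrow> ddef n (\<lambda>D e. n_at (e i) (e j) (e k))"
  unfolding n_at_def by (intro ddef_intros) simp_all

lemma ddef_n_uniq: "i < n \<Longrightarrow> ddef n (\<lambda>D e. n_uniq (e i))"
  unfolding n_uniq_def by (intro ddef_intros) simp_all

lemma ddef_n_gen: "i < n \<Longrightarrow> j < n \<Longrightarrow> ddef n (\<lambda>D e. n_gen D (e i) (e j))"
  unfolding n_gen_def by (intro ddef_intros ddef_n_at ddef_n_occ) simp_all

lemma ddef_n_copy: "i < n \<Longrightarrow> j < n \<Longrightarrow> ddef n (\<lambda>D e. n_copy D (e i) (e j))"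
  unfolding n_copy_def by (intro ddef_intros ddef_n_at) simp_all

text \<open>The cyclic successor among the records of a certificate.\<close>

definition n_next :: "(nat \<Rightarrow> item list) \<Rightarrow> node \<Rightarrow> node \<Rightarrow> bool" where
  "n_next D r r' \<longleftrightarrow> (before r r' \<and> \<not> (\<exists>x \<in> items 1 D. before r x \<and> before x r')) \<or>
     (\<not> (\<exists>x \<in> items 1 D. before r x) \<and> \<not> (\<exists>x \<in> items 1 D. before x r'))"

definition n_tgd :: "(nat \<Rightarrow> item list) \<Rightarrow> node \<Rightarrow> bool" where
  "n_tgd D r \<longleftrightarrow> (\<exists>x \<in> items 0 D. same_slot 0 x r \<and> same_slot 1 x r)"

definition n_cert :: "(nat \<Rightarrow> item list) \<Rightarrow> bool" where
  "n_cert D \<longleftrightarrow> (\<forall>r \<in> items 1 D. n_tgd D r \<and> n_uniq r) \<and>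
     (\<forall>r \<in> items 1 D. \<forall>r' \<in> items 1 D. n_next D r r' \<longrightarrow> n_edge r r' \<and> (n_copy D r r' \<or> n_gen D r r')) \<and>
     (\<exists>r \<in> items 1 D. \<exists>r' \<in> items 1 D. n_next D r r' \<and> n_gen D r r')"

text \<open>A single refuted step suffices: the alleged closed walk then lacks a verified chase
  edge.\<close>

definition n_refuted :: "(nat \<Rightarrow> item list) \<Rightarrow> bool" where
  "n_refuted D \<longleftrightarrow> (\<exists>r \<in> items 1 D. \<exists>r' \<in> items 1 D. n_next D r r' \<and> (\<exists>h \<in> items 2 D. n_ext r r' h))"

lemma ddef_n_next: "i < n \<Longrightarrow> j < n \<Longrightarrow> ddef n (\<lambda>D e. n_next D (e i) (e j))"
  unfolding n_next_def by (intro ddef_intros) simp_all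

lemma ddef_n_tgd: "i < n \<Longrightarrow> ddef n (\<lambda>D e. n_tgd D (e i))"
  unfolding n_tgd_def by (intro ddef_intros) simp_all

lemma ddef_certificate: "ddef 0 (\<lambda>D e. n_cert D \<longrightarrow> n_refuted D)"
  unfolding n_cert_def n_refuted_def
  by (intro ddef_intros ddef_n_tgd ddef_n_uniq ddef_n_edge ddef_n_copy ddef_n_gen ddef_n_next ddef_n_ext) simp_all

subsection \<open>Certificates as lists\<close>

definition val_of :: "trm atom list \<Rightarrow> trm \<Rightarrow> trm \<Rightarrow> bool" where
  "val_of As t v \<longleftrightarrow> (\<not> is_var t \<and> t = v) \<or> (is_var t \<and> (\<exists>A \<in> set As. rel A = name t \<and> v \<in> set (args A)))"

definition img_of :: "(trm \<Rightarrow> trm \<Rightarrow> bool) \<Rightarrow> trm atom \<Rightarrow> trm atom \<Rightarrow> bool" where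
  "img_of R A B \<longleftrightarrow> rel A = rel B \<and> list_all2 R (args A) (args B)"

definition func :: "trm atom list \<Rightarrow> bool" where
  "func As \<longleftrightarrow> (\<forall>A \<in> set As. \<forall>B \<in> set As. rel A = rel B \<longrightarrow> (\<forall>y \<in> set (args A). \<forall>z \<in> set (args B). y = z))"

definition occ :: "trm \<Rightarrow> trm atom list \<Rightarrow> bool" where
  "occ t As \<longleftrightarrow> (\<exists>A \<in> set As. t \<in> set (args A))"

definition fresh :: "item \<Rightarrow> bool" where
  "fresh it \<longleftrightarrow> (\<forall>z. occ z (it ! 1) \<and> is_var z \<and> \<not> occ z (it ! 0) \<longrightarrow>
     (\<forall>A \<in> set (it ! 2). rel A = name z \<longrightarrow> (\<forall>y \<in> set (args A). is_var y \<and> \<not> occ y (it ! 4) \<and>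
       (\<forall>z'. occ z' (it ! 1) \<and> is_var z' \<and> \<not> occ z' (it ! 0) \<longrightarrow>
         (\<forall>A' \<in> set (it ! 2). rel A' = name z' \<longrightarrow> y \<in> set (args A') \<longrightarrow> z = z')))))"

definition edge :: "item \<Rightarrow> item \<Rightarrow> bool" where
  "edge it it' \<longleftrightarrow> func (it ! 2) \<and> func (it ! 3) \<and>
     (\<forall>A \<in> set (it ! 0). \<exists>B \<in> set (it ! 4). img_of (val_of (it ! 2)) A B) \<and>
     (\<forall>A \<in> set (it ! 1). \<exists>B \<in> set (it ! 5). img_of (val_of (it ! 2)) A B) \<and>
     (\<forall>B \<in> set (it ! 5). \<exists>A \<in> set (it ! 1). img_of (val_of (it ! 2)) A B) \<and>
     fresh it \<and>
     (\<forall>A \<in> set (it' ! 0). (\<exists>B \<in> set (it ! 4). img_of (val_of (it ! 3)) A B) \<or> (\<exists>B \<in> set (it ! 5). img_of (val_of (it ! 3)) A B)) \<and>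
     (\<exists>A \<in> set (it' ! 0). \<forall>B \<in> set (it ! 4). \<not> img_of (val_of (it ! 3)) A B) \<and>
     (\<forall>B \<in> set (it ! 4). (\<exists>A \<in> set (it ! 0). img_of (val_of (it ! 2)) A B) \<or> (\<exists>A \<in> set (it' ! 0). img_of (val_of (it ! 3)) A B))"

definition ext_val :: "item \<Rightarrow> item \<Rightarrow> item \<Rightarrow> trm \<Rightarrow> trm \<Rightarrow> bool" where
  "ext_val it it' h t y \<longleftrightarrow> (\<not> is_var t \<and> t = y) \<or> (is_var t \<and>
     ((occ t (it' ! 0) \<and> val_of (it ! 3) t y) \<or>
      (\<not> occ t (it' ! 0) \<and> ((\<exists>A \<in> set (h ! 0). rel A = name t \<and> (\<exists>z \<in> set (args A). val_of (it ! 2) z y)) \<or>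
         (\<exists>A \<in> set (h ! 1). rel A = name t \<and> (\<exists>z \<in> set (args A). val_of (it ! 3) z y))))))"

definition ext :: "item \<Rightarrow> item \<Rightarrow> item \<Rightarrow> bool" where
  "ext it it' h \<longleftrightarrow> func (h ! 0) \<and> func (h ! 1) \<and> (\<forall>A \<in> set (h ! 0). \<forall>B \<in> set (h ! 1). rel A \<noteq> rel B) \<and>
     (\<forall>A \<in> set (it' ! 1). (\<exists>B \<in> set (it ! 4). img_of (ext_val it it' h) A B) \<or> (\<exists>B \<in> set (it ! 5). img_of (ext_val it it' h) A B))"

definition at_pos :: "item \<Rightarrow> pos \<Rightarrow> bool" where
  "at_pos it p \<longleftrightarrow> (\<exists>A \<in> set (it ! 6). \<exists>i < length (args A). is_var (args A ! i) \<and> p = ((rel A, length (args A)), i))"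

definition unique_pos :: "item \<Rightarrow> bool" where
  "unique_pos it \<longleftrightarrow> (\<forall>p q. at_pos it p \<and> at_pos it q \<longrightarrow> p = q)"

definition tgd_of :: "item \<Rightarrow> tgd" where
  "tgd_of it = TGD (it ! 0) (it ! 1)"

definition linked :: "(pos \<times> pos) set \<Rightarrow> item \<Rightarrow> item \<Rightarrow> bool" where
  "linked R it it' \<longleftrightarrow> (\<exists>p q. at_pos it p \<and> at_pos it' q \<and> (p, q) \<in> R)"

definition certificate :: "item list \<Rightarrow> item list \<Rightarrow> bool" where
  "certificate X U \<longleftrightarrow> tgd_of ` set U \<subseteq> tgd_of ` set X \<and> (\<forall>it \<in> set U. unique_pos it) \<and>
     (\<forall>i < length U. edge (U ! i) (U ! (Suc i mod length U)) \<and>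
        linked (copy_edges (tgd_of ` set U) \<union> gen_edges (tgd_of ` set U)) (U ! i) (U ! (Suc i mod length U))) \<and>
     (\<exists>i < length U. linked (gen_edges (tgd_of ` set U)) (U ! i) (U ! (Suc i mod length U)))"

definition refuted :: "item list \<Rightarrow> item list \<Rightarrow> bool" where
  "refuted U V \<longleftrightarrow> (\<exists>i < length U. \<exists>h \<in> set V. ext (U ! i) (U ! (Suc i mod length U)) h)"

section \<open>From quantifiers over nodes to quantifiers over lists\<close>

lemma lnodes_mem: "(q, k, x) \<in> set (lnodes l p k0 xs) \<Longrightarrow> k0 \<le> k \<and> k < k0 + length xs \<and> x = xs ! (k - k0)"
  using lnodes_index[of k x l p k0 xs] by force

lemma lnodes_ex: "j < length xs \<Longrightarrow> \<exists>q. (q, j, xs ! j) \<in> set (lnodes l p 0 xs)"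
  using lnodes_index[of j "xs ! j" l p 0 xs] by force

lemma ex_atoms:
  assumes "s < length it" "\<And>q A. A \<in> set (it ! s) \<Longrightarrow> P (ANode q A) = P' A"
  shows "(\<exists>a \<in> atoms s (INode p it). P a) = (\<exists>A \<in> set (it ! s). P' A)"
proof
  assume "\<exists>a \<in> atoms s (INode p it). P a"
  then obtain q k A where m: "(q, k, A) \<in> set (lnodes (\<lambda>A. length (enc_atom A)) (p + length (enc_item (take s it))) 0 (it ! s))"
    and P: "P (ANode q A)" using assms(1) by auto
  have "A \<in> set (it ! s)" using lnodes_mem[OF m] by simp
  then show "\<exists>A \<in> set (it ! s). P' A" using P assms(2) by blast
next
  assume "\<exists>A \<in> set (it ! s). P' A"
  then obtain j where j: "j < length (it ! s)" "P' (it ! s ! j)" by (auto simp: in_set_conv_nth)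
  obtain q where m: "(q, j, it ! s ! j) \<in> set (lnodes (\<lambda>A. length (enc_atom A)) (p + length (enc_item (take s it))) 0 (it ! s))"
    using lnodes_ex[OF j(1)] by blast
  then have "ANode q (it ! s ! j) \<in> atoms s (INode p it)" using assms(1) by force
  moreover have "P (ANode q (it ! s ! j))" using j assms(2) by simp
  ultimately show "\<exists>a \<in> atoms s (INode p it). P a" by blast
qed

lemma all_atoms:
  assumes "s < length it" "\<And>q A. A \<in> set (it ! s) \<Longrightarrow> P (ANode q A) = P' A"
  shows "(\<forall>a \<in> atoms s (INode p it). P a) = (\<forall>A \<in> set (it ! s). P' A)"
  using ex_atoms[of s it "\<lambda>a. \<not> P a" "\<lambda>A. \<not> P' A" p] assms by blast

lemma ex_args:
  assumes "\<And>q k. k < length (args A) \<Longrightarrow> P (TNode q k (args A ! k)) = P' k"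
  shows "(\<exists>t \<in> terms (ANode p A). P t) = (\<exists>k < length (args A). P' k)"
proof
  assume "\<exists>t \<in> terms (ANode p A). P t"
  then obtain q k t where m: "(q, k, t) \<in> set (lnodes (\<lambda>t. length (enc_trm t)) (p + length (enc_nat (rel A))) 0 (args A))"
    and P: "P (TNode q k t)" by auto
  show "\<exists>k < length (args A). P' k" using lnodes_mem[OF m] P assms by auto
next
  assume "\<exists>k < length (args A). P' k"
  then obtain k where k: "k < length (args A)" "P' k" by blast
  obtain q where "(q, k, args A ! k) \<in> set (lnodes (\<lambda>t. length (enc_trm t)) (p + length (enc_nat (rel A))) 0 (args A))"
    using lnodes_ex[OF k(1)] by blast
  then have "TNode q k (args A ! k) \<in> terms (ANode p A)" by force
  then show "\<exists>t \<in> terms (ANode p A). P t" using k assms by blast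
qed

lemma all_args:
  assumes "\<And>q k. k < length (args A) \<Longrightarrow> P (TNode q k (args A ! k)) = P' k"
  shows "(\<forall>t \<in> terms (ANode p A). P t) = (\<forall>k < length (args A). P' k)"
  using ex_args[of A "\<lambda>a. \<not> P a" "\<lambda>A. \<not> P' A" p] assms by blast

lemma ex_terms:
  assumes "\<And>q k t. t \<in> set (args A) \<Longrightarrow> P (TNode q k t) = P' t"
  shows "(\<exists>t \<in> terms (ANode p A). P t) = (\<exists>t \<in> set (args A). P' t)"
proof -
  have "(\<exists>t \<in> terms (ANode p A). P t) = (\<exists>k < length (args A). P' (args A ! k))"
    by (rule ex_args) (simp add: assms)
  then show ?thesis by (metis in_set_conv_nth)
qed

lemma all_terms:
  assumes "\<And>q k t. t \<in> set (args A) \<Longrightarrow> P (TNode q k t) = P' t"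
  shows "(\<forall>t \<in> terms (ANode p A). P t) = (\<forall>t \<in> set (args A). P' t)"
  using ex_terms[of A "\<lambda>a. \<not> P a" "\<lambda>A. \<not> P' A" p] assms by blast

declare terms.simps [simp del] atoms.simps [simp del]

section \<open>Agreement of the node predicates with the list predicates\<close>

lemma same_trm_iff [simp]: "same_trm (TNode q k t) (TNode q' k' u) \<longleftrightarrow> t = u"
  by (auto simp: same_trm_def same_name_def trm_eq_iff)

lemma same_name_iff [simp]:
  "same_name (ANode q A) (ANode q' B) \<longleftrightarrow> rel A = rel B"
  "same_name (ANode q A) (TNode q' k t) \<longleftrightarrow> rel A = name t"
  by (simp_all add: same_name_def)

lemma n_val_iff:
  assumes "s < length it"
  shows "n_val s (INode p it) (TNode q k t) (TNode q' k' y) \<longleftrightarrow> val_of (it ! s) t y"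
proof -
  have "(\<exists>a \<in> atoms s (INode p it). same_name a (TNode q k t) \<and> (\<exists>z \<in> terms a. same_trm z (TNode q' k' y))) \<longleftrightarrow>
    (\<exists>A \<in> set (it ! s). rel A = name t \<and> (\<exists>z \<in> set (args A). z = y))"
  proof (rule ex_atoms[OF assms])
    fix r A
    have "(\<exists>z \<in> terms (ANode r A). same_trm z (TNode q' k' y)) = (\<exists>z \<in> set (args A). z = y)"
      by (rule ex_terms) simp
    then show "(same_name (ANode r A) (TNode q k t) \<and> (\<exists>z \<in> terms (ANode r A). same_trm z (TNode q' k' y))) =
      (rel A = name t \<and> (\<exists>z \<in> set (args A). z = y))" by simp
  qed
  then show ?thesis by (simp add: n_val_def val_of_def)
qed

lemma img_iff:
  assumes "\<And>q k t q' k' y. P (TNode q k t) (TNode q' k' y) \<longleftrightarrow> R t y"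
  shows "(same_name (ANode q A) (ANode q' B) \<and> same_arity (ANode q A) (ANode q' B) \<and>
     (\<forall>t \<in> terms (ANode q A). \<forall>y \<in> terms (ANode q' B). same_index t y \<longrightarrow> P t y)) \<longleftrightarrow> img_of R A B"
proof -
  have "(\<forall>t \<in> terms (ANode q A). \<forall>y \<in> terms (ANode q' B). same_index t y \<longrightarrow> P t y) \<longleftrightarrow>
    (\<forall>i < length (args A). \<forall>j < length (args B). i = j \<longrightarrow> R (args A ! i) (args B ! j))"
    by (intro all_args) (simp add: assms)
  then show ?thesis unfolding img_of_def list_all2_conv_all_nth by auto
qed

lemma n_img_iff:
  "s < length it \<Longrightarrow> n_img s (INode p it) (ANode q A) (ANode q' B) \<longleftrightarrow> img_of (val_of (it ! s)) A B"
  unfolding n_img_def by (rule img_iff) (rule n_val_iff)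

lemma n_func_iff: "s < length it \<Longrightarrow> n_func s (INode p it) \<longleftrightarrow> func (it ! s)"
  unfolding n_func_def func_def
  by (intro all_atoms imp_cong all_terms) simp_all

lemma n_occ_iff: "it \<noteq> [] \<Longrightarrow> n_occ (TNode q k t) (INode p it) \<longleftrightarrow> occ t (it ! 0)"
proof -
  assume "it \<noteq> []"
  then have "n_occ (TNode q k t) (INode p it) \<longleftrightarrow> (\<exists>A \<in> set (it ! 0). \<exists>u \<in> set (args A). t = u)"
    unfolding n_occ_def by (intro ex_atoms ex_terms) simp_all
  then show ?thesis by (simp add: occ_def)
qed

lemma n_fresh_iff:
  assumes "4 < length it"
  shows "n_fresh (INode p it) \<longleftrightarrow> fresh it"
proof -
  have l: "1 < length it" "2 < length it" "4 < length it" "it \<noteq> []" using assms by auto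
  have "n_fresh (INode p it) \<longleftrightarrow> (\<forall>Z \<in> set (it ! 1). \<forall>z \<in> set (args Z). is_var z \<and> \<not> occ z (it ! 0) \<longrightarrow>
     (\<forall>a \<in> set (it ! 2). rel a = name z \<longrightarrow> (\<forall>y \<in> set (args a). is_var y \<and>
       (\<forall>b \<in> set (it ! 4). \<forall>u \<in> set (args b). \<not> y = u) \<and>
       (\<forall>Z' \<in> set (it ! 1). \<forall>z' \<in> set (args Z'). is_var z' \<and> \<not> occ z' (it ! 0) \<longrightarrow>
         (\<forall>a' \<in> set (it ! 2). rel a' = name z' \<longrightarrow> (\<forall>y' \<in> set (args a'). y = y' \<longrightarrow> z = z'))))))"
    unfolding n_fresh_def
    by (intro all_atoms all_terms imp_cong conj_cong l) (simp_all add: n_occ_iff[OF l(4)])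
  also have "\<dots> \<longleftrightarrow> fresh it" unfolding fresh_def occ_def by blast
  finally show ?thesis .
qed

lemma n_edge_iff:
  assumes "5 < length it" "it' \<noteq> []"
  shows "n_edge (INode p it) (INode p' it') \<longleftrightarrow> edge it it'"
proof -
  have l: "0 < length it" "1 < length it" "2 < length it" "3 < length it" "4 < length it" "5 < length it" "0 < length it'"
    using assms by auto
  show ?thesis unfolding n_edge_def edge_def
    by (intro conj_cong disj_cong n_func_iff n_fresh_iff all_atoms ex_atoms l) (simp_all add: n_img_iff l)
qed

lemma n_ext_val_iff:
  assumes "3 < length it" "it' \<noteq> []" "1 < length h"
  shows "n_ext_val (INode p it) (INode p' it') (INode p'' h) (TNode q k t) (TNode q' k' y) \<longleftrightarrow> ext_val it it' h t y"
proof -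
  have l: "2 < length it" "3 < length it" "0 < length h" "1 < length h" using assms by auto
  have *: "(\<exists>a \<in> atoms s (INode p'' h). same_name a (TNode q k t) \<and> (\<exists>z \<in> terms a. n_val s' (INode p it) z (TNode q' k' y))) \<longleftrightarrow>
    (\<exists>A \<in> set (h ! s). rel A = name t \<and> (\<exists>z \<in> set (args A). val_of (it ! s') z y))" if "s < length h" "s' < length it" for s s'
  proof (rule ex_atoms[OF that(1)])
    fix r A
    have "(\<exists>z \<in> terms (ANode r A). n_val s' (INode p it) z (TNode q' k' y)) = (\<exists>z \<in> set (args A). val_of (it ! s') z y)"
      by (rule ex_terms) (rule n_val_iff[OF that(2)])
    then show "(same_name (ANode r A) (TNode q k t) \<and> (\<exists>z \<in> terms (ANode r A). n_val s' (INode p it) z (TNode q' k' y))) =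
      (rel A = name t \<and> (\<exists>z \<in> set (args A). val_of (it ! s') z y))" by simp
  qed
  show ?thesis unfolding n_ext_val_def ext_val_def *[OF l(3,1)] *[OF l(4,2)] n_occ_iff[OF assms(2)] n_val_iff[OF l(2)]
    by simp
qed

lemma n_ext_iff:
  assumes "5 < length it" "1 < length it'" "1 < length h"
  shows "n_ext (INode p it) (INode p' it') (INode p'' h) \<longleftrightarrow> ext it it' h"
proof -
  have l: "3 < length it" "4 < length it" "5 < length it" "it' \<noteq> []" "0 < length h" "1 < length h" "1 < length it'" using assms by auto
  have img: "n_ext_img (INode p it) (INode p' it') (INode p'' h) (ANode q A) (ANode q' B) \<longleftrightarrow> img_of (ext_val it it' h) A B" for q A q' B
    unfolding n_ext_img_def by (rule img_iff) (rule n_ext_val_iff[OF l(1,4,6)])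
  show ?thesis unfolding n_ext_def ext_def
    by (intro conj_cong disj_cong n_func_iff all_atoms ex_atoms l) (simp_all add: img)
qed

lemma n_at_iff:
  assumes "6 < length it"
  shows "n_at (INode p it) (ANode q A) (TNode q' k t) \<longleftrightarrow> at_pos it ((rel A, length (args A)), k)"
proof -
  have "n_at (INode p it) (ANode q A) (TNode q' k t) \<longleftrightarrow> (\<exists>B \<in> set (it ! 6). \<exists>i < length (args B). is_var (args B ! i) \<and>
     rel A = rel B \<and> length (args A) = length (args B) \<and> k = i)"
    unfolding n_at_def by (intro ex_atoms ex_args assms) simp_all
  then show ?thesis unfolding at_pos_def by auto
qed

lemma n_uniq_iff:
  assumes "6 < length it"
  shows "n_uniq (INode p it) \<longleftrightarrow> unique_pos it"
proof -
  have "n_uniq (INode p it) \<longleftrightarrow> (\<forall>A \<in> set (it ! 6). \<forall>B \<in> set (it ! 6). \<forall>i < length (args A). \<forall>j < length (args B).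
    is_var (args A ! i) \<and> is_var (args B ! j) \<longrightarrow> rel A = rel B \<and> length (args A) = length (args B) \<and> i = j)"
    unfolding n_uniq_def by (intro all_atoms all_args assms) simp_all
  also have "\<dots> \<longleftrightarrow> unique_pos it" unfolding unique_pos_def at_pos_def by blast
  finally show ?thesis .
qed

text \<open>Positions of items increase with their indices. This turns \<open>before\<close> into
  the order of indices, and \<open>n_next\<close> into the cyclic successor.\<close>

lemma items_index:
  "\<exists>f. items \<pi> D = (\<lambda>k. INode (f k) (D \<pi> ! k)) ` {..<length (D \<pi>)} \<and>
    (\<forall>i < length (D \<pi>). \<forall>j < length (D \<pi>). f i < f j \<longleftrightarrow> i < (j::nat))"
proof -
  let ?L = "lnodes (\<lambda>it. length (enc_item it)) (part_start \<pi> D) 0 (D \<pi>)"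
  have "\<forall>k. \<exists>q. k < length (D \<pi>) \<longrightarrow> (q, k, D \<pi> ! k) \<in> set ?L" using lnodes_ex by blast
  then obtain f where f: "\<And>k. k < length (D \<pi>) \<Longrightarrow> (f k, k, D \<pi> ! k) \<in> set ?L" by metis
  have q: "q = f k" if "(q, k, it) \<in> set ?L" for q k it
  proof -
    have "k < length (D \<pi>)" using lnodes_mem[OF that] by simp
    then show ?thesis using lnodes_mono[OF that f[of k]] lnodes_mono[OF f[of k] that] by (metis less_irrefl linorder_neqE_nat)
  qed
  have "items \<pi> D = (\<lambda>k. INode (f k) (D \<pi> ! k)) ` {..<length (D \<pi>)}"
  proof
    show "items \<pi> D \<subseteq> (\<lambda>k. INode (f k) (D \<pi> ! k)) ` {..<length (D \<pi>)}"
    proof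
      fix n assume "n \<in> items \<pi> D"
      then obtain q k it where n: "n = INode q it" "(q, k, it) \<in> set ?L" by (auto simp: items_def)
      then show "n \<in> (\<lambda>k. INode (f k) (D \<pi> ! k)) ` {..<length (D \<pi>)}" using lnodes_mem[OF n(2)] q[OF n(2)] by auto
    qed
    show "(\<lambda>k. INode (f k) (D \<pi> ! k)) ` {..<length (D \<pi>)} \<subseteq> items \<pi> D"
      using f by (force simp: items_def)
  qed
  moreover have "f i < f j \<longleftrightarrow> i < j" if "i < length (D \<pi>)" "j < length (D \<pi>)" for i j
    using lnodes_mono[OF f[OF that(1)] f[OF that(2)]] .
  ultimately show ?thesis by blast
qed

lemma ex_items:
  assumes "\<And>p it. it \<in> set (D \<pi>) \<Longrightarrow> P (INode p it) = P' it"
  shows "(\<exists>r \<in> items \<pi> D. P r) = (\<exists>it \<in> set (D \<pi>). P' it)"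
proof -
  obtain f where f: "items \<pi> D = (\<lambda>k. INode (f k) (D \<pi> ! k)) ` {..<length (D \<pi>)}" using items_index by blast
  have "(\<exists>r \<in> items \<pi> D. P r) = (\<exists>k < length (D \<pi>). P (INode (f k) (D \<pi> ! k)))" unfolding f by auto
  also have "\<dots> = (\<exists>k < length (D \<pi>). P' (D \<pi> ! k))" using assms[OF nth_mem] by (simp cong: conj_cong)
  also have "\<dots> = (\<exists>it \<in> set (D \<pi>). P' it)" by (metis in_set_conv_nth)
  finally show ?thesis .
qed

lemma all_items:
  assumes "\<And>p it. it \<in> set (D \<pi>) \<Longrightarrow> P (INode p it) = P' it"
  shows "(\<forall>r \<in> items \<pi> D. P r) = (\<forall>it \<in> set (D \<pi>). P' it)"
  using ex_items[of D \<pi> "\<lambda>a. \<not> P a" "\<lambda>A. \<not> P' A"] assms by blast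

lemma ex_next:
  assumes "\<And>p it p' it'. it \<in> set (D 1) \<Longrightarrow> it' \<in> set (D 1) \<Longrightarrow> P (INode p it) (INode p' it') = P' it it'"
  shows "(\<exists>r \<in> items 1 D. \<exists>r' \<in> items 1 D. n_next D r r' \<and> P r r') =
    (\<exists>i < length (D 1). P' (D 1 ! i) (D 1 ! (Suc i mod length (D 1))))"
proof -
  let ?n = "length (D 1)"
  obtain f where f: "items 1 D = (\<lambda>k. INode (f k) (D 1 ! k)) ` {..<?n}" and
    m': "\<forall>i < ?n. \<forall>j < ?n. f i < f j \<longleftrightarrow> i < j" using items_index[of 1 D] by (elim exE conjE)
  have m: "f i < f j \<longleftrightarrow> i < j" if "i < ?n" "j < ?n" for i j using m' that by blast
  have b: "(\<exists>x \<in> items 1 D. Q x) \<longleftrightarrow> (\<exists>k < ?n. Q (INode (f k) (D 1 ! k)))" for Q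
    unfolding f by auto
  have nx: "n_next D (INode (f i) (D 1 ! i)) (INode (f j) (D 1 ! j)) \<longleftrightarrow> j = Suc i mod ?n"
    if ij: "i < ?n" "j < ?n" for i j
  proof -
    have "n_next D (INode (f i) (D 1 ! i)) (INode (f j) (D 1 ! j)) \<longleftrightarrow>
      (i < j \<and> \<not> (\<exists>k < ?n. i < k \<and> k < j)) \<or> (\<not> (\<exists>k < ?n. i < k) \<and> \<not> (\<exists>k < ?n. k < j))"
      unfolding n_next_def b before_def npos.simps using ij m by (simp only: m cong: conj_cong)
    also have "\<dots> \<longleftrightarrow> j = Suc i mod ?n"
    proof (cases "Suc i = ?n")
      \<comment> \<open>After the last record nothing follows, so its successor must have nothing
        before it, that is, index 0. A single record is thereby its own successor.\<close>
      case True
      then have "Suc i mod ?n = 0" by simp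
      moreover have "\<not> i < j" "\<not> (\<exists>k < ?n. i < k)" using True ij by linarith+
      moreover have "(\<exists>k < ?n. k < j) \<longleftrightarrow> j \<noteq> 0" using ij by (auto intro: exI[of _ 0])
      ultimately show ?thesis by simp
    next
      case False
      then have s: "Suc i < ?n" using ij by simp
      then have "\<exists>k < ?n. i < k" by blast
      moreover have "i < j \<and> \<not> (\<exists>k < ?n. i < k \<and> k < j) \<longleftrightarrow> j = Suc i"
      proof
        assume "i < j \<and> \<not> (\<exists>k < ?n. i < k \<and> k < j)"
        then have "i < j" "\<not> Suc i < j" using s by blast+
        then show "j = Suc i" by simp
      qed auto
      ultimately show ?thesis using s by simp
    qed
    finally show ?thesis .
  qed
  have "(\<exists>r \<in> items 1 D. \<exists>r' \<in> items 1 D. n_next D r r' \<and> P r r') \<longleftrightarrow>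
    (\<exists>i < ?n. \<exists>j < ?n. j = Suc i mod ?n \<and> P' (D 1 ! i) (D 1 ! j))"
    unfolding b using nx assms[OF nth_mem nth_mem] by (simp cong: conj_cong)
  also have "\<dots> \<longleftrightarrow> (\<exists>i < ?n. P' (D 1 ! i) (D 1 ! (Suc i mod ?n)))"
  proof -
    have "Suc i mod ?n < ?n" if "i < ?n" for i using that by (intro mod_less_divisor) linarith
    then show ?thesis by blast
  qed
  finally show ?thesis .
qed

lemma all_next:
  assumes "\<And>p it p' it'. it \<in> set (D 1) \<Longrightarrow> it' \<in> set (D 1) \<Longrightarrow> P (INode p it) (INode p' it') = P' it it'"
  shows "(\<forall>r \<in> items 1 D. \<forall>r' \<in> items 1 D. n_next D r r' \<longrightarrow> P r r') =
    (\<forall>i < length (D 1). P' (D 1 ! i) (D 1 ! (Suc i mod length (D 1))))"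
proof -
  have "(\<exists>r \<in> items 1 D. \<exists>r' \<in> items 1 D. n_next D r r' \<and> \<not> P r r') =
    (\<exists>i < length (D 1). \<not> P' (D 1 ! i) (D 1 ! (Suc i mod length (D 1))))"
    by (rule ex_next) (simp add: assms)
  then show ?thesis by blast
qed


lemma occ_Var: "occ (Var x) As \<longleftrightarrow> x \<in> atom_vars As"
  by (auto simp: occ_def atom_vars_def)

lemma atom_varsI: "A \<in> set As \<Longrightarrow> i < length (args A) \<Longrightarrow> args A ! i = Var x \<Longrightarrow> x \<in> atom_vars As"
  unfolding atom_vars_def by (metis (mono_tags, lifting) mem_Collect_eq nth_mem)

lemma n_gen_iff:
  assumes D: "\<forall>it \<in> set (D 1). 6 < length it" and l: "6 < length it" "6 < length it'"
  shows "n_gen D (INode p it) (INode p' it') \<longleftrightarrow> linked (gen_edges (tgd_of ` set (D 1))) it it'"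
proof -
  have "n_gen D (INode p it) (INode p' it') \<longleftrightarrow> (\<exists>q \<in> set (D 1). \<exists>A \<in> set (q ! 0). \<exists>i < length (args A).
    \<exists>B \<in> set (q ! 1). \<exists>j < length (args B). at_pos it ((rel A, length (args A)), i) \<and> at_pos it' ((rel B, length (args B)), j) \<and>
      is_var (args A ! i) \<and> is_var (args B ! j) \<and> \<not> occ (args B ! j) (q ! 0) \<and> (\<exists>C \<in> set (q ! 1). \<exists>u \<in> set (args C). args A ! i = u))"
    unfolding n_gen_def
  proof (intro ex_items)
    fix r q assume "q \<in> set (D 1)"
    then have q: "0 < length q" "1 < length q" "q \<noteq> []" using D by fastforce+
    show "(\<exists>a \<in> atoms 0 (INode r q). \<exists>t \<in> terms a. \<exists>b \<in> atoms 1 (INode r q). \<exists>u \<in> terms b.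
        n_at (INode p it) a t \<and> n_at (INode p' it') b u \<and> var_node t \<and> var_node u \<and> \<not> n_occ u (INode r q) \<and>
        (\<exists>b' \<in> atoms 1 (INode r q). \<exists>u' \<in> terms b'. same_trm t u')) \<longleftrightarrow>
      (\<exists>A \<in> set (q ! 0). \<exists>i < length (args A).
    \<exists>B \<in> set (q ! 1). \<exists>j < length (args B). at_pos it ((rel A, length (args A)), i) \<and> at_pos it' ((rel B, length (args B)), j) \<and>
      is_var (args A ! i) \<and> is_var (args B ! j) \<and> \<not> occ (args B ! j) (q ! 0) \<and> (\<exists>C \<in> set (q ! 1). \<exists>u \<in> set (args C). args A ! i = u))"
      by (intro ex_atoms ex_args conj_cong ex_terms q) (simp_all add: n_at_iff l n_occ_iff[OF q(3)])
  qed
  also have "\<dots> \<longleftrightarrow> linked (gen_edges (tgd_of ` set (D 1))) it it'"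
  proof
    assume "\<exists>q \<in> set (D 1). \<exists>A \<in> set (q ! 0). \<exists>i < length (args A).
    \<exists>B \<in> set (q ! 1). \<exists>j < length (args B). at_pos it ((rel A, length (args A)), i) \<and> at_pos it' ((rel B, length (args B)), j) \<and>
      is_var (args A ! i) \<and> is_var (args B ! j) \<and> \<not> occ (args B ! j) (q ! 0) \<and> (\<exists>C \<in> set (q ! 1). \<exists>u \<in> set (args C). args A ! i = u)"
    then obtain q A i B j C where *: "q \<in> set (D 1)" "A \<in> set (q ! 0)" "i < length (args A)" "B \<in> set (q ! 1)" "j < length (args B)"
      "at_pos it ((rel A, length (args A)), i)" "at_pos it' ((rel B, length (args B)), j)"
      "is_var (args A ! i)" "is_var (args B ! j)" "\<not> occ (args B ! j) (q ! 0)" "C \<in> set (q ! 1)" "args A ! i \<in> set (args C)" by blast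
    obtain x z where xz: "args A ! i = Var x" "args B ! j = Var z" using *(8,9) by (auto simp: is_var_def)
    have "x \<in> univ_vars (tgd_of q)" using atom_varsI[OF *(2,3) xz(1)] by (simp add: univ_vars_def tgd_of_def)
    moreover have "x \<in> atom_vars (head (tgd_of q))" using *(11,12) xz by (auto simp: tgd_of_def atom_vars_def)
    moreover have "z \<in> ex_vars (tgd_of q)" using atom_varsI[OF *(4,5) xz(2)] *(10) xz
      by (simp add: ex_vars_def tgd_of_def occ_Var)
    moreover have "((rel A, length (args A)), i) \<in> positions (body (tgd_of q)) x"
      using *(2,3) xz by (auto simp: positions_def tgd_of_def)
    moreover have "((rel B, length (args B)), j) \<in> positions (head (tgd_of q)) z"
      using *(4,5) xz by (auto simp: positions_def tgd_of_def)
    ultimately have "(((rel A, length (args A)), i), ((rel B, length (args B)), j)) \<in> gen_edges (tgd_of ` set (D 1))"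
      unfolding gen_edges_def using *(1) by blast
    then show "linked (gen_edges (tgd_of ` set (D 1))) it it'" using *(6,7) unfolding linked_def by blast
  next
    assume "linked (gen_edges (tgd_of ` set (D 1))) it it'"
    then obtain a b q x z where *: "at_pos it a" "at_pos it' b" "q \<in> set (D 1)" "x \<in> atom_vars (head (tgd_of q))"
      "z \<in> ex_vars (tgd_of q)" "a \<in> positions (body (tgd_of q)) x" "b \<in> positions (head (tgd_of q)) z"
      unfolding linked_def gen_edges_def by blast
    obtain A i where A: "A \<in> set (q ! 0)" "i < length (args A)" "a = ((rel A, length (args A)), i)" "args A ! i = Var x"
      using *(6) by (auto simp: positions_def tgd_of_def)
    obtain B j where B: "B \<in> set (q ! 1)" "j < length (args B)" "b = ((rel B, length (args B)), j)" "args B ! j = Var z"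
      using *(7) by (auto simp: positions_def tgd_of_def)
    have "\<not> occ (args B ! j) (q ! 0)" using *(5) B(4) by (simp add: occ_Var ex_vars_def tgd_of_def)
    moreover obtain C where "C \<in> set (q ! 1)" "args A ! i \<in> set (args C)" using *(4) A(4) by (auto simp: atom_vars_def tgd_of_def)
    moreover have "is_var (args A ! i)" "is_var (args B ! j)" using A B by simp_all
    ultimately show "\<exists>q \<in> set (D 1). \<exists>A \<in> set (q ! 0). \<exists>i < length (args A).
    \<exists>B \<in> set (q ! 1). \<exists>j < length (args B). at_pos it ((rel A, length (args A)), i) \<and> at_pos it' ((rel B, length (args B)), j) \<and>
      is_var (args A ! i) \<and> is_var (args B ! j) \<and> \<not> occ (args B ! j) (q ! 0) \<and> (\<exists>C \<in> set (q ! 1). \<exists>u \<in> set (args C). args A ! i = u)"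
      using *(1-3) A(1-3) B(1-3) by blast
  qed
  finally show ?thesis .
qed

lemma n_copy_iff:
  assumes D: "\<forall>it \<in> set (D 1). 6 < length it" and l: "6 < length it" "6 < length it'"
  shows "n_copy D (INode p it) (INode p' it') \<longleftrightarrow> linked (copy_edges (tgd_of ` set (D 1))) it it'"
proof -
  have "n_copy D (INode p it) (INode p' it') \<longleftrightarrow> (\<exists>q \<in> set (D 1). \<exists>A \<in> set (q ! 0). \<exists>i < length (args A).
    \<exists>B \<in> set (q ! 1). \<exists>j < length (args B). at_pos it ((rel A, length (args A)), i) \<and> at_pos it' ((rel B, length (args B)), j) \<and>
      is_var (args A ! i) \<and> args A ! i = args B ! j)"
    unfolding n_copy_def
  proof (intro ex_items)
    fix r q assume "q \<in> set (D 1)"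
    then have q: "0 < length q" "1 < length q" using D by fastforce+
    show "(\<exists>a \<in> atoms 0 (INode r q). \<exists>t \<in> terms a. \<exists>b \<in> atoms 1 (INode r q). \<exists>u \<in> terms b.
        n_at (INode p it) a t \<and> n_at (INode p' it') b u \<and> var_node t \<and> same_trm t u) \<longleftrightarrow>
      (\<exists>A \<in> set (q ! 0). \<exists>i < length (args A).
    \<exists>B \<in> set (q ! 1). \<exists>j < length (args B). at_pos it ((rel A, length (args A)), i) \<and> at_pos it' ((rel B, length (args B)), j) \<and>
      is_var (args A ! i) \<and> args A ! i = args B ! j)"
      by (intro ex_atoms ex_args conj_cong q) (simp_all add: n_at_iff l)
  qed
  also have "\<dots> \<longleftrightarrow> linked (copy_edges (tgd_of ` set (D 1))) it it'"
  proof
    assume "\<exists>q \<in> set (D 1). \<exists>A \<in> set (q ! 0). \<exists>i < length (args A).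
    \<exists>B \<in> set (q ! 1). \<exists>j < length (args B). at_pos it ((rel A, length (args A)), i) \<and> at_pos it' ((rel B, length (args B)), j) \<and>
      is_var (args A ! i) \<and> args A ! i = args B ! j"
    then obtain q A i B j where *: "q \<in> set (D 1)" "A \<in> set (q ! 0)" "i < length (args A)" "B \<in> set (q ! 1)" "j < length (args B)"
      "at_pos it ((rel A, length (args A)), i)" "at_pos it' ((rel B, length (args B)), j)"
      "is_var (args A ! i)" "args A ! i = args B ! j" by blast
    obtain x where x: "args A ! i = Var x" "args B ! j = Var x" using *(8,9) by (auto simp: is_var_def)
    have "x \<in> univ_vars (tgd_of q)" using atom_varsI[OF *(2,3) x(1)] by (simp add: univ_vars_def tgd_of_def)
    moreover have "x \<in> atom_vars (head (tgd_of q))" using atom_varsI[OF *(4,5) x(2)] by (simp add: tgd_of_def)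
    moreover have "((rel A, length (args A)), i) \<in> positions (body (tgd_of q)) x"
      using *(2,3) x by (auto simp: positions_def tgd_of_def)
    moreover have "((rel B, length (args B)), j) \<in> positions (head (tgd_of q)) x"
      using *(4,5) x by (auto simp: positions_def tgd_of_def)
    ultimately have "(((rel A, length (args A)), i), ((rel B, length (args B)), j)) \<in> copy_edges (tgd_of ` set (D 1))"
      unfolding copy_edges_def using *(1) by blast
    then show "linked (copy_edges (tgd_of ` set (D 1))) it it'" using *(6,7) unfolding linked_def by blast
  next
    assume "linked (copy_edges (tgd_of ` set (D 1))) it it'"
    then obtain a b q x where *: "at_pos it a" "at_pos it' b" "q \<in> set (D 1)"
      "a \<in> positions (body (tgd_of q)) x" "b \<in> positions (head (tgd_of q)) x"
      unfolding linked_def copy_edges_def by blast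
    obtain A i where A: "A \<in> set (q ! 0)" "i < length (args A)" "a = ((rel A, length (args A)), i)" "args A ! i = Var x"
      using *(4) by (auto simp: positions_def tgd_of_def)
    obtain B j where B: "B \<in> set (q ! 1)" "j < length (args B)" "b = ((rel B, length (args B)), j)" "args B ! j = Var x"
      using *(5) by (auto simp: positions_def tgd_of_def)
    have "is_var (args A ! i)" "args A ! i = args B ! j" using A B by simp_all
    then show "\<exists>q \<in> set (D 1). \<exists>A \<in> set (q ! 0). \<exists>i < length (args A).
    \<exists>B \<in> set (q ! 1). \<exists>j < length (args B). at_pos it ((rel A, length (args A)), i) \<and> at_pos it' ((rel B, length (args B)), j) \<and>
      is_var (args A ! i) \<and> args A ! i = args B ! j"
      using *(1-3) A(1-3) B(1-3) by blast
  qed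
  finally show ?thesis .
qed

lemma n_tgd_iff: "n_tgd D (INode p it) \<longleftrightarrow> tgd_of it \<in> tgd_of ` set (D 0)"
proof -
  have "n_tgd D (INode p it) \<longleftrightarrow> (\<exists>x \<in> set (D 0). x ! 0 = it ! 0 \<and> x ! 1 = it ! 1)"
    unfolding n_tgd_def by (intro ex_items) simp
  then show ?thesis unfolding tgd_of_def image_iff tgd.inject by metis
qed

lemma linked_Un: "linked (R \<union> S) it it' \<longleftrightarrow> linked R it it' \<or> linked S it it'"
  unfolding linked_def by blast

lemma certificate_iff:
  assumes D: "doc_ok D"
  shows "(n_cert D \<longrightarrow> n_refuted D) \<longleftrightarrow> (certificate (D 0) (D 1) \<longrightarrow> refuted (D 1) (D 2))"
proof -
  have l: "length x = slots \<pi>" if "x \<in> set (D \<pi>)" for x \<pi> using D that unfolding doc_ok_def by blast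
  have l1: "\<forall>x \<in> set (D 1). 6 < length x" and l2: "\<forall>x \<in> set (D 2). length x = 2"
    using l[of _ 1] l[of _ 2] by (simp_all add: slots_def)
  let ?T = "tgd_of ` set (D 1)"
  have 1: "(\<forall>r \<in> items 1 D. n_tgd D r \<and> n_uniq r) \<longleftrightarrow> ?T \<subseteq> tgd_of ` set (D 0) \<and> (\<forall>it \<in> set (D 1). unique_pos it)"
  proof -
    have "(\<forall>r \<in> items 1 D. n_tgd D r \<and> n_uniq r) \<longleftrightarrow> (\<forall>it \<in> set (D 1). tgd_of it \<in> tgd_of ` set (D 0) \<and> unique_pos it)"
      by (intro all_items) (use n_tgd_iff n_uniq_iff l1 in blast)
    then show ?thesis by blast
  qed
  have e: "n_edge (INode p it) (INode p' it') \<longleftrightarrow> edge it it'" if "it \<in> set (D 1)" "it' \<in> set (D 1)" for p it p' it'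
    using that l1 by (intro n_edge_iff) fastforce+
  have g: "n_gen D (INode p it) (INode p' it') \<longleftrightarrow> linked (gen_edges ?T) it it'" if "it \<in> set (D 1)" "it' \<in> set (D 1)" for p it p' it'
    using that l1 by (intro n_gen_iff) blast+
  have c: "n_copy D (INode p it) (INode p' it') \<longleftrightarrow> linked (copy_edges ?T) it it'" if "it \<in> set (D 1)" "it' \<in> set (D 1)" for p it p' it'
    using that l1 by (intro n_copy_iff) blast+
  have x: "(\<exists>h \<in> items 2 D. n_ext (INode p it) (INode p' it') h) \<longleftrightarrow> (\<exists>h \<in> set (D 2). ext it it' h)"
    if "it \<in> set (D 1)" "it' \<in> set (D 1)" for p it p' it'
  proof (intro ex_items n_ext_iff)
    show "5 < length it" "1 < length it'" using that l1 by fastforce+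
    show "1 < length h" if "h \<in> set (D 2)" for h using that l2 by fastforce
  qed
  have 2: "(\<forall>r \<in> items 1 D. \<forall>r' \<in> items 1 D. n_next D r r' \<longrightarrow> n_edge r r' \<and> (n_copy D r r' \<or> n_gen D r r')) \<longleftrightarrow>
     (\<forall>i < length (D 1). edge (D 1 ! i) (D 1 ! (Suc i mod length (D 1))) \<and>
        linked (copy_edges ?T \<union> gen_edges ?T) (D 1 ! i) (D 1 ! (Suc i mod length (D 1))))"
    by (rule all_next) (simp add: e g c linked_Un)
  have 3: "(\<exists>r \<in> items 1 D. \<exists>r' \<in> items 1 D. n_next D r r' \<and> n_gen D r r') \<longleftrightarrow>
     (\<exists>i < length (D 1). linked (gen_edges ?T) (D 1 ! i) (D 1 ! (Suc i mod length (D 1))))"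
    by (rule ex_next) (rule g)
  have 4: "n_refuted D \<longleftrightarrow> refuted (D 1) (D 2)"
    unfolding n_refuted_def refuted_def by (rule ex_next) (rule x)
  show ?thesis unfolding n_cert_def certificate_def 1 2 3 4 by blast
qed

lemma ddef_cong: "ddef n P \<Longrightarrow> (\<And>D e. doc_ok D \<Longrightarrow> P D e = Q D e) \<Longrightarrow> ddef n Q"
  unfolding ddef_def by metis

theorem ptime_certificate:
  "ptime_rel (\<lambda>x u v. (\<exists>X. encodes 0 x X) \<and> ((\<exists>U. encodes 1 u U) \<longrightarrow>
    (\<exists>X U V. encodes 0 x X \<and> encodes 1 u U \<and> encodes 2 v V \<and> (certificate X U \<longrightarrow> refuted U V))))"
  by (rule ptime_doc, rule ddef_cong[OF ddef_certificate]) (rule certificate_iff)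

section \<open>Correctness of certificates\<close>

fun tv :: "trm \<Rightarrow> val" where
  "tv (Cst c) = Const c"
| "tv (Var n) = Null n"

lemma tv_inject [simp]: "tv t = tv u \<longleftrightarrow> t = u"
  by (cases t; cases u) auto

text \<open>A variable without an atom gets an unspecified value. An argument that evaluates a
  variable must therefore first find a value listed for it.\<close>

definition asg :: "trm atom list \<Rightarrow> nat \<Rightarrow> val" where
  "asg As x = tv (SOME v. \<exists>A \<in> set As. rel A = x \<and> v \<in> set (args A))"

lemma val_asg:
  assumes "func As" "val_of As t v"
  shows "subst (asg As) t = tv v"
proof (cases t)
  case (Var x)
  then have ex: "\<exists>A \<in> set As. rel A = x \<and> v \<in> set (args A)" using assms(2) by (simp add: val_of_def)
  then have "\<exists>A \<in> set As. rel A = x \<and> (SOME v. \<exists>A \<in> set As. rel A = x \<and> v \<in> set (args A)) \<in> set (args A)"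
    by (rule someI)
  with ex have "(SOME v. \<exists>A \<in> set As. rel A = x \<and> v \<in> set (args A)) = v"
    using assms(1) unfolding func_def by blast
  then show ?thesis by (simp add: Var asg_def)
qed (use assms(2) in \<open>auto simp: val_of_def\<close>)

lemma val_conv:
  assumes "func As" "val_of As t v" "subst (asg As) t = tv w"
  shows "val_of As t w"
  using val_asg[OF assms(1,2)] assms(2,3) by simp

lemma val_fun: "func As \<Longrightarrow> val_of As t v \<Longrightarrow> val_of As t w \<Longrightarrow> v = w"
  by (metis val_asg tv_inject)

lemma map_atom_eq: "map_atom f A = map_atom g B \<longleftrightarrow> rel A = rel B \<and> map f (args A) = map g (args B)"
  by (cases A; cases B) auto

lemma img_asg:
  assumes "img_of R A B" "\<And>t v. R t v \<Longrightarrow> subst h t = tv v"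
  shows "map_atom (subst h) A = map_atom tv B"
  using assms unfolding img_of_def map_atom_eq by (auto simp: list_all2_conv_all_nth intro: nth_equalityI)

lemma img_conv:
  assumes "map_atom (subst h) A = map_atom tv B" "\<And>t y. t \<in> set (args A) \<Longrightarrow> subst h t = tv y \<Longrightarrow> R t y"
  shows "img_of R A B"
proof -
  have r: "rel A = rel B" and m: "map (subst h) (args A) = map tv (args B)"
    using assms(1) by (simp_all add: map_atom_eq)
  have "length (args A) = length (args B)" using m by (metis length_map)
  moreover have "R (args A ! i) (args B ! i)" if "i < length (args A)" for i
    using assms(2)[of "args A ! i" "args B ! i"] that m calculation by (metis nth_map nth_mem)
  ultimately show ?thesis using r by (simp add: img_of_def list_all2_conv_all_nth)
qed

lemma img_left: "img_of R A B \<Longrightarrow> t \<in> set (args A) \<Longrightarrow> \<exists>v \<in> set (args B). R t v"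
  unfolding img_of_def by (metis list_all2_conv_all_nth in_set_conv_nth)

lemma img_right: "img_of R A B \<Longrightarrow> v \<in> set (args B) \<Longrightarrow> \<exists>t \<in> set (args A). R t v"
  unfolding img_of_def by (metis list_all2_conv_all_nth in_set_conv_nth)

section \<open>Refutations and extendability\<close>

lemma ext_val_fun:
  assumes "func (it ! 2)" "func (it ! 3)" "ext it it' h" "ext_val it it' h t v" "ext_val it it' h t w"
  shows "v = w"
proof (cases "is_var t \<and> \<not> occ t (it' ! 0)")
  case True
  have f: "func (h ! 0)" "func (h ! 1)" "\<forall>A \<in> set (h ! 0). \<forall>B \<in> set (h ! 1). rel A \<noteq> rel B"
    using assms(3) by (simp_all add: ext_def)
  have v: "(\<exists>A \<in> set (h ! 0). rel A = name t \<and> (\<exists>z \<in> set (args A). val_of (it ! 2) z y)) \<or>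
     (\<exists>A \<in> set (h ! 1). rel A = name t \<and> (\<exists>z \<in> set (args A). val_of (it ! 3) z y))" if "ext_val it it' h t y" for y
    using that True by (simp add: ext_val_def)
  consider A z B z' where "A \<in> set (h ! 0)" "rel A = name t" "z \<in> set (args A)" "val_of (it ! 2) z v"
      "B \<in> set (h ! 0)" "rel B = name t" "z' \<in> set (args B)" "val_of (it ! 2) z' w"
    | A z B z' where "A \<in> set (h ! 1)" "rel A = name t" "z \<in> set (args A)" "val_of (it ! 3) z v"
      "B \<in> set (h ! 1)" "rel B = name t" "z' \<in> set (args B)" "val_of (it ! 3) z' w"
    using v[OF assms(4)] v[OF assms(5)] f(3) by metis
  then show ?thesis
  proof cases
    case 1
    then have "z = z'" using f(1) unfolding func_def by metis
    then show ?thesis using val_fun[OF assms(1)] 1 by blast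
  next
    case 2
    then have "z = z'" using f(2) unfolding func_def by metis
    then show ?thesis using val_fun[OF assms(2)] 2 by blast
  qed
next
  case False
  then show ?thesis using assms(4,5) val_fun[OF assms(2)] unfolding ext_val_def by blast
qed

definition facts :: "item \<Rightarrow> inst" where
  "facts it = map_atom tv ` (set (it ! 4) \<union> set (it ! 5))"

text \<open>Since the body of the next tgd holds after the step, the negation of this is the failure
  of \<open>sat\<close> that a chase edge requires.\<close>

definition extendable :: "item \<Rightarrow> item \<Rightarrow> bool" where
  "extendable it it' \<longleftrightarrow> (\<exists>h. extends (tgd_of it') (asg (it ! 3)) h \<and> hom_image h (it' ! 1) \<subseteq> facts it)"

lemma univ_tgd_of: "x \<in> univ_vars (tgd_of it) \<longleftrightarrow> occ (Var x) (it ! 0)"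
  by (simp add: univ_vars_def tgd_of_def occ_Var)

text \<open>A refutation names a value indirectly, through a term. The functionality of its two
  slots, their disjoint names and the functionality of the two assignments together make the named
  value unique, so it defines an extension.\<close>

lemma ext_sound:
  assumes "func (it ! 2)" "func (it ! 3)" "ext it it' h"
  shows "extendable it it'"
proof -
  define h' where "h' x = (if occ (Var x) (it' ! 0) then asg (it ! 3) x else tv (SOME v. ext_val it it' h (Var x) v))" for x
  have val: "subst h' t = tv v" if "ext_val it it' h t v" for t v
  proof (cases t)
    case (Cst c)
    then show ?thesis using that by (auto simp: ext_val_def)
  next
    case (Var x)
    show ?thesis
    proof (cases "occ (Var x) (it' ! 0)")
      case True
      then have "val_of (it ! 3) t v" using that Var by (simp add: ext_val_def)
      then show ?thesis using val_asg[OF assms(2)] Var True by (fastforce simp: h'_def)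
    next
      case False
      have "ext_val it it' h (Var x) (SOME v. ext_val it it' h (Var x) v)" using that Var by (auto intro: someI)
      then show ?thesis using ext_val_fun[OF assms] that Var False by (simp add: h'_def)
    qed
  qed
  have "extends (tgd_of it') (asg (it ! 3)) h'"
    unfolding extends_def by (simp add: h'_def univ_tgd_of)
  moreover have "hom_image h' (it' ! 1) \<subseteq> facts it"
  proof
    fix X assume "X \<in> hom_image h' (it' ! 1)"
    then obtain A where A: "A \<in> set (it' ! 1)" "X = map_atom (subst h') A" by (auto simp: hom_image_def)
    then obtain B where "B \<in> set (it ! 4) \<union> set (it ! 5)" "img_of (ext_val it it' h) A B"
      using assms(3) unfolding ext_def by blast
    then show "X \<in> facts it" using img_asg[of "ext_val it it' h" A B h'] val A(2) by (auto simp: facts_def)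
  qed
  ultimately show ?thesis unfolding extendable_def by blast
qed

definition tms :: "trm atom list \<Rightarrow> trm list" where
  "tms As = concat (map args As)"

lemma occ_tms: "occ t As \<longleftrightarrow> t \<in> set (tms As)"
  by (simp add: occ_def tms_def)

text \<open>Every value in the facts comes from a term of the two tgds: slot 5 consists of images of
  head atoms, and slot 4 only of images of body atoms. So each further variable of the head can name
  such a term, and the size of the refutation does not depend on how long the values are.\<close>

lemma ext_complete:
  assumes e: "edge it it'" and x: "extendable it it'"
  shows "\<exists>h0 h1. ext it it' [h0, h1] \<and> (\<forall>As \<in> {h0, h1}. length As \<le> length (tms (it' ! 1)) \<and>
    (\<forall>A \<in> set As. \<exists>z t. z \<in> set (tms (it' ! 1)) \<and> t \<in> set (tms (it ! 0)) \<union> set (tms (it ! 1)) \<union> set (tms (it' ! 0)) \<and>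
       A = Atom (name z) [t]))"
proof -
  have f: "func (it ! 2)" "func (it ! 3)" using e by (simp_all add: edge_def)
  obtain h where h: "extends (tgd_of it') (asg (it ! 3)) h" "hom_image h (it' ! 1) \<subseteq> facts it"
    using x unfolding extendable_def by blast
  define P0 where "P0 t s \<longleftrightarrow> (s \<in> set (tms (it ! 0)) \<or> s \<in> set (tms (it ! 1))) \<and> (\<exists>y. val_of (it ! 2) s y \<and> subst h t = tv y)" for t s
  define P1 where "P1 t s \<longleftrightarrow> s \<in> set (tms (it' ! 0)) \<and> (\<exists>y. val_of (it ! 3) s y \<and> subst h t = tv y)" for t s
  have J: "\<exists>B \<in> set (it ! 4) \<union> set (it ! 5). map_atom (subst h) A = map_atom tv B" if "A \<in> set (it' ! 1)" for A
    using h(2) that unfolding hom_image_def facts_def by blast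
  have P: "(\<exists>s. P0 t s) \<or> (\<exists>s. P1 t s)" if t: "t \<in> set (tms (it' ! 1))" for t
  proof -
    obtain A where A: "A \<in> set (it' ! 1)" "t \<in> set (args A)" using t by (auto simp: tms_def)
    obtain B where B: "B \<in> set (it ! 4) \<union> set (it ! 5)" "map_atom (subst h) A = map_atom tv B" using J[OF A(1)] by blast
    have "subst h t \<in> set (map tv (args B))" using A(2) B(2) unfolding map_atom_eq by (metis image_eqI set_map)
    then obtain y where y: "y \<in> set (args B)" "subst h t = tv y" by auto
    have "(\<exists>C \<in> set (it ! 0) \<union> set (it ! 1). img_of (val_of (it ! 2)) C B) \<or> (\<exists>C \<in> set (it' ! 0). img_of (val_of (it ! 3)) C B)"
      using e B(1) unfolding edge_def by blast
    then show ?thesis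
    proof
      assume "\<exists>C \<in> set (it ! 0) \<union> set (it ! 1). img_of (val_of (it ! 2)) C B"
      then obtain C s where "C \<in> set (it ! 0) \<union> set (it ! 1)" "s \<in> set (args C)" "val_of (it ! 2) s y"
        using img_right[OF _ y(1)] by blast
      then have "P0 t s" using y(2) unfolding P0_def tms_def by auto
      then show ?thesis by blast
    next
      assume "\<exists>C \<in> set (it' ! 0). img_of (val_of (it ! 3)) C B"
      then obtain C s where "C \<in> set (it' ! 0)" "s \<in> set (args C)" "val_of (it ! 3) s y"
        using img_right[OF _ y(1)] by blast
      then have "P1 t s" using y(2) unfolding P1_def tms_def by auto
      then show ?thesis by blast
    qed
  qed
  define zs where "zs = filter (\<lambda>t. is_var t \<and> \<not> occ t (it' ! 0)) (tms (it' ! 1))"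
  define s0 where "s0 t = (SOME s. P0 t s)" for t
  define s1 where "s1 t = (SOME s. P1 t s)" for t
  define h0 where "h0 = map (\<lambda>t. Atom (name t) [s0 t]) (filter (\<lambda>t. \<exists>s. P0 t s) zs)"
  \<comment> \<open>A variable enters \<open>h1\<close> only if no term of the first tgd names its
    value; this keeps the names in the two slots disjoint.\<close>
  define h1 where "h1 = map (\<lambda>t. Atom (name t) [s1 t]) (filter (\<lambda>t. \<not> (\<exists>s. P0 t s)) zs)"
  have s0: "P0 t (s0 t)" if "\<exists>s. P0 t s" for t using someI_ex[OF that] by (simp add: s0_def)
  have s1: "P1 t (s1 t)" if "t \<in> set zs" "\<not> (\<exists>s. P0 t s)" for t
  proof -
    have "\<exists>s. P1 t s" using P[of t] that by (auto simp: zs_def)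
    then show ?thesis unfolding s1_def by (rule someI_ex)
  qed
  have nm: "t = u" if "t \<in> set zs" "u \<in> set zs" "name t = name u" for t u
    using that by (simp add: zs_def trm_eq_iff)
  have func: "func h0" "func h1" "\<forall>A \<in> set h0. \<forall>B \<in> set h1. rel A \<noteq> rel B"
  proof -
    have m0: "\<exists>z \<in> set zs. (\<exists>s. P0 z s) \<and> A = Atom (name z) [s0 z]" if "A \<in> set h0" for A
      using that by (auto simp: h0_def)
    have m1: "\<exists>z \<in> set zs. \<not> (\<exists>s. P0 z s) \<and> A = Atom (name z) [s1 z]" if "A \<in> set h1" for A
      using that by (auto simp: h1_def)
    show "func h0" unfolding func_def
    proof (intro ballI impI)
      fix A B y z assume "A \<in> set h0" "B \<in> set h0" and r: "rel A = rel B" and yz: "y \<in> set (args A)" "z \<in> set (args B)"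
      then obtain a b where ab: "a \<in> set zs" "A = Atom (name a) [s0 a]" "b \<in> set zs" "B = Atom (name b) [s0 b]"
        using m0[of A] m0[of B] by auto
      then have "a = b" using nm r by simp
      then show "y = z" using yz ab by simp
    qed
    show "func h1" unfolding func_def
    proof (intro ballI impI)
      fix A B y z assume "A \<in> set h1" "B \<in> set h1" and r: "rel A = rel B" and yz: "y \<in> set (args A)" "z \<in> set (args B)"
      then obtain a b where ab: "a \<in> set zs" "A = Atom (name a) [s1 a]" "b \<in> set zs" "B = Atom (name b) [s1 b]"
        using m1[of A] m1[of B] by auto
      then have "a = b" using nm r by simp
      then show "y = z" using yz ab by simp
    qed
    show "\<forall>A \<in> set h0. \<forall>B \<in> set h1. rel A \<noteq> rel B"
    proof (intro ballI)
      fix A B assume AB: "A \<in> set h0" "B \<in> set h1"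
      obtain a where a: "a \<in> set zs" "\<exists>s. P0 a s" "A = Atom (name a) [s0 a]" using m0[OF AB(1)] by blast
      obtain b where b: "b \<in> set zs" "\<not> (\<exists>s. P0 b s)" "B = Atom (name b) [s1 b]" using m1[OF AB(2)] by blast
      have "a \<noteq> b" using a(2) b(2) by blast
      then show "rel A \<noteq> rel B" using nm[OF a(1) b(1)] a(3) b(3) by auto
    qed
  qed
  have val: "ext_val it it' [h0, h1] t y" if t: "t \<in> set (tms (it' ! 1))" and y: "subst h t = tv y" for t y
  proof (cases "is_var t")
    case False
    then have "subst h t = tv t" by (cases t) simp_all
    then show ?thesis using y False by (simp add: ext_val_def)
  next
    case True
    then obtain x where tx: "t = Var x" by (auto simp: is_var_def)
    show ?thesis
    proof (cases "occ t (it' ! 0)")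
      case oc: True
      then obtain A where A: "A \<in> set (it' ! 0)" "t \<in> set (args A)" by (auto simp: occ_def)
      moreover have "\<forall>A \<in> set (it' ! 0). (\<exists>B \<in> set (it ! 4). img_of (val_of (it ! 3)) A B) \<or> (\<exists>B \<in> set (it ! 5). img_of (val_of (it ! 3)) A B)"
        using e by (simp add: edge_def)
      ultimately obtain B where B: "img_of (val_of (it ! 3)) A B" by blast
      obtain v where v: "val_of (it ! 3) t v" using img_left[OF B A(2)] by blast
      have "h x = asg (it ! 3) x" using h(1) oc by (simp add: extends_def univ_tgd_of tx)
      then have "val_of (it ! 3) t y" using y by (intro val_conv[OF f(2) v]) (simp add: tx)
      then show ?thesis using True oc by (simp add: ext_val_def)
    next
      case False
      then have z: "t \<in> set zs" using t True by (simp add: zs_def)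
      show ?thesis
      proof (cases "\<exists>s. P0 t s")
        case p: True
        then have "Atom (name t) [s0 t] \<in> set h0" using z by (auto simp: h0_def)
        moreover have "val_of (it ! 2) (s0 t) y"
        proof -
          obtain y' where "val_of (it ! 2) (s0 t) y'" "subst h t = tv y'"
            using s0[OF p] unfolding P0_def by blast
          then show ?thesis using y by simp
        qed
        ultimately have "\<exists>A \<in> set ([h0, h1] ! 0). rel A = name t \<and> (\<exists>z \<in> set (args A). val_of (it ! 2) z y)"
          by (intro bexI[of _ "Atom (name t) [s0 t]"]) simp_all
        then show ?thesis unfolding ext_val_def
          by (intro disjI2 conjI True False disjI1)
      next
        case p: False
        then have "Atom (name t) [s1 t] \<in> set h1" using z by (auto simp: h1_def)
        moreover have "val_of (it ! 3) (s1 t) y"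
        proof -
          obtain y' where "val_of (it ! 3) (s1 t) y'" "subst h t = tv y'"
            using s1[OF z p] unfolding P1_def by blast
          then show ?thesis using y by simp
        qed
        ultimately have "\<exists>A \<in> set ([h0, h1] ! 1). rel A = name t \<and> (\<exists>z \<in> set (args A). val_of (it ! 3) z y)"
          by (intro bexI[of _ "Atom (name t) [s1 t]"]) simp_all
        then show ?thesis unfolding ext_val_def
          by (intro disjI2 conjI True False)
      qed
    qed
  qed
  have "\<exists>B \<in> set (it ! 4) \<union> set (it ! 5). img_of (ext_val it it' [h0, h1]) A B" if A: "A \<in> set (it' ! 1)" for A
  proof -
    obtain B where "B \<in> set (it ! 4) \<union> set (it ! 5)" "map_atom (subst h) A = map_atom tv B" using J[OF A] by blast
    moreover have "t \<in> set (tms (it' ! 1))" if "t \<in> set (args A)" for t using A that by (auto simp: tms_def)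
    ultimately show ?thesis using img_conv[of h A B "ext_val it it' [h0, h1]"] val by blast
  qed
  note J' = this
  have "ext it it' [h0, h1]" unfolding ext_def
  proof (intro conjI ballI)
    show "func ([h0, h1] ! 0)" "func ([h0, h1] ! 1)" using func by simp_all
    show "rel A \<noteq> rel B" if "A \<in> set ([h0, h1] ! 0)" "B \<in> set ([h0, h1] ! 1)" for A B using func that by simp
    show "(\<exists>B \<in> set (it ! 4). img_of (ext_val it it' [h0, h1]) A B) \<or> (\<exists>B \<in> set (it ! 5). img_of (ext_val it it' [h0, h1]) A B)"
      if "A \<in> set (it' ! 1)" for A using J'[OF that] by blast
  qed
  moreover have "length As \<le> length (tms (it' ! 1)) \<and> (\<forall>A \<in> set As. \<exists>z t. z \<in> set (tms (it' ! 1)) \<and>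
      t \<in> set (tms (it ! 0)) \<union> set (tms (it ! 1)) \<union> set (tms (it' ! 0)) \<and> A = Atom (name z) [t])" if hs: "As = h0 \<or> As = h1" for As
  proof
    have "length zs \<le> length (tms (it' ! 1))" by (simp add: zs_def)
    moreover have "length h0 \<le> length zs" "length h1 \<le> length zs" unfolding h0_def h1_def by simp_all
    ultimately show "length As \<le> length (tms (it' ! 1))" using hs by auto
    have z: "z \<in> set (tms (it' ! 1))" if "z \<in> set zs" for z using that by (simp add: zs_def)
    show "\<forall>A \<in> set As. \<exists>z t. z \<in> set (tms (it' ! 1)) \<and>
      t \<in> set (tms (it ! 0)) \<union> set (tms (it ! 1)) \<union> set (tms (it' ! 0)) \<and> A = Atom (name z) [t]"
    proof
      fix A assume "A \<in> set As"
      with hs have "A \<in> set h0 \<or> A \<in> set h1" by blast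
      then consider x where "x \<in> set zs" "\<exists>s. P0 x s" "A = Atom (name x) [s0 x]"
        | x where "x \<in> set zs" "\<not> (\<exists>s. P0 x s)" "A = Atom (name x) [s1 x]"
        unfolding h0_def h1_def set_map set_filter by blast
      then show "\<exists>z t. z \<in> set (tms (it' ! 1)) \<and>
        t \<in> set (tms (it ! 0)) \<union> set (tms (it ! 1)) \<union> set (tms (it' ! 0)) \<and> A = Atom (name z) [t]"
      proof cases
        case (1 x)
        have "s0 x \<in> set (tms (it ! 0)) \<union> set (tms (it ! 1)) \<union> set (tms (it' ! 0))" using s0[OF 1(2)] by (simp add: P0_def)
        then show ?thesis using z[OF 1(1)] 1(3) by blast
      next
        case (2 x)
        have "s1 x \<in> set (tms (it ! 0)) \<union> set (tms (it ! 1)) \<union> set (tms (it' ! 0))" using s1[OF 2(1,2)] by (simp add: P1_def)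
        then show ?thesis using z[OF 2(1)] 2(3) by blast
      qed
    qed
  qed
  ultimately show ?thesis by (intro exI[of _ h0] exI[of _ h1]) simp
qed

section \<open>From a verified step to an edge of the chase graph\<close>

lemma map_atom_args: "set (args (map_atom f A)) = f ` set (args A)"
  by (cases A) simp

lemma edge_prec:
  assumes e: "edge it it'" and nx: "\<not> extendable it it'"
  shows "tgd_of it \<prec> tgd_of it'"
proof -
  \<comment> \<open>Slot 2 assigns universal and existential variables alike, so \<open>?h1\<close>
    serves both as the trigger and as its fresh extension.\<close>
  let ?I = "map_atom tv ` set (it ! 4)" and ?h1 = "asg (it ! 2)" and ?h2 = "asg (it ! 3)"
  let ?J = "?I \<union> hom_image ?h1 (it ! 1)"
  have f: "func (it ! 2)" "func (it ! 3)" using e by (simp_all add: edge_def)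
  have i2: "map_atom (subst ?h1) A = map_atom tv B" if "img_of (val_of (it ! 2)) A B" for A B
    using img_asg[OF that] val_asg[OF f(1)] by blast
  have i3: "map_atom (subst ?h2) A = map_atom tv B" if "img_of (val_of (it ! 3)) A B" for A B
    using img_asg[OF that] val_asg[OF f(2)] by blast
  have body1: "hom_image ?h1 (it ! 0) \<subseteq> ?I"
    using e i2 unfolding edge_def hom_image_def by fastforce
  have head1: "hom_image ?h1 (it ! 1) = map_atom tv ` set (it ! 5)"
  proof
    show "hom_image ?h1 (it ! 1) \<subseteq> map_atom tv ` set (it ! 5)"
      using e i2 unfolding edge_def hom_image_def by fastforce
    show "map_atom tv ` set (it ! 5) \<subseteq> hom_image ?h1 (it ! 1)"
    proof
      fix X assume "X \<in> map_atom tv ` set (it ! 5)"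
      then obtain B A where "X = map_atom tv B" "A \<in> set (it ! 1)" "img_of (val_of (it ! 2)) A B"
        using e unfolding edge_def by blast
      then show "X \<in> hom_image ?h1 (it ! 1)" using i2[of A B] unfolding hom_image_def by (metis imageI)
    qed
  qed
  then have J: "?J = facts it" by (auto simp: facts_def)
  have body2: "hom_image ?h2 (it' ! 0) \<subseteq> ?J"
  proof
    fix X assume "X \<in> hom_image ?h2 (it' ! 0)"
    then obtain A where A: "A \<in> set (it' ! 0)" "X = map_atom (subst ?h2) A" by (auto simp: hom_image_def)
    then obtain B where "B \<in> set (it ! 4) \<union> set (it ! 5)" "img_of (val_of (it ! 3)) A B" using e unfolding edge_def by blast
    then show "X \<in> ?J" unfolding J facts_def using i3 A(2) by blast
  qed
  \<comment> \<open>This makes condition (i) hold vacuously: the body of the second tgd fails before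
    the step.\<close>
  have new: "\<not> hom_image ?h2 (it' ! 0) \<subseteq> ?I"
  proof
    assume s: "hom_image ?h2 (it' ! 0) \<subseteq> ?I"
    obtain A where A: "A \<in> set (it' ! 0)" "\<forall>B \<in> set (it ! 4). \<not> img_of (val_of (it ! 3)) A B" using e unfolding edge_def by blast
    \<comment> \<open>Any image of \<open>A\<close> shows that slot 3 lists a value for each of its
      variables. Only then does evaluation by \<open>?h2\<close> determine \<open>val_of\<close>, as
      \<open>?h2\<close> is unspecified elsewhere.\<close>
    obtain C where "img_of (val_of (it ! 3)) A C" using A(1) e unfolding edge_def by blast
    then have tot: "\<exists>v. val_of (it ! 3) t v" if "t \<in> set (args A)" for t using img_left that by blast
    obtain B where B: "B \<in> set (it ! 4)" "map_atom (subst ?h2) A = map_atom tv B" using s A(1) unfolding hom_image_def by blast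
    have "img_of (val_of (it ! 3)) A B"
      by (rule img_conv[OF B(2)]) (use tot val_conv[OF f(2)] in blast)
    then show False using A(2) B(1) by blast
  qed
  have ex: "\<exists>y. val_of (it ! 2) (Var z) y \<and> ?h1 z = tv y \<and> is_var y \<and> \<not> occ y (it ! 4) \<and>
      (\<forall>z' y'. z' \<in> ex_vars (tgd_of it) \<longrightarrow> val_of (it ! 2) (Var z') y' \<longrightarrow> y' = y \<longrightarrow> z' = z)"
    if z: "z \<in> ex_vars (tgd_of it)" for z
  proof -
    have o: "occ (Var z) (it ! 1)" "\<not> occ (Var z) (it ! 0)" using z by (simp_all add: ex_vars_def tgd_of_def occ_Var)
    then obtain A where A: "A \<in> set (it ! 1)" "Var z \<in> set (args A)" by (auto simp: occ_def)
    then obtain B where "img_of (val_of (it ! 2)) A B" using e unfolding edge_def by blast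
    then obtain y where y: "val_of (it ! 2) (Var z) y" using img_left A(2) by blast
    have fr: "fresh it" using e by (simp add: edge_def)
    obtain C where C: "C \<in> set (it ! 2)" "rel C = z" "y \<in> set (args C)" using y by (auto simp: val_of_def)
    have fy: "is_var y \<and> \<not> occ y (it ! 4) \<and> (\<forall>z'. occ z' (it ! 1) \<and> is_var z' \<and> \<not> occ z' (it ! 0) \<longrightarrow>
         (\<forall>A' \<in> set (it ! 2). rel A' = name z' \<longrightarrow> y \<in> set (args A') \<longrightarrow> Var z = z'))"
      using fr[unfolded fresh_def, rule_format, of "Var z" C y] o C by auto
    have "z' = z" if a: "z' \<in> ex_vars (tgd_of it)" and b: "val_of (it ! 2) (Var z') y" for z'
    proof -
      have "occ (Var z') (it ! 1)" "\<not> occ (Var z') (it ! 0)" using a by (simp_all add: ex_vars_def tgd_of_def occ_Var)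
      moreover obtain C' where "C' \<in> set (it ! 2)" "rel C' = z'" "y \<in> set (args C')" using b by (auto simp: val_of_def)
      ultimately have "Var z = Var z'" using fy by auto
      then show ?thesis by simp
    qed
    moreover have "?h1 z = tv y" using val_asg[OF f(1) y] by simp
    ultimately show ?thesis using y fy by blast
  qed
  have fresh: "fresh_ext ?I (tgd_of it) ?h1 ?h1"
    unfolding fresh_ext_def
  proof (intro conjI ballI)
    show "extends (tgd_of it) ?h1 ?h1" by (simp add: extends_def)
    show "inj_on ?h1 (ex_vars (tgd_of it))"
    proof (rule inj_onI)
      fix z z' assume "z \<in> ex_vars (tgd_of it)" "z' \<in> ex_vars (tgd_of it)" "?h1 z = ?h1 z'"
      then show "z = z'" using ex[of z] ex[of z'] by (metis tv_inject)
    qed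
    fix z assume "z \<in> ex_vars (tgd_of it)"
    from ex[OF this] obtain y where y: "?h1 z = tv y" "is_var y" "\<not> occ y (it ! 4)" by blast
    then show "?h1 z \<in> range Null" by (auto simp: is_var_def)
    show "?h1 z \<notin> inst_vals ?I"
      using y(1,3) by (auto simp: inst_vals_def map_atom_args occ_def)
  qed
  show ?thesis unfolding prec_def
  proof (intro exI conjI)
    show "finite ?I" by simp
    show "sat ?I ?h2 (tgd_of it')" using new by (simp add: sat_def tgd_of_def)
    show "oblivious_step ?I (tgd_of it) ?h1 ?J"
      unfolding oblivious_step_def using body1 fresh by (auto simp: tgd_of_def)
    show "\<not> sat ?J ?h2 (tgd_of it')"
      using nx body2 unfolding sat_def extendable_def J by (simp add: tgd_of_def)
  qed
qed

section \<open>From an edge of the chase graph to a small witness\<close>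

lemma hom_image_cong: "(\<And>x. x \<in> atom_vars As \<Longrightarrow> h x = k x) \<Longrightarrow> hom_image h As = hom_image k As"
proof -
  assume a: "\<And>x. x \<in> atom_vars As \<Longrightarrow> h x = k x"
  have "map_atom (subst h) A = map_atom (subst k) A" if A: "A \<in> set As" for A
  proof -
    have "subst h t = subst k t" if t: "t \<in> set (args A)" for t
    proof (cases t)
      case (Var x)
      then have "x \<in> atom_vars As" using t A unfolding atom_vars_def by blast
      then show ?thesis using a Var by simp
    qed simp
    then show ?thesis unfolding map_atom_eq by simp
  qed
  then show ?thesis unfolding hom_image_def by (rule image_cong[OF refl])
qed

lemma img_graph:
  assumes "\<And>t v. t \<in> set (args A) \<Longrightarrow> R t v \<longleftrightarrow> v = g t"
  shows "img_of R A B \<longleftrightarrow> B = map_atom g A"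
proof -
  have "list_all2 R (args A) (args B) \<longleftrightarrow> args B = map g (args A)"
    unfolding list_all2_conv_all_nth list_eq_iff_nth_eq using assms by (auto simp: nth_mem)
  then show ?thesis unfolding img_of_def by (cases A; cases B) auto
qed

text \<open>The two shapes are the atoms of an assignment, named after a term and with one argument,
  and facts with relation and arity of an atom of the tgds. Arguments are terms of \<open>T\<close>
  or nulls numbered below its length.\<close>

definition small_atom :: "trm list \<Rightarrow> trm atom set \<Rightarrow> trm atom \<Rightarrow> bool" where
  "small_atom T Bs A \<longleftrightarrow> ((\<exists>t \<in> set T. rel A = name t \<and> length (args A) = 1) \<or>
      (\<exists>B \<in> Bs. rel A = rel B \<and> length (args A) = length (args B))) \<and>
     (\<forall>t \<in> set (args A). t \<in> set T \<or> (\<exists>i < length T. t = Var i))"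

text \<open>A chase edge has a witness whose values are constants of the two tgds and few nulls: only the
  facts used by the two triggers matter, and all other values may be renamed to nulls.\<close>

lemma prec_edge:
  assumes prec: "\<xi>1 \<prec> \<xi>2"
  defines "T \<equiv> tms (body \<xi>1) @ tms (head \<xi>1) @ tms (body \<xi>2)"
  shows "\<exists>a2 a3 Il Kl. (\<forall>P it'. it' ! 0 = body \<xi>2 \<longrightarrow> it' ! 1 = head \<xi>2 \<longrightarrow>
      edge [body \<xi>1, head \<xi>1, a2, a3, Il, Kl, P] it' \<and> \<not> extendable [body \<xi>1, head \<xi>1, a2, a3, Il, Kl, P] it') \<and>
    (\<forall>As \<in> {a2, a3, Il, Kl}. length As \<le> length T + length (body \<xi>1) + length (head \<xi>1) + length (body \<xi>2) \<and>
      (\<forall>A \<in> set As. small_atom T (set (body \<xi>1) \<union> set (head \<xi>1) \<union> set (body \<xi>2)) A))"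
proof -
  obtain I h1 h2 J where fin: "finite I" and s1: "sat I h2 \<xi>2" and st: "oblivious_step I \<xi>1 h1 J" and s2: "\<not> sat J h2 \<xi>2"
    using prec unfolding prec_def by blast
  obtain h' where b1: "hom_image h1 (body \<xi>1) \<subseteq> I" and fr: "fresh_ext I \<xi>1 h1 h'" and J: "J = I \<union> hom_image h' (head \<xi>1)"
    using st unfolding oblivious_step_def by blast
  \<comment> \<open>From here on \<open>h'\<close> takes the place of \<open>h1\<close>, with which
    it agrees on the body; one assignment then describes the whole step.\<close>
  have "hom_image h' (body \<xi>1) = hom_image h1 (body \<xi>1)"
    by (rule hom_image_cong) (use fr in \<open>simp add: fresh_ext_def extends_def univ_vars_def\<close>)
  then have B1: "map_atom (subst h') A \<in> I" if "A \<in> set (body \<xi>1)" for A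
    using b1 that unfolding hom_image_def by blast
  have b2: "hom_image h2 (body \<xi>2) \<subseteq> J" and nx: "\<And>k. extends \<xi>2 h2 k \<Longrightarrow> \<not> hom_image k (head \<xi>2) \<subseteq> J"
    using s2 unfolding sat_def by blast+
  have new: "\<not> hom_image h2 (body \<xi>2) \<subseteq> I"
  proof
    assume "hom_image h2 (body \<xi>2) \<subseteq> I"
    then obtain k where "extends \<xi>2 h2 k" "hom_image k (head \<xi>2) \<subseteq> I" using s1 unfolding sat_def by blast
    then show False using nx J by blast
  qed
  define T1 where "T1 = tms (body \<xi>1) @ tms (head \<xi>1)"
  \<comment> \<open>These are the values that the two triggers give to terms of the tgds. Listing
    them bounds their number by the length of \<open>T\<close>.\<close>
  define L where "L = map (subst h') T1 @ map (subst h2) (tms (body \<xi>2))"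
  define V where "V = set L"
  have V1: "subst h' t \<in> V" if "t \<in> set T1" for t using that by (simp add: V_def L_def)
  have V2: "subst h2 t \<in> V" if "t \<in> set (tms (body \<xi>2))" for t using that by (simp add: V_def L_def)
  have cardV: "card V \<le> length T"
    using card_length[of L] by (simp add: V_def L_def T_def T1_def)
  obtain f where f: "bij_betw f V {0..<card V}" using ex_bij_betw_finite_nat[of V] by (auto simp: V_def)
  define C where "C = {c. Cst c \<in> set T}"
  \<comment> \<open>A constant of the tgds must be its own image, since it stands in the atoms to be
    matched. Nulls remain nulls and distinct values in \<open>V\<close> remain distinct, so
    freshness survives the renaming.\<close>
  define g where "g v = (case v of Const c \<Rightarrow> if c \<in> C then Cst c else Var (f v) | Null n \<Rightarrow> Var (f v))" for v
  have g_Cst: "v = Const c" if "g v = Cst c" for v c using that by (auto simp: g_def split: val.splits if_splits)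
  have g_inj: "inj_on g V"
  proof (rule inj_onI)
    fix v w assume vw: "v \<in> V" "w \<in> V" "g v = g w"
    show "v = w"
    proof (cases "g v")
      case (Cst c)
      then show ?thesis using g_Cst vw(3) by metis
    next
      case (Var n)
      then have "f v = f w" using vw(3) by (auto simp: g_def split: val.splits if_splits)
      then show ?thesis using f vw(1,2) unfolding bij_betw_def inj_on_def by blast
    qed
  qed
  have gV: "g v \<in> set T \<or> (\<exists>i < length T. g v = Var i)" if "v \<in> V" for v
  proof -
    have "f v < length T" using bij_betwE[OF f] that cardV by fastforce
    then show ?thesis by (auto simp: g_def C_def split: val.splits)
  qed
  define G1 where "G1 t = g (subst h' t)" for t
  define G2 where "G2 t = g (subst h2 t)" for t
  have cst: "G1 t = t" "G2 t = t" if ht: "t \<in> set T" "\<not> is_var t" for t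
  proof -
    obtain c where c: "t = Cst c" using ht(2) by (cases t) auto
    then have "g (Const c) = t" using ht(1) by (simp add: g_def C_def)
    then show "G1 t = t" "G2 t = t" by (simp_all add: c G1_def G2_def)
  qed
  define a2 where "a2 = map (\<lambda>t. Atom (name t) [G1 t]) (filter is_var T1)"
  define a3 where "a3 = map (\<lambda>t. Atom (name t) [G2 t]) (filter is_var (tms (body \<xi>2)))"
  have func: "func (map (\<lambda>t. Atom (name t) [G t]) (filter is_var ts))" for G ts
    unfolding func_def
  proof (intro ballI impI)
    fix A B y z assume "A \<in> set (map (\<lambda>t. Atom (name t) [G t]) (filter is_var ts))"
      "B \<in> set (map (\<lambda>t. Atom (name t) [G t]) (filter is_var ts))" "rel A = rel B" and yz: "y \<in> set (args A)" "z \<in> set (args B)"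
    then obtain t u where tu: "is_var t" "is_var u" "A = Atom (name t) [G t]" "B = Atom (name u) [G u]" and "rel A = rel B" by auto
    then have "t = u" by (simp add: trm_eq_iff)
    then show "y = z" using yz tu by simp
  qed
  have val: "val_of (map (\<lambda>t. Atom (name t) [G t]) (filter is_var ts)) t v \<longleftrightarrow> v = G t"
    if "t \<in> set ts" "\<not> is_var t \<Longrightarrow> G t = t" for G ts t v
  proof (cases "is_var t")
    case True
    have "(\<exists>A \<in> set (map (\<lambda>t. Atom (name t) [G t]) (filter is_var ts)). rel A = name t \<and> v \<in> set (args A)) \<longleftrightarrow>
      (\<exists>u \<in> set ts. is_var u \<and> name u = name t \<and> v = G u)" by (simp add: Bex_def image_iff conj_assoc) force
    also have "\<dots> \<longleftrightarrow> v = G t"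
    proof
      assume "\<exists>u \<in> set ts. is_var u \<and> name u = name t \<and> v = G u"
      then obtain u where u: "is_var u" "name u = name t" "v = G u" by blast
      then have "u = t" using True trm_eq_iff[of u t] by blast
      then show "v = G t" using u(3) by simp
    next
      assume "v = G t"
      with that(1) True show "\<exists>u \<in> set ts. is_var u \<and> name u = name t \<and> v = G u" by (intro bexI[of _ t] conjI refl)
    qed
    finally show ?thesis using True by (simp add: val_of_def)
  next
    case False
    then show ?thesis using that(2)[OF False] by (auto simp: val_of_def)
  qed
  have val2: "val_of a2 t v \<longleftrightarrow> v = G1 t" if "t \<in> set T1" for t v
    unfolding a2_def using that by (intro val cst) (auto simp: T_def T1_def)
  have val3: "val_of a3 t v \<longleftrightarrow> v = G2 t" if "t \<in> set (tms (body \<xi>2))" for t v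
    unfolding a3_def using that by (intro val cst) (auto simp: T_def)
  have args1: "set (args A) \<subseteq> set T1" if "A \<in> set (body \<xi>1) \<union> set (head \<xi>1)" for A
    using that by (auto simp: T1_def tms_def)
  have args2: "set (args A) \<subseteq> set (tms (body \<xi>2))" if "A \<in> set (body \<xi>2)" for A
    using that by (auto simp: tms_def)
  have img2: "img_of (val_of a2) A B \<longleftrightarrow> B = map_atom G1 A" if "A \<in> set (body \<xi>1) \<union> set (head \<xi>1)" for A B
    by (rule img_graph) (use args1[OF that] val2 in blast)
  have img3: "img_of (val_of a3) A B \<longleftrightarrow> B = map_atom G2 A" if "A \<in> set (body \<xi>2)" for A B
    by (rule img_graph) (use args2[OF that] val3 in blast)
  have mg1: "map_atom G1 A = map_atom g (map_atom (subst h') A)" for A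
    by (cases A) (simp add: G1_def)
  have mg2: "map_atom G2 A = map_atom g (map_atom (subst h2) A)" for A
    by (cases A) (simp add: G2_def)
  have v1: "set (args (map_atom (subst h') A)) \<subseteq> V" if "A \<in> set (body \<xi>1) \<union> set (head \<xi>1)" for A
    using args1[OF that] V1 by (auto simp: map_atom_args)
  have v2: "set (args (map_atom (subst h2) A)) \<subseteq> V" if "A \<in> set (body \<xi>2)" for A
    using args2[OF that] V2 by (auto simp: map_atom_args)
  have mg_inj: "X = Y" if "map_atom g X = map_atom g Y" "set (args X) \<subseteq> V" "set (args Y) \<subseteq> V" for X Y
  proof -
    have "inj_on g (set (args X) \<union> set (args Y))" using g_inj that(2,3) by (meson Un_least inj_on_subset)
    then show ?thesis using that(1) by (cases X; cases Y) (auto simp: inj_on_map_eq_map)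
  qed
  \<comment> \<open>Images of the second body enter only if they lie in \<open>I\<close>; the others
    come from the head and are in \<open>Kl\<close>. Adding them here would make the body hold
    before the step.\<close>
  define Il where "Il = map (map_atom G1) (body \<xi>1) @ map (map_atom G2) (filter (\<lambda>A. map_atom (subst h2) A \<in> I) (body \<xi>2))"
  define Kl where "Kl = map (map_atom G1) (head \<xi>1)"
  have Il: "\<exists>X \<in> I. set (args X) \<subseteq> V \<and> B = map_atom g X" if B: "B \<in> set Il" for B
  proof -
    consider A where "A \<in> set (body \<xi>1)" "B = map_atom G1 A"
      | A where "A \<in> set (body \<xi>2)" "map_atom (subst h2) A \<in> I" "B = map_atom G2 A" using B by (auto simp: Il_def)
    then show ?thesis
    proof cases
      case (1 A)
      then show ?thesis using B1[OF 1(1)] v1[of A] mg1 by blast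
    next
      case (2 A)
      then show ?thesis using v2[OF 2(1)] mg2 by blast
    qed
  qed
  have Kl': "\<exists>X \<in> J. set (args X) \<subseteq> V \<and> B = map_atom g X" if B: "B \<in> set Kl" for B
  proof -
    obtain A where A: "A \<in> set (head \<xi>1)" "B = map_atom G1 A" using B by (auto simp: Kl_def)
    then have "map_atom (subst h') A \<in> J" unfolding J hom_image_def by blast
    then show ?thesis using v1[of A] mg1 A by blast
  qed
  let ?it = "\<lambda>P. [body \<xi>1, head \<xi>1, a2, a3, Il, Kl, P]"
  have fresh: "fresh (?it P)" for P
  proof -
    have ex: "\<exists>x. z = Var x \<and> x \<in> ex_vars \<xi>1 \<and> z \<in> set T1" if "occ z (head \<xi>1)" "is_var z" "\<not> occ z (body \<xi>1)" for z
      using that by (auto simp: is_var_def occ_Var ex_vars_def T1_def occ_tms[symmetric])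
    have a2v: "y = G1 z" if "z \<in> set T1" "is_var z" "A \<in> set a2" "rel A = name z" "y \<in> set (args A)" for z A y
      using val2[OF that(1), of y] that unfolding val_of_def by blast
    show ?thesis unfolding fresh_def
    proof (intro allI impI ballI conjI; (elim conjE)?)
      fix z A y
      assume z: "occ z (?it P ! 1)" "is_var z" "\<not> occ z (?it P ! 0)" and A: "A \<in> set (?it P ! 2)" "rel A = name z" "y \<in> set (args A)"
      obtain x where x: "z = Var x" "x \<in> ex_vars \<xi>1" "z \<in> set T1" using ex[of z] z by auto
      have y: "y = g (h' x)" using a2v[OF x(3) z(2)] A x(1) by (simp add: G1_def)
      have hx: "h' x \<in> range Null" "h' x \<notin> inst_vals I" using fr x(2) by (auto simp: fresh_ext_def)
      have hV: "h' x \<in> V" using V1[OF x(3)] x(1) by simp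
      show "is_var y" using hx(1) y by (auto simp: g_def)
      show "\<not> occ y (?it P ! 4)"
      proof
        assume "occ y (?it P ! 4)"
        then obtain B where "B \<in> set Il" "y \<in> set (args B)" by (auto simp: occ_def)
        then obtain X where X: "X \<in> I" "set (args X) \<subseteq> V" "y \<in> set (args (map_atom g X))" using Il by blast
        then obtain v where v: "v \<in> set (args X)" "y = g v" by (auto simp: map_atom_args)
        then have "v = h' x" using g_inj hV X(2) y by (auto dest: inj_onD)
        then show False using hx(2) X(1) v(1) by (auto simp: inst_vals_def)
      qed
      fix z' A' assume z': "occ z' (?it P ! 1)" "is_var z'" "\<not> occ z' (?it P ! 0)" and A': "A' \<in> set (?it P ! 2)" "rel A' = name z'" "y \<in> set (args A')"
      obtain x' where x': "z' = Var x'" "x' \<in> ex_vars \<xi>1" "z' \<in> set T1" using ex[of z'] z' by auto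
      have "y = g (h' x')" using a2v[OF x'(3) z'(2)] A' x'(1) by (simp add: G1_def)
      moreover have "h' x' \<in> V" using V1[OF x'(3)] x'(1) by simp
      ultimately have "h' x = h' x'" using g_inj hV y by (auto dest: inj_onD)
      then have "x = x'" using fr x(2) x'(2) by (auto simp: fresh_ext_def dest: inj_onD)
      then show "z = z'" using x(1) x'(1) by simp
    qed
  qed
  have main: "edge (?it P) it' \<and> \<not> extendable (?it P) it'" if it': "it' ! 0 = body \<xi>2" "it' ! 1 = head \<xi>2" for P it'
  proof
    have e1: "\<forall>A \<in> set (body \<xi>1). \<exists>B \<in> set Il. img_of (val_of a2) A B"
      using img2 by (auto simp: Il_def)
    have e2: "\<forall>A \<in> set (head \<xi>1). \<exists>B \<in> set Kl. img_of (val_of a2) A B"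
      using img2 by (auto simp: Kl_def)
    have e3: "\<forall>B \<in> set Kl. \<exists>A \<in> set (head \<xi>1). img_of (val_of a2) A B"
      using img2 by (auto simp: Kl_def)
    have e4: "(\<exists>B \<in> set Il. img_of (val_of a3) A B) \<or> (\<exists>B \<in> set Kl. img_of (val_of a3) A B)" if A: "A \<in> set (body \<xi>2)" for A
    proof (cases "map_atom (subst h2) A \<in> I")
      case True
      then have "map_atom G2 A \<in> set Il" using A by (auto simp: Il_def)
      then show ?thesis using img3[OF A] by blast
    next
      case False
      then obtain B where "B \<in> set (head \<xi>1)" "map_atom (subst h2) A = map_atom (subst h') B"
        using b2 A unfolding J hom_image_def by blast
      then have "map_atom G2 A \<in> set Kl" using mg1 mg2 by (auto simp: Kl_def)
      then show ?thesis using img3[OF A] by blast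
    qed
    have e5: "\<exists>A \<in> set (body \<xi>2). \<forall>B \<in> set Il. \<not> img_of (val_of a3) A B"
    proof -
      obtain A where A: "A \<in> set (body \<xi>2)" "map_atom (subst h2) A \<notin> I" using new unfolding hom_image_def by blast
      have "B \<noteq> map_atom G2 A" if B: "B \<in> set Il" for B
      proof
        assume "B = map_atom G2 A"
        moreover obtain X where X: "X \<in> I" "set (args X) \<subseteq> V" "B = map_atom g X" using Il[OF B] by blast
        \<comment> \<open>Injectivity of \<open>g\<close> on \<open>V\<close> keeps the missing body
          atom missing after the renaming.\<close>
        ultimately have "X = map_atom (subst h2) A" using mg_inj[OF _ X(2) v2[OF A(1)]] mg2 by metis
        then show False using X(1) A(2) by simp
      qed
      then show ?thesis using img3[OF A(1)] A(1) by blast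
    qed
    have e6: "(\<exists>A \<in> set (body \<xi>1). img_of (val_of a2) A B) \<or> (\<exists>A \<in> set (body \<xi>2). img_of (val_of a3) A B)" if hB: "B \<in> set Il" for B
    proof -
      consider A where "A \<in> set (body \<xi>1)" "B = map_atom G1 A" | A where "A \<in> set (body \<xi>2)" "B = map_atom G2 A"
        using hB by (auto simp: Il_def)
      then show ?thesis using img2 img3 by cases blast+
    qed
    have "func a2" "func a3" unfolding a2_def a3_def by (rule func)+
    then show "edge (?it P) it'" unfolding edge_def using fresh e1 e2 e3 e4 e5 e6 by (simp add: it')
    show "\<not> extendable (?it P) it'"
    proof
      assume "extendable (?it P) it'"
      then obtain k where k: "extends (tgd_of it') (asg a3) k" "hom_image k (head \<xi>2) \<subseteq> map_atom tv ` (set Il \<union> set Kl)"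
        unfolding extendable_def facts_def it'(2) by auto
      \<comment> \<open>An extension found after the renaming is pulled back along \<open>g\<close>.
        The inverse is well-defined where it matters: a value given to a head variable occurs in a
        renamed fact and so has the form \<open>tv (g v)\<close> with \<open>v\<close> in
        \<open>V\<close>.\<close>
      define k' where "k' x = (if x \<in> univ_vars \<xi>2 then h2 x else inv_into V (\<lambda>v. tv (g v)) (k x))" for x
      have inj: "inj_on (\<lambda>v. tv (g v)) V" using g_inj by (simp add: inj_on_def)
      have pt: "subst k' t = v" if "subst k t = tv (g v)" "v \<in> V" for t v
      proof (cases t)
        case (Cst c)
        then have "g v = Cst c" using that(1) by (cases "g v") auto
        then show ?thesis using g_Cst Cst by simp
      next
        case (Var x)
        show ?thesis
        proof (cases "x \<in> univ_vars \<xi>2")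
          case True
          then have o: "Var x \<in> set (tms (body \<xi>2))" by (simp add: univ_vars_def occ_Var[symmetric] occ_tms)
          have "univ_vars (tgd_of it') = univ_vars \<xi>2" by (simp add: univ_vars_def tgd_of_def it')
          then have "k x = asg a3 x" using k(1) True by (simp add: extends_def)
          also have "\<dots> = tv (G2 (Var x))" using val_asg[OF \<open>func a3\<close>, of "Var x" "G2 (Var x)"] val3[OF o] by simp
          finally have "g (h2 x) = g v" using that(1) Var by (simp add: G2_def)
          then have "h2 x = v" using g_inj V2[OF o] that(2) by (auto dest: inj_onD)
          then show ?thesis using Var True by (simp add: k'_def)
        next
          case False
          then show ?thesis using that Var inv_into_f_f[OF inj that(2)] by (simp add: k'_def)
        qed
      qed
      have "hom_image k' (head \<xi>2) \<subseteq> J"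
      proof
        fix Y assume "Y \<in> hom_image k' (head \<xi>2)"
        then obtain A where A: "A \<in> set (head \<xi>2)" "Y = map_atom (subst k') A" by (auto simp: hom_image_def)
        then obtain B where B: "B \<in> set Il \<union> set Kl" "map_atom (subst k) A = map_atom tv B" using k(2) unfolding hom_image_def by blast
        then obtain X where X: "X \<in> J" "set (args X) \<subseteq> V" "B = map_atom g X" using Il Kl' J by blast
        have r: "rel A = rel X" "map (subst k) (args A) = map (\<lambda>v. tv (g v)) (args X)"
          using B(2) X(3) by (cases A; cases X; simp)+
        then have len: "length (args A) = length (args X)" by (metis length_map)
        have "map (subst k') (args A) = args X"
        proof (rule nth_equalityI)
          fix i assume "i < length (map (subst k') (args A))"
          then have i: "i < length (args A)" "i < length (args X)" using len by simp_all
          have "subst k (args A ! i) = tv (g (args X ! i))" using r(2) i by (metis nth_map)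
          moreover have "args X ! i \<in> V" using X(2) i(2) nth_mem by blast
          ultimately have "subst k' (args A ! i) = args X ! i" by (rule pt)
          then show "map (subst k') (args A) ! i = args X ! i" using i by simp
        qed (simp add: len)
        then have "map_atom (subst k') A = X" using r(1) by (cases A; cases X) simp
        then show "Y \<in> J" using A(2) X(1) by simp
      qed
      moreover have "extends \<xi>2 h2 k'" by (simp add: extends_def k'_def)
      ultimately show False using nx by blast
    qed
  qed
  have T1T: "set T1 \<subseteq> set T" "set (tms (body \<xi>2)) \<subseteq> set T" by (auto simp: T_def T1_def)
  let ?Bs = "set (body \<xi>1) \<union> set (head \<xi>1) \<union> set (body \<xi>2)"
  have sm1: "small_atom T ?Bs (map_atom G1 A)" if A: "A \<in> set (body \<xi>1) \<union> set (head \<xi>1)" for A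
    unfolding small_atom_def
  proof
    have "rel (map_atom G1 A) = rel A" "length (args (map_atom G1 A)) = length (args A)" by (cases A; simp)+
    then show "(\<exists>t \<in> set T. rel (map_atom G1 A) = name t \<and> length (args (map_atom G1 A)) = 1) \<or>
      (\<exists>B \<in> ?Bs. rel (map_atom G1 A) = rel B \<and> length (args (map_atom G1 A)) = length (args B))" using A by blast
    show "\<forall>t \<in> set (args (map_atom G1 A)). t \<in> set T \<or> (\<exists>i < length T. t = Var i)"
      unfolding map_atom_args G1_def using gV V1 args1[OF A] by blast
  qed
  have sm2: "small_atom T ?Bs (map_atom G2 A)" if A: "A \<in> set (body \<xi>2)" for A
    unfolding small_atom_def
  proof
    have "rel (map_atom G2 A) = rel A" "length (args (map_atom G2 A)) = length (args A)" by (cases A; simp)+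
    then show "(\<exists>t \<in> set T. rel (map_atom G2 A) = name t \<and> length (args (map_atom G2 A)) = 1) \<or>
      (\<exists>B \<in> ?Bs. rel (map_atom G2 A) = rel B \<and> length (args (map_atom G2 A)) = length (args B))" using A by blast
    show "\<forall>t \<in> set (args (map_atom G2 A)). t \<in> set T \<or> (\<exists>i < length T. t = Var i)"
      unfolding map_atom_args G2_def using gV V2 args2[OF A] by blast
  qed
  have sm: "small_atom T ?Bs (Atom (name t) [w])" if "t \<in> set T" "w \<in> set T \<or> (\<exists>i < length T. w = Var i)" for t w
    using that by (auto simp: small_atom_def)
  have "length As \<le> length T + length (body \<xi>1) + length (head \<xi>1) + length (body \<xi>2) \<and> (\<forall>A \<in> set As. small_atom T ?Bs A)"
    if "As = a2 \<or> As = a3 \<or> As = Il \<or> As = Kl" for As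
    using that
  proof (elim disjE)
    assume As: "As = a2"
    have "length a2 \<le> length T1" unfolding a2_def length_map by (rule length_filter_le)
    then have "length a2 \<le> length T" by (simp add: T_def T1_def)
    moreover have "small_atom T ?Bs A" if A: "A \<in> set a2" for A
    proof -
      obtain t where "t \<in> set T1" "A = Atom (name t) [G1 t]" using A by (auto simp: a2_def)
      then show ?thesis using sm[of t "G1 t"] gV V1 T1T(1) unfolding G1_def by blast
    qed
    ultimately show ?thesis unfolding As by (intro conjI ballI) (linarith, blast)
  next
    assume As: "As = a3"
    have "length a3 \<le> length (tms (body \<xi>2))" unfolding a3_def length_map by (rule length_filter_le)
    then have "length a3 \<le> length T" by (simp add: T_def)
    moreover have "small_atom T ?Bs A" if A: "A \<in> set a3" for A
    proof -
      obtain t where "t \<in> set (tms (body \<xi>2))" "A = Atom (name t) [G2 t]" using A by (auto simp: a3_def)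
      then show ?thesis using sm[of t "G2 t"] gV V2 T1T(2) unfolding G2_def by blast
    qed
    ultimately show ?thesis unfolding As by (intro conjI ballI) (linarith, blast)
  next
    assume As: "As = Il"
    have "length Il \<le> length (body \<xi>1) + length (body \<xi>2)" unfolding Il_def by simp
    moreover have "small_atom T ?Bs A" if hA: "A \<in> set Il" for A
    proof -
      consider B where "B \<in> set (body \<xi>1)" "A = map_atom G1 B" | B where "B \<in> set (body \<xi>2)" "A = map_atom G2 B"
        using hA by (auto simp: Il_def)
      then show ?thesis using sm1 sm2 by cases blast+
    qed
    ultimately show ?thesis unfolding As by (intro conjI ballI) (linarith, blast)
  next
    assume As: "As = Kl"
    have "length Kl = length (head \<xi>1)" unfolding Kl_def by simp
    moreover have "small_atom T ?Bs A" if "A \<in> set Kl" for A using that sm1 by (auto simp: Kl_def)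
    ultimately show ?thesis unfolding As by (intro conjI ballI) (linarith, blast)
  qed
  note sizes = this
  show ?thesis
  proof (intro exI conjI)
    show "\<forall>P it'. it' ! 0 = body \<xi>2 \<longrightarrow> it' ! 1 = head \<xi>2 \<longrightarrow> edge (?it P) it' \<and> \<not> extendable (?it P) it'"
      using main by blast
    show "\<forall>As \<in> {a2, a3, Il, Kl}. length As \<le> length T + length (body \<xi>1) + length (head \<xi>1) + length (body \<xi>2) \<and>
      (\<forall>A \<in> set As. small_atom T ?Bs A)"
      using sizes by (intro ballI) blast
  qed
qed

section \<open>Closed walks\<close>

text \<open>The list omits the final vertex. So walks are joined by appending, and the list of a
  closed walk has the form used by \<open>is_cycle\<close>.\<close>

fun walk :: "('a \<times> 'a) set \<Rightarrow> 'a \<Rightarrow> 'a list \<Rightarrow> 'a \<Rightarrow> bool" where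
  "walk E a [] b \<longleftrightarrow> a = b"
| "walk E a (x # xs) b \<longleftrightarrow> x = a \<and> (\<exists>c. (a, c) \<in> E \<and> walk E c xs b)"

lemma walk_append: "walk E a xs b \<Longrightarrow> walk E b ys c \<Longrightarrow> walk E a (xs @ ys) c"
  by (induction xs arbitrary: a) auto

lemma relpow_walk: "(a, b) \<in> E ^^ n \<Longrightarrow> \<exists>xs. length xs = n \<and> walk E a xs b"
proof (induction n arbitrary: a)
  case (Suc n)
  then obtain c where "(a, c) \<in> E" "(c, b) \<in> E ^^ n" by (meson relpow_Suc_D2)
  then show ?case using Suc.IH[of c] by (metis length_Cons walk.simps(2))
qed simp

lemma trancl_walk:
  assumes "finite E" "(a, b) \<in> E\<^sup>+"
  shows "\<exists>xs. xs \<noteq> [] \<and> length xs \<le> card E \<and> walk E a xs b"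
proof -
  obtain n where n: "0 < n" "n \<le> card E" "(a, b) \<in> E ^^ n"
    using assms unfolding trancl_finite_eq_relpow[OF assms(1)] by auto
  from relpow_walk[OF n(3)] obtain xs where "length xs = n" "walk E a xs b" by blast
  then show ?thesis using n by (intro exI[of _ xs]) auto
qed

lemma walk_nth0: "walk E a xs b \<Longrightarrow> (xs @ [b]) ! 0 = a"
  by (cases xs) auto

lemma walk_nth: "walk E a xs b \<Longrightarrow> i < length xs \<Longrightarrow> (xs ! i, (xs @ [b]) ! Suc i) \<in> E"
proof (induction xs arbitrary: a i)
  case (Cons x xs)
  then obtain c where c: "x = a" "(a, c) \<in> E" "walk E c xs b" by auto
  show ?case
  proof (cases i)
    case 0
    then show ?thesis using c walk_nth0[OF c(3)] by simp
  next
    case (Suc j)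
    then show ?thesis using Cons.IH[OF c(3), of j] Cons.prems(2) by simp
  qed
qed simp

lemma is_cycle_iff: "is_cycle E p \<longleftrightarrow> p \<noteq> [] \<and> (\<forall>i < length p. (p ! i, p ! (Suc i mod length p)) \<in> E)"
  unfolding is_cycle_def walk_edges_def set_zip by (auto simp: nth_rotate1)

lemma walk_edges_iff: "e \<in> walk_edges p \<longleftrightarrow> (\<exists>i < length p. e = (p ! i, p ! (Suc i mod length p)))"
  unfolding walk_edges_def set_zip by (auto simp: nth_rotate1)

lemma closed_walk_next:
  assumes "walk E a xs a" "i < length xs"
  shows "(xs @ [a]) ! Suc i = xs ! (Suc i mod length xs)"
  proof (cases "Suc i < length xs")
    case False
    then have "Suc i = length xs" using assms(2) by simp
    moreover have "xs ! 0 = a" using assms walk_nth0[OF assms(1)] by (cases xs) auto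
    ultimately show ?thesis by (simp add: nth_append)
  qed (simp add: nth_append)

lemma closed_walk_nth:
  "walk E a xs a \<Longrightarrow> i < length xs \<Longrightarrow> (xs ! i, xs ! (Suc i mod length xs)) \<in> E"
  using walk_nth[of E a xs a i] closed_walk_next[of E a xs i] by simp

lemma cycle_reach:
  assumes "is_cycle E p" "a \<in> set p" "b \<in> set p"
  shows "(a, b) \<in> E\<^sup>+"
proof -
  let ?n = "length p"
  obtain i j where ij: "i < ?n" "a = p ! i" "j < ?n" "b = p ! j" using assms(2,3) by (auto simp: in_set_conv_nth)
  have e: "(p ! i, p ! (Suc i mod ?n)) \<in> E" if "i < ?n" for i using assms(1) that by (simp add: is_cycle_iff)
  have "(p ! i, p ! ((i + Suc k) mod ?n)) \<in> E\<^sup>+" for k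
  proof (induction k)
    case 0
    then show ?case using e[OF ij(1)] by auto
  next
    case (Suc k)
    have "(i + Suc k) mod ?n < ?n" using ij(1) by (intro mod_less_divisor) linarith
    from e[OF this] have "(p ! ((i + Suc k) mod ?n), p ! ((i + Suc (Suc k)) mod ?n)) \<in> E"
      by (simp add: mod_Suc_eq)
    with Suc show ?case by (rule trancl.trancl_into_trancl)
  qed
  \<comment> \<open>Going around once before stopping at \<open>j\<close> makes the number of steps
    positive and avoids a comparison of \<open>i\<close> and \<open>j\<close>.\<close>
  moreover have "i + Suc (?n + j - i - 1) = ?n + j" using ij(1) by linarith
  ultimately have "(p ! i, p ! ((?n + j) mod ?n)) \<in> E\<^sup>+" by metis
  then show ?thesis using ij by simp
qed

lemma tour:
  assumes "finite E" "\<And>a b. a \<in> S \<Longrightarrow> b \<in> S \<Longrightarrow> (a, b) \<in> E\<^sup>+" "a \<in> S"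
  shows "set vs \<subseteq> S \<Longrightarrow> \<exists>xs. walk E a xs a \<and> set vs \<subseteq> set xs \<and> length xs \<le> length vs * (2 * card E)"
proof (induction vs)
  case (Cons v vs)
  then obtain xs where xs: "walk E a xs a" "set vs \<subseteq> set xs" "length xs \<le> length vs * (2 * card E)" by auto
  have v: "v \<in> S" using Cons.prems by simp
  obtain ys where ys: "length ys \<le> card E" "walk E a ys v"
    using trancl_walk[OF assms(1) assms(2)[OF assms(3) v]] by blast
  obtain zs where zs: "zs \<noteq> []" "length zs \<le> card E" "walk E v zs a"
    using trancl_walk[OF assms(1) assms(2)[OF v assms(3)]] by blast
  have "v \<in> set zs" using zs(1,3) by (cases zs) auto
  then show ?case using xs ys zs walk_append[OF walk_append[OF ys(2) zs(3)] xs(1)]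
    by (intro exI[of _ "(ys @ zs) @ xs"]) auto
qed simp

section \<open>Sizes\<close>

lemma enc_list_mem: "x \<in> set xs \<Longrightarrow> length (e x) \<le> length (enc_list e xs)"
  by (induction xs) auto

lemma enc_list_length: "length xs \<le> length (enc_list e xs)"
  by (induction xs) auto

lemma enc_list_le: "\<forall>x \<in> set xs. length (e x) \<le> b \<Longrightarrow> length (enc_list e xs) \<le> 1 + length xs * (1 + b)"
  by (induction xs) auto

lemma length_bin: "length (bin n) \<le> n"
proof (induction n rule: less_induct)
  case (less n)
  show ?case
  proof (cases "n = 0")
    case False
    then have "length (bin n) = Suc (length (bin (n div 2)))" by (simp add: bin.simps[of n])
    moreover have "length (bin (n div 2)) \<le> n div 2" using less False by simp
    ultimately show ?thesis using False by linarith
  qed simp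
qed

text \<open>A crude bound is good enough: it is applied to the numbers of the nulls, which are
  smaller than the number of terms.\<close>

lemma length_enc_nat: "length (enc_nat n) \<le> 2 * n + 1"
proof -
  have "length (enc_list (\<lambda>b::bool. [b]) bs) = 2 * length bs + 1" for bs by (induction bs) auto
  then show ?thesis using length_bin[of n] by (simp add: enc_nat_def)
qed

lemma length_tms: "length (tms As) \<le> length (enc_list enc_atom As)"
proof (induction As)
  case (Cons A As)
  have "length (args A) \<le> length (enc_atom A)" using enc_list_length[of "args A" enc_trm] by (simp add: enc_atom_def)
  then show ?case using Cons by (simp add: tms_def)
qed (simp add: tms_def)

definition atom_ok :: "nat \<Rightarrow> trm atom \<Rightarrow> bool" where
  "atom_ok B A \<longleftrightarrow> length (enc_nat (rel A)) \<le> B \<and> length (args A) \<le> B \<and> (\<forall>t \<in> set (args A). length (enc_trm t) \<le> B)"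

text \<open>Two applications of \<open>enc_list_le\<close>: at most \<open>B\<close> atoms, each
  with a name of at most \<open>B\<close> bits and at most \<open>B\<close> arguments of at most
  \<open>B\<close> bits.\<close>

definition slot_bound :: "nat \<Rightarrow> nat" where
  "slot_bound B = 1 + B * (1 + (B + (1 + B * (1 + B))))"

lemma slot_size:
  assumes "length As \<le> B" "\<forall>A \<in> set As. atom_ok B A"
  shows "length (enc_list enc_atom As) \<le> slot_bound B"
proof -
  have "length (enc_atom A) \<le> B + (1 + B * (1 + B))" if "A \<in> set As" for A
  proof -
    have ok: "atom_ok B A" using assms(2) that by blast
    have "length (enc_list enc_trm (args A)) \<le> 1 + length (args A) * (1 + B)"
      by (rule enc_list_le) (use ok in \<open>simp add: atom_ok_def\<close>)
    also have "\<dots> \<le> 1 + B * (1 + B)" using ok by (intro add_left_mono mult_right_mono) (simp_all add: atom_ok_def)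
    finally show ?thesis using ok by (simp add: enc_atom_def atom_ok_def)
  qed
  then have "length (enc_list enc_atom As) \<le> 1 + length As * (1 + (B + (1 + B * (1 + B))))"
    by (intro enc_list_le) blast
  also have "\<dots> \<le> slot_bound B" unfolding slot_bound_def using assms(1) by (intro add_left_mono mult_right_mono) simp_all
  finally show ?thesis .
qed

lemma item_size: "\<forall>As \<in> set it. length (enc_list enc_atom As) \<le> b \<Longrightarrow> length (enc_item it) \<le> length it * b"
  by (induction it) (auto simp: enc_item_def)

lemma tgd_size:
  assumes "length (enc_tgd \<xi>) \<le> L"
  shows "length (tms (body \<xi>)) + length (tms (head \<xi>)) \<le> L"
    "length (body \<xi>) + length (head \<xi>) \<le> L"
    "\<And>A. A \<in> set (body \<xi>) \<union> set (head \<xi>) \<Longrightarrow> atom_ok L A"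
    "\<And>t. t \<in> set (tms (body \<xi>)) \<union> set (tms (head \<xi>)) \<Longrightarrow> length (enc_trm t) \<le> L"
proof -
  have l: "length (enc_list enc_atom (body \<xi>)) + length (enc_list enc_atom (head \<xi>)) \<le> L"
    using assms by (simp add: enc_tgd_def)
  show "length (tms (body \<xi>)) + length (tms (head \<xi>)) \<le> L" using l length_tms[of "body \<xi>"] length_tms[of "head \<xi>"] by linarith
  show "length (body \<xi>) + length (head \<xi>) \<le> L"
    using l enc_list_length[of "body \<xi>" enc_atom] enc_list_length[of "head \<xi>" enc_atom] by linarith
  have a: "length (enc_atom A) \<le> L" if "A \<in> set (body \<xi>) \<union> set (head \<xi>)" for A
    using that l enc_list_mem[of A "body \<xi>" enc_atom] enc_list_mem[of A "head \<xi>" enc_atom] by fastforce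
  show ok: "atom_ok L A" if A: "A \<in> set (body \<xi>) \<union> set (head \<xi>)" for A
  proof -
    have "length (enc_nat (rel A)) + length (enc_list enc_trm (args A)) \<le> L" using a[OF A] by (simp add: enc_atom_def)
    moreover have "length (enc_trm t) \<le> length (enc_list enc_trm (args A))" if "t \<in> set (args A)" for t
      using enc_list_mem[OF that] .
    moreover have "length (args A) \<le> length (enc_list enc_trm (args A))" by (rule enc_list_length)
    ultimately show ?thesis unfolding atom_ok_def by fastforce
  qed
  show "length (enc_trm t) \<le> L" if "t \<in> set (tms (body \<xi>)) \<union> set (tms (head \<xi>))" for t
    using that ok by (auto simp: tms_def atom_ok_def)
qed

lemma length_enc_name: "length (enc_nat (name t)) \<le> length (enc_trm t)"
  by (cases t) simp_all

lemma atom_ok_mono: "atom_ok B A \<Longrightarrow> B \<le> B' \<Longrightarrow> atom_ok B' A"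
  unfolding atom_ok_def by fastforce

text \<open>The longest terms are the nulls: their numbers are below \<open>2 * L\<close>, and the
  null with number i takes at most 2i + 2 bits. This is the source of the factor 4.\<close>

lemma small_atom_ok:
  assumes s: "small_atom T Bs A" and T: "length T \<le> 2 * L" "\<forall>t \<in> set T. length (enc_trm t) \<le> L" "\<forall>A \<in> Bs. atom_ok L A"
    and B: "4 * L + 4 \<le> B"
  shows "atom_ok B A"
proof -
  have "length (enc_nat (rel A)) \<le> L" "length (args A) \<le> L + 1"
    using s T(2,3) length_enc_name unfolding small_atom_def atom_ok_def by (fastforce intro: le_trans)+
  moreover have "length (enc_trm t) \<le> B" if t: "t \<in> set (args A)" for t
  proof -
    have "t \<in> set T \<or> (\<exists>i < length T. t = Var i)" using s t by (simp add: small_atom_def)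
    then show ?thesis
    proof
      assume "\<exists>i < length T. t = Var i"
      then obtain i where "i < length T" "t = Var i" by blast
      then show ?thesis using length_enc_nat[of i] T(1) B by simp
    qed (use T(2) B in fastforce)
  qed
  ultimately show ?thesis using B unfolding atom_ok_def by auto
qed

section \<open>Positions of the dependency graph\<close>

definition mark :: "pos \<Rightarrow> trm atom" where
  "mark p = Atom (fst (fst p)) (map (\<lambda>j. if j = snd p then Var 0 else Cst 0) [0..<snd (fst p)])"

lemma at_pos_mark:
  assumes "snd p < snd (fst p)" "it ! 6 = [mark p]"
  shows "at_pos it q \<longleftrightarrow> q = p"
  using assms unfolding at_pos_def mark_def by (cases p; cases "fst p") (auto split: if_splits)

definition pos_list :: "tgd list \<Rightarrow> pos list" where
  "pos_list X = concat (map (\<lambda>\<xi>. concat (map (\<lambda>A. map (\<lambda>i. ((rel A, length (args A)), i)) [0..<length (args A)]) (body \<xi> @ head \<xi>))) X)"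

lemma length_pos_list: "length (pos_list X) \<le> length (enc_tgds X)"
proof -
  have "length (concat (map (\<lambda>A. map (\<lambda>i. ((rel A, length (args A)), i)) [0..<length (args A)]) As)) = length (tms As)" for As :: "trm atom list"
    by (induction As) (simp_all add: tms_def)
  then have *: "length (concat (map (\<lambda>A. map (\<lambda>i. ((rel A, length (args A)), i)) [0..<length (args A)]) (body \<xi> @ head \<xi>))) \<le> length (enc_tgd \<xi>)" for \<xi>
    using tgd_size(1)[of \<xi> "length (enc_tgd \<xi>)"] by (simp add: tms_def)
  have **: "length (concat (map q X)) \<le> length (enc_list enc_tgd X)"
    if "\<And>\<xi>. length (q \<xi>) \<le> length (enc_tgd \<xi>)" for q :: "tgd \<Rightarrow> pos list"
  proof (induction X)
    case (Cons \<xi> X)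
    then show ?case using that[of \<xi>] by simp
  qed simp
  show ?thesis unfolding pos_list_def enc_tgds_def by (rule **) (rule *)
qed

lemma dep_edges_subset: "copy_edges (set X) \<union> gen_edges (set X) \<subseteq> set (pos_list X) \<times> set (pos_list X)"
proof -
  have "p \<in> set (pos_list X)" if "\<xi> \<in> set X" "p \<in> positions (body \<xi>) x \<or> p \<in> positions (head \<xi>) x" for p \<xi> x
    using that unfolding pos_list_def positions_def by force
  then show ?thesis unfolding copy_edges_def gen_edges_def by blast
qed

text \<open>Failure of weak acyclicity is thus inherited by larger sets of tgds, which permits a
  chase walk through more tgds than the original cycle has.\<close>

lemma dep_edges_mono: "S \<subseteq> S' \<Longrightarrow> copy_edges S \<subseteq> copy_edges S' \<and> gen_edges S \<subseteq> gen_edges S'"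
  unfolding copy_edges_def gen_edges_def by blast

lemma pos_list_ok:
  assumes "p \<in> set (pos_list X)" "\<forall>\<xi> \<in> set X. length (enc_tgd \<xi>) \<le> L"
  shows "snd p < snd (fst p)" "atom_ok (L + 2) (mark p)"
proof -
  obtain \<xi> A i where A: "\<xi> \<in> set X" "A \<in> set (body \<xi>) \<union> set (head \<xi>)" "i < length (args A)" "p = ((rel A, length (args A)), i)"
  proof -
    have "\<exists>\<xi> \<in> set X. \<exists>A \<in> set (body \<xi> @ head \<xi>). \<exists>i \<in> set [0..<length (args A)]. p = ((rel A, length (args A)), i)"
      using assms(1) unfolding pos_list_def by (simp only: set_concat set_map UN_iff bex_simps image_iff)
    then obtain \<xi> A i where "\<xi> \<in> set X" "A \<in> set (body \<xi> @ head \<xi>)" "i \<in> set [0..<length (args A)]" "p = ((rel A, length (args A)), i)"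
      by (elim bexE)
    then show thesis by (intro that[of \<xi> A i]) simp_all
  qed
  then show "snd p < snd (fst p)" by simp
  have "atom_ok L A" using tgd_size(3)[of \<xi> L A] A assms(2) by blast
  moreover have "length (enc_nat 0) = 1" by (simp add: enc_nat_def)
  ultimately show "atom_ok (L + 2) (mark p)" unfolding atom_ok_def mark_def A(4) by auto
qed

section \<open>Testing C-stratification\<close>

definition tgd_items :: "tgd list \<Rightarrow> item list" where
  "tgd_items X = map (\<lambda>\<xi>. [body \<xi>, head \<xi>]) X"

lemma enc_tgds_items: "enc_tgds X = enc_items (tgd_items X)"
  by (induction X) (simp_all add: enc_tgds_def enc_items_def tgd_items_def enc_tgd_def enc_item_def)

lemma tgd_of_items: "tgd_of ` set (tgd_items X) = set X"
proof -
  have "tgd_of [body \<xi>, head \<xi>] = \<xi>" for \<xi> by (cases \<xi>) (simp add: tgd_of_def)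
  then show ?thesis by (simp add: tgd_items_def image_image)
qed

lemma tgd_of_sel [simp]: "body (tgd_of it) = it ! 0" "head (tgd_of it) = it ! 1"
  by (simp_all add: tgd_of_def)

text \<open>If no step were extendable, \<open>edge_prec\<close> would turn the records into a cycle
  of the chase graph whose vertices are exactly their tgds. The marked positions, unique in each
  record, would form a cycle of their dependency graph through a generating edge.\<close>

lemma certificate_extendable:
  assumes C: "set X \<in> CStr" and cert: "certificate (tgd_items X) U"
  shows "\<exists>i < length U. extendable (U ! i) (U ! (Suc i mod length U))"
proof (rule ccontr)
  assume nx: "\<not> (\<exists>i < length U. extendable (U ! i) (U ! (Suc i mod length U)))"
  let ?n = "length U" and ?T = "tgd_of ` set U"
  have T: "?T \<subseteq> set X" and uq: "\<And>it. it \<in> set U \<Longrightarrow> unique_pos it"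
    and e: "\<And>i. i < ?n \<Longrightarrow> edge (U ! i) (U ! (Suc i mod ?n))"
    and l: "\<And>i. i < ?n \<Longrightarrow> linked (copy_edges ?T \<union> gen_edges ?T) (U ! i) (U ! (Suc i mod ?n))"
    and g: "\<exists>i < ?n. linked (gen_edges ?T) (U ! i) (U ! (Suc i mod ?n))"
    using cert unfolding certificate_def tgd_of_items by blast+
  have n0: "0 < ?n" using g by linarith
  have nxt: "Suc i mod ?n < ?n" for i using n0 by simp
  have "is_cycle (chase_graph (set X)) (map tgd_of U)"
    unfolding is_cycle_iff
  proof (intro conjI allI impI)
    show "map tgd_of U \<noteq> []" using n0 by auto
    fix i assume i: "i < length (map tgd_of U)"
    then have "tgd_of (U ! i) \<prec> tgd_of (U ! (Suc i mod ?n))" using edge_prec e nx by simp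
    moreover have "tgd_of (U ! i) \<in> set X" "tgd_of (U ! (Suc i mod ?n)) \<in> set X" using T i nxt[of i] by auto
    ultimately show "(map tgd_of U ! i, map tgd_of U ! (Suc i mod length (map tgd_of U))) \<in> chase_graph (set X)"
      using i nxt[of i] by (simp add: chase_graph_def)
  qed
  then have wa: "weakly_acyclic ?T" using C unfolding CStr_def by fastforce
  define P where "P it = (THE p. at_pos it p)" for it
  have P: "p = P it" if "it \<in> set U" "at_pos it p" for it p
  proof -
    have "(THE p. at_pos it p) = p" using uq[OF that(1)] that(2) unfolding unique_pos_def by blast
    then show ?thesis by (simp add: P_def)
  qed
  have link: "(P (U ! i), P (U ! (Suc i mod ?n))) \<in> R" if i: "i < ?n" and lR: "linked R (U ! i) (U ! (Suc i mod ?n))" for i R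
  proof -
    obtain p q where "at_pos (U ! i) p" "at_pos (U ! (Suc i mod ?n)) q" "(p, q) \<in> R" using lR unfolding linked_def by blast
    then show ?thesis using P[of "U ! i" p] P[of "U ! (Suc i mod ?n)" q] i nxt[of i] by simp
  qed
  have "is_cycle (copy_edges ?T \<union> gen_edges ?T) (map P U)"
    unfolding is_cycle_iff using n0 link[OF _ l] nxt by auto
  moreover obtain i where i: "i < ?n" "(P (U ! i), P (U ! (Suc i mod ?n))) \<in> gen_edges ?T" using g link by blast
  have "(P (U ! i), P (U ! (Suc i mod ?n))) \<in> walk_edges (map P U)"
    unfolding walk_edges_iff using i(1) nxt[of i] by (intro exI[of _ i]) simp
  ultimately show False using wa i(2) unfolding weakly_acyclic_def by blast
qed

text \<open>One item refuting one extendable step is enough, and by \<open>ext_complete\<close> its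
  size depends on the tgds and not on \<open>U\<close>. The summand 2 counts the bits that announce
  the item and end the list.\<close>

lemma certificate_refuted:
  assumes C: "set X \<in> CStr" and cert: "certificate (tgd_items X) U" and L: "L = length (enc_tgds X)"
  shows "\<exists>h. length h = 2 \<and> refuted U [h] \<and> length (enc_items [h]) \<le> 2 + 2 * slot_bound (4 * L + 6)"
proof -
  obtain i where i: "i < length U" "extendable (U ! i) (U ! (Suc i mod length U))"
    using certificate_extendable[OF C cert] by blast
  let ?it = "U ! i" and ?it' = "U ! (Suc i mod length U)"
  have e: "edge ?it ?it'" using cert i(1) unfolding certificate_def by blast
  have "Suc i mod length U < length U" using i(1) by (intro mod_less_divisor) linarith
  then have "tgd_of ?it \<in> set X" "tgd_of ?it' \<in> set X"
    using cert i(1) unfolding certificate_def tgd_of_items by auto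
  then have sz: "length (enc_tgd (tgd_of ?it)) \<le> L" "length (enc_tgd (tgd_of ?it')) \<le> L"
    unfolding L enc_tgds_def by (auto intro: enc_list_mem)
  obtain h0 h1 where h: "ext ?it ?it' [h0, h1]" "\<forall>As \<in> {h0, h1}. length As \<le> length (tms (?it' ! 1)) \<and>
    (\<forall>A \<in> set As. \<exists>z t. z \<in> set (tms (?it' ! 1)) \<and> t \<in> set (tms (?it ! 0)) \<union> set (tms (?it ! 1)) \<union> set (tms (?it' ! 0)) \<and>
       A = Atom (name z) [t])"
    using ext_complete[OF e i(2)] by blast
  have slot: "length (enc_list enc_atom As) \<le> slot_bound (4 * L + 6)" if As: "As \<in> {h0, h1}" for As
  proof (rule slot_size)
    show "length As \<le> 4 * L + 6" using h(2) As tgd_size(1)[OF sz(2)] by fastforce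
    show "\<forall>A \<in> set As. atom_ok (4 * L + 6) A"
    proof
      fix A assume "A \<in> set As"
      then obtain z t where zt: "z \<in> set (tms (?it' ! 1))" "t \<in> set (tms (?it ! 0)) \<union> set (tms (?it ! 1)) \<union> set (tms (?it' ! 0))"
        "A = Atom (name z) [t]" using h(2) As by blast
      have "length (enc_trm z) \<le> L" using tgd_size(4)[OF sz(2), of z] zt(1) by simp
      moreover have "length (enc_trm t) \<le> L" using tgd_size(4)[OF sz(1), of t] tgd_size(4)[OF sz(2), of t] zt(2) by auto
      ultimately show "atom_ok (4 * L + 6) A" unfolding atom_ok_def zt(3) using length_enc_name[of z] by simp
    qed
  qed
  have "refuted U [[h0, h1]]" unfolding refuted_def using i(1) h(1) by auto
  moreover have "length (enc_items [[h0, h1]]) \<le> 2 + 2 * slot_bound (4 * L + 6)"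
    using slot[of h0] slot[of h1] by (simp add: enc_items_def enc_item_def)
  ultimately show ?thesis by (intro exI[of _ "[h0, h1]"]) simp
qed

text \<open>The factors of the bound are the length of the closed chase walk, the length of the
  closed dependency walk, and the size of a record of seven slots with its announcing bit.\<close>

lemma certificate_exists:
  assumes C: "set X \<notin> CStr" and L: "L = length (enc_tgds X)"
  shows "\<exists>U. (\<forall>it \<in> set U. length it = 7) \<and> certificate (tgd_items X) U \<and> (\<forall>V. \<not> refuted U V) \<and>
    length (enc_items U) \<le> 1 + (L * (2 * (L * L))) * (1 + L * L) * (1 + 7 * slot_bound (4 * L + 6))"
proof -
  let ?E = "chase_graph (set X)"
  obtain p where p: "is_cycle ?E p" "\<not> weakly_acyclic (set p)" using C unfolding CStr_def by blast
  have E_sub: "?E \<subseteq> set X \<times> set X" unfolding chase_graph_def by blast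
  then have finE: "finite ?E" by (rule finite_subset) simp
  have cX: "card (set X) \<le> L" "length X \<le> L"
    unfolding L enc_tgds_def using card_length[of X] enc_list_length[of X enc_tgd] by linarith+
  have "card ?E \<le> card (set X \<times> set X)" using E_sub by (intro card_mono) simp_all
  also have "\<dots> \<le> L * L" using cX by (simp add: card_cartesian_product mult_mono)
  finally have cE: "card ?E \<le> L * L" .
  have p_sub: "set p \<subseteq> set X"
  proof
    fix \<xi> assume "\<xi> \<in> set p"
    then obtain i where "i < length p" "\<xi> = p ! i" by (auto simp: in_set_conv_nth)
    then show "\<xi> \<in> set X" using p(1) E_sub unfolding is_cycle_iff by blast
  qed
  obtain a0 where a0: "a0 \<in> set p" using p(1) by (cases p) (auto simp: is_cycle_def)
  \<comment> \<open>Without repetitions, the number of round trips is at most the number of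
    tgds.\<close>
  obtain xs where xs: "walk ?E a0 xs a0" "set (remdups p) \<subseteq> set xs" "length xs \<le> length (remdups p) * (2 * card ?E)"
    using tour[OF finE cycle_reach[OF p(1)] a0, of "remdups p"] by auto
  define m where "m = length xs"
  have "length (remdups p) \<le> L" using card_mono[OF _ p_sub] cX by (simp add: length_remdups_card_conv)
  then have mL: "m \<le> L * (2 * (L * L))"
    using xs(3) cE unfolding m_def by (meson le_trans mult_le_mono mult_le_mono2)
  have m0: "0 < m" using xs(2) a0 unfolding m_def by (cases xs) auto
  have xsE: "(xs ! i, xs ! (Suc i mod m)) \<in> ?E" if "i < m" for i
    using closed_walk_nth[OF xs(1)] that by (simp add: m_def)
  have xsX: "xs ! i \<in> set X" if "i < m" for i using xsE[OF that] E_sub by blast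
  let ?D = "copy_edges (set p) \<union> gen_edges (set p)"
  obtain c a b where c: "is_cycle ?D c" "(a, b) \<in> walk_edges c" "(a, b) \<in> gen_edges (set p)"
    using p(2) unfolding weakly_acyclic_def by auto
  have D_sub: "?D \<subseteq> set (pos_list X) \<times> set (pos_list X)"
    using dep_edges_subset[of X] dep_edges_mono[OF p_sub] by blast
  then have finD: "finite ?D" by (rule finite_subset) simp
  have "card ?D \<le> card (set (pos_list X) \<times> set (pos_list X))" using D_sub by (intro card_mono) simp_all
  also have "\<dots> \<le> L * L"
    using card_length[of "pos_list X"] length_pos_list[of X] unfolding L by (simp add: card_cartesian_product mult_mono)
  finally have cD: "card ?D \<le> L * L" .
  have "a \<in> set c" "b \<in> set c"
  proof -
    obtain i where i: "i < length c" "(a, b) = (c ! i, c ! (Suc i mod length c))" using c(2) unfolding walk_edges_iff by blast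
    then have "Suc i mod length c < length c" by (intro mod_less_divisor) linarith
    then show "a \<in> set c" "b \<in> set c" using i by auto
  qed
  from cycle_reach[OF c(1) this(2,1)] obtain ys where ys: "length ys \<le> card ?D" "walk ?D b ys a"
    using trancl_walk[OF finD] by blast
  \<comment> \<open>The generating edge from \<open>a\<close> to \<open>b\<close> is put in front of
    a walk from \<open>b\<close> back to \<open>a\<close>, so that it is the edge at index
    0.\<close>
  define zs where "zs = a # ys"
  define d where "d = length zs"
  have "(a, b) \<in> ?D" using c(3) by blast
  then have zs: "walk ?D a zs a" using ys(2) unfolding zs_def walk.simps by blast
  have d0: "0 < d" by (simp add: d_def zs_def)
  have dL: "d \<le> 1 + L * L" using ys(1) cD by (simp add: d_def zs_def)
  have zsD: "(zs ! i, zs ! (Suc i mod d)) \<in> ?D" if "i < d" for i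
    using closed_walk_nth[OF zs] that by (simp add: d_def)
  have zs01: "(zs ! 0, zs ! (Suc 0 mod d)) \<in> gen_edges (set p)"
  proof -
    have "zs ! (Suc 0 mod d) = (zs @ [a]) ! Suc 0" using closed_walk_next[OF zs, of 0] d0 by (simp add: d_def)
    also have "\<dots> = b" using walk_nth0[OF ys(2)] by (simp add: zs_def)
    finally show ?thesis using c(3) by (simp add: zs_def)
  qed
  have zsP: "zs ! i \<in> set (pos_list X)" if "i < d" for i using zsD[OF that] D_sub by blast
  \<comment> \<open>\<open>edge\<close> depends on the successor only through body and head, and
    here it holds for every content \<open>P\<close> of the position slot. So one witness per chase
    edge can be reused at each visit, with different marks.\<close>
  define good where "good i a2 a3 Il Kl \<longleftrightarrow> (\<forall>P it'. it' ! 0 = body (xs ! (Suc i mod m)) \<longrightarrow> it' ! 1 = head (xs ! (Suc i mod m)) \<longrightarrow>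
      edge [body (xs ! i), head (xs ! i), a2, a3, Il, Kl, P] it' \<and> \<not> extendable [body (xs ! i), head (xs ! i), a2, a3, Il, Kl, P] it') \<and>
    (\<forall>As \<in> {a2, a3, Il, Kl}. length (enc_list enc_atom As) \<le> slot_bound (4 * L + 6))" for i a2 a3 Il Kl
  have szX: "length (enc_tgd \<xi>) \<le> L" if "\<xi> \<in> set X" for \<xi>
    unfolding L enc_tgds_def using that by (rule enc_list_mem)
  have "\<exists>a2 a3 Il Kl. good i a2 a3 Il Kl" if i: "i < m" for i
  proof -
    let ?x = "xs ! i" and ?y = "xs ! (Suc i mod m)"
    let ?T = "tms (body ?x) @ tms (head ?x) @ tms (body ?y)"
    have "?x \<prec> ?y" using xsE[OF i] by (simp add: chase_graph_def)
    from prec_edge[OF this] obtain a2 a3 Il Kl where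
      w: "\<forall>P it'. it' ! 0 = body ?y \<longrightarrow> it' ! 1 = head ?y \<longrightarrow>
        edge [body ?x, head ?x, a2, a3, Il, Kl, P] it' \<and> \<not> extendable [body ?x, head ?x, a2, a3, Il, Kl, P] it'"
      and s: "\<forall>As \<in> {a2, a3, Il, Kl}. length As \<le> length ?T + length (body ?x) + length (head ?x) + length (body ?y) \<and>
        (\<forall>A \<in> set As. small_atom ?T (set (body ?x) \<union> set (head ?x) \<union> set (body ?y)) A)" by blast
    have "Suc i mod m < m" using m0 by simp
    then have sx: "length (enc_tgd ?x) \<le> L" and sy: "length (enc_tgd ?y) \<le> L" using szX xsX i by blast+
    note tx = tgd_size[OF sx] and ty = tgd_size[OF sy]
    have "length (enc_list enc_atom As) \<le> slot_bound (4 * L + 6)" if As: "As \<in> {a2, a3, Il, Kl}" for As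
    proof (rule slot_size)
      have "length As \<le> length ?T + length (body ?x) + length (head ?x) + length (body ?y)" using s As by blast
      then show "length As \<le> 4 * L + 6" using tx(1,2) ty(1,2) by simp
      show "\<forall>A \<in> set As. atom_ok (4 * L + 6) A"
      proof
        fix A assume "A \<in> set As"
        then have "small_atom ?T (set (body ?x) \<union> set (head ?x) \<union> set (body ?y)) A" using s As by blast
        then show "atom_ok (4 * L + 6) A"
        proof (rule small_atom_ok[where L = L])
          show "length ?T \<le> 2 * L" using tx(1) ty(1) by simp
          show "\<forall>t \<in> set ?T. length (enc_trm t) \<le> L" using tx(4) ty(4) by auto
          show "\<forall>A \<in> set (body ?x) \<union> set (head ?x) \<union> set (body ?y). atom_ok L A" using tx(3) ty(3) by blast
        qed simp
      qed
    qed
    then show ?thesis using w unfolding good_def by blast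
  qed
  then obtain a2 a3 Il Kl where gd: "\<And>i. i < m \<Longrightarrow> good i (a2 i) (a3 i) (Il i) (Kl i)" by metis
  \<comment> \<open>Record \<open>k\<close> combines the two closed walks at \<open>k mod m\<close>
    and \<open>k mod d\<close>. After \<open>m * d\<close> records both are back at their
    beginnings, whatever common divisors \<open>m\<close> and \<open>d\<close> have.\<close>
  define R where "R k = [body (xs ! (k mod m)), head (xs ! (k mod m)), a2 (k mod m), a3 (k mod m), Il (k mod m), Kl (k mod m),
    [mark (zs ! (k mod d))]]" for k
  define U where "U = map R [0..<m * d]"
  have n: "length U = m * d" by (simp add: U_def)
  have md: "0 < m * d" using m0 d0 by simp
  have Uk: "U ! k = R k" if "k < m * d" for k using that by (simp add: U_def)
  have Rn: "U ! (Suc k mod (m * d)) = R (Suc k)" for k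
  proof -
    have "Suc k mod (m * d) < m * d" using md by simp
    then have "U ! (Suc k mod (m * d)) = R (Suc k mod (m * d))" by (rule Uk)
    moreover have "Suc k mod (m * d) mod m = Suc k mod m" "Suc k mod (m * d) mod d = Suc k mod d"
      by (simp_all add: mod_mod_cancel)
    ultimately show ?thesis by (simp add: R_def)
  qed
  have tgdR: "tgd_of (R k) = xs ! (k mod m)" for k by (cases "xs ! (k mod m)") (simp add: R_def tgd_of_def)
  have T: "tgd_of ` set U = set xs"
  proof
    show "tgd_of ` set U \<subseteq> set xs" using m0 by (auto simp: U_def tgdR m_def)
    show "set xs \<subseteq> tgd_of ` set U"
    proof
      fix \<xi> assume "\<xi> \<in> set xs"
      then obtain j where j: "j < m" "\<xi> = xs ! j" by (auto simp: in_set_conv_nth m_def)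
      have "j < m * d" using j(1) d0 by (metis One_nat_def Suc_leI less_le_trans mult.right_neutral mult_le_mono2)
      then have "R j \<in> set U" by (auto simp: U_def)
      moreover have "tgd_of (R j) = \<xi>" using j by (simp add: tgdR)
      ultimately show "\<xi> \<in> tgd_of ` set U" by blast
    qed
  qed
  have ed: "edge (R k) (R (Suc k)) \<and> \<not> extendable (R k) (R (Suc k))" for k
  proof -
    have "k mod m < m" using m0 by simp
    moreover have "Suc (k mod m) mod m = Suc k mod m" by (rule mod_Suc_eq)
    ultimately show ?thesis using gd[of "k mod m"] unfolding good_def by (simp add: R_def)
  qed
  have at: "at_pos (R k) q \<longleftrightarrow> q = zs ! (k mod d)" for k q
  proof (rule at_pos_mark)
    have "k mod d < d" using d0 by simp
    then show "snd (zs ! (k mod d)) < snd (fst (zs ! (k mod d)))"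
      using pos_list_ok(1)[OF zsP] szX by blast
  qed (simp add: R_def)
  have sub: "set p \<subseteq> set xs" using xs(2) by simp
  have lk: "linked (copy_edges (set xs) \<union> gen_edges (set xs)) (R k) (R (Suc k))" for k
  proof -
    have "k mod d < d" using d0 by simp
    from zsD[OF this] have "(zs ! (k mod d), zs ! (Suc k mod d)) \<in> ?D" by (simp add: mod_Suc_eq)
    then show ?thesis unfolding linked_def at using dep_edges_mono[OF sub] by blast
  qed
  have lg: "linked (gen_edges (set xs)) (R 0) (R (Suc 0))"
    unfolding linked_def at using zs01 dep_edges_mono[OF sub] by auto
  have "certificate (tgd_items X) U"
    unfolding certificate_def T tgd_of_items n
  proof (intro conjI ballI allI impI)
    show "set xs \<subseteq> set X" using xsX by (auto simp: in_set_conv_nth m_def)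
    have u: "unique_pos (R k)" for k unfolding unique_pos_def at by metis
    show "unique_pos it" if it: "it \<in> set U" for it
    proof -
      obtain k where "it = R k" using it unfolding U_def by (auto simp only: set_map)
      then show ?thesis using u by simp
    qed
    show "edge (U ! i) (U ! (Suc i mod (m * d)))" if "i < m * d" for i using ed[of i] that by (simp add: Uk Rn)
    show "linked (copy_edges (set xs) \<union> gen_edges (set xs)) (U ! i) (U ! (Suc i mod (m * d)))" if "i < m * d" for i
      using lk[of i] that by (simp add: Uk Rn)
    show "\<exists>i < m * d. linked (gen_edges (set xs)) (U ! i) (U ! (Suc i mod (m * d)))"
      using lg md unfolding Uk[OF md, symmetric] Rn[of 0, symmetric] by blast
  qed
  moreover have "\<not> refuted U V" for V
  proof
    assume "refuted U V"
    then obtain i h where i: "i < m * d" "ext (R i) (R (Suc i)) h"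
      unfolding refuted_def n by (auto simp: Uk Rn)
    have "func (R i ! 2)" "func (R i ! 3)" using ed[of i] by (simp_all add: edge_def)
    then have "extendable (R i) (R (Suc i))" using i(2) by (rule ext_sound)
    then show False using ed[of i] by blast
  qed
  moreover have len7: "\<forall>it \<in> set U. length it = 7" by (auto simp: U_def R_def)
  moreover have "length (enc_items U) \<le> 1 + (L * (2 * (L * L))) * (1 + L * L) * (1 + 7 * slot_bound (4 * L + 6))"
  proof -
    have "length (enc_item it) \<le> 7 * slot_bound (4 * L + 6)" if it: "it \<in> set U" for it
    proof -
      obtain k where k: "it = R k" using it by (auto simp: U_def)
      have km: "k mod m < m" and kd: "k mod d < d" using m0 d0 by simp_all
      have x: "length (enc_tgd (xs ! (k mod m))) \<le> L" by (rule szX[OF xsX[OF km]])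
      have "length (enc_list enc_atom As) \<le> slot_bound (4 * L + 6)" if As: "As \<in> set (R k)" for As
      proof -
        consider "As = body (xs ! (k mod m)) \<or> As = head (xs ! (k mod m))"
          | "As \<in> {a2 (k mod m), a3 (k mod m), Il (k mod m), Kl (k mod m)}" | "As = [mark (zs ! (k mod d))]"
          using As by (auto simp: R_def)
        then show ?thesis
        proof cases
          case 1
          show ?thesis
          proof (rule slot_size)
            show "length As \<le> 4 * L + 6" using 1 tgd_size(2)[OF x] by auto
            show "\<forall>A \<in> set As. atom_ok (4 * L + 6) A"
            proof
              fix A assume "A \<in> set As"
              then have "atom_ok L A" using 1 tgd_size(3)[OF x, of A] by blast
              then show "atom_ok (4 * L + 6) A" by (rule atom_ok_mono) simp
            qed
          qed
        next
          case 2
          then show ?thesis using gd[OF km] unfolding good_def by blast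
        next
          case 3
          have "atom_ok (L + 2) (mark (zs ! (k mod d)))" using pos_list_ok(2)[OF zsP[OF kd]] szX by blast
          then have "atom_ok (4 * L + 6) (mark (zs ! (k mod d)))" by (rule atom_ok_mono) simp
          then show ?thesis using 3 by (intro slot_size) simp_all
        qed
      qed
      then show ?thesis using item_size[of it "slot_bound (4 * L + 6)"] len7 it k by auto
    qed
    then have "length (enc_items U) \<le> 1 + length U * (1 + 7 * slot_bound (4 * L + 6))"
      unfolding enc_items_def by (intro enc_list_le) blast
    also have "\<dots> \<le> 1 + (L * (2 * (L * L))) * (1 + L * L) * (1 + 7 * slot_bound (4 * L + 6))"
      unfolding n using mult_le_mono[OF mL dL] by (intro add_left_mono mult_right_mono) simp_all
    finally show ?thesis .
  qed
  ultimately show ?thesis by blast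
qed

theorem theorem15: "CStr_problem \<in> Pi2p"
proof -
  let ?R = "\<lambda>x u v. (\<exists>X. encodes 0 x X) \<and> ((\<exists>U. encodes 1 u U) \<longrightarrow>
    (\<exists>X U V. encodes 0 x X \<and> encodes 1 u U \<and> encodes 2 v V \<and> (certificate X U \<longrightarrow> refuted U V)))"
  \<comment> \<open>The value 4L + 6 covers the number of atoms in a slot (at most 4L), the codes of
    nulls, and the position marks (L + 2). \<open>s\<close> is \<open>slot_bound\<close> at this
    value, and \<open>p\<close> adds the bounds for refutation and certificate, since one polynomial
    must serve both words.\<close>
  define b :: "nat poly" where "b = [:6, 4:]"
  define s :: "nat poly" where "s = [:1:] + b * ([:1:] + (b + ([:1:] + b * ([:1:] + b))))"
  define p :: "nat poly" where "p = [:3:] + smult 2 s + [:0, 0, 0, 2:] * [:1, 0, 1:] * ([:1:] + smult 7 s)"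
  have s: "poly s L = slot_bound (4 * L + 6)" for L
    by (simp add: s_def b_def slot_bound_def algebra_simps)
  have p: "poly p L = 3 + 2 * slot_bound (4 * L + 6) + (L * (2 * (L * L))) * (1 + L * L) * (1 + 7 * slot_bound (4 * L + 6))" for L
    by (simp add: p_def s algebra_simps)
  have "x \<in> CStr_problem \<longleftrightarrow> (\<forall>u. length u \<le> poly p (length x) \<longrightarrow> (\<exists>v. length v \<le> poly p (length x) \<and> ?R x u v))" for x
  proof (cases "\<exists>X. encodes 0 x X")
    case False
    have "x \<notin> CStr_problem"
    proof
      assume "x \<in> CStr_problem"
      then obtain X where "x = enc_tgds X" unfolding CStr_problem_def by blast
      then have "encodes 0 x (tgd_items X)" by (simp add: encodes_def enc_tgds_items slots_def) (simp add: tgd_items_def)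
      then show False using False by blast
    qed
    \<comment> \<open>For a malformed input the relation fails for all pairs of words, so any
      admissible \<open>u\<close> is a counterexample; the empty word is short enough.\<close>
    moreover have "length ([]::bool list) \<le> poly p (length x)" by simp
    ultimately show ?thesis using False by blast
  next
    case True
    then obtain Y where Y: "encodes 0 x Y" by blast
    define X where "X = map tgd_of Y"
    have "[it ! 0, it ! 1] = it" if "it \<in> set Y" for it
    proof -
      have "length it = 2" using Y that by (simp add: encodes_def slots_def)
      then show ?thesis by (auto simp: length_Suc_conv numeral_2_eq_2)
    qed
    then have YX: "Y = tgd_items X" by (simp add: X_def tgd_items_def map_idI)
    then have x: "x = enc_tgds X" using Y by (simp add: encodes_def enc_tgds_items)
    have mem: "x \<in> CStr_problem \<longleftrightarrow> set X \<in> CStr" unfolding x by (rule enc_in_CStr_problem)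
    show ?thesis
    proof (cases "set X \<in> CStr")
      case C: True
      have "\<exists>v. length v \<le> poly p (length x) \<and> ?R x u v" for u
      proof (cases "\<exists>U. encodes 1 u U")
        case False
        then show ?thesis using True by (intro exI[of _ "[]"]) simp
      next
        case U: True
        then obtain U where U: "encodes 1 u U" by blast
        show ?thesis
        proof (cases "certificate (tgd_items X) U")
          case cert: True
          obtain h where h: "length h = 2" "refuted U [h]" "length (enc_items [h]) \<le> 2 + 2 * slot_bound (4 * length x + 6)"
            using certificate_refuted[OF C cert refl] unfolding x by blast
          have "encodes 2 (enc_items [h]) [h]" using h(1) by (simp add: encodes_def slots_def)
          then have "?R x u (enc_items [h])" using Y U h(2) by blast
          moreover have "length (enc_items [h]) \<le> poly p (length x)" using h(3) unfolding p by linarith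
          ultimately show ?thesis by blast
        next
          case nc: False
          \<comment> \<open>An invalid certificate needs no refutation; the empty list is a
            well-formed answer.\<close>
          have "encodes 2 (enc_items []) []" by (simp add: encodes_def)
          then have "?R x u (enc_items [])" using Y U nc unfolding YX by blast
          moreover have "length (enc_items []) \<le> poly p (length x)" unfolding p by (simp add: enc_items_def)
          ultimately show ?thesis by blast
        qed
      qed
      then show ?thesis using C mem by blast
    next
      case nC: False
      obtain U where U: "\<forall>it \<in> set U. length it = 7" "certificate (tgd_items X) U" "\<forall>V. \<not> refuted U V"
        "length (enc_items U) \<le> 1 + (length x * (2 * (length x * length x))) * (1 + length x * length x) * (1 + 7 * slot_bound (4 * length x + 6))"
        using certificate_exists[OF nC refl] unfolding x by blast
      have e: "encodes 1 (enc_items U) U" using U(1) by (simp add: encodes_def slots_def)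
      have "length (enc_items U) \<le> poly p (length x)" using U(4) unfolding p by linarith
      moreover have "\<not> ?R x (enc_items U) v" for v
      proof
        assume "?R x (enc_items U) v"
        then obtain X' U' V where r: "encodes 0 x X'" "encodes 1 (enc_items U) U'" "certificate X' U' \<longrightarrow> refuted U' V"
          using e by blast
        have "X' = tgd_items X" "U' = U" using encodes_unique[OF r(1) Y] encodes_unique[OF r(2) e] YX by simp_all
        then show False using r(3) U(2,3) by blast
      qed
      ultimately show ?thesis using nC mem by blast
    qed
  qed
  then show ?thesis unfolding Pi2p_def using ptime_certificate by blast
qed

end
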